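(* Let $A$ be an affine $\mathbb C$-algebra equipped with $\mathbb C$-linear derivations $\delta_1,\ldots,\delta_m$ (not necessarily commuting). If $A$ has infinitely many height one prime differential ideals, then there exists $f\in\operatorname{Frac}(A)\setminus\mathbb C$ with $\delta_i(f)=0$ for all $i=1,\ldots,m$.
   Context: An affine $\mathbb C$-algebra is a finitely generated commutative $\mathbb C$-algebra that is an integral domain. A differential ideal is an ideal $I$ with $\delta_i(I)\subseteq I$ for all $i$. The derivations are extended to $\operatorname{Frac}(A)$ by the quotient rule. *)

theory Defs
  imports Complex_Main "HOL-Computational_Algebra.Fraction_Field"
begin

text \<open>A commutative C-algebra structure on an integral domain 'a is given by a
  ring homomorphism iota from the complex numbers into 'a.\<close>

definition ring_hom_C :: "(complex \<Rightarrow> 'a::comm_ring_1) \<Rightarrow> bool" where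
  "ring_hom_C \<iota> \<longleftrightarrow> \<iota> 1 = 1 \<and> (\<forall>c d. \<iota> (c + d) = \<iota> c + \<iota> d) \<and> (\<forall>c d. \<iota> (c * d) = \<iota> c * \<iota> d)"

inductive_set alg_gen :: "(complex \<Rightarrow> 'a::comm_ring_1) \<Rightarrow> 'a set \<Rightarrow> 'a set"
  for \<iota> :: "complex \<Rightarrow> 'a" and S :: "'a set" where
  scalar: "\<iota> c \<in> alg_gen \<iota> S"
| gen: "x \<in> S \<Longrightarrow> x \<in> alg_gen \<iota> S"
| add: "x \<in> alg_gen \<iota> S \<Longrightarrow> y \<in> alg_gen \<iota> S \<Longrightarrow> x + y \<in> alg_gen \<iota> S"
| mult: "x \<in> alg_gen \<iota> S \<Longrightarrow> y \<in> alg_gen \<iota> S \<Longrightarrow> x * y \<in> alg_gen \<iota> S"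

text \<open>Affine C-algebra: finitely generated commutative C-algebra which is an integral
  domain (the integral-domain property is the type class idom).\<close>

definition affine_C_algebra :: "(complex \<Rightarrow> 'a::idom) \<Rightarrow> bool" where
  "affine_C_algebra \<iota> \<longleftrightarrow> ring_hom_C \<iota> \<and> (\<exists>S. finite S \<and> alg_gen \<iota> S = UNIV)"

definition C_derivation :: "(complex \<Rightarrow> 'a::comm_ring_1) \<Rightarrow> ('a \<Rightarrow> 'a) \<Rightarrow> bool" where
  "C_derivation \<iota> \<delta> \<longleftrightarrow>
     (\<forall>x y. \<delta> (x + y) = \<delta> x + \<delta> y) \<and>
     (\<forall>c x. \<delta> (\<iota> c * x) = \<iota> c * \<delta> x) \<and>
     (\<forall>x y. \<delta> (x * y) = x * \<delta> y + \<delta> x * y)"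

definition is_ideal :: "'a::comm_ring_1 set \<Rightarrow> bool" where
  "is_ideal I \<longleftrightarrow> 0 \<in> I \<and> (\<forall>x\<in>I. \<forall>y\<in>I. x + y \<in> I) \<and> (\<forall>r. \<forall>x\<in>I. r * x \<in> I)"

definition is_prime_ideal :: "'a::comm_ring_1 set \<Rightarrow> bool" where
  "is_prime_ideal P \<longleftrightarrow> is_ideal P \<and> P \<noteq> UNIV \<and> (\<forall>x y. x * y \<in> P \<longrightarrow> x \<in> P \<or> y \<in> P)"

definition height_one_prime :: "'a::idom set \<Rightarrow> bool" where
  "height_one_prime P \<longleftrightarrow> is_prime_ideal P \<and> P \<noteq> {0} \<and>
     (\<forall>Q. is_prime_ideal Q \<and> Q \<subseteq> P \<longrightarrow> Q = {0} \<or> Q = P)"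

definition differential_ideal :: "(nat \<Rightarrow> 'a \<Rightarrow> 'a) \<Rightarrow> nat \<Rightarrow> 'a::comm_ring_1 set \<Rightarrow> bool" where
  "differential_ideal \<delta> m I \<longleftrightarrow> is_ideal I \<and> (\<forall>i<m. \<delta> i ` I \<subseteq> I)"

text \<open>Extension of a derivation to the fraction field by the quotient rule:
  delta(a/b) = (delta(a) b - a delta(b)) / b^2, computed from any representative.\<close>

definition frac_deriv :: "('a::idom \<Rightarrow> 'a) \<Rightarrow> 'a fract \<Rightarrow> 'a fract" where
  "frac_deriv \<delta> f = (let (a, b) = (SOME (a, b). b \<noteq> 0 \<and> f = Fract a b)
                      in Fract (\<delta> a * b - a * \<delta> b) (b * b))"

definition frac_consts :: "(complex \<Rightarrow> 'a::idom) \<Rightarrow> 'a fract set" where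
  "frac_consts \<iota> = range (\<lambda>c. Fract (\<iota> c) 1)"

end

theory Submission
  imports Defs "HOL-Computational_Algebra.Polynomial" "HOL-Library.Poly_Mapping"
begin

text \<open>Adjoin indeterminates \<open>t\<close> to \<open>A\<close>, write \<open>k = \<complex>(t)\<close>, replace a transcendence basis among the
  generators \<open>z b\<close> by the generic linear forms \<open>X a = z a + \<Sum>b. t\<^sub>a\<^sub>b z b\<close>, and let \<open>y\<close> be one more generic
  linear form; it generates the function field over \<open>k(X)\<close>. Differentiation with respect to the \<open>t\<^sub>a\<^sub>b\<close>
  yields derivations that send \<open>X a\<close> to \<open>y\<close> or to \<open>X c\<close>, fix the remaining coordinates and preserve the
  extension of every prime \<open>P\<close> of \<open>A\<close>. This invariance makes the generator \<open>p\<close> of \<open>P \<inter> k[X]\<close> monic of full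
  degree in each variable, and makes it possible to attach to \<open>P\<close> a differential form \<open>\<omega>\<^sub>P\<close> that has a simple
  logarithmic pole along \<open>P\<close>, no other pole, and a degree bounded independently of \<open>P\<close>. If \<open>P\<close> is a
  differential ideal, then the Lie derivatives of \<open>\<omega>\<^sub>P\<close> along the given derivations are regular, so they
  lie in a finite-dimensional \<open>k\<close>-space that does not depend on \<open>P\<close>. Infinitely many \<open>P\<close> therefore give
  infinitely many \<open>k\<close>-independent combinations of the \<open>\<omega>\<^sub>P\<close> with vanishing Lie derivatives. These are
  dependent over the function field, and the coefficients of a shortest relation are constants, not all
  in \<open>k\<close>. Comparing coefficients in a shortest fraction turns such a constant into one of \<open>Frac A\<close>.\<close>

section \<open>Subrings, ideals and primes\<close>

text \<open>A height one prime need not be principal. The generator \<open>p\<close> of its trace on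
  \<open>k[X]\<close> gives the form \<open>dp / p\<close>, but this has poles along every component
  of \<open>p = 0\<close>, and the given derivations need not respect the other components. Euler's
  dual basis of the powers of \<open>y\<close> removes them: it combines polynomials congruent to
  \<open>y ^ j * dp\<close> modulo \<open>P\<close> into one numerator that agrees with
  \<open>dp\<close> along \<open>P\<close> and becomes divisible by \<open>p\<close> when multiplied
  by any element of \<open>P\<close>. Uniformity in \<open>P\<close> is a matter of degrees. If
  these polynomials exceed \<open>dp\<close> in degree by at most \<open>j\<close>, the numerator of
  a Lie derivative over \<open>p ^ 2\<close> has degree at most twice that of \<open>p\<close> plus
  a constant, and division by \<open>p ^ 2\<close> cancels the part that depends on
  \<open>P\<close>. So modulo \<open>P\<close> the element \<open>y\<close> must behave as if it had
  degree one; this follows from a derivation that moves \<open>X a\<close> with velocity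
  \<open>y\<close>. Such derivations exist because an extended prime is generated by elements free
  of \<open>t\<close> and is therefore stable under differentiation by any \<open>t\<close>. The
  price is that they act nontrivially on \<open>k\<close>, which is only stable under them.\<close>

definition subring :: "'r::comm_ring_1 set \<Rightarrow> bool" where
  "subring S \<longleftrightarrow> 0 \<in> S \<and> 1 \<in> S \<and> (\<forall>x\<in>S. \<forall>y\<in>S. x + y \<in> S) \<and>
     (\<forall>x\<in>S. \<forall>y\<in>S. x * y \<in> S) \<and> (\<forall>x\<in>S. - x \<in> S)"

lemma subringD:
  assumes "subring S"
  shows subring_0: "0 \<in> S" and subring_1: "1 \<in> S"
    and subring_add: "x \<in> S \<Longrightarrow> y \<in> S \<Longrightarrow> x + y \<in> S"
    and subring_mult: "x \<in> S \<Longrightarrow> y \<in> S \<Longrightarrow> x * y \<in> S"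
    and subring_uminus: "x \<in> S \<Longrightarrow> - x \<in> S"
    and subring_diff: "x \<in> S \<Longrightarrow> y \<in> S \<Longrightarrow> x - y \<in> S"
  using assms unfolding subring_def by (auto simp only: diff_conv_add_uminus)

lemma subring_sum: "subring S \<Longrightarrow> (\<And>i. i \<in> A \<Longrightarrow> f i \<in> S) \<Longrightarrow> sum f A \<in> S"
  by (induction A rule: infinite_finite_induct) (auto simp: subring_0 subring_add)

lemma subring_power: "subring S \<Longrightarrow> x \<in> S \<Longrightarrow> x ^ n \<in> S"
  by (induction n) (auto simp: subring_1 subring_mult)

lemma subring_of_nat: "subring S \<Longrightarrow> of_nat n \<in> S"
  by (induction n) (auto simp: subring_0 subring_1 subring_add)

lemma subring_UNIV: "subring UNIV"
  by (simp add: subring_def)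

text \<open>Ideals and primes are taken relative to a carrier \<open>S\<close>, since the argument
  moves between many subrings of one function field.\<close>

definition ideal_of :: "'r::comm_ring_1 set \<Rightarrow> 'r set \<Rightarrow> bool" where
  "ideal_of S I \<longleftrightarrow> I \<subseteq> S \<and> 0 \<in> I \<and> (\<forall>x\<in>I. \<forall>y\<in>I. x + y \<in> I) \<and> (\<forall>r\<in>S. \<forall>x\<in>I. r * x \<in> I)"

definition prime_of :: "'r::comm_ring_1 set \<Rightarrow> 'r set \<Rightarrow> bool" where
  "prime_of S P \<longleftrightarrow> ideal_of S P \<and> 1 \<notin> P \<and> (\<forall>x\<in>S. \<forall>y\<in>S. x * y \<in> P \<longrightarrow> x \<in> P \<or> y \<in> P)"

lemma ideal_ofD:
  assumes "ideal_of S I"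
  shows ideal_of_subset: "x \<in> I \<Longrightarrow> x \<in> S" and ideal_of_0: "0 \<in> I"
    and ideal_of_add: "x \<in> I \<Longrightarrow> y \<in> I \<Longrightarrow> x + y \<in> I"
    and ideal_of_mult: "r \<in> S \<Longrightarrow> x \<in> I \<Longrightarrow> r * x \<in> I"
    and ideal_of_mult2: "r \<in> S \<Longrightarrow> x \<in> I \<Longrightarrow> x * r \<in> I"
  using assms unfolding ideal_of_def by (auto simp: mult.commute)

lemma ideal_of_uminus:
  assumes "ideal_of S I" "subring S" "x \<in> I"
  shows "- x \<in> I"
proof -
  have "(-1) * x \<in> I"
    using assms by (intro ideal_of_mult) (auto intro: subring_uminus subring_1)
  then show ?thesis by simp
qed

lemma ideal_of_diff: "ideal_of S I \<Longrightarrow> subring S \<Longrightarrow> x \<in> I \<Longrightarrow> y \<in> I \<Longrightarrow> x - y \<in> I"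
  by (metis diff_conv_add_uminus ideal_of_add ideal_of_uminus)

lemma ideal_of_sum: "ideal_of S I \<Longrightarrow> (\<And>i. i \<in> A \<Longrightarrow> f i \<in> I) \<Longrightarrow> sum f A \<in> I"
  by (induction A rule: infinite_finite_induct) (auto simp: ideal_of_0 ideal_of_add)

lemma prime_ofD:
  assumes "prime_of S P"
  shows prime_of_ideal: "ideal_of S P" and prime_of_1: "1 \<notin> P"
    and prime_of_mult: "x \<in> S \<Longrightarrow> y \<in> S \<Longrightarrow> x * y \<in> P \<Longrightarrow> x \<in> P \<or> y \<in> P"
  using assms by (auto simp: prime_of_def)

lemma prime_of_power:
  assumes "prime_of S P" "subring S" "x \<in> S" "x ^ n \<in> P"
  shows "x \<in> P"
  using assms(4)
proof (induction n)
  case 0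
  then show ?case using assms(1) by (simp add: prime_of_1)
next
  case (Suc n)
  then show ?case using prime_of_mult[OF assms(1,3), of "x ^ n"] assms(2,3)
    by (auto simp: subring_power)
qed

lemma prime_of_prod:
  assumes "prime_of S P" "subring S" "finite A" "\<And>i. i \<in> A \<Longrightarrow> f i \<in> S \<and> f i \<notin> P"
  shows "prod f A \<in> S \<and> prod f A \<notin> P"
  using assms(3,4)
proof (induction A rule: finite_induct)
  case empty
  then show ?case using assms by (simp add: subring_1 prime_of_1)
next
  case (insert a A)
  then show ?case using assms(1,2) prime_of_mult[OF assms(1), of "f a" "prod f A"]
    by (auto simp: subring_mult)
qed

text \<open>Krull's argument: an ideal maximal among those that miss a multiplicative set is prime.
  It supplies the primes in Kaplansky's criterion for factoriality and the smaller prime that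
  contradicts height one.\<close>

lemma prime_avoiding:
  assumes S: "subring S" and J: "ideal_of S J" and M1: "1 \<in> M"
    and Mm: "\<And>x y. x \<in> M \<Longrightarrow> y \<in> M \<Longrightarrow> x * y \<in> M" and JM: "J \<inter> M = {}"
  shows "\<exists>P. prime_of S P \<and> J \<subseteq> P \<and> P \<inter> M = {}"
proof -
  define F where "F = {I. ideal_of S I \<and> J \<subseteq> I \<and> I \<inter> M = {}}"
  have "\<exists>P\<in>F. \<forall>Q\<in>F. P \<subseteq> Q \<longrightarrow> Q = P"
  proof (rule subset_Zorn)
    fix C assume C: "subset.chain F C"
    show "\<exists>U\<in>F. \<forall>X\<in>C. X \<subseteq> U"
    proof (cases "C = {}")
      case True
      then show ?thesis using J JM by (auto simp: F_def)
    next
      case False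
      have CF: "\<And>X. X \<in> C \<Longrightarrow> ideal_of S X \<and> J \<subseteq> X \<and> X \<inter> M = {}"
        using C by (auto simp: subset.chain_def F_def)
      have lin: "\<And>X Y. X \<in> C \<Longrightarrow> Y \<in> C \<Longrightarrow> X \<subseteq> Y \<or> Y \<subseteq> X"
        using C by (auto simp: subset.chain_def)
      have "ideal_of S (\<Union>C)"
        unfolding ideal_of_def
      proof (intro conjI ballI)
        show "\<Union>C \<subseteq> S" using CF by (meson Union_least ideal_of_subset subsetI)
        show "0 \<in> \<Union>C" using False CF by (auto simp: ideal_of_def)
        fix x y assume "x \<in> \<Union>C" "y \<in> \<Union>C"
        then obtain X Y where "X \<in> C" "Y \<in> C" "x \<in> X" "y \<in> Y" by blast
        then show "x + y \<in> \<Union>C"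
          using lin[of X Y] CF[of X] CF[of Y] ideal_of_add by (metis UnionI subsetD)
      next
        fix r x assume "r \<in> S" "x \<in> \<Union>C"
        then show "r * x \<in> \<Union>C" using CF ideal_of_mult by (metis Union_iff)
      qed
      moreover have "J \<subseteq> \<Union>C" using False CF by blast
      moreover have "\<Union>C \<inter> M = {}" using CF by blast
      ultimately show ?thesis by (auto simp: F_def)
    qed
  qed
  then obtain P where PF: "P \<in> F" and max: "\<And>Q. Q \<in> F \<Longrightarrow> P \<subseteq> Q \<Longrightarrow> Q = P" by blast
  have P: "ideal_of S P" "J \<subseteq> P" "P \<inter> M = {}" using PF by (auto simp: F_def)
  have ext: "\<exists>p r. p \<in> P \<and> r \<in> S \<and> p + r * x \<in> M" if x: "x \<in> S" "x \<notin> P" for x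
  proof (rule ccontr)
    assume neg: "\<not> ?thesis"
    define Q where "Q = {p + r * x |p r. p \<in> P \<and> r \<in> S}"
    have "P \<subseteq> Q"
    proof
      fix p assume "p \<in> P"
      then have "p = p + 0 * x \<and> p \<in> P \<and> 0 \<in> S" using S by (simp add: subring_0)
      then show "p \<in> Q" unfolding Q_def by blast
    qed
    have "x \<in> Q"
    proof -
      have "x = 0 + 1 * x \<and> 0 \<in> P \<and> 1 \<in> S" using S P by (simp add: subring_1 ideal_of_0)
      then show ?thesis unfolding Q_def by blast
    qed
    have "ideal_of S Q"
      unfolding ideal_of_def
    proof (intro conjI ballI)
      show "Q \<subseteq> S"
        using P(1) S x by (auto simp: Q_def intro!: subring_add subring_mult dest: ideal_of_subset)
      show "0 \<in> Q" using \<open>P \<subseteq> Q\<close> P(1) ideal_of_0 by blast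
      fix u v assume "u \<in> Q" "v \<in> Q"
      then obtain p r p' r' where "u = p + r * x" "v = p' + r' * x" "p \<in> P" "p' \<in> P" "r \<in> S" "r' \<in> S"
        by (auto simp: Q_def)
      then have "u + v = (p + p') + (r + r') * x \<and> p + p' \<in> P \<and> r + r' \<in> S"
        using P(1) S by (auto simp: algebra_simps ideal_of_add subring_add)
      then show "u + v \<in> Q" unfolding Q_def by blast
    next
      fix c u assume "c \<in> S" "u \<in> Q"
      then obtain p r where "u = p + r * x" "p \<in> P" "r \<in> S" by (auto simp: Q_def)
      then have "c * u = c * p + (c * r) * x \<and> c * p \<in> P \<and> c * r \<in> S"
        using P(1) S \<open>c \<in> S\<close> by (auto simp: algebra_simps ideal_of_mult subring_mult)
      then show "c * u \<in> Q" unfolding Q_def by blast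
    qed
    moreover have "Q \<inter> M = {}" using neg by (auto simp: Q_def)
    ultimately have "Q \<in> F" using P \<open>P \<subseteq> Q\<close> by (auto simp: F_def)
    then show False using max[of Q] \<open>P \<subseteq> Q\<close> \<open>x \<in> Q\<close> x by blast
  qed
  have "prime_of S P"
    unfolding prime_of_def
  proof (intro conjI ballI impI)
    show "ideal_of S P" by fact
    show "1 \<notin> P" using P(3) M1 by blast
    fix x y assume xy: "x \<in> S" "y \<in> S" "x * y \<in> P"
    show "x \<in> P \<or> y \<in> P"
    proof (rule ccontr)
      assume "\<not> ?thesis"
      then obtain p r p' r' where *: "p \<in> P" "r \<in> S" "p + r * x \<in> M" "p' \<in> P" "r' \<in> S" "p' + r' * y \<in> M"
        using ext[of x] ext[of y] xy by blast
      have "(p + r * x) * (p' + r' * y) = p * (p' + r' * y) + ((r * x) * p' + (r * r') * (x * y))"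
        by (simp add: algebra_simps)
      also have "\<dots> \<in> P"
      proof (intro ideal_of_add[OF P(1)])
        show "p * (p' + r' * y) \<in> P"
          using * xy P(1) S ideal_of_subset[OF P(1)]
          by (intro ideal_of_mult2[OF P(1)] subring_add[OF S] subring_mult[OF S]) auto
        show "(r * x) * p' \<in> P" "(r * r') * (x * y) \<in> P"
          using ideal_of_mult[OF P(1) subring_mult[OF S *(2) xy(1)] *(4)]
            ideal_of_mult[OF P(1) subring_mult[OF S *(2,5)] xy(3)] by auto
      qed
      finally show False using Mm[OF *(3,6)] P(3) by blast
    qed
  qed
  then show ?thesis using P by blast
qed

section \<open>Derivations and the degree filtration\<close>

definition poly_over :: "'r::comm_ring_1 set \<Rightarrow> 'r poly set" where
  "poly_over S = {f. \<forall>i. coeff f i \<in> S}"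

lemma poly_overD: "f \<in> poly_over S \<Longrightarrow> coeff f i \<in> S"
  by (simp add: poly_over_def)

lemma poly_over_mono: "S \<subseteq> T \<Longrightarrow> poly_over S \<subseteq> poly_over T"
  by (auto simp: poly_over_def)

lemma poly_over_closed:
  assumes "subring S"
  shows poly_over_0: "0 \<in> poly_over S"
    and poly_over_add: "f \<in> poly_over S \<Longrightarrow> g \<in> poly_over S \<Longrightarrow> f + g \<in> poly_over S"
    and poly_over_uminus: "f \<in> poly_over S \<Longrightarrow> - f \<in> poly_over S"
    and poly_over_diff: "f \<in> poly_over S \<Longrightarrow> g \<in> poly_over S \<Longrightarrow> f - g \<in> poly_over S"
    and poly_over_mult: "f \<in> poly_over S \<Longrightarrow> g \<in> poly_over S \<Longrightarrow> f * g \<in> poly_over S"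
    and poly_over_smult: "c \<in> S \<Longrightarrow> f \<in> poly_over S \<Longrightarrow> smult c f \<in> poly_over S"
    and poly_over_monom: "c \<in> S \<Longrightarrow> monom c n \<in> poly_over S"
    and poly_over_const: "c \<in> S \<Longrightarrow> [:c:] \<in> poly_over S"
    and poly_over_pCons: "c \<in> S \<Longrightarrow> f \<in> poly_over S \<Longrightarrow> pCons c f \<in> poly_over S"
  using assms unfolding poly_over_def
  by (auto simp: coeff_mult coeff_pCons subring_0 subring_add subring_mult subring_uminus subring_diff
      intro!: subring_sum split: nat.splits)

lemma subring_poly_over: "subring S \<Longrightarrow> subring (poly_over S)"
  unfolding subring_def[of "poly_over S"]
  by (auto intro: poly_over_0 poly_over_add poly_over_uminus poly_over_mult
      poly_over_const[of S 1, simplified one_pCons[symmetric]] subring_1)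

lemma poly_over_pderiv: "subring S \<Longrightarrow> f \<in> poly_over S \<Longrightarrow> pderiv f \<in> poly_over S"
  unfolding poly_over_def
  by (auto simp: coeff_pderiv intro!: subring_mult subring_of_nat subring_add subring_1)

lemma poly_over_poly:
  assumes "subring S" "f \<in> poly_over S" "x \<in> S"
  shows "poly f x \<in> S"
  unfolding poly_altdef
  using assms by (intro subring_sum subring_mult subring_power) (auto simp: poly_over_def)

text \<open>Scaling by powers of the leading coefficient replaces division, so that quotient and
  remainder stay over \<open>S\<close>. The case \<open>r = 0\<close> is listed separately because
  the zero polynomial has degree \<open>0\<close>, which is not below the degree of a constant
  \<open>g\<close>.\<close>

lemma pseudo_division:
  fixes g :: "'r::idom poly"
  assumes S: "subring S" and g: "g \<in> poly_over S" "g \<noteq> 0" and f: "f \<in> poly_over S"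
  shows "\<exists>N q r. q \<in> poly_over S \<and> r \<in> poly_over S \<and>
    smult (lead_coeff g ^ N) f = g * q + r \<and> (r = 0 \<or> degree r < degree g)"
  using f
proof (induction "degree f" arbitrary: f rule: less_induct)
  case less
  show ?case
  proof (cases "f = 0 \<or> degree f < degree g")
    case True
    then have "smult (lead_coeff g ^ 0) f = g * 0 + f \<and> (f = 0 \<or> degree f < degree g)" by simp
    then show ?thesis using less.prems poly_over_0[OF S] by blast
  next
    case False
    then have f0: "f \<noteq> 0" and dg: "degree g \<le> degree f" by auto
    define m where "m = monom (lead_coeff f) (degree f - degree g)"
    define h where "h = smult (lead_coeff g) f - g * m"
    have mS: "m \<in> poly_over S"
      unfolding m_def using less.prems by (intro poly_over_monom S) (auto simp: poly_over_def)
    have hS: "h \<in> poly_over S"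
      unfolding h_def using less.prems g mS
      by (intro poly_over_diff poly_over_smult poly_over_mult S) (auto simp: poly_over_def)
    have dm: "degree (g * m) = degree f"
      using f0 g dg by (simp add: m_def degree_mult_eq degree_monom_eq)
    have c0: "coeff h (degree f) = 0"
      using dm dg f0 coeff_mult_degree_sum[of g m]
      by (simp add: h_def m_def degree_monom_eq mult.commute)
    have hdeg: "degree h \<le> degree f"
      unfolding h_def using dm by (intro degree_diff_le) (auto intro: degree_smult_le)
    have eqf: "smult (lead_coeff g) f = g * m + h" by (simp add: h_def)
    show ?thesis
    proof (cases "h = 0 \<or> degree h < degree g")
      case True
      then have "smult (lead_coeff g ^ 1) f = g * m + h \<and> (h = 0 \<or> degree h < degree g)"
        using eqf by simp
      then show ?thesis using mS hS by blast
    next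
      case False
      then have "degree h < degree f"
        using hdeg c0 by (metis le_neq_implies_less leading_coeff_0_iff)
      from less.hyps[OF this hS] obtain N q r where
        *: "q \<in> poly_over S" "r \<in> poly_over S" "smult (lead_coeff g ^ N) h = g * q + r"
          "r = 0 \<or> degree r < degree g" by blast
      have "smult (lead_coeff g ^ Suc N) f = smult (lead_coeff g ^ N) (smult (lead_coeff g) f)"
        by (simp add: mult.commute)
      also have "\<dots> = g * (smult (lead_coeff g ^ N) m + q) + r"
        by (simp add: eqf smult_add_right *(3) algebra_simps)
      finally have "smult (lead_coeff g ^ Suc N) f = g * (smult (lead_coeff g ^ N) m + q) + r" .
      moreover have "smult (lead_coeff g ^ N) m + q \<in> poly_over S"
        using * mS g by (intro poly_over_add poly_over_smult S subring_power) (auto simp: poly_over_def)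
      ultimately show ?thesis using * by blast
    qed
  qed
qed

text \<open>Linearity over a base field is kept apart: several derivations below map
  \<open>k\<close> into itself without killing it.\<close>

definition derivation :: "('r::comm_ring_1 \<Rightarrow> 'r) \<Rightarrow> bool" where
  "derivation d \<longleftrightarrow> (\<forall>x y. d (x + y) = d x + d y) \<and> (\<forall>x y. d (x * y) = d x * y + x * d y)"

lemma derivationD:
  assumes "derivation d"
  shows derivation_add: "d (x + y) = d x + d y"
    and derivation_mult: "d (x * y) = d x * y + x * d y"
    and derivation_0: "d 0 = 0" and derivation_1: "d 1 = 0"
    and derivation_uminus: "d (- x) = - d x"
    and derivation_diff: "d (x - y) = d x - d y"
proof -
  have A: "d (x + y) = d x + d y" "d (x * y) = d x * y + x * d y" for x y
    using assms by (auto simp: derivation_def)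
  show "d (x + y) = d x + d y" "d (x * y) = d x * y + x * d y" by (rule A)+
  have "d (0 + 0) = d 0 + d 0" by (rule A)
  then show Z: "d 0 = 0" by simp
  have "d (1 * 1) = d 1 * 1 + 1 * d 1" by (rule A)
  then show "d 1 = 0" by simp
  have U: "d (- x) = - d x" for x
    using A(1)[of x "- x"] Z by (simp add: add_eq_0_iff)
  then show "d (- x) = - d x" .
  show "d (x - y) = d x - d y"
    using A(1)[of x "- y"] U by simp
qed

lemma derivation_sum: "derivation d \<Longrightarrow> d (sum f A) = (\<Sum>i\<in>A. d (f i))"
  by (induction A rule: infinite_finite_induct) (auto simp: derivation_0 derivation_add)

lemma derivation_of_nat: "derivation d \<Longrightarrow> d (of_nat n) = 0"
  by (induction n) (auto simp: derivation_0 derivation_1 derivation_add)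

text \<open>Separates the action of \<open>d\<close> on the coefficients from its action on the
  point. Most later computations compare these two parts.\<close>

lemma derivation_poly:
  assumes d: "derivation d"
  shows "d (poly f x) = poly (map_poly d f) x + poly (pderiv f) x * d x"
proof (induction f)
  case 0
  then show ?case using d by (simp add: derivation_0)
next
  case (pCons a f)
  then show ?case using d
    by (simp add: map_poly_pCons derivation_0 derivation_add derivation_mult pderiv_pCons algebra_simps)
qed

lemma coeff_map_poly_derivation: "derivation d \<Longrightarrow> coeff (map_poly d f) i = d (coeff f i)"
  by (simp add: coeff_map_poly derivation_0)

lemma map_poly_derivation_over:
  "derivation d \<Longrightarrow> d ` S \<subseteq> S \<Longrightarrow> f \<in> poly_over S \<Longrightarrow> map_poly d f \<in> poly_over S"
  by (auto simp: poly_over_def coeff_map_poly_derivation)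

lemma pderiv_map_poly_derivation:
  "derivation d \<Longrightarrow> pderiv (map_poly d f) = map_poly d (pderiv f)"
  by (rule poly_eqI)
    (simp add: coeff_pderiv coeff_map_poly_derivation derivation_mult derivation_of_nat
      derivation_add derivation_1 algebra_simps)

lemma derivation_divide:
  fixes d :: "'r::field \<Rightarrow> 'r"
  assumes d: "derivation d" and y: "y \<noteq> 0"
  shows "d (x / y) = (d x * y - x * d y) / (y * y)"
proof -
  have "d x = d (x / y * y)" using y by simp
  also have "\<dots> = d (x / y) * y + x / y * d y" by (rule derivation_mult[OF d])
  finally show ?thesis using y by (simp add: field_simps)
qed

text \<open>The elements of \<open>k[X i | i \<in> I]\<close> of total degree less than \<open>n\<close>; the bound is strict so
  that the zero polynomial is the only element of degree less than \<open>0\<close>.\<close>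

inductive deg_ltp :: "'r::comm_ring_1 set \<Rightarrow> (nat \<Rightarrow> 'r) \<Rightarrow> nat set \<Rightarrow> 'r \<Rightarrow> nat \<Rightarrow> bool"
  for k :: "'r set" and X :: "nat \<Rightarrow> 'r" and I :: "nat set" where
  zero: "deg_ltp k X I 0 n"
| const: "c \<in> k \<Longrightarrow> deg_ltp k X I c (Suc n)"
| var: "i \<in> I \<Longrightarrow> deg_ltp k X I b n \<Longrightarrow> deg_ltp k X I (X i * b) (Suc n)"
| add: "deg_ltp k X I a n \<Longrightarrow> deg_ltp k X I b n \<Longrightarrow> deg_ltp k X I (a + b) n"

definition deg_lt :: "'r::comm_ring_1 set \<Rightarrow> (nat \<Rightarrow> 'r) \<Rightarrow> nat set \<Rightarrow> nat \<Rightarrow> 'r set" where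
  "deg_lt k X I n = {b. deg_ltp k X I b n}"

lemma deg_lt_zero: "0 \<in> deg_lt k X I n"
  and deg_lt_const: "c \<in> k \<Longrightarrow> c \<in> deg_lt k X I (Suc n)"
  and deg_lt_var: "i \<in> I \<Longrightarrow> b \<in> deg_lt k X I n \<Longrightarrow> X i * b \<in> deg_lt k X I (Suc n)"
  and deg_lt_add: "a \<in> deg_lt k X I n \<Longrightarrow> b \<in> deg_lt k X I n \<Longrightarrow> a + b \<in> deg_lt k X I n"
  by (auto simp: deg_lt_def intro: deg_ltp.intros)

lemmas deg_lt_intros = deg_lt_zero deg_lt_const deg_lt_var deg_lt_add

lemma deg_lt_induct [consumes 1, case_names zero const var add]:
  assumes "b \<in> deg_lt k X I n"
    and "\<And>n. Q 0 n" and "\<And>c n. c \<in> k \<Longrightarrow> Q c (Suc n)"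
    and "\<And>i b n. i \<in> I \<Longrightarrow> b \<in> deg_lt k X I n \<Longrightarrow> Q b n \<Longrightarrow> Q (X i * b) (Suc n)"
    and "\<And>a n b. a \<in> deg_lt k X I n \<Longrightarrow> Q a n \<Longrightarrow> b \<in> deg_lt k X I n \<Longrightarrow> Q b n \<Longrightarrow> Q (a + b) n"
  shows "Q b n"
  using assms(1) unfolding deg_lt_def mem_Collect_eq
  by (induction rule: deg_ltp.induct) (auto intro: assms(2-) simp: deg_lt_def)

text \<open>The polynomial ring is realised inside the ambient ring: the \<open>X i\<close> are
  given elements, and their independence is a separate hypothesis.\<close>

definition pring :: "'r::comm_ring_1 set \<Rightarrow> (nat \<Rightarrow> 'r) \<Rightarrow> nat set \<Rightarrow> 'r set" where
  "pring k X I = (\<Union>n. deg_lt k X I n)"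

lemma deg_lt_0: "b \<in> deg_lt k X I 0 \<longleftrightarrow> b = 0"
proof
  have "b \<in> deg_lt k X I n \<Longrightarrow> n = 0 \<Longrightarrow> b = 0" for n
    by (induction rule: deg_lt_induct) auto
  then show "b \<in> deg_lt k X I 0 \<Longrightarrow> b = 0" by blast
qed (auto intro: deg_lt_zero)

lemma deg_lt_mono:
  assumes "b \<in> deg_lt k X I n" "n \<le> m" "I \<subseteq> J"
  shows "b \<in> deg_lt k X J m"
  using assms
proof (induction arbitrary: m rule: deg_lt_induct)
  case (const c n)
  then show ?case by (cases m) (auto intro: deg_lt_const)
next
  case (var i b n)
  then show ?case by (cases m) (auto intro: deg_lt_var)
qed (auto intro: deg_lt_intros)

lemma deg_lt_pring: "b \<in> deg_lt k X I n \<Longrightarrow> b \<in> pring k X I"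
  by (auto simp: pring_def)

lemma pring_mono: "I \<subseteq> J \<Longrightarrow> pring k X I \<subseteq> pring k X J"
  by (auto simp: pring_def intro: deg_lt_mono)

lemma deg_lt_sum: "(\<And>i. i \<in> A \<Longrightarrow> f i \<in> deg_lt k X I n) \<Longrightarrow> sum f A \<in> deg_lt k X I n"
  by (induction A rule: infinite_finite_induct) (auto intro: deg_lt_intros)

lemma deg_lt_pow:
  assumes "i \<in> I" "b \<in> deg_lt k X I n"
  shows "b * X i ^ m \<in> deg_lt k X I (n + m)"
proof (induction m)
  case 0
  then show ?case using assms by simp
next
  case (Suc m)
  then have "X i * (b * X i ^ m) \<in> deg_lt k X I (Suc (n + m))" by (rule deg_lt_var[OF assms(1)])
  then show ?case by (simp add: algebra_simps)
qed

context
  fixes k :: "'r::comm_ring_1 set"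
  assumes k: "subring k"
begin

lemma deg_lt_scale:
  assumes "c \<in> k" "b \<in> deg_lt k X I n"
  shows "c * b \<in> deg_lt k X I n"
  using assms(2)
proof (induction rule: deg_lt_induct)
  case (var i b n)
  then have "X i * (c * b) \<in> deg_lt k X I (Suc n)" by (intro deg_lt_var) auto
  then show ?case by (simp add: algebra_simps)
qed (use assms(1) in \<open>auto simp: distrib_left intro: deg_lt_intros subring_mult[OF k]\<close>)

lemma deg_lt_uminus: "b \<in> deg_lt k X I n \<Longrightarrow> - b \<in> deg_lt k X I n"
  using deg_lt_scale[of "- 1" b X I n] k by (simp add: subring_uminus subring_1)

lemma deg_lt_diff: "a \<in> deg_lt k X I n \<Longrightarrow> b \<in> deg_lt k X I n \<Longrightarrow> a - b \<in> deg_lt k X I n"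
  using deg_lt_add[OF _ deg_lt_uminus] by fastforce

text \<open>Degrees at most \<open>m - 1\<close> and \<open>n - 1\<close> add up to at most
  \<open>m + n - 2\<close>, hence the strict bound \<open>m + n - 1\<close>; truncation takes care
  of a zero factor.\<close>

lemma deg_lt_mult:
  assumes "a \<in> deg_lt k X I m" "b \<in> deg_lt k X I n"
  shows "a * b \<in> deg_lt k X I (m + n - 1)"
  using assms(1)
proof (induction rule: deg_lt_induct)
  case (const c m)
  then show ?case using deg_lt_mono[OF deg_lt_scale[OF const assms(2)]] by simp
next
  case (var i a m)
  show ?case
  proof (cases "m + n")
    case 0
    then show ?thesis using var assms(2) by (auto simp: deg_lt_0 intro: deg_lt_zero)
  next
    case (Suc l)
    then have "X i * (a * b) \<in> deg_lt k X I (Suc (m + n - 1))" using var by (intro deg_lt_var) auto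
    then show ?thesis using Suc by (simp add: mult.assoc)
  qed
qed (auto simp: distrib_right intro: deg_lt_intros)

lemma subring_pring: "subring (pring k X I)"
proof -
  have add: "x + y \<in> pring k X I" if "x \<in> pring k X I" "y \<in> pring k X I" for x y
  proof -
    from that obtain m n where "x \<in> deg_lt k X I m" "y \<in> deg_lt k X I n" unfolding pring_def by blast
    then have "x \<in> deg_lt k X I (m + n)" "y \<in> deg_lt k X I (m + n)" by (auto intro: deg_lt_mono)
    then show ?thesis by (auto simp: pring_def intro: deg_lt_add)
  qed
  show ?thesis
    unfolding subring_def
  proof (intro conjI ballI)
    show "1 \<in> pring k X I" using deg_lt_const[OF subring_1[OF k]] by (auto simp: pring_def)
  qed (use add in \<open>auto simp: pring_def intro: deg_lt_zero deg_lt_mult deg_lt_uminus\<close>)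
qed

lemma const_pring: "c \<in> k \<Longrightarrow> c \<in> pring k X I"
  by (auto simp: pring_def intro: deg_lt_const)

lemma var_deg_lt: "i \<in> I \<Longrightarrow> X i \<in> deg_lt k X I 2"
  using deg_lt_var[OF _ deg_lt_const[OF subring_1[OF k]], of i I X 0] by (simp add: numeral_2_eq_2)

lemma var_pring: "i \<in> I \<Longrightarrow> X i \<in> pring k X I"
  by (auto simp: pring_def intro: var_deg_lt)

lemma pring_minimal:
  assumes "subring S" "k \<subseteq> S" "\<And>i. i \<in> I \<Longrightarrow> X i \<in> S"
  shows "pring k X I \<subseteq> S"
proof
  fix b assume "b \<in> pring k X I"
  then obtain n where "b \<in> deg_lt k X I n" by (auto simp: pring_def)
  then show "b \<in> S"
    by (induction rule: deg_lt_induct)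
      (use assms(2,3) in \<open>auto intro: subring_0[OF assms(1)] subring_mult[OF assms(1)] subring_add[OF assms(1)]\<close>)
qed

lemma pring_empty: "pring k X {} = k"
proof
  show "pring k X {} \<subseteq> k" using k by (intro pring_minimal) auto
qed (auto intro: const_pring)

lemma deg_lt_Suc_0: "b \<in> deg_lt k X I (Suc 0) \<longleftrightarrow> b \<in> k"
proof
  have "b \<in> deg_lt k X I n \<Longrightarrow> n \<le> Suc 0 \<Longrightarrow> b \<in> k" for n
    by (induction rule: deg_lt_induct)
      (auto simp: deg_lt_0 subring_0[OF k] subring_add[OF k])
  then show "b \<in> deg_lt k X I (Suc 0) \<Longrightarrow> b \<in> k" by blast
qed (auto intro: deg_lt_const)

text \<open>The bound \<open>n - j\<close> truncates at \<open>0\<close>, where only the zero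
  element is left, so it also limits the powers of \<open>X a\<close> that occur.\<close>

lemma deg_lt_expand:
  assumes "a \<in> I" "b \<in> deg_lt k X I n"
  shows "\<exists>\<beta>. (\<forall>j. coeff \<beta> j \<in> deg_lt k X (I - {a}) (n - j)) \<and> poly \<beta> (X a) = b"
  using assms(2)
proof (induction rule: deg_lt_induct)
  case (zero n)
  then show ?case by (intro exI[of _ 0]) (auto intro: deg_lt_zero)
next
  case (const c n)
  then show ?case
    by (intro exI[of _ "[:c:]"]) (auto simp: coeff_pCons split: nat.splits intro: deg_lt_intros)
next
  case (var i b n)
  then obtain \<beta> where \<beta>: "\<And>j. coeff \<beta> j \<in> deg_lt k X (I - {a}) (n - j)" "poly \<beta> (X a) = b" by blast
  show ?case
  proof (cases "i = a")
    case True
    then show ?thesis using \<beta>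
      by (intro exI[of _ "pCons 0 \<beta>"]) (auto simp: coeff_pCons split: nat.splits intro: deg_lt_zero)
  next
    case False
    have "X i * coeff \<beta> j \<in> deg_lt k X (I - {a}) (Suc n - j)" for j
    proof (cases "j \<le> n")
      case True
      then have "Suc n - j = Suc (n - j)" by simp
      then show ?thesis using \<beta>(1)[of j] var(1) False by (auto intro: deg_lt_var)
    next
      case False
      then have "coeff \<beta> j = 0" using \<beta>(1)[of j] by (simp add: deg_lt_0)
      then show ?thesis by (simp add: deg_lt_zero)
    qed
    then show ?thesis using \<beta> by (intro exI[of _ "smult (X i) \<beta>"]) auto
  qed
next
  case (add b n c)
  then obtain \<beta> \<gamma> where "\<And>j. coeff \<beta> j \<in> deg_lt k X (I - {a}) (n - j)" "poly \<beta> (X a) = b"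
    "\<And>j. coeff \<gamma> j \<in> deg_lt k X (I - {a}) (n - j)" "poly \<gamma> (X a) = c" by blast
  then show ?case by (intro exI[of _ "\<beta> + \<gamma>"]) (auto intro: deg_lt_add)
qed

lemma deg_lt_collect:
  assumes "a \<in> I" "\<And>j. coeff \<beta> j \<in> deg_lt k X (I - {a}) (n - j)"
  shows "poly \<beta> (X a) \<in> deg_lt k X I n"
  unfolding poly_altdef
proof (rule deg_lt_sum)
  fix j
  show "coeff \<beta> j * X a ^ j \<in> deg_lt k X I n"
  proof (cases "j \<le> n")
    case True
    have "coeff \<beta> j \<in> deg_lt k X I (n - j)" using assms(2)[of j] by (rule deg_lt_mono) auto
    from deg_lt_pow[OF assms(1) this, of j] show ?thesis using True by simp
  next
    case False
    then have "coeff \<beta> j = 0" using assms(2)[of j] by (simp add: deg_lt_0)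
    then show ?thesis by (simp add: deg_lt_zero)
  qed
qed

lemma pring_expand:
  assumes "a \<in> I" "b \<in> pring k X I"
  shows "\<exists>\<beta>\<in>poly_over (pring k X (I - {a})). poly \<beta> (X a) = b"
proof -
  obtain n where "b \<in> deg_lt k X I n" using assms by (auto simp: pring_def)
  then obtain \<beta> where "\<And>j. coeff \<beta> j \<in> deg_lt k X (I - {a}) (n - j)" "poly \<beta> (X a) = b"
    using deg_lt_expand assms(1) by blast
  then show ?thesis by (intro bexI[of _ \<beta>]) (auto simp: poly_over_def pring_def)
qed

lemma pring_collect:
  assumes "a \<in> I" "\<beta> \<in> poly_over (pring k X (I - {a}))"
  shows "poly \<beta> (X a) \<in> pring k X I"
proof (rule poly_over_poly[OF subring_pring])
  show "\<beta> \<in> poly_over (pring k X I)"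
    using assms(2) poly_over_mono[OF pring_mono[of "I - {a}" I k X]] by blast
qed (use assms(1) in \<open>auto intro: var_pring\<close>)

end

section \<open>Algebraic independence and factoriality\<close>

lemma smult_cancel_left: "(c::'r::idom) \<noteq> 0 \<Longrightarrow> smult c f = smult c g \<Longrightarrow> f = g"
  by (metis eq_iff_diff_eq_0 smult_diff_right smult_eq_0_iff)

definition transc :: "'r::comm_ring_1 set \<Rightarrow> 'r \<Rightarrow> bool" where
  "transc R x \<longleftrightarrow> (\<forall>\<beta>\<in>poly_over R. poly \<beta> x = 0 \<longrightarrow> \<beta> = 0)"

text \<open>Formulated so that any single variable can be split off. \<open>alg_indep_insert\<close>
  recovers the usual construction one element at a time.\<close>

definition alg_indep :: "'r::comm_ring_1 set \<Rightarrow> (nat \<Rightarrow> 'r) \<Rightarrow> nat set \<Rightarrow> bool" where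
  "alg_indep k X I \<longleftrightarrow> (\<forall>a\<in>I. transc (pring k X (I - {a})) (X a))"

lemma transcD: "transc R x \<Longrightarrow> \<beta> \<in> poly_over R \<Longrightarrow> poly \<beta> x = 0 \<Longrightarrow> \<beta> = 0"
  by (auto simp: transc_def)

lemma transc_eq:
  assumes "transc R x" "subring R" "\<beta> \<in> poly_over R" "\<gamma> \<in> poly_over R" "poly \<beta> x = poly \<gamma> x"
  shows "\<beta> = \<gamma>"
proof -
  have "\<beta> - \<gamma> = 0"
    using assms by (intro transcD[OF assms(1)] poly_over_diff) auto
  then show ?thesis by simp
qed

lemma alg_indep_subset:
  assumes "alg_indep k X I" "J \<subseteq> I"
  shows "alg_indep k X J"
  unfolding alg_indep_def transc_def
proof (intro ballI impI)
  fix a \<beta> assume "a \<in> J" "\<beta> \<in> poly_over (pring k X (J - {a}))" "poly \<beta> (X a) = 0"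
  moreover have "pring k X (J - {a}) \<subseteq> pring k X (I - {a})" using assms(2) by (intro pring_mono) auto
  ultimately show "\<beta> = 0" using assms poly_over_mono unfolding alg_indep_def transc_def by blast
qed

lemma deg_lt_exact:
  assumes "b \<in> pring k X I" "b \<notin> deg_lt k X I n"
  obtains m where "n \<le> m" "b \<in> deg_lt k X I (Suc m)" "b \<notin> deg_lt k X I m"
proof -
  define M where "M = (LEAST m. b \<in> deg_lt k X I m)"
  have M: "b \<in> deg_lt k X I M" "\<And>m. m < M \<Longrightarrow> b \<notin> deg_lt k X I m"
    using assms(1) unfolding M_def pring_def by (auto intro: LeastI dest: not_less_Least)
  have "n < M" using M(1) assms(2) deg_lt_mono[of b k X I M n I] by (meson not_less order_refl)
  then show ?thesis using that[of "M - 1"] M(1) M(2)[of "M - 1"] by simp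
qed

text \<open>The index \<open>j\<close> is the largest power of \<open>X a\<close> in the homogeneous
  part of degree \<open>m\<close>. Homogeneous parts are never formed; membership in the filtration
  detects them.\<close>

lemma top_coeff:
  assumes k: "subring k" and a: "a \<in> I"
    and \<beta>: "\<And>j. coeff \<beta> j \<in> deg_lt k X (I - {a}) (Suc m - j)"
    and b: "poly \<beta> (X a) \<notin> deg_lt k X I m"
  obtains j where "j \<le> m" "coeff \<beta> j \<notin> deg_lt k X (I - {a}) (m - j)"
    "\<And>i. j < i \<Longrightarrow> coeff \<beta> i \<in> deg_lt k X (I - {a}) (m - i)"
proof -
  define A where "A = {j. coeff \<beta> j \<notin> deg_lt k X (I - {a}) (m - j)}"
  have sub: "A \<subseteq> {..m}"
  proof
    fix j assume "j \<in> A"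
    show "j \<in> {..m}"
    proof (rule ccontr)
      assume "j \<notin> {..m}"
      then have "coeff \<beta> j = 0" using \<beta>[of j] by (simp add: deg_lt_0)
      then show False using \<open>j \<in> A\<close> by (simp add: A_def deg_lt_zero)
    qed
  qed
  have "A \<noteq> {}"
    using b deg_lt_collect[OF k a, of \<beta> X m] by (auto simp: A_def)
  have fin: "finite A" using sub finite_subset by blast
  have "Max A \<in> A" using fin \<open>A \<noteq> {}\<close> by simp
  moreover have "i \<notin> A" if "Max A < i" for i using fin Max_ge[OF fin, of i] that by (meson not_less)
  moreover have A: "j \<in> A \<longleftrightarrow> coeff \<beta> j \<notin> deg_lt k X (I - {a}) (m - j)" for j
    by (simp add: A_def)
  ultimately show ?thesis
    using sub that[of "Max A"] by blast
qed

text \<open>Leading forms do not cancel. If \<open>j\<close> and \<open>l\<close> are the top powers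
  of \<open>X a\<close> in the two leading forms, the coefficient of \<open>X a ^ (j + l)\<close> in
  the product has a single contribution of full degree, and the induction hypothesis applies to
  it.\<close>

lemma deg_lt_mult_exact:
  fixes k :: "'r::idom set"
  assumes k: "subring k" and I: "finite I" "alg_indep k X I"
    and p: "p \<in> deg_lt k X I (Suc m)" "p \<notin> deg_lt k X I m"
    and b: "b \<in> deg_lt k X I (Suc n)" "b \<notin> deg_lt k X I n"
  shows "p * b \<notin> deg_lt k X I (m + n)"
  using I p b
proof (induction I arbitrary: p b m n rule: finite_induct)
  case empty
  have "p \<in> k" "b \<in> k"
    using empty deg_lt_pring[of _ k X "{}"] by (auto simp: pring_empty[OF k])
  then have "m = 0" "n = 0"
    using empty by (metis deg_lt_const not0_implies_Suc)+
  then show ?case using empty by (simp add: deg_lt_0)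
next
  case (insert a F)
  have aF: "a \<in> insert a F" "insert a F - {a} = F" using insert by auto
  have FI: "alg_indep k X F" using insert.prems(1) alg_indep_subset by blast
  have tr: "transc (pring k X F) (X a)" using insert.prems(1) aF by (auto simp: alg_indep_def)
  obtain \<beta> where \<beta>: "\<And>j. coeff \<beta> j \<in> deg_lt k X F (Suc m - j)" "poly \<beta> (X a) = p"
    using deg_lt_expand[OF k aF(1) insert.prems(2)] aF by auto
  obtain \<eta> where \<eta>: "\<And>j. coeff \<eta> j \<in> deg_lt k X F (Suc n - j)" "poly \<eta> (X a) = b"
    using deg_lt_expand[OF k aF(1) insert.prems(4)] aF by auto
  obtain j where j: "j \<le> m" "coeff \<beta> j \<notin> deg_lt k X F (m - j)"
    "\<And>i. j < i \<Longrightarrow> coeff \<beta> i \<in> deg_lt k X F (m - i)"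
    using top_coeff[OF k aF(1), of \<beta> X m] \<beta> insert.prems(3) aF by auto
  obtain l where l: "l \<le> n" "coeff \<eta> l \<notin> deg_lt k X F (n - l)"
    "\<And>i. l < i \<Longrightarrow> coeff \<eta> i \<in> deg_lt k X F (n - i)"
    using top_coeff[OF k aF(1), of \<eta> X n] \<eta> insert.prems(5) aF by auto
  show ?case
  proof
    assume "p * b \<in> deg_lt k X (insert a F) (m + n)"
    then obtain \<gamma> where \<gamma>: "\<And>j. coeff \<gamma> j \<in> deg_lt k X F (m + n - j)" "poly \<gamma> (X a) = p * b"
      using deg_lt_expand[OF k aF(1)] aF by fastforce
    have over: "\<beta> \<in> poly_over (pring k X F)" "\<eta> \<in> poly_over (pring k X F)" "\<gamma> \<in> poly_over (pring k X F)"
      using \<beta> \<eta> \<gamma> by (auto simp: poly_over_def pring_def)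
    have "\<gamma> = \<beta> * \<eta>"
      using over \<beta> \<eta> \<gamma>
      by (intro transc_eq[OF tr subring_pring[OF k]] poly_over_mult subring_pring k) auto
    then have "coeff \<gamma> (j + l) = (\<Sum>i\<le>j + l. coeff \<beta> i * coeff \<eta> (j + l - i))"
      by (simp add: coeff_mult)
    also have "\<dots> = coeff \<beta> j * coeff \<eta> l + (\<Sum>i\<in>{..j + l} - {j}. coeff \<beta> i * coeff \<eta> (j + l - i))"
      by (subst sum.remove[of _ j]) auto
    finally have eq: "coeff \<beta> j * coeff \<eta> l =
      coeff \<gamma> (j + l) - (\<Sum>i\<in>{..j + l} - {j}. coeff \<beta> i * coeff \<eta> (j + l - i))" by simp
    \<comment> \<open>Either the first index exceeds \<open>j\<close> or the second exceeds
      \<open>l\<close>, so one factor has smaller degree than its position allows.\<close>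
    have "coeff \<beta> i * coeff \<eta> (j + l - i) \<in> deg_lt k X F (m + n - (j + l))"
      if i: "i \<in> {..j + l} - {j}" for i
    proof (cases "i > j")
      case True
      show ?thesis
      proof (cases "i \<le> m")
        case im: True
        have "coeff \<beta> i * coeff \<eta> (j + l - i) \<in> deg_lt k X F ((m - i) + (Suc n - (j + l - i)) - 1)"
          by (rule deg_lt_mult[OF k j(3)[OF True] \<eta>(1)])
        moreover have "(m - i) + (Suc n - (j + l - i)) - 1 = m + n - (j + l)"
          using i im True l(1) by auto
        ultimately show ?thesis by simp
      next
        case False
        then have "coeff \<beta> i = 0" using \<beta>(1)[of i] by (simp add: deg_lt_0)
        then show ?thesis by (simp add: deg_lt_zero)
      qed
    next
      case False
      then have ij: "i < j" "l < j + l - i" using i by auto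
      show ?thesis
      proof (cases "j + l - i \<le> n")
        case im: True
        have "coeff \<beta> i * coeff \<eta> (j + l - i) \<in> deg_lt k X F ((Suc m - i) + (n - (j + l - i)) - 1)"
          by (rule deg_lt_mult[OF k \<beta>(1) l(3)[OF ij(2)]])
        moreover have "(Suc m - i) + (n - (j + l - i)) - 1 = m + n - (j + l)"
          using ij im j(1) by auto
        ultimately show ?thesis by simp
      next
        case False
        then have "coeff \<eta> (j + l - i) = 0" using \<eta>(1)[of "j + l - i"] by (simp add: deg_lt_0)
        then show ?thesis by (simp add: deg_lt_zero)
      qed
    qed
    then have "coeff \<beta> j * coeff \<eta> l \<in> deg_lt k X F (m + n - (j + l))"
      unfolding eq using \<gamma>(1) by (intro deg_lt_diff deg_lt_sum k) auto
    moreover have "m + n - (j + l) = (m - j) + (n - l)" using j l by auto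
    ultimately have "coeff \<beta> j * coeff \<eta> l \<in> deg_lt k X F ((m - j) + (n - l))" by simp
    moreover have "Suc m - j = Suc (m - j)" "Suc n - l = Suc (n - l)" using j l by auto
    ultimately show False
      using insert.IH[OF FI, of "coeff \<beta> j" "m - j" "coeff \<eta> l" "n - l"] \<beta>(1)[of j] \<eta>(1)[of l] j(2) l(2)
      by auto
  qed
qed

text \<open>Dividing by \<open>p\<close> gives back the whole degree that \<open>p\<close>
  contributed. This is how bounds become independent of \<open>p\<close>.\<close>

lemma deg_lt_cancel:
  fixes k :: "'r::idom set"
  assumes k: "subring k" and I: "finite I" "alg_indep k X I"
    and p: "p \<in> pring k X I" "p \<notin> deg_lt k X I m"
    and b: "b \<in> pring k X I" and pb: "p * b \<in> deg_lt k X I (m + n)"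
  shows "b \<in> deg_lt k X I n"
proof (rule ccontr)
  assume "b \<notin> deg_lt k X I n"
  then obtain n' where n': "n \<le> n'" "b \<in> deg_lt k X I (Suc n')" "b \<notin> deg_lt k X I n'"
    using deg_lt_exact b by blast
  obtain m' where m': "m \<le> m'" "p \<in> deg_lt k X I (Suc m')" "p \<notin> deg_lt k X I m'"
    using deg_lt_exact p by blast
  have "p * b \<in> deg_lt k X I (m' + n')"
    using pb by (rule deg_lt_mono) (use m' n' in auto)
  then show False using deg_lt_mult_exact[OF k I m'(2,3) n'(2,3)] by blast
qed

lemma derivation_deg_lt:
  assumes k: "subring k" and d: "derivation d" and dk: "d ` k \<subseteq> k"
    and dX: "\<And>i. i \<in> I \<Longrightarrow> d (X i) \<in> deg_lt k X I 2" and b: "b \<in> deg_lt k X I n"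
  shows "d b \<in> deg_lt k X I n"
  using b
proof (induction rule: deg_lt_induct)
  case (var i b n)
  have "d (X i) * b \<in> deg_lt k X I (2 + n - 1)"
    using var dX by (intro deg_lt_mult k) auto
  then show ?case using var d by (auto simp: derivation_mult intro!: deg_lt_add deg_lt_var)
qed (use d dk in \<open>auto simp: derivation_0 derivation_add intro: deg_lt_intros\<close>)

lemma derivation_deg_lt_lower:
  assumes k: "subring k" and d: "derivation d" and dk: "\<And>c. c \<in> k \<Longrightarrow> d c = 0"
    and dX: "\<And>i. i \<in> I \<Longrightarrow> d (X i) \<in> k" and b: "b \<in> deg_lt k X I n"
  shows "d b \<in> deg_lt k X I (n - 1)"
  using b
proof (induction rule: deg_lt_induct)
  case (var i b n)
  have "X i * d b \<in> deg_lt k X I n"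
  proof (cases n)
    case 0
    then show ?thesis using var d by (simp add: deg_lt_0 derivation_0)
  next
    case (Suc m)
    then show ?thesis using var by (auto intro: deg_lt_var)
  qed
  moreover have "d (X i) * b \<in> deg_lt k X I n" using var dX by (intro deg_lt_scale k) auto
  ultimately show ?case using d by (auto simp: derivation_mult intro: deg_lt_add)
qed (use d dk in \<open>auto simp: derivation_0 derivation_add intro: deg_lt_intros\<close>)

section \<open>Prime factorisations, Gauss's lemma and factoriality of polynomial extensions\<close>

definition unit_in :: "'r::comm_ring_1 set \<Rightarrow> 'r \<Rightarrow> bool" where
  "unit_in R u \<longleftrightarrow> u \<in> R \<and> (\<exists>v\<in>R. u * v = 1)"

definition prime_elt :: "'r::comm_ring_1 set \<Rightarrow> 'r \<Rightarrow> bool" where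
  "prime_elt R p \<longleftrightarrow> p \<in> R \<and> p \<noteq> 0 \<and> prime_of R ((*) p ` R)"

text \<open>The counter is the number of prime factors; it serves as induction measure when factors
  are removed.\<close>

inductive prime_prod :: "'r::comm_ring_1 set \<Rightarrow> 'r \<Rightarrow> nat \<Rightarrow> bool" for R where
  unit: "unit_in R u \<Longrightarrow> prime_prod R u 0"
| mult: "prime_elt R p \<Longrightarrow> prime_prod R m n \<Longrightarrow> prime_prod R (p * m) (Suc n)"

definition prime_factorial :: "'r::comm_ring_1 set \<Rightarrow> bool" where
  "prime_factorial R \<longleftrightarrow> (\<forall>r\<in>R. r \<noteq> 0 \<longrightarrow> (\<exists>n. prime_prod R r n))"

lemma ideal_of_principal: "subring S \<Longrightarrow> z \<in> S \<Longrightarrow> ideal_of S ((*) z ` S)"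
  unfolding ideal_of_def
proof (intro conjI ballI)
  assume S: "subring S" "z \<in> S"
  show "(*) z ` S \<subseteq> S" using S by (auto intro: subring_mult)
  show "0 \<in> (*) z ` S" using S by (auto simp: image_iff intro!: bexI[of _ 0] subring_0)
  show "x + y \<in> (*) z ` S" if "x \<in> (*) z ` S" "y \<in> (*) z ` S" for x y
  proof -
    from that obtain u v where uv: "u \<in> S" "v \<in> S" "x = z * u" "y = z * v" by blast
    then have "x + y = z * (u + v)" by (simp add: distrib_left)
    then show ?thesis using uv subring_add[OF S(1)] by blast
  qed
  show "r * x \<in> (*) z ` S" if "r \<in> S" "x \<in> (*) z ` S" for r x
  proof -
    from that obtain u where u: "u \<in> S" "x = z * u" by blast
    then have "r * x = z * (r * u)" by (simp add: mult.left_commute)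
    then show ?thesis using u that subring_mult[OF S(1)] by blast
  qed
qed

lemma prime_elt_dvd:
  assumes "prime_elt R p" "x \<in> R" "y \<in> R" "x * y \<in> (*) p ` R"
  shows "x \<in> (*) p ` R \<or> y \<in> (*) p ` R"
  using assms by (auto simp: prime_elt_def dest: prime_of_mult)

lemma prime_elt_not_unit: "prime_elt R p \<Longrightarrow> \<not> unit_in R p"
  unfolding prime_elt_def unit_in_def by (metis image_eqI prime_of_1)

lemma prime_prod_closed:
  assumes "subring R" "prime_prod R r n"
  shows "r \<in> R"
  using assms(2) by induction (auto simp: unit_in_def prime_elt_def subring_mult[OF assms(1)])

lemma unit_in_mult:
  assumes "subring R" "unit_in R u" "unit_in R v"
  shows "unit_in R (u * v)"
proof -
  obtain u' v' where "u \<in> R" "v \<in> R" "u' \<in> R" "v' \<in> R" "u * u' = 1" "v * v' = 1"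
    using assms by (auto simp: unit_in_def)
  moreover from this have "(u * v) * (u' * v') = 1"
    by (metis mult.assoc mult.commute mult_1_right)
  ultimately show ?thesis
    using assms(1) unfolding unit_in_def by (meson subring_mult)
qed

lemma prime_prod_unit_mult:
  assumes R: "subring R" and "unit_in R u" "prime_prod R r n"
  shows "prime_prod R (u * r) n"
  using assms(3)
proof induction
  case (unit v)
  then show ?case using assms by (intro prime_prod.unit unit_in_mult)
next
  case (mult p m n)
  then have "prime_prod R (p * (u * m)) (Suc n)" by (intro prime_prod.mult)
  then show ?case by (simp add: mult.left_commute)
qed

lemma prime_prod_mult:
  assumes R: "subring R" and "prime_prod R r m" "prime_prod R s n"
  shows "prime_prod R (r * s) (m + n)"
  using assms(2)
proof induction
  case (unit v)
  then show ?case using assms prime_prod_unit_mult by auto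
next
  case (mult p r m)
  then have "prime_prod R (p * (r * s)) (Suc (m + n))" by (intro prime_prod.mult)
  then show ?case by (simp add: mult.assoc)
qed

lemma prime_prod_split:
  fixes R :: "'r::idom set"
  assumes R: "subring R" and "prime_prod R r n" "r = a * b" "a \<in> R" "b \<in> R"
  shows "\<exists>i j. i + j = n \<and> prime_prod R a i \<and> prime_prod R b j"
  using assms(2-)
proof (induction arbitrary: a b)
  case (unit u)
  then obtain v where v: "v \<in> R" "a * b * v = 1" by (auto simp: unit_in_def)
  have "a * (b * v) = 1" "b * (a * v) = 1" using v by (auto simp: mult_ac)
  moreover have "b * v \<in> R" "a * v \<in> R" using v unit subring_mult[OF R] by auto
  ultimately have "unit_in R a" "unit_in R b" using unit by (auto simp: unit_in_def)
  then show ?case by (auto intro: prime_prod.unit)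
next
  case (mult p m n)
  have p: "p \<in> R" "p \<noteq> 0" using mult by (auto simp: prime_elt_def)
  have mR: "m \<in> R" using mult R prime_prod_closed by blast
  have "a * b \<in> (*) p ` R" using mult mR by (metis image_eqI)
  then consider c where "a = p * c" "c \<in> R" | c where "b = p * c" "c \<in> R"
    using prime_elt_dvd[OF mult.hyps(1) mult.prems(2,3)] by blast
  then show ?case
  proof cases
    case 1
    then have "m = c * b" using mult.prems(1) p by (simp add: mult.assoc)
    then obtain i j where "i + j = n" "prime_prod R c i" "prime_prod R b j"
      using mult.IH 1 mult.prems by blast
    then have "Suc i + j = Suc n \<and> prime_prod R a (Suc i) \<and> prime_prod R b j"
      using 1 mult.hyps prime_prod.mult by auto
    then show ?thesis by blast
  next
    case 2
    then have "m = a * c" using mult.prems(1) p by (simp add: mult.left_commute)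
    then obtain i j where "i + j = n" "prime_prod R a i" "prime_prod R c j"
      using mult.IH 2 mult.prems by blast
    then have "i + Suc j = Suc n \<and> prime_prod R a i \<and> prime_prod R b (Suc j)"
      using 2 mult.hyps prime_prod.mult by auto
    then show ?thesis by blast
  qed
qed

lemma prime_contains_prime_elt:
  assumes R: "subring R" and "prime_prod R r n" and P: "prime_of S P" "R \<subseteq> S" and "r \<in> P"
  shows "\<exists>p. prime_elt R p \<and> p \<in> P"
  using assms(2,5)
proof induction
  case (unit u)
  then obtain v where "v \<in> R" "u * v = 1" by (auto simp: unit_in_def)
  then have "1 \<in> P" using unit P ideal_of_mult2[OF prime_of_ideal[OF P(1)]] by (metis subsetD)
  then show ?case using P by (simp add: prime_of_1)
next
  case (mult p m n)
  then have "p \<in> P \<or> m \<in> P"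
    using prime_of_mult[OF P(1), of p m] prime_prod_closed[OF R mult(2)] P(2)
    by (auto simp: prime_elt_def)
  then show ?case using mult by blast
qed

text \<open>The lowest coefficients outside \<open>P\<close> of the two factors give a coefficient
  of the product outside \<open>P\<close>, all other contributions to it being in
  \<open>P\<close>.\<close>

lemma gauss_prime_ideal:
  assumes R: "subring R" and P: "prime_of R P" and f: "f \<in> poly_over R" and g: "g \<in> poly_over R"
    and fg: "f * g \<in> poly_over P"
  shows "f \<in> poly_over P \<or> g \<in> poly_over P"
proof (rule ccontr)
  assume neg: "\<not> ?thesis"
  have "\<exists>l. coeff f l \<notin> P" using neg by (auto simp: poly_over_def)
  then obtain i where i: "coeff f i \<notin> P" "\<And>l. l < i \<Longrightarrow> coeff f l \<in> P"
    using exists_least_iff[of "\<lambda>l. coeff f l \<notin> P"] by auto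
  have "\<exists>l. coeff g l \<notin> P" using neg by (auto simp: poly_over_def)
  then obtain j where j: "coeff g j \<notin> P" "\<And>l. l < j \<Longrightarrow> coeff g l \<in> P"
    using exists_least_iff[of "\<lambda>l. coeff g l \<notin> P"] by auto
  have I: "ideal_of R P" using P by (rule prime_of_ideal)
  have "coeff (f * g) (i + j) = (\<Sum>l\<le>i + j. coeff f l * coeff g (i + j - l))" by (simp add: coeff_mult)
  also have "\<dots> = coeff f i * coeff g j + (\<Sum>l\<in>{..i + j} - {i}. coeff f l * coeff g (i + j - l))"
    by (subst sum.remove[of _ i]) auto
  finally have eq: "coeff f i * coeff g j =
    coeff (f * g) (i + j) - (\<Sum>l\<in>{..i + j} - {i}. coeff f l * coeff g (i + j - l))" by simp
  have "coeff f l * coeff g (i + j - l) \<in> P" if "l \<in> {..i + j} - {i}" for l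
  proof (cases "l < i")
    case True
    then show ?thesis using i g by (intro ideal_of_mult2[OF I]) (auto simp: poly_over_def)
  next
    case False
    then have "i + j - l < j" using that by auto
    then show ?thesis using j f by (intro ideal_of_mult[OF I]) (auto simp: poly_over_def)
  qed
  then have "coeff f i * coeff g j \<in> P"
    unfolding eq using fg by (intro ideal_of_diff[OF I R] ideal_of_sum[OF I]) (auto simp: poly_over_def)
  then show False
    using prime_of_mult[OF P poly_overD[OF f] poly_overD[OF g]] i(1) j(1) by blast
qed

lemma poly_over_principal:
  assumes "f \<in> poly_over ((*) p ` R)" "0 \<in> R" "(p::'r::idom) \<noteq> 0"
  shows "\<exists>h\<in>poly_over R. f = smult p h"
proof -
  \<comment> \<open>The quotient at a zero coefficient is fixed as \<open>0\<close>, so that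
    \<open>c\<close> has finite support and is the coefficient sequence of a polynomial.\<close>
  define c where "c i = (if coeff f i = 0 then 0 else SOME c. c \<in> R \<and> coeff f i = p * c)" for i
  have c: "c i \<in> R \<and> coeff f i = p * c i" for i
  proof (cases "coeff f i = 0")
    case True
    then show ?thesis using assms by (simp add: c_def)
  next
    case False
    have "\<exists>c. c \<in> R \<and> coeff f i = p * c" using assms(1) by (auto simp: poly_over_def)
    from someI_ex[OF this] show ?thesis using False unfolding c_def by auto
  qed
  have "\<forall>\<^sub>\<infinity>i. c i = 0" using MOST_coeff_eq_0[of f] by (auto simp: c_def elim: MOST_mono)
  then have h: "coeff (Abs_poly c) = c" by (simp add: Abs_poly_inverse)
  show ?thesis
    by (intro bexI[of _ "Abs_poly c"] poly_eqI) (use c in \<open>auto simp: h poly_over_def\<close>)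
qed

lemma subring_image:
  assumes R: "subring R"
  shows "subring ((\<lambda>\<beta>. poly \<beta> x) ` poly_over R)"
proof -
  have S: "subring (poly_over R)" by (rule subring_poly_over[OF R])
  show ?thesis
    unfolding subring_def
  proof (intro conjI ballI)
    show "0 \<in> (\<lambda>\<beta>. poly \<beta> x) ` poly_over R"
      using subring_0[OF S] by (intro image_eqI[of _ _ 0]) auto
    show "1 \<in> (\<lambda>\<beta>. poly \<beta> x) ` poly_over R"
      using subring_1[OF S] by (intro image_eqI[of _ _ 1]) auto
  next
    fix u v assume "u \<in> (\<lambda>\<beta>. poly \<beta> x) ` poly_over R" "v \<in> (\<lambda>\<beta>. poly \<beta> x) ` poly_over R"
    then obtain f g where "f \<in> poly_over R" "g \<in> poly_over R" "u = poly f x" "v = poly g x" by blast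
    then show "u + v \<in> (\<lambda>\<beta>. poly \<beta> x) ` poly_over R" "u * v \<in> (\<lambda>\<beta>. poly \<beta> x) ` poly_over R"
      using subring_add[OF S, of f g] subring_mult[OF S, of f g] by (auto simp flip: poly_add poly_mult)
  next
    fix u assume "u \<in> (\<lambda>\<beta>. poly \<beta> x) ` poly_over R"
    then obtain f where "f \<in> poly_over R" "u = poly f x" by blast
    then show "- u \<in> (\<lambda>\<beta>. poly \<beta> x) ` poly_over R"
      using subring_uminus[OF S, of f] by (auto simp flip: poly_minus)
  qed
qed

context
  fixes R :: "'r::idom set" and x :: 'r
  assumes R: "subring R" and pf: "prime_factorial R" and x: "transc R x"
begin

text \<open>A polynomial of least degree in \<open>Q\<close>, freed of all prime factors from
  \<open>R\<close>, generates \<open>Q\<close>: pseudo-division of \<open>g\<close> by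
  \<open>f\<close> gives \<open>c g = f q\<close>, and the primes of \<open>c\<close> cancel against
  \<open>q\<close> by Gauss's lemma.\<close>

lemma prime_principal:
  assumes Q: "prime_of ((\<lambda>\<beta>. poly \<beta> x) ` poly_over R) Q" and QR: "Q \<inter> R = {0}" and Q0: "Q \<noteq> {0}"
  shows "\<exists>f. f \<in> (\<lambda>\<beta>. poly \<beta> x) ` poly_over R \<and> f \<noteq> 0 \<and> Q = (*) f ` ((\<lambda>\<beta>. poly \<beta> x) ` poly_over R)"
proof -
  let ?S = "(\<lambda>\<beta>. poly \<beta> x) ` poly_over R"
  have RS: "R \<subseteq> ?S"
    using R by (auto simp: image_iff intro!: bexI[of _ "[:_:]"] poly_over_const)
  have I: "ideal_of ?S Q" using Q by (rule prime_of_ideal)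
  define N where "N = {\<beta>\<in>poly_over R. poly \<beta> x \<in> Q}"
  have Q_N: "q \<in> Q \<Longrightarrow> \<exists>\<beta>\<in>N. poly \<beta> x = q" for q
    using ideal_of_subset[OF I] by (fastforce simp: N_def)
  obtain \<beta>1 where \<beta>1: "\<beta>1 \<in> N" "\<beta>1 \<noteq> 0"
  proof -
    obtain q where "q \<in> Q" "q \<noteq> 0" using Q0 ideal_of_0[OF I] by blast
    moreover from this obtain \<beta> where "\<beta> \<in> N" "poly \<beta> x = q" using Q_N by blast
    moreover from this \<open>q \<noteq> 0\<close> have "\<beta> \<noteq> 0" by auto
    ultimately show ?thesis using that by blast
  qed
  define D where "D = (LEAST n. \<exists>\<beta>\<in>N. \<beta> \<noteq> 0 \<and> degree \<beta> = n)"
  have "\<exists>n. \<exists>\<beta>\<in>N. \<beta> \<noteq> 0 \<and> degree \<beta> = n" using \<beta>1 by blast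
  from LeastI_ex[OF this] obtain \<beta>0 where \<beta>0: "\<beta>0 \<in> N" "\<beta>0 \<noteq> 0" "degree \<beta>0 = D"
    unfolding D_def by auto
  have min: "D \<le> degree \<beta>" if "\<beta> \<in> N" "\<beta> \<noteq> 0" for \<beta>
    unfolding D_def using that by (intro Least_le) blast
  have nz: "c \<notin> Q" if "c \<in> R" "c \<noteq> 0" for c using that QR by blast
  \<comment> \<open>Division by a prime of \<open>R\<close> stays inside \<open>Q\<close>, because
    \<open>Q\<close> contains no nonzero element of \<open>R\<close>; it lowers the number of prime
    factors of the leading coefficient.\<close>
  have prim: "\<exists>f\<in>N. f \<noteq> 0 \<and> degree f = D \<and> (\<forall>p. prime_elt R p \<longrightarrow> f \<notin> poly_over ((*) p ` R))"
    if "\<beta> \<in> N" "\<beta> \<noteq> 0" "degree \<beta> = D" "prime_prod R (lead_coeff \<beta>) n" for \<beta> n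
    using that
  proof (induction n arbitrary: \<beta> rule: less_induct)
    case (less n)
    show ?case
    proof (cases "\<forall>p. prime_elt R p \<longrightarrow> \<beta> \<notin> poly_over ((*) p ` R)")
      case True
      then show ?thesis using less.prems by blast
    next
      case False
      then obtain p where p: "prime_elt R p" "\<beta> \<in> poly_over ((*) p ` R)" by blast
      then have pR: "p \<in> R" "p \<noteq> 0" by (auto simp: prime_elt_def)
      obtain h where h: "h \<in> poly_over R" "\<beta> = smult p h"
        using poly_over_principal[OF p(2) subring_0[OF R] pR(2)] by blast
      have "p * poly h x \<in> Q" using less.prems(1) h by (auto simp: N_def)
      then have "poly h x \<in> Q"
        using prime_of_mult[OF Q, of p "poly h x"] pR nz[of p] RS h(1) by auto
      then have hN: "h \<in> N" using h by (auto simp: N_def)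
      have h0: "h \<noteq> 0" using less.prems(2) h by auto
      have dh: "degree h = D" using less.prems(3) h pR by simp
      have "lead_coeff \<beta> = p * lead_coeff h" using h by (simp add: pR lead_coeff_smult)
      then obtain i j where ij: "i + j = n" "prime_prod R p i" "prime_prod R (lead_coeff h) j"
        using prime_prod_split[OF R less.prems(4)] pR h by (metis poly_overD)
      have "i \<noteq> 0"
      proof
        assume "i = 0"
        then have "unit_in R p" using ij(2) by (auto elim: prime_prod.cases)
        then show False using prime_elt_not_unit p by blast
      qed
      then show ?thesis using less.IH[OF _ hN h0 dh ij(3)] ij(1) by auto
    qed
  qed
  have "lead_coeff \<beta>0 \<in> R" "lead_coeff \<beta>0 \<noteq> 0" using \<beta>0 by (auto simp: N_def poly_over_def)
  then obtain n where "prime_prod R (lead_coeff \<beta>0) n" using pf by (auto simp: prime_factorial_def)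
  then obtain f where f: "f \<in> N" "f \<noteq> 0" "degree f = D"
    "\<And>p. prime_elt R p \<Longrightarrow> f \<notin> poly_over ((*) p ` R)" using prim[OF \<beta>0] by blast
  have fR: "f \<in> poly_over R" using f by (simp add: N_def)
  have cancel: "\<exists>h\<in>poly_over R. g = f * h"
    if "prime_prod R c n" "g \<in> poly_over R" "q \<in> poly_over R" "smult c g = f * q" for c n g q
    using that
  proof (induction arbitrary: q)
    case (unit u)
    then obtain v where v: "v \<in> R" "u * v = 1" by (auto simp: unit_in_def)
    have "smult v (smult u g) = smult v (f * q)" using unit by simp
    then have "g = f * smult v q" using v by (simp add: mult.commute)
    then show ?case using v unit R by (auto intro!: bexI[of _ "smult v q"] poly_over_smult)
  next
    case (mult p m n)
    have p: "p \<in> R" "p \<noteq> 0" "prime_of R ((*) p ` R)" using mult by (auto simp: prime_elt_def)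
    have mR: "m \<in> R" using mult R prime_prod_closed by blast
    have "f * q \<in> poly_over ((*) p ` R)"
      unfolding mult.prems(3)[symmetric] using mult.prems(1) mR R
      by (auto simp: poly_over_def mult.assoc intro!: imageI subring_mult)
    then have "q \<in> poly_over ((*) p ` R)"
      using gauss_prime_ideal[OF R p(3) fR mult.prems(2)] f(4) mult.hyps by blast
    then obtain q' where q': "q' \<in> poly_over R" "q = smult p q'"
      using poly_over_principal subring_0[OF R] p(2) by blast
    have "smult p (smult m g) = smult p (f * q')" using mult.prems(3) q' by simp
    then have "smult m g = f * q'" by (rule smult_cancel_left[OF p(2)])
    then show ?case using mult.IH mult.prems q' by blast
  qed
  have main: "\<exists>h\<in>poly_over R. g = f * h" if g: "g \<in> N" for g
  proof -
    have gR: "g \<in> poly_over R" using g by (simp add: N_def)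
    obtain M q r where *: "q \<in> poly_over R" "r \<in> poly_over R"
      "smult (lead_coeff f ^ M) g = f * q + r" "r = 0 \<or> degree r < degree f"
      using pseudo_division[OF R fR f(2) gR] by blast
    have c: "lead_coeff f ^ M \<in> R" "lead_coeff f ^ M \<noteq> 0"
      using fR f R by (auto intro: subring_power poly_overD)
    have "r = smult (lead_coeff f ^ M) g - f * q" using *(3) by simp
    then have "poly r x = lead_coeff f ^ M * poly g x - poly q x * poly f x" by (simp add: mult.commute)
    moreover have "lead_coeff f ^ M * poly g x \<in> Q" "poly q x * poly f x \<in> Q"
      using g f c RS *(1) by (auto simp: N_def intro!: ideal_of_mult[OF I])
    ultimately have "r \<in> N" using * ideal_of_diff[OF I subring_image[OF R]] by (auto simp: N_def)
    then have "r = 0" using min[of r] *(4) f(3) by (cases "r = 0") auto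
    then have "smult (lead_coeff f ^ M) g = f * q" using * by simp
    moreover obtain n where "prime_prod R (lead_coeff f ^ M) n"
      using pf c by (auto simp: prime_factorial_def)
    ultimately show ?thesis using cancel gR *(1) by blast
  qed
  have "Q = (*) (poly f x) ` ?S"
  proof
    show "Q \<subseteq> (*) (poly f x) ` ?S"
    proof
      fix q assume "q \<in> Q"
      then obtain g where "g \<in> N" "poly g x = q" using Q_N by blast
      then obtain h where "h \<in> poly_over R" "q = poly f x * poly h x" using main by (metis poly_mult)
      then show "q \<in> (*) (poly f x) ` ?S" by blast
    qed
    show "(*) (poly f x) ` ?S \<subseteq> Q" using f by (auto simp: N_def intro!: ideal_of_mult2[OF I])
  qed
  moreover have "poly f x \<noteq> 0" using transcD[OF x fR] f(2) by blast
  ultimately show ?thesis using fR by blast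
qed

lemma prime_elt_extend:
  assumes p: "prime_elt R p"
  shows "prime_elt ((\<lambda>\<beta>. poly \<beta> x) ` poly_over R) p"
proof -
  let ?S = "(\<lambda>\<beta>. poly \<beta> x) ` poly_over R"
  have pR: "p \<in> R" "p \<noteq> 0" "prime_of R ((*) p ` R)" using p by (auto simp: prime_elt_def)
  have pS: "p \<in> ?S"
    using R pR by (auto simp: image_iff intro!: bexI[of _ "[:_:]"] poly_over_const)
  have key: "\<beta> \<in> poly_over ((*) p ` R)" if "\<beta> \<in> poly_over R" "poly \<beta> x \<in> (*) p ` ?S" for \<beta>
  proof -
    from that obtain \<gamma> where \<gamma>: "\<gamma> \<in> poly_over R" "poly \<beta> x = p * poly \<gamma> x" by auto
    then have "poly \<beta> x = poly (smult p \<gamma>) x" by simp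
    then have "\<beta> = smult p \<gamma>"
      using that \<gamma> pR by (intro transc_eq[OF x R] poly_over_smult R) auto
    then show ?thesis using \<gamma> by (auto simp: poly_over_def)
  qed
  have conv: "poly \<beta> x \<in> (*) p ` ?S" if "\<beta> \<in> poly_over ((*) p ` R)" for \<beta>
    using poly_over_principal[OF that subring_0[OF R] pR(2)] by auto
  have "prime_of ?S ((*) p ` ?S)"
    unfolding prime_of_def
  proof (intro conjI ballI impI)
    show "ideal_of ?S ((*) p ` ?S)" by (rule ideal_of_principal[OF subring_image[OF R] pS])
    show "1 \<notin> (*) p ` ?S"
    proof
      assume "1 \<in> (*) p ` ?S"
      then have "[:1:] \<in> poly_over ((*) p ` R)"
        by (intro key poly_over_const R subring_1) auto
      then have "coeff [:1:] 0 \<in> (*) p ` R" unfolding poly_over_def by blast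
      then show False using prime_of_1[OF pR(3)] by simp
    qed
    fix u v assume "u \<in> ?S" "v \<in> ?S" "u * v \<in> (*) p ` ?S"
    then obtain \<beta> \<gamma> where *: "\<beta> \<in> poly_over R" "\<gamma> \<in> poly_over R" "u = poly \<beta> x" "v = poly \<gamma> x" by blast
    have "\<beta> * \<gamma> \<in> poly_over ((*) p ` R)"
      using * \<open>u * v \<in> _\<close> by (intro key poly_over_mult R) auto
    then have "\<beta> \<in> poly_over ((*) p ` R) \<or> \<gamma> \<in> poly_over ((*) p ` R)"
      using gauss_prime_ideal[OF R pR(3) *(1,2)] by blast
    then show "u \<in> (*) p ` ?S \<or> v \<in> (*) p ` ?S" using conv * by blast
  qed
  then show ?thesis using pS pR by (simp add: prime_elt_def)
qed

text \<open>Kaplansky's criterion. Divisors of products of primes are such products, so if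
  \<open>z\<close> is none, some prime ideal \<open>Q\<close> contains \<open>z\<close> and avoids
  them all. But \<open>Q\<close> contains a prime element: its generator if it meets
  \<open>R\<close> in zero, otherwise a prime of \<open>R\<close>, which stays prime.\<close>

lemma prime_factorial_extend: "prime_factorial ((\<lambda>\<beta>. poly \<beta> x) ` poly_over R)"
proof -
  let ?S = "(\<lambda>\<beta>. poly \<beta> x) ` poly_over R"
  have S: "subring ?S" by (rule subring_image[OF R])
  have RS: "R \<subseteq> ?S"
    using R by (auto simp: image_iff intro!: bexI[of _ "[:_:]"] poly_over_const)
  define M where "M = {z. \<exists>n. prime_prod ?S z n}"
  have primeM: "p \<in> M" if "prime_elt ?S p" for p
  proof -
    have "prime_prod ?S (p * 1) (Suc 0)"
      using that S by (intro prime_prod.mult prime_prod.unit) (auto simp: unit_in_def subring_1)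
    then show ?thesis by (auto simp: M_def)
  qed
  have "z \<in> M" if z: "z \<in> ?S" "z \<noteq> 0" for z
  proof (rule ccontr)
    assume zM: "z \<notin> M"
    have "(*) z ` ?S \<inter> M = {}"
    proof (rule ccontr)
      assume "(*) z ` ?S \<inter> M \<noteq> {}"
      then obtain c n where "c \<in> ?S" "prime_prod ?S (z * c) n" by (auto simp: M_def)
      then have "z \<in> M" using prime_prod_split[OF S _ refl z(1)] by (fastforce simp: M_def)
      then show False using zM by blast
    qed
    moreover have "1 \<in> M" using S by (auto simp: M_def unit_in_def subring_1 intro!: exI[of _ 0] prime_prod.unit)
    moreover have "u * v \<in> M" if "u \<in> M" "v \<in> M" for u v
      using that prime_prod_mult[OF S] unfolding M_def by blast
    ultimately obtain Q where Q: "prime_of ?S Q" "(*) z ` ?S \<subseteq> Q" "Q \<inter> M = {}"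
      using prime_avoiding[OF S ideal_of_principal[OF S z(1)]] by meson
    have "z * 1 \<in> (*) z ` ?S" using subring_1[OF S] by (rule imageI)
    then have zQ: "z \<in> Q" using Q(2) by auto
    show False
    proof (cases "Q \<inter> R = {0}")
      case True
      then obtain f where f: "f \<in> ?S" "f \<noteq> 0" "Q = (*) f ` ?S"
        using prime_principal[OF Q(1)] zQ z(2) by blast
      then have "prime_elt ?S f" using Q(1) by (simp add: prime_elt_def)
      moreover have "f * 1 \<in> (*) f ` ?S" using subring_1[OF S] by (rule imageI)
      ultimately show False using primeM f(3) Q(3) by auto
    next
      case False
      moreover have "0 \<in> Q \<inter> R" using R Q by (auto simp: subring_0 intro: ideal_of_0 prime_of_ideal)
      ultimately obtain r where r: "r \<in> Q" "r \<in> R" "r \<noteq> 0" by blast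
      then obtain n where "prime_prod R r n" using pf by (auto simp: prime_factorial_def)
      then obtain p where "prime_elt R p" "p \<in> Q"
        using prime_contains_prime_elt[OF R _ Q(1) RS] r by blast
      then show False using primeM[OF prime_elt_extend] Q(3) by blast
    qed
  qed
  then show ?thesis by (auto simp: prime_factorial_def M_def)
qed

end

definition subfield :: "'r::comm_ring_1 set \<Rightarrow> bool" where
  "subfield k \<longleftrightarrow> subring k \<and> (\<forall>c\<in>k. c \<noteq> 0 \<longrightarrow> (\<exists>v\<in>k. c * v = 1))"

lemma pring_insert_eq:
  assumes k: "subring k" and a: "a \<in> I"
  shows "pring k X I = (\<lambda>\<beta>. poly \<beta> (X a)) ` poly_over (pring k X (I - {a}))"
  using pring_expand[OF k a] pring_collect[OF k a] by (fastforce simp: image_iff)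

lemma prime_factorial_pring:
  fixes k :: "'r::idom set"
  assumes k: "subfield k" and I: "finite I" "alg_indep k X I"
  shows "prime_factorial (pring k X I)"
  using I
proof (induction I rule: finite_induct)
  case empty
  have "subring k" using k by (simp add: subfield_def)
  moreover have "prime_factorial k"
    unfolding prime_factorial_def
  proof (intro ballI impI)
    fix r assume "r \<in> k" "r \<noteq> 0"
    then have "unit_in k r" using k by (auto simp: unit_in_def subfield_def)
    then show "\<exists>n. prime_prod k r n" by (blast intro: prime_prod.unit)
  qed
  ultimately show ?case by (simp add: pring_empty)
next
  case (insert a F)
  have kr: "subring k" using k by (simp add: subfield_def)
  have F: "insert a F - {a} = F" using insert by auto
  have "alg_indep k X F" using insert.prems alg_indep_subset by blast
  moreover have "transc (pring k X F) (X a)" using insert.prems F by (auto simp: alg_indep_def)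
  ultimately show ?case
    unfolding pring_insert_eq[OF kr, of a "insert a F", OF insertI1] F
    using insert.IH subring_pring[OF kr] by (intro prime_factorial_extend) auto
qed

section \<open>Lifting powers of the primitive element modulo a prime\<close>

text \<open>Among the multiples of \<open>G\<close> modulo \<open>Q\<close> that lie outside
  \<open>Q\<close>, one of least degree must be constant: pseudo-division of \<open>F\<close> by it
  leaves no remainder, and the cofactor lies in \<open>Q\<close>, hence has at least the degree of
  \<open>F\<close>. This inverts \<open>G\<close> modulo \<open>Q\<close> up to a nonzero element of
  \<open>R\<close>.\<close>

lemma bezout_mod_prime:
  fixes R :: "'r::idom set"
  assumes R: "subring R" and S: "subring S" "R \<subseteq> S" "x \<in> S" and Q: "prime_of S Q"
    and QR: "\<And>r. r \<in> R \<Longrightarrow> r \<in> Q \<Longrightarrow> r = 0"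
    and F: "F \<in> poly_over R" "poly F x \<in> Q" "F \<noteq> 0"
    and min: "\<And>f. f \<in> poly_over R \<Longrightarrow> poly f x \<in> Q \<Longrightarrow> f \<noteq> 0 \<Longrightarrow> degree F \<le> degree f"
    and G: "G \<in> poly_over R" "poly G x \<notin> Q" "degree G < degree F"
  shows "\<exists>\<beta>\<in>poly_over R. \<exists>r\<in>R. r \<noteq> 0 \<and> poly \<beta> x * poly G x - r \<in> Q"
proof -
  have I: "ideal_of S Q" using Q by (rule prime_of_ideal)
  have evS: "poly f x \<in> S" if "f \<in> poly_over R" for f
    using that S poly_over_mono by (intro poly_over_poly) auto
  define A where "A = {f\<in>poly_over R. poly f x \<notin> Q \<and> (\<exists>\<beta>\<in>poly_over R. poly f x - poly \<beta> x * poly G x \<in> Q)}"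
  have "G \<in> A"
    using G I R by (auto simp: A_def ideal_of_0 subring_1 intro!: bexI[of _ "[:1:]"] poly_over_const)
  then obtain f where f: "f \<in> A" "\<And>g. g \<in> A \<Longrightarrow> degree f \<le> degree g"
    using exists_least_iff[of "\<lambda>n. \<exists>g\<in>A. degree g = n"] by (metis not_le)
  obtain \<beta> where \<beta>: "\<beta> \<in> poly_over R" "poly f x - poly \<beta> x * poly G x \<in> Q"
    using f(1) by (auto simp: A_def)
  have fR: "f \<in> poly_over R" "poly f x \<notin> Q" using f(1) by (auto simp: A_def)
  have f0: "f \<noteq> 0" using fR ideal_of_0[OF I] by auto
  have fF: "degree f < degree F" using f(2)[OF \<open>G \<in> A\<close>] G(3) by simp
  obtain N q r where qr: "q \<in> poly_over R" "r \<in> poly_over R"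
    "smult (lead_coeff f ^ N) F = f * q + r" "r = 0 \<or> degree r < degree f"
    using pseudo_division[OF R fR(1) f0 F(1)] by blast
  define c where "c = lead_coeff f ^ N"
  have c: "c \<noteq> 0" "c \<in> R" using f0 fR R by (auto simp: c_def intro!: subring_power poly_overD)
  have rx: "poly r x = c * poly F x - poly f x * poly q x"
    using arg_cong[OF qr(3), of "\<lambda>h. poly h x"] by (simp add: c_def)
  have cF: "c * poly F x \<in> Q" using c S F by (intro ideal_of_mult[OF I]) auto
  have rQ: "poly r x \<in> Q"
  proof (rule ccontr)
    assume "poly r x \<notin> Q"
    have "poly r x - poly (- (q * \<beta>)) x * poly G x =
      c * poly F x - poly q x * (poly f x - poly \<beta> x * poly G x)"
      by (simp add: rx algebra_simps)
    also have "\<dots> \<in> Q"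
      by (rule ideal_of_diff[OF I S(1) cF ideal_of_mult[OF I evS[OF qr(1)] \<beta>(2)]])
    finally have "r \<in> A"
      using \<open>poly r x \<notin> Q\<close> qr \<beta> R unfolding A_def
      by (auto intro!: bexI[of _ "- (q * \<beta>)"] poly_over_uminus poly_over_mult)
    then show False using f(2)[of r] qr(4) \<open>poly r x \<notin> Q\<close> ideal_of_0[OF I] by auto
  qed
  have r0: "r = 0" using min[OF qr(2) rQ] qr(4) fF by (cases "r = 0") auto
  have fq: "smult c F = f * q" using qr(3) r0 by (simp add: c_def)
  have "poly f x * poly q x \<in> Q" using cF rx r0 by (simp add: algebra_simps)
  then have qQ: "poly q x \<in> Q" using prime_of_mult[OF Q evS[OF fR(1)] evS[OF qr(1)]] fR by blast
  have q0: "q \<noteq> 0" using fq c F(3) by auto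
  have "degree F = degree f + degree q"
    using arg_cong[OF fq, of degree] c f0 q0 by (simp add: degree_mult_eq)
  then have "degree f = 0" using min[OF qr(1) qQ q0] by simp
  then obtain u where u: "f = [:u:]" by (rule degree_eq_zeroE)
  have "u \<in> R" using poly_overD[OF fR(1), of 0] u by simp
  moreover have "u \<noteq> 0" using u f0 by simp
  moreover have "poly \<beta> x * poly G x - u \<in> Q"
    using ideal_of_uminus[OF I S(1) \<beta>(2)] u by simp
  ultimately show ?thesis using \<beta>(1) by blast
qed

lemma coeff_mult_deg_lt:
  assumes k: "subring k" and f: "\<And>j. coeff f j \<in> deg_lt k X I (m - j)"
    and g: "\<And>j. coeff g j \<in> deg_lt k X I (Suc n - j)"
  shows "coeff (f * g) i \<in> deg_lt k X I (m + n - i)"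
  unfolding coeff_mult
proof (rule deg_lt_sum)
  fix j assume "j \<in> {..i}"
  have "coeff f j * coeff g (i - j) \<in> deg_lt k X I ((m - j) + (Suc n - (i - j)) - 1)"
    by (rule deg_lt_mult[OF k f g])
  moreover have "coeff f j = 0" if "m < j" using f[of j] that by (simp add: deg_lt_0)
  moreover have "coeff g (i - j) = 0" if "n < i - j" using g[of "i - j"] that by (simp add: deg_lt_0)
  moreover have "(m - j) + (Suc n - (i - j)) - 1 = m + n - i" if "\<not> m < j" "\<not> n < i - j"
    using that \<open>j \<in> {..i}\<close> by auto
  ultimately show "coeff f j * coeff g (i - j) \<in> deg_lt k X I (m + n - i)"
    by (cases "m < j \<or> n < i - j") (auto simp: deg_lt_zero)
qed

text \<open>Solving \<open>p q' - q p' = G\<close> for \<open>q\<close> from the top coefficient downwards: the coefficient of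
  \<open>T ^ (D + j - 1)\<close> on the left is \<open>(j - D) q\<^sub>j\<close> plus terms in \<open>q\<^sub>i\<close> with \<open>i > j\<close>.\<close>

lemma ode_coefficients:
  fixes p q :: "'e::field poly"
  assumes k: "subfield k" and char: "\<And>n. n > 0 \<Longrightarrow> of_nat n \<noteq> (0::'e)"
    and p: "\<And>j. coeff p j \<in> deg_lt k X I (Suc D - j)" "coeff p D = 1"
    and q: "degree q < D"
    and G: "\<And>i. coeff (p * pderiv q - q * pderiv p) i \<in> deg_lt k X I (D + M - 1 - i)"
  shows "coeff q j \<in> deg_lt k X I (M - j)"
proof (cases "j < D")
  case False
  then have "coeff q j = 0" using q by (intro coeff_eq_0) auto
  then show ?thesis by (simp add: deg_lt_zero)
next
  case True
  have kr: "subring k" using k by (simp add: subfield_def)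
  \<comment> \<open>The coefficient of \<open>T * f'\<close> at \<open>T ^ v\<close> is
    \<open>v\<close> times that of \<open>f\<close>; multiplying the equation by \<open>T\<close>
    removes all index shifts.\<close>
  have shift: "coeff (pCons 0 (pderiv f)) v = of_nat v * coeff f v" for f :: "'e poly" and v
    by (cases v) (auto simp: coeff_pderiv)
  show ?thesis using True
  proof (induction "D - j" arbitrary: j rule: less_induct)
    case less
    define t where "t = D + j"
    have "coeff (p * pderiv q - q * pderiv p) (t - 1) = coeff (pCons 0 (p * pderiv q - q * pderiv p)) t"
      using less.prems by (simp add: t_def coeff_pCons split: nat.splits)
    also have "pCons 0 (p * pderiv q - q * pderiv p) = p * pCons 0 (pderiv q) - pCons 0 (pderiv p) * q"
      by simp
    also have "coeff \<dots> t = (\<Sum>u\<le>t. (of_nat (t - u) - of_nat u) * (coeff p u * coeff q (t - u)))"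
      unfolding coeff_diff coeff_mult shift sum_subtractf[symmetric]
      by (intro sum.cong) (auto simp: algebra_simps)
    also have "\<dots> = (of_nat j - of_nat D) * coeff q j +
        (\<Sum>u\<in>{..t} - {D}. (of_nat (t - u) - of_nat u) * (coeff p u * coeff q (t - u)))"
      by (subst sum.remove[of _ D]) (auto simp: t_def p(2))
    finally have eq: "(of_nat j - of_nat D) * coeff q j =
      coeff (p * pderiv q - q * pderiv p) (t - 1) -
      (\<Sum>u\<in>{..t} - {D}. (of_nat (t - u) - of_nat u) * (coeff p u * coeff q (t - u)))"
      by simp
    have "(of_nat (t - u) - of_nat u) * (coeff p u * coeff q (t - u)) \<in> deg_lt k X I (M - j)"
      if u: "u \<in> {..t} - {D}" for u
    \<comment> \<open>For \<open>u < D\<close> the index \<open>t - u\<close> exceeds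
      \<open>j\<close>, so its bound is already known or the coefficient of \<open>q\<close>
      vanishes; for \<open>u > D\<close> the coefficient of \<open>p\<close> vanishes. The third
      condition singles out the case where \<open>M - (t - u)\<close> truncates to \<open>0\<close>
      and the known bound says that the coefficient is zero.\<close>
    proof (cases "u < D \<and> t - u < D \<and> t - u \<le> M")
      case True
      have "coeff q (t - u) \<in> deg_lt k X I (M - (t - u))"
        using True u by (intro less.hyps) (auto simp: t_def)
      then have "coeff p u * coeff q (t - u) \<in> deg_lt k X I ((Suc D - u) + (M - (t - u)) - 1)"
        by (intro deg_lt_mult kr p(1))
      moreover have "(Suc D - u) + (M - (t - u)) - 1 = M - j" using True u by (auto simp: t_def)
      ultimately have "coeff p u * coeff q (t - u) \<in> deg_lt k X I (M - j)" by simp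
      then show ?thesis
        by (rule deg_lt_scale[OF kr subring_diff[OF kr subring_of_nat[OF kr] subring_of_nat[OF kr]]])
    next
      case False
      have "coeff p u * coeff q (t - u) = 0"
      proof (cases "u < D")
        case uD: True
        show ?thesis
        proof (cases "t - u < D")
          case True
          have "coeff q (t - u) \<in> deg_lt k X I (M - (t - u))"
            using True uD u by (intro less.hyps) (auto simp: t_def)
          then show ?thesis using False True uD by (simp add: deg_lt_0)
        next
          case False
          then show ?thesis using q by (simp add: coeff_eq_0)
        qed
      next
        case False
        then have "coeff p u = 0" using p(1)[of u] u by (simp add: deg_lt_0)
        then show ?thesis by simp
      qed
      then show ?thesis by (simp only: mult_zero_right deg_lt_zero)
    qed
    then have "(of_nat j - of_nat D) * coeff q j \<in> deg_lt k X I (M - j)"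
      unfolding eq using G[of "t - 1"] less.prems
      by (intro deg_lt_diff[OF kr] deg_lt_sum) (auto simp: t_def)
    moreover have "of_nat j - of_nat D = - (of_nat (D - j) :: 'e)"
      using less.prems by (simp add: of_nat_diff)
    ultimately have *: "of_nat (D - j) * coeff q j \<in> deg_lt k X I (M - j)"
      using deg_lt_uminus[OF kr] by fastforce
    obtain v where v: "v \<in> k" "of_nat (D - j) * v = 1"
      using k char[of "D - j"] less.prems subring_of_nat[OF kr, of "D - j"] by (auto simp: subfield_def)
    have "v * (of_nat (D - j) * coeff q j) = coeff q j"
      using v by (metis mult.assoc mult.commute mult_1_left)
    then show ?case using deg_lt_scale[OF kr v(1) *] by (simp only:)
  qed
qed

text \<open>Lagrange's dual basis argument without traces. With \<open>p = \<Prod>(T - \<theta>\<^sub>i)\<close> and \<open>r\<^sub>i\<close> the value of \<open>y\<close>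
  at \<open>\<theta>\<^sub>i\<close>, the polynomial constructed here is \<open>\<Sum>\<^sub>i r\<^sub>i ^ K \<Prod>\<^sub>j\<^sub>\<noteq>\<^sub>i (T - \<theta>\<^sub>j)\<close>. The derivation \<open>d\<close> moves
  \<open>\<theta>\<^sub>i\<close> with velocity \<open>r\<^sub>i\<close>, and passing from \<open>K\<close> to \<open>K + 1\<close> amounts to solving a
  differential equation whose solutions stay polynomial of bounded degree.\<close>

lemma lift_powers:
  fixes k :: "'e::field set"
  assumes k: "subfield k" and char: "\<And>n. n > 0 \<Longrightarrow> of_nat n \<noteq> (0::'e)"
    and I: "finite I" "alg_indep k X I" "a \<in> I"
    and L: "subring L" "pring k X I \<subseteq> L" "y \<in> L"
    and P: "prime_of L P" and Pp: "\<And>b. b \<in> P \<Longrightarrow> b \<in> pring k X I \<Longrightarrow> b \<in> (*) p ` pring k X I"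
    and pP: "p \<in> P" and p: "p = poly ph (X a)"
    and ph: "\<And>j. coeff ph j \<in> deg_lt k X (I - {a}) (Suc D - j)" "coeff ph D = 1"
    and d: "derivation d" "d ` k \<subseteq> k" "\<And>b. b \<in> I - {a} \<Longrightarrow> d (X b) = 0" "d (X a) = y" "d y = 0"
    and dP: "d ` P \<subseteq> P"
  shows "\<exists>q\<in>deg_lt k X I (D + K). q - y ^ K * poly (pderiv ph) (X a) \<in> P"
proof -
  define R where "R = pring k X (I - {a})"
  define ev where "ev f = poly f (X a)" for f
  have kr: "subring k" using k by (simp add: subfield_def)
  have R: "subring R" unfolding R_def by (rule subring_pring[OF kr])
  have RB: "R \<subseteq> pring k X I" unfolding R_def by (intro pring_mono) auto
  have RL: "R \<subseteq> L" using RB L by blast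
  have tr: "transc R (X a)" using I by (auto simp: alg_indep_def R_def)
  have XL: "X a \<in> L" using L var_pring[OF kr I(3)] by blast
  have Id: "ideal_of L P" using P by (rule prime_of_ideal)
  note Padd = ideal_of_add[OF Id] and Pdiff = ideal_of_diff[OF Id L(1)]
    and Pmult = ideal_of_mult[OF Id] and Pmult2 = ideal_of_mult2[OF Id]
  note Ladd = subring_add[OF L(1)] and Lmult = subring_mult[OF L(1)] and Ldiff = subring_diff[OF L(1)]
    and Lum = subring_uminus[OF L(1)] and Lpow = subring_power[OF L(1)]
  have evL: "ev f \<in> L" if "f \<in> poly_over R" for f
    unfolding ev_def using that RL poly_over_mono XL L(1) by (intro poly_over_poly) auto
  have phR: "ph \<in> poly_over R" using ph by (auto simp: poly_over_def R_def pring_def)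
  have degph: "degree ph = D"
  proof (rule antisym)
    show "degree ph \<le> D"
      by (rule degree_le) (use ph(1) in \<open>auto simp: deg_lt_0 Suc_diff_le dest!: spec\<close>,
        metis ph(1) deg_lt_0 diff_is_0_eq' Suc_leI)
    show "D \<le> degree ph" using ph(2) by (intro le_degree) auto
  qed
  have ph0: "ph \<noteq> 0" using ph(2) by auto
  \<comment> \<open>So \<open>ph\<close> plays the role of the minimal polynomial of
    \<open>X a\<close> modulo \<open>P\<close>.\<close>
  have key: "\<exists>h\<in>poly_over R. f = ph * h" if f: "f \<in> poly_over R" "ev f \<in> P" for f
  proof -
    have "ev f \<in> pring k X I" unfolding ev_def using f I(3) by (intro pring_collect kr) (auto simp: R_def)
    then obtain b where b: "b \<in> pring k X I" "ev f = p * b" using Pp f by blast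
    obtain h where h: "h \<in> poly_over R" "poly h (X a) = b"
      using pring_expand[OF kr I(3) b(1)] by (auto simp: R_def)
    have "f = ph * h"
      using f h b p phR by (intro transc_eq[OF tr R] poly_over_mult R) (auto simp: ev_def)
    then show ?thesis using h by blast
  qed
  have key0: "f = 0" if f: "f \<in> poly_over R" "ev f \<in> P" "degree f < D" for f
  proof -
    obtain h where h: "f = ph * h" using key f by blast
    show ?thesis using f(3) degph h by (cases "h = 0") (auto simp: degree_mult_eq ph0)
  qed
  have D0: "0 < D"
  proof (rule ccontr)
    assume "\<not> 0 < D"
    then have "ph = [:1:]" using degph ph(2) by (metis degree_eq_zeroE coeff_pCons_0 gr0I)
    then show False using p pP prime_of_1[OF P] by simp
  qed
  have dX: "d (X i) \<in> deg_lt k X (I - {a}) 2" if "i \<in> I - {a}" for i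
    using d(3)[OF that] by (simp add: deg_lt_zero)
  have dw: "d b \<in> deg_lt k X (I - {a}) n" if "b \<in> deg_lt k X (I - {a}) n" for b n
    using derivation_deg_lt[OF kr d(1,2) _ that] dX by blast
  have dR: "d c \<in> R" if "c \<in> R" for c
  proof -
    obtain n where "c \<in> deg_lt k X (I - {a}) n" using \<open>c \<in> R\<close> by (auto simp: R_def pring_def)
    then have "d c \<in> deg_lt k X (I - {a}) n"
      by (rule dw)
    then show ?thesis by (auto simp: R_def pring_def)
  qed
  define g where "g = map_poly d ph"
  have gR: "g \<in> poly_over R" unfolding g_def using dR phR d by (intro map_poly_derivation_over) auto
  have dg: "degree g < D"
  proof -
    have "coeff g i = 0" if "i \<ge> D" for i
    proof (cases "i = D")
      case True
      then show ?thesis using ph(2) d(1) by (simp add: g_def coeff_map_poly_derivation derivation_1)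
    next
      case False
      then have "coeff ph i = 0" using that degph by (intro coeff_eq_0) auto
      then show ?thesis using d(1) by (simp add: g_def coeff_map_poly_derivation derivation_0)
    qed
    then show ?thesis using D0 by (metis degree_0 leading_coeff_0_iff not_le)
  qed
  define P1 where "P1 = ev (pderiv ph)"
  define P2 where "P2 = ev (pderiv (pderiv ph))"
  have pdR: "pderiv f \<in> poly_over R" if "f \<in> poly_over R" for f using poly_over_pderiv[OF R that] .
  have P1L: "P1 \<in> L" "P2 \<in> L" unfolding P1_def P2_def by (auto intro!: evL pdR phR)
  have dpd: "degree (pderiv f) < D" if "degree f \<le> D" for f :: "'e poly"
  proof -
    have "degree (pderiv f) \<le> degree f - 1"
      by (rule degree_le) (auto simp: coeff_pderiv coeff_eq_0)
    then show ?thesis using that D0 by linarith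
  qed
  have P1P: "P1 \<notin> P"
  proof
    assume "P1 \<in> P"
    then have "pderiv ph = 0" using key0[OF pdR[OF phR]] dpd[of ph] degph by (simp add: P1_def)
    then have "coeff (pderiv ph) (D - 1) = 0" by simp
    then show False using D0 ph(2) char[of D] by (simp add: coeff_pderiv)
  qed
  \<comment> \<open>This is \<open>d p \<in> P\<close>: modulo \<open>P\<close>, the velocity
    \<open>y\<close> of \<open>X a\<close> is the value of \<open>- g / ph'\<close> at
    \<open>X a\<close>.\<close>
  have f1: "ev g + P1 * y \<in> P"
    using dP pP derivation_poly[OF d(1), of ph "X a"] by (force simp: p ev_def g_def P1_def d(4))
  have QR: "r = 0" if "r \<in> R" "r \<in> P" for r
    using key0[of "[:r:]"] that D0 R by (auto simp: ev_def intro!: poly_over_const)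
  have "degree ph \<le> degree f" if "f \<in> poly_over R" "poly f (X a) \<in> P" "f \<noteq> 0" for f
    using key0[of f] that degph unfolding ev_def by (metis not_le)
  moreover have "poly (pderiv ph) (X a) \<notin> P" using P1P by (simp add: P1_def ev_def)
  moreover have "degree (pderiv ph) < degree ph" using dpd[of ph] degph by simp
  moreover have "poly ph (X a) \<in> P" using p pP by simp
  ultimately obtain \<alpha> r where \<alpha>: "\<alpha> \<in> poly_over R" and r: "r \<in> R" "r \<noteq> 0"
    and "poly \<alpha> (X a) * poly (pderiv ph) (X a) - r \<in> P"
    using bezout_mod_prime[OF R L(1) RL XL P QR phR _ ph0 _ pdR[OF phR]] by blast
  then have f3: "ev \<alpha> * P1 - r \<in> P" by (simp add: ev_def P1_def)
  have rP: "r \<notin> P" "r \<in> L" using QR r RL by auto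
  have "\<exists>q\<in>poly_over R. degree q < D \<and> (\<forall>j. coeff q j \<in> deg_lt k X (I - {a}) (D + K - j)) \<and>
    ev q - y ^ K * P1 \<in> P"
  proof (induction K)
    case 0
    have "coeff (pderiv ph) j \<in> deg_lt k X (I - {a}) (D + 0 - j)" for j
      using ph(1)[of "Suc j"] subring_of_nat[OF kr, of "Suc j"]
      by (auto simp: coeff_pderiv simp del: of_nat_Suc intro: deg_lt_scale kr)
    then show ?case
      using dpd[of ph] degph pdR[OF phR] ideal_of_0[OF Id]
      by (intro bexI[of _ "pderiv ph"]) (auto simp: P1_def)
  next
    case (Suc K)
    then obtain q where q: "q \<in> poly_over R" "degree q < D"
      "\<And>j. coeff q j \<in> deg_lt k X (I - {a}) (D + K - j)" "ev q - y ^ K * P1 \<in> P" by blast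
    define qd where "qd = map_poly d q"
    have qdR: "qd \<in> poly_over R" unfolding qd_def using dR q d by (intro map_poly_derivation_over) auto
    have "d (ev q - y ^ K * P1) \<in> P" using q(4) dP by blast
    moreover have "d (y ^ K) = 0" using d by (induction K) (auto simp: derivation_1 derivation_mult)
    moreover have "d P1 = ev (pderiv g) + P2 * y"
      using derivation_poly[OF d(1), of "pderiv ph" "X a"]
      by (simp add: P1_def P2_def ev_def d(4) g_def pderiv_map_poly_derivation[OF d(1)])
    moreover have "d (ev q) = ev qd + ev (pderiv q) * y"
      using derivation_poly[OF d(1), of q "X a"] by (simp add: ev_def d(4) qd_def)
    ultimately have f2: "ev qd + ev (pderiv q) * y - y ^ K * (ev (pderiv g) + P2 * y) \<in> P"
      using d(1) by (simp add: derivation_diff derivation_mult)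
    \<comment> \<open>Modulo \<open>P\<close> the inverse of \<open>ph'\<close> is
      \<open>\<alpha> / r\<close>, so this polynomial takes the value \<open>r * y * q\<close>. Its
      remainder \<open>Q0\<close> by the monic \<open>ph\<close> is therefore \<open>r\<close> times
      the polynomial wanted for \<open>Suc K\<close>.\<close>
    have nR: "- (\<alpha> * g * q) \<in> poly_over R"
      using \<alpha> gR q by (intro poly_over_uminus poly_over_mult R)
    obtain N u Q0 where Q0: "u \<in> poly_over R" "Q0 \<in> poly_over R"
      "smult (lead_coeff ph ^ N) (- (\<alpha> * g * q)) = ph * u + Q0" "Q0 = 0 \<or> degree Q0 < degree ph"
      using pseudo_division[OF R phR ph0 nR] by blast
    have eq0: "- (\<alpha> * g * q) = ph * u + Q0" using Q0(3) degph ph(2) by simp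
    have dQ0: "degree Q0 < D" using Q0(4) degph D0 by auto
    have "ev (- (\<alpha> * g * q)) = ev (ph * u + Q0)" by (simp only: eq0)
    then have "- (ev \<alpha> * ev g * ev q) = p * ev u + ev Q0" by (simp add: ev_def p)
    then have "ev Q0 + ev \<alpha> * ev g * ev q = - (p * ev u)" by algebra
    also have "\<dots> \<in> P" by (rule ideal_of_uminus[OF Id L(1) Pmult2[OF evL[OF Q0(1)] pP]])
    finally have f4: "ev Q0 + ev \<alpha> * ev g * ev q \<in> P" .
    have inL: "ev \<alpha> \<in> L" "ev g \<in> L" "ev q \<in> L" "ev Q0 \<in> L" "ev (pderiv q) \<in> L" "ev (pderiv g) \<in> L"
      "ev qd \<in> L" using \<alpha> gR q Q0 qdR by (auto intro!: evL pdR)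
    have "ev Q0 - r * y * ev q =
      (ev Q0 + ev \<alpha> * ev g * ev q) - (ev \<alpha> * ev q) * (ev g + P1 * y) + (y * ev q) * (ev \<alpha> * P1 - r)"
      by (simp add: algebra_simps)
    also have "\<dots> \<in> P"
      by (intro Padd Pdiff f4 Pmult f1 f3 Lmult inL L(3))
    finally have f5: "ev Q0 - r * y * ev q \<in> P" .
    \<comment> \<open>Substituting the velocity formula for \<open>y\<close> shows that
      \<open>W\<close> vanishes modulo \<open>P\<close> and is thus a multiple
      \<open>ph * h\<close>.\<close>
    define W where "W = Q0 * pderiv ph + smult r (q * g)"
    have WR: "W \<in> poly_over R"
      unfolding W_def using Q0 q gR r by (intro poly_over_add poly_over_mult poly_over_smult R pdR phR)
    have "ev W = P1 * (ev Q0 - r * y * ev q) + (r * ev q) * (ev g + P1 * y)"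
      by (simp add: W_def ev_def P1_def algebra_simps)
    also have "\<dots> \<in> P" by (intro Padd Pmult f5 f1 Lmult P1L inL rP)
    finally obtain h where h: "h \<in> poly_over R" "W = ph * h" using key[OF WR] by blast
    have dh: "degree h < D"
    proof (cases "h = 0")
      case True
      then show ?thesis using D0 by simp
    next
      case False
      have "degree W \<le> 2 * D - 2"
        unfolding W_def
      proof (rule degree_add_le)
        show "degree (Q0 * pderiv ph) \<le> 2 * D - 2"
          using degree_mult_le[of Q0 "pderiv ph"] dQ0 dpd[of ph] degph by auto
        show "degree (smult r (q * g)) \<le> 2 * D - 2"
          using degree_mult_le[of q g] q(2) dg degree_smult_le[of r "q * g"] by auto
      qed
      moreover have "degree W = D + degree h" using h False ph0 degph by (simp add: degree_mult_eq)
      ultimately show ?thesis using D0 by linarith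
    qed
    \<comment> \<open>Differentiating \<open>W = ph * h\<close> in the variable and the congruence
      for \<open>q\<close> along \<open>d\<close> predicts the quotient \<open>h\<close> modulo
      \<open>P\<close>. The error \<open>E\<close> of this prediction has degree below
      \<open>D\<close>, so it is zero once its value lies in \<open>P\<close>.\<close>
    define E where "E = h - pderiv Q0 - smult r qd"
    have ER: "E \<in> poly_over R"
      unfolding E_def using h Q0 qdR r by (intro poly_over_diff poly_over_smult R pdR)
    have dE: "degree E < D"
    proof -
      have "degree (smult r qd) < D"
      proof -
        have "degree qd \<le> degree q"
          using d(1) by (intro degree_le) (auto simp: qd_def coeff_map_poly_derivation coeff_eq_0 derivation_0)
        then show ?thesis using q(2) degree_smult_le[of r qd] by linarith
      qed
      then show ?thesis unfolding E_def using dh dpd[of Q0] dQ0 by (intro degree_diff_less) auto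
    qed
    have "P1 * ev h - ev (pderiv W) = - (p * ev (pderiv h))"
      unfolding h(2) by (simp add: pderiv_mult ev_def P1_def p algebra_simps)
    also have "\<dots> \<in> P" using h by (intro ideal_of_uminus[OF Id L(1)] Pmult2[OF _ pP] evL pdR)
    finally have f6: "P1 * ev h - ev (pderiv W) \<in> P" .
    have "P1 * ev E = (P1 * ev h - ev (pderiv W)) + P2 * (ev Q0 - r * y * ev q)
        + (r * ev (pderiv q)) * (ev g + P1 * y)
        + (r * (ev (pderiv g) + P2 * y)) * (ev q - y ^ K * P1)
        - (r * P1) * (ev qd + ev (pderiv q) * y - y ^ K * (ev (pderiv g) + P2 * y))"
      by (simp add: E_def W_def ev_def P1_def P2_def pderiv_add pderiv_mult pderiv_smult algebra_simps)
    also have "\<dots> \<in> P"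
      by (intro Padd Pdiff f6 Pmult f5 f1 f2 q(4) Lmult Ladd P1L inL rP L(3))
    finally have "ev E \<in> P" using prime_of_mult[OF P P1L(1) evL[OF ER]] P1P by blast
    then have "E = 0" using key0 ER dE by blast
    then have heq: "h = pderiv Q0 + smult r qd" by (simp add: E_def algebra_simps)
    \<comment> \<open>Division by \<open>r\<close> leaves \<open>k[X]\<close> at first. The
      differential equation for \<open>q1\<close> no longer involves \<open>r\<close>, and the
      controlled degrees on its right hand side put the coefficients back into the
      filtration.\<close>
    define q1 where "q1 = smult (inverse r) Q0"
    have Q0q1: "Q0 = smult r q1" using r by (simp add: q1_def)
    have "smult r (ph * pderiv q1 - q1 * pderiv ph) = smult r (q * g - ph * qd)"
    proof -
      have "Q0 * pderiv ph + smult r (q * g) = ph * (pderiv Q0 + smult r qd)"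
        using h(2) heq W_def by simp
      then show ?thesis
        unfolding Q0q1 by (simp add: pderiv_smult smult_diff_right algebra_simps)
    qed
    then have ode: "ph * pderiv q1 - q1 * pderiv ph = q * g - ph * qd"
      by (rule smult_cancel_left[OF r(2)])
    have dq1: "degree q1 < D" using dQ0 r by (simp add: q1_def)
    have gw: "coeff g j \<in> deg_lt k X (I - {a}) (Suc D - j)" for j
      unfolding g_def coeff_map_poly_derivation[OF d(1)]
      by (rule dw[OF ph(1)])
    have qdw: "coeff qd j \<in> deg_lt k X (I - {a}) (D + K - j)" for j
      unfolding qd_def coeff_map_poly_derivation[OF d(1)]
      by (rule dw[OF q(3)])
    have G: "coeff (ph * pderiv q1 - q1 * pderiv ph) i \<in> deg_lt k X (I - {a}) (D + (D + Suc K) - 1 - i)" for i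
      unfolding ode coeff_diff
      using coeff_mult_deg_lt[OF kr q(3) gw, of i] coeff_mult_deg_lt[OF kr qdw ph(1), of i]
      by (intro deg_lt_diff[OF kr]) (auto simp: mult.commute algebra_simps)
    have q1w: "coeff q1 j \<in> deg_lt k X (I - {a}) (D + Suc K - j)" for j
      by (rule ode_coefficients[OF k _ ph(1) ph(2) dq1 G]) (erule char)
    then have q1R: "q1 \<in> poly_over R" by (auto simp: poly_over_def R_def pring_def)
    have "r * (ev q1 - y ^ Suc K * P1) = (ev Q0 - r * y * ev q) + (r * y) * (ev q - y ^ K * P1)"
      by (simp add: Q0q1 ev_def algebra_simps)
    also have "\<dots> \<in> P" by (intro Padd f5 Pmult q(4) Lmult rP L(3))
    finally have "ev q1 - y ^ Suc K * P1 \<in> P"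
      using prime_of_mult[OF P rP(2), of "ev q1 - y ^ Suc K * P1"] rP
      by (metis Ldiff Lmult Lpow L(3) P1L(1) evL q1R)
    then show ?case using q1R q1w dq1 by blast
  qed
  then obtain q where "\<And>j. coeff q j \<in> deg_lt k X (I - {a}) (D + K - j)" "ev q - y ^ K * P1 \<in> P" by blast
  then show ?thesis
    using deg_lt_collect[OF kr I(3), of q X "D + K"]
    by (intro bexI[of _ "ev q"]) (auto simp: ev_def P1_def)
qed

section \<open>Logarithmic forms attached to invariant primes\<close>

lemma derivation_kills_pring:
  assumes k: "subring k" and d: "derivation d" "\<And>c. c \<in> k \<Longrightarrow> d c = 0" "\<And>i. i \<in> I \<Longrightarrow> d (X i) = 0"
    and b: "b \<in> pring k X I"
  shows "d b = 0"
proof -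
  obtain n where "b \<in> deg_lt k X I n" using b by (auto simp: pring_def)
  then show ?thesis
    by (induction rule: deg_lt_induct) (use d in \<open>auto simp: derivation_0 derivation_add derivation_mult\<close>)
qed

text \<open>If the leading form involves \<open>X a\<close>, differentiation by \<open>X a\<close>
  multiplies its top coefficient by a positive integer, which is invertible. Otherwise the leading
  form lives in the remaining variables and sits in the coefficient at \<open>0\<close>.\<close>

lemma top_derivative:
  fixes k :: "'e::field set"
  assumes k: "subfield k" and char: "\<And>n. n > 0 \<Longrightarrow> of_nat n \<noteq> (0::'e)"
    and I: "finite I" "alg_indep k X I"
    and pd: "\<And>c. c \<in> I \<Longrightarrow> derivation (pd c)" "\<And>c x. c \<in> I \<Longrightarrow> x \<in> k \<Longrightarrow> pd c x = 0"
      "\<And>c b. c \<in> I \<Longrightarrow> b \<in> I \<Longrightarrow> pd c (X b) = (if c = b then 1 else 0)"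
    and r: "r \<in> deg_lt k X I (Suc m)" "r \<notin> deg_lt k X I m" and m: "0 < m"
  shows "\<exists>c\<in>I. pd c r \<notin> deg_lt k X I (m - 1)"
  using I pd r
proof (induction I arbitrary: r rule: finite_induct)
  case empty
  have "r \<in> k" using empty deg_lt_pring[of r k X "{}"] k by (auto simp: pring_empty subfield_def)
  then show ?case using empty m by (metis deg_lt_const Suc_pred)
next
  case (insert a F)
  have kr: "subring k" using k by (simp add: subfield_def)
  have aF: "a \<in> insert a F" "insert a F - {a} = F" using insert by auto
  have tr: "transc (pring k X F) (X a)" using insert.prems(1) aF by (auto simp: alg_indep_def)
  have FI: "alg_indep k X F" using insert.prems(1) alg_indep_subset by blast
  have R: "subring (pring k X F)" by (rule subring_pring[OF kr])
  obtain \<psi> where \<psi>: "\<And>j. coeff \<psi> j \<in> deg_lt k X F (Suc m - j)" "poly \<psi> (X a) = r"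
    using deg_lt_expand[OF kr aF(1) insert.prems(5)] aF by auto
  have \<psi>R: "\<psi> \<in> poly_over (pring k X F)" using \<psi> by (auto simp: poly_over_def pring_def)
  obtain j where j: "j \<le> m" "coeff \<psi> j \<notin> deg_lt k X F (m - j)"
  proof -
    have "\<And>j. coeff \<psi> j \<in> deg_lt k X (insert a F - {a}) (Suc m - j)" using \<psi>(1) aF(2) by simp
    moreover have "poly \<psi> (X a) \<notin> deg_lt k X (insert a F) m" using \<psi>(2) insert.prems(6) by simp
    ultimately show ?thesis using top_coeff[OF kr aF(1)] that unfolding aF(2) by metis
  qed
  show ?case
  proof (cases "j = 0")
    case False
    have "pd a r \<notin> deg_lt k X (insert a F) (m - 1)"
    proof
      assume "pd a r \<in> deg_lt k X (insert a F) (m - 1)"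
      then obtain \<gamma> where \<gamma>: "\<And>j. coeff \<gamma> j \<in> deg_lt k X F (m - 1 - j)" "poly \<gamma> (X a) = pd a r"
        using deg_lt_expand[OF kr aF(1)] aF by fastforce
      have da: "derivation (pd a)" using insert.prems(2) by simp
      have "pd a b = 0" if "b \<in> pring k X F" for b
        using that insert.prems insert.hyps
        by (intro derivation_kills_pring[OF kr da _ _ that]) auto
      then have "map_poly (pd a) \<psi> = 0"
        using \<psi>R by (intro poly_eqI) (auto simp: coeff_map_poly_derivation[OF da] poly_over_def)
      then have "pd a r = poly (pderiv \<psi>) (X a)"
        using derivation_poly[OF da, of \<psi> "X a"] \<psi>(2) insert.prems(4)[of a a] by simp
      then have "\<gamma> = pderiv \<psi>"
        using \<gamma> \<psi>R by (intro transc_eq[OF tr R] poly_over_pderiv R) (auto simp: poly_over_def pring_def)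
      then have "of_nat j * coeff \<psi> j \<in> deg_lt k X F (m - j)"
        using \<gamma>(1)[of "j - 1"] False by (simp add: coeff_pderiv)
      moreover obtain v where "v \<in> k" "of_nat j * v = 1"
        using k char[of j] False subring_of_nat[OF kr, of j] by (auto simp: subfield_def)
      moreover from this have "v * (of_nat j * coeff \<psi> j) = coeff \<psi> j"
        by (metis mult.assoc mult.commute mult_1_left)
      ultimately have "coeff \<psi> j \<in> deg_lt k X F (m - j)" using deg_lt_scale[OF kr] by metis
      then show False using j by blast
    qed
    then show ?thesis by blast
  next
    case True
    have "\<exists>c\<in>F. pd c (coeff \<psi> 0) \<notin> deg_lt k X F (m - 1)"
      using \<psi>(1)[of 0] j True insert.prems FI by (intro insert.IH) auto
    then obtain c where c: "c \<in> F" "pd c (coeff \<psi> 0) \<notin> deg_lt k X F (m - 1)" by blast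
    have "pd c r \<notin> deg_lt k X (insert a F) (m - 1)"
    proof
      assume "pd c r \<in> deg_lt k X (insert a F) (m - 1)"
      then obtain \<gamma> where \<gamma>: "\<And>j. coeff \<gamma> j \<in> deg_lt k X F (m - 1 - j)" "poly \<gamma> (X a) = pd c r"
        using deg_lt_expand[OF kr aF(1)] aF by fastforce
      have dc: "derivation (pd c)" using insert.prems(2) c by simp
      have "pd c (X a) = 0" using insert.prems(4)[of c a] c insert.hyps by auto
      then have "pd c r = poly (map_poly (pd c) \<psi>) (X a)"
        using derivation_poly[OF dc, of \<psi> "X a"] \<psi>(2) by simp
      moreover have "map_poly (pd c) \<psi> \<in> poly_over (pring k X F)"
      proof -
        have "pd c b \<in> pring k X F" if b: "b \<in> pring k X F" for b
        proof -
          obtain n where "b \<in> deg_lt k X F n" using b by (auto simp: pring_def)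
          then have "pd c b \<in> deg_lt k X F (n - 1)"
            using c insert.prems by (intro derivation_deg_lt_lower[OF kr dc]) (auto simp: subring_0[OF kr] subring_1[OF kr])
          then show ?thesis by (auto simp: pring_def)
        qed
        then show ?thesis using \<psi>R by (intro map_poly_derivation_over[OF dc]) auto
      qed
      ultimately have "\<gamma> = map_poly (pd c) \<psi>"
        using \<gamma> by (intro transc_eq[OF tr R]) (auto simp: poly_over_def pring_def)
      then show False using \<gamma>(1)[of 0] c by (simp add: coeff_map_poly_derivation[OF dc])
    qed
    then show ?thesis using c by blast
  qed
qed

text \<open>In the application the field is the fraction field of the polynomial ring over the
  algebra. \<open>F\<close> is a relation of least degree for the primitive element
  \<open>y\<close>, and \<open>L\<close> is \<open>k[X][y]\<close> with \<open>s\<close> inverted,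
  where \<open>s\<close> is chosen so that \<open>F'(y)\<close> and the leading coefficient of
  \<open>F\<close> become units. The \<open>pd a\<close> are the partial derivatives over
  \<open>k\<close>. \<open>Dy\<close> and \<open>Dx\<close> come from differentiation by
  indeterminates that lie in \<open>k\<close>, which is why \<open>k\<close> is only assumed stable
  under them.\<close>

locale core =
  fixes k :: "'e::field set" and X :: "nat \<Rightarrow> 'e" and I :: "nat set"
    and y s :: 'e and F :: "'e poly" and L :: "'e set"
    and pd :: "nat \<Rightarrow> 'e \<Rightarrow> 'e" and Dy :: "nat \<Rightarrow> 'e \<Rightarrow> 'e" and Dx :: "nat \<Rightarrow> nat \<Rightarrow> 'e \<Rightarrow> 'e"
  assumes k: "subfield k" and char: "\<And>n. n > 0 \<Longrightarrow> of_nat n \<noteq> (0::'e)"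
    and I: "finite I" "alg_indep k X I"
    and L: "subring L" "pring k X I \<subseteq> L" "y \<in> L"
    and F: "F \<in> poly_over (pring k X I)" "poly F y = 0"
    and Fd: "poly (pderiv F) y \<noteq> 0" "inverse (poly (pderiv F) y) \<in> L"
    and s: "s \<in> pring k X I" "s \<noteq> 0" "inverse s \<in> L"
    and lcF: "\<exists>c\<in>pring k X I. \<exists>i. lead_coeff F * c = s ^ i"
    and L_rep: "\<And>x. x \<in> L \<Longrightarrow> \<exists>i V. V \<in> poly_over (pring k X I) \<and> degree V < degree F \<and> s ^ i * x = poly V y"
    and V_uniq: "\<And>V. V \<in> poly_over (pring k X I) \<Longrightarrow> degree V < degree F \<Longrightarrow> poly V y = 0 \<Longrightarrow> V = 0"
    and pd: "\<And>a. a \<in> I \<Longrightarrow> derivation (pd a)" "\<And>a c. a \<in> I \<Longrightarrow> c \<in> k \<Longrightarrow> pd a c = 0"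
      "\<And>a b. a \<in> I \<Longrightarrow> b \<in> I \<Longrightarrow> pd a (X b) = (if a = b then 1 else 0)"
      "\<And>a x. a \<in> I \<Longrightarrow> x \<in> L \<Longrightarrow> pd a x \<in> L"
    and Dy: "\<And>a. a \<in> I \<Longrightarrow> derivation (Dy a)" "\<And>a. a \<in> I \<Longrightarrow> Dy a ` k \<subseteq> k"
      "\<And>a b. a \<in> I \<Longrightarrow> b \<in> I \<Longrightarrow> Dy a (X b) = (if a = b then y else 0)" "\<And>a. a \<in> I \<Longrightarrow> Dy a y = 0"
    and Dx: "\<And>a c. a \<in> I \<Longrightarrow> c \<in> I \<Longrightarrow> derivation (Dx a c)" "\<And>a c. a \<in> I \<Longrightarrow> c \<in> I \<Longrightarrow> Dx a c ` k \<subseteq> k"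
      "\<And>a c b. a \<in> I \<Longrightarrow> c \<in> I \<Longrightarrow> b \<in> I \<Longrightarrow> Dx a c (X b) = (if a = b then X c else 0)"
begin

abbreviation B where "B \<equiv> pring k X I"
abbreviation dl where "dl \<equiv> deg_lt k X I"

text \<open>The last two conditions express that the trace on \<open>B\<close> has height one: it is
  nonzero, yet all variables but one stay independent modulo \<open>P\<close>.\<close>

definition good :: "'e set \<Rightarrow> bool" where
  "good P \<longleftrightarrow> prime_of L P \<and> (\<forall>a\<in>I. Dy a ` P \<subseteq> P) \<and> (\<forall>a\<in>I. \<forall>c\<in>I. Dx a c ` P \<subseteq> P) \<and>
     (\<exists>a\<in>I. P \<inter> pring k X (I - {a}) = {0}) \<and> P \<inter> B \<noteq> {0}"

lemma kr: "subring k" using k by (simp add: subfield_def)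
lemma Br: "subring B" by (rule subring_pring[OF kr])

lemma prime_of_B: "prime_of L P \<Longrightarrow> prime_of B (P \<inter> B)"
proof -
  assume P: "prime_of L P"
  note Id = prime_of_ideal[OF P]
  show ?thesis
    unfolding prime_of_def ideal_of_def
  proof (intro conjI ballI impI)
    show "0 \<in> P \<inter> B" using ideal_of_0[OF Id] subring_0[OF Br] by simp
    show "x + y \<in> P \<inter> B" if "x \<in> P \<inter> B" "y \<in> P \<inter> B" for x y
      using that ideal_of_add[OF Id] subring_add[OF Br] by simp
    show "r * x \<in> P \<inter> B" if "r \<in> B" "x \<in> P \<inter> B" for r x
      using that ideal_of_mult[OF Id, of r x] subring_mult[OF Br, of r x] L by auto
    show "x \<in> P \<inter> B \<or> y \<in> P \<inter> B" if "x \<in> B" "y \<in> B" "x * y \<in> P \<inter> B" for x y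
      using that prime_of_mult[OF P, of x y] L by auto
    show "1 \<notin> P \<inter> B" using prime_of_1[OF P] by simp
  qed simp
qed

text \<open>Over the factorial ring in the variables other than \<open>a\<close>, the trace of
  \<open>P\<close> on \<open>B\<close> is a prime that meets the coefficients in zero, hence
  principal.\<close>

lemma good_generator:
  assumes P: "good P"
  obtains p n where "p \<in> P" "p \<in> B" "p \<noteq> 0" "\<And>b. b \<in> P \<Longrightarrow> b \<in> B \<Longrightarrow> b \<in> (*) p ` B"
    "p \<in> dl (Suc n)" "p \<notin> dl n"
proof -
  obtain a where a: "a \<in> I" "P \<inter> pring k X (I - {a}) = {0}" using P by (auto simp: good_def)
  define R where "R = pring k X (I - {a})"
  have BR: "B = (\<lambda>\<beta>. poly \<beta> (X a)) ` poly_over R" unfolding R_def by (rule pring_insert_eq[OF kr a(1)])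
  have pf: "prime_factorial R"
    unfolding R_def using I by (intro prime_factorial_pring k) (auto intro: alg_indep_subset)
  have tr: "transc R (X a)" using I a by (auto simp: alg_indep_def R_def)
  have "prime_of B (P \<inter> B)" using P by (intro prime_of_B) (auto simp: good_def)
  moreover have "P \<inter> B \<inter> R = {0}" using a pring_mono[of "I - {a}" I k X] by (auto simp: R_def)
  moreover have "P \<inter> B \<noteq> {0}" using P by (simp add: good_def)
  ultimately obtain p where p: "p \<in> B" "p \<noteq> 0" "P \<inter> B = (*) p ` B"
    using prime_principal[OF _ pf tr, of "P \<inter> B"] subring_pring[OF kr] unfolding BR R_def by metis
  obtain n where "p \<in> dl (Suc n)" "p \<notin> dl n"
    using deg_lt_exact[of p k X I 0] p by (auto simp: deg_lt_0)
  moreover have "p * 1 \<in> (*) p ` B" using subring_1[OF Br] by (rule imageI)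
  ultimately show ?thesis using that[of p n] p by auto
qed

text \<open>Suppose the leading form of \<open>p\<close> has degree \<open>j < n\<close> in
  \<open>X a\<close>. Some \<open>pd c\<close> lowers the degree of its top coefficient by exactly
  one. The derivation that replaces \<open>X c\<close> by \<open>X a\<close> preserves
  \<open>P\<close> and the degree, so it multiplies \<open>p\<close> by a scalar
  \<open>\<kappa>\<close>; yet it creates a term with \<open>X a ^ (j + 1)\<close> of full degree,
  which a multiple of \<open>p\<close> does not have.\<close>

lemma good_monic:
  assumes P: "good P" and p: "p \<in> P" "p \<in> B" "p \<noteq> 0" "\<And>b. b \<in> P \<Longrightarrow> b \<in> B \<Longrightarrow> b \<in> (*) p ` B"
    "p \<in> dl (Suc n)" "p \<notin> dl n" and a: "a \<in> I"
  shows "\<exists>\<beta>\<in>k. \<exists>ph. \<beta> \<noteq> 0 \<and> p = \<beta> * poly ph (X a) \<and>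
    (\<forall>j. coeff ph j \<in> deg_lt k X (I - {a}) (Suc n - j)) \<and> coeff ph n = 1"
proof -
  define R where "R = pring k X (I - {a})"
  have R: "subring R" unfolding R_def by (rule subring_pring[OF kr])
  have tr: "transc R (X a)" using I a by (auto simp: alg_indep_def R_def)
  obtain \<psi> where \<psi>: "\<And>j. coeff \<psi> j \<in> deg_lt k X (I - {a}) (Suc n - j)" "poly \<psi> (X a) = p"
    using deg_lt_expand[OF kr a p(5)] by blast
  have \<psi>R: "\<psi> \<in> poly_over R" using \<psi> by (auto simp: poly_over_def R_def pring_def)
  obtain j where j: "j \<le> n" "coeff \<psi> j \<notin> deg_lt k X (I - {a}) (n - j)"
    "\<And>i. j < i \<Longrightarrow> coeff \<psi> i \<in> deg_lt k X (I - {a}) (n - i)"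
    using top_coeff[OF kr a \<psi>(1)] p(6) \<psi>(2) by metis
  have "j = n"
  proof (rule ccontr)
    assume "j \<noteq> n"
    then have jn: "j < n" using j by simp
    have "\<exists>c\<in>I - {a}. pd c (coeff \<psi> j) \<notin> deg_lt k X (I - {a}) (n - j - 1)"
      using I jn \<psi>(1)[of j] j pd
      by (intro top_derivative[OF k char]) (auto intro: alg_indep_subset simp: Suc_diff_le)
    then obtain c where c: "c \<in> I" "c \<noteq> a" "pd c (coeff \<psi> j) \<notin> deg_lt k X (I - {a}) (n - j - 1)" by blast
    define d where "d = Dx c a"
    have d: "derivation d" "d ` k \<subseteq> k" "\<And>b. b \<in> I \<Longrightarrow> d (X b) = (if c = b then X a else 0)"
      using Dx c a by (auto simp: d_def)
    have "d p \<in> dl (Suc n)"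
      using a by (intro derivation_deg_lt[OF kr d(1,2) _ p(5)]) (auto simp: d(3) deg_lt_zero intro: var_deg_lt[OF kr])
    moreover have "d p \<in> P" using P c a p(1) unfolding good_def d_def by blast
    ultimately obtain \<kappa> where \<kappa>: "\<kappa> \<in> B" "d p = p * \<kappa>" using p(4)[of "d p"] by (auto simp: pring_def)
    have "p * \<kappa> \<in> dl (n + 1)" using \<open>d p \<in> dl (Suc n)\<close> \<kappa>(2) by simp
    then have "\<kappa> \<in> dl 1" by (rule deg_lt_cancel[OF kr I p(2,6) \<kappa>(1)])
    then have \<kappa>k: "\<kappa> \<in> k" using deg_lt_Suc_0[OF kr] by simp
    \<comment> \<open>In the decomposition \<open>d = d0 + X a * pd c\<close> the part
      \<open>d0\<close> kills the variables and acts on scalars only, so both summands act on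
      coefficients free of \<open>X a\<close> and can be compared power by power.\<close>
    define d0 where "d0 x = d x - X a * pd c x" for x
    have d0: "derivation d0"
      using d(1) pd(1)[OF c(1)] unfolding derivation_def d0_def by (simp add: algebra_simps)
    have d0k: "d0 ` k \<subseteq> k" using d(2) pd(2)[OF c(1)] by (auto simp: d0_def)
    have d0X: "d0 (X b) = 0" if "b \<in> I - {a}" for b
      using that d(3)[of b] pd(3)[of c b] c by (auto simp: d0_def)
    have d0w: "d0 b \<in> deg_lt k X (I - {a}) m" if "b \<in> deg_lt k X (I - {a}) m" for b m
      using derivation_deg_lt[OF kr d0 d0k _ that] d0X by (simp add: deg_lt_zero)
    have pdw: "pd c b \<in> deg_lt k X (I - {a}) (m - 1)" if "b \<in> deg_lt k X (I - {a}) m" for b m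
      using pd c by (intro derivation_deg_lt_lower[OF kr _ _ _ that]) (auto simp: subring_0[OF kr] subring_1[OF kr])
    define \<psi>1 where "\<psi>1 = map_poly d0 \<psi> + pCons 0 (map_poly (pd c) \<psi>)"
    have "poly (map_poly d \<psi>) (X a) = poly (map_poly d0 \<psi>) (X a) + X a * poly (map_poly (pd c) \<psi>) (X a)"
    proof -
      have "map_poly d \<psi> = map_poly d0 \<psi> + smult (X a) (map_poly (pd c) \<psi>)"
        using pd(1)[OF c(1)]
        by (intro poly_eqI) (simp add: coeff_map_poly_derivation d(1) d0 d0_def)
      then show ?thesis by simp
    qed
    then have "poly \<psi>1 (X a) = d p"
      using derivation_poly[OF d(1), of \<psi> "X a"] \<psi>(2) d(3)[OF a] c(2) by (simp add: \<psi>1_def)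
    then have "\<psi>1 = smult \<kappa> \<psi>"
    proof (intro transc_eq[OF tr R])
      show "\<psi>1 \<in> poly_over R"
        unfolding \<psi>1_def using d0w[OF \<psi>(1)] pdw[OF \<psi>(1)]
        by (intro poly_over_add poly_over_pCons R)
          (auto simp: poly_over_def R_def coeff_map_poly_derivation d0 pd(1)[OF c(1)] subring_0[OF R[unfolded R_def]]
            intro: deg_lt_pring)
      show "smult \<kappa> \<psi> \<in> poly_over R"
        using \<psi>R \<kappa>k by (intro poly_over_smult R) (auto simp: R_def intro: const_pring kr)
    qed (simp add: \<psi>(2) \<kappa>(2) mult.commute)
    then have "coeff \<psi>1 (Suc j) = \<kappa> * coeff \<psi> (Suc j)" by simp
    then have "pd c (coeff \<psi> j) = \<kappa> * coeff \<psi> (Suc j) - d0 (coeff \<psi> (Suc j))"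
      using pd(1)[OF c(1)] by (simp add: \<psi>1_def coeff_map_poly_derivation d0 eq_diff_eq add.commute)
    also have "\<dots> \<in> deg_lt k X (I - {a}) (n - Suc j)"
      using j(3)[of "Suc j"] by (intro deg_lt_diff[OF kr] deg_lt_scale[OF kr \<kappa>k] d0w) auto
    finally show False using c(3) by simp
  qed
  define \<beta> where "\<beta> = coeff \<psi> n"
  have \<beta>: "\<beta> \<in> k" "\<beta> \<noteq> 0"
    using j \<psi>(1)[of n] \<open>j = n\<close> by (auto simp: \<beta>_def deg_lt_0 deg_lt_Suc_0[OF kr])
  obtain v where v: "v \<in> k" "\<beta> * v = 1" using \<beta> k by (auto simp: subfield_def)
  show ?thesis
  proof (intro bexI[of _ \<beta>] exI[of _ "smult v \<psi>"] conjI allI)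
    show "p = \<beta> * poly (smult v \<psi>) (X a)" using v(2) \<psi>(2) by (simp add: mult.assoc[symmetric])
    show "coeff (smult v \<psi>) i \<in> deg_lt k X (I - {a}) (Suc n - i)" for i
      using deg_lt_scale[OF kr v(1) \<psi>(1)] by simp
    show "coeff (smult v \<psi>) n = 1" using v(2) by (simp add: \<beta>_def mult.commute)
  qed (use \<beta> in auto)
qed

text \<open>After scaling, \<open>p\<close> is monic in \<open>X a\<close> and \<open>pd a p\<close>
  is its formal derivative there, so \<open>lift_powers\<close> applies with the derivation
  \<open>Dy a\<close>.\<close>

lemma good_lift:
  assumes P: "good P" and p: "p \<in> P" "p \<in> B" "p \<noteq> 0" "\<And>b. b \<in> P \<Longrightarrow> b \<in> B \<Longrightarrow> b \<in> (*) p ` B"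
    "p \<in> dl (Suc n)" "p \<notin> dl n" and a: "a \<in> I"
  shows "\<exists>q\<in>dl (n + K). q - y ^ K * pd a p \<in> P"
proof -
  have Pp: "prime_of L P" using P by (simp add: good_def)
  have Id: "ideal_of L P" using Pp by (rule prime_of_ideal)
  obtain \<beta> ph where \<beta>: "\<beta> \<in> k" "\<beta> \<noteq> 0" and ph: "p = \<beta> * poly ph (X a)"
    "\<And>j. coeff ph j \<in> deg_lt k X (I - {a}) (Suc n - j)" "coeff ph n = 1"
    using good_monic[OF assms] by blast
  obtain v where v: "v \<in> k" "\<beta> * v = 1" using \<beta> k by (auto simp: subfield_def)
  have kB: "c \<in> B" "c \<in> L" if "c \<in> k" for c using that const_pring[OF kr, of c X I] L by auto
  define p1 where "p1 = poly ph (X a)"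
  have p1: "p1 = v * p" using v ph(1) by (simp add: p1_def mult.assoc[symmetric] mult.commute[of v])
  have p1P: "p1 \<in> P" unfolding p1 using kB v p by (intro ideal_of_mult[OF Id]) auto
  have "b \<in> (*) p1 ` B" if b: "b \<in> P" "b \<in> B" for b
  proof -
    obtain c where "c \<in> B" "b = p * c" using p(4)[OF b] by blast
    have "p1 * (\<beta> * c) = (\<beta> * v) * (p * c)" by (simp add: p1 mult_ac)
    then have "b = p1 * (\<beta> * c)" using v(2) \<open>b = p * c\<close> by (simp only: mult_1_left)
    moreover have "\<beta> * c \<in> B" using kB \<beta> \<open>c \<in> B\<close> subring_mult[OF Br] by blast
    ultimately show ?thesis by blast
  qed
  moreover have "\<And>b. b \<in> I - {a} \<Longrightarrow> Dy a (X b) = 0" using Dy(3)[of a] a by auto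
  moreover have "Dy a ` P \<subseteq> P" using P a by (simp add: good_def)
  moreover have "Dy a (X a) = y" using Dy(3)[OF a a] by simp
  ultimately obtain q where q: "q \<in> dl (n + K)" "q - y ^ K * poly (pderiv ph) (X a) \<in> P"
    using lift_powers[OF k char I a L Pp _ p1P p1_def ph(2,3) Dy(1)[OF a] Dy(2)[OF a] _ _ Dy(4)[OF a]]
    by blast
  have da: "derivation (pd a)" using pd(1) a .
  have "map_poly (pd a) ph = 0"
  proof (rule poly_eqI)
    fix j
    have cj: "coeff ph j \<in> pring k X (I - {a})" using ph(2) by (rule deg_lt_pring)
    have "pd a (X i) = 0" if "i \<in> I - {a}" for i using pd(3)[of a i] a that by auto
    then have "pd a (coeff ph j) = 0"
      using derivation_kills_pring[OF kr da _ _ cj] pd(2)[OF a] by blast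
    then show "coeff (map_poly (pd a) ph) j = coeff 0 j" by (simp add: coeff_map_poly_derivation[OF da])
  qed
  then have "pd a p = \<beta> * poly (pderiv ph) (X a)"
    unfolding ph(1) using derivation_poly[OF da, of ph "X a"] pd(2,3)[OF a] \<beta> a da
    by (simp add: derivation_mult)
  then have "\<beta> * q - y ^ K * pd a p = \<beta> * (q - y ^ K * poly (pderiv ph) (X a))"
    by (simp add: algebra_simps)
  also have "\<dots> \<in> P" using kB \<beta> q by (intro ideal_of_mult[OF Id]) auto
  finally show ?thesis using q deg_lt_scale[OF kr \<beta>(1)] by blast
qed

end

section \<open>Localised coordinates, Euler's dual basis and cancellation of denominators\<close>

context core
begin

definition Bs where "Bs = {x. \<exists>i. s ^ i * x \<in> B}"

lemma s_pow_B: "s ^ i \<in> B"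
  using s by (intro subring_power Br)

lemma s_pow_L: "s ^ i \<in> L" "inverse (s ^ i) \<in> L"
  using s_pow_B L s subring_power[OF L(1), of "inverse s" i] by (auto simp: power_inverse)

lemma B_Bs: "B \<subseteq> Bs"
  by (auto simp: Bs_def intro: exI[of _ 0])

lemma subring_Bs: "subring Bs"
  unfolding subring_def
proof (intro conjI ballI)
  show "0 \<in> Bs" "1 \<in> Bs" using B_Bs subring_0[OF Br] subring_1[OF Br] by auto
  show "- x \<in> Bs" if "x \<in> Bs" for x
    using that subring_uminus[OF Br] by (auto simp: Bs_def)
next
  fix u v assume "u \<in> Bs" "v \<in> Bs"
  then obtain i j where ij: "s ^ i * u \<in> B" "s ^ j * v \<in> B" by (auto simp: Bs_def)
  have "s ^ (i + j) * (u + v) = s ^ j * (s ^ i * u) + s ^ i * (s ^ j * v)"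
    by (simp add: power_add algebra_simps)
  also have "\<dots> \<in> B" by (intro subring_add subring_mult Br ij s_pow_B)
  finally show "u + v \<in> Bs" unfolding Bs_def by blast
  have "s ^ (i + j) * (u * v) = (s ^ i * u) * (s ^ j * v)" by (simp add: power_add)
  also have "\<dots> \<in> B" by (intro subring_mult Br ij)
  finally show "u * v \<in> Bs" unfolding Bs_def by blast
qed

lemma Bs_L: "Bs \<subseteq> L"
proof
  fix x assume "x \<in> Bs"
  then obtain i where "s ^ i * x \<in> B" by (auto simp: Bs_def)
  then have "inverse (s ^ i) * (s ^ i * x) \<in> L" using L s_pow_L subring_mult[OF L(1)] by blast
  then show "x \<in> L" using s by (simp add: mult.assoc[symmetric])
qed

lemma inv_s_Bs: "inverse (s ^ i) \<in> Bs"
  using s subring_1[OF Br] by (auto simp: Bs_def intro!: exI[of _ i])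

lemma Fe: "0 < degree F"
  using Fd(1) by (metis degree_eq_zeroE gr0I pderiv_0 pderiv_pCons add.right_neutral pCons_0_0 poly_0)

lemma F0: "F \<noteq> 0" using Fe by auto

lemma L_rep_Bs:
  assumes "x \<in> L"
  obtains V where "V \<in> poly_over Bs" "degree V < degree F" "x = poly V y"
proof -
  obtain i V where V: "V \<in> poly_over B" "degree V < degree F" "s ^ i * x = poly V y"
    using L_rep[OF assms] by blast
  have "poly (smult (inverse (s ^ i)) V) y = inverse (s ^ i) * (s ^ i * x)" by (simp add: V(3))
  then have "x = poly (smult (inverse (s ^ i)) V) y" using s by (simp add: mult.assoc[symmetric])
  moreover have "smult (inverse (s ^ i)) V \<in> poly_over Bs"
    using V(1) poly_over_mono[OF B_Bs] by (intro poly_over_smult subring_Bs inv_s_Bs) auto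
  moreover have "degree (smult (inverse (s ^ i)) V) < degree F" using V(2) by simp
  ultimately show ?thesis using that by blast
qed

lemma mod_F_over:
  assumes V: "V \<in> poly_over Bs"
  shows "V mod F \<in> poly_over Bs"
proof -
  have FBs: "F \<in> poly_over Bs" using F poly_over_mono[OF B_Bs] by blast
  obtain N q r where qr: "q \<in> poly_over Bs" "r \<in> poly_over Bs"
    "smult (lead_coeff F ^ N) V = F * q + r" "r = 0 \<or> degree r < degree F"
    using pseudo_division[OF subring_Bs FBs F0 V] by blast
  define c where "c = inverse (lead_coeff F ^ N)"
  obtain b i where b: "b \<in> B" "lead_coeff F * b = s ^ i" using lcF by blast
  then have "s ^ i * inverse (lead_coeff F) = b" using F0 by (simp add: b(2)[symmetric])
  then have "inverse (lead_coeff F) \<in> Bs" using b by (auto simp: Bs_def)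
  then have cBs: "c \<in> Bs" unfolding c_def power_inverse[symmetric] by (intro subring_power subring_Bs)
  have "V = smult c (smult (lead_coeff F ^ N) V)" using F0 by (simp add: c_def)
  also have "\<dots> = F * smult c q + smult c r" by (simp add: qr(3) smult_add_right)
  finally have "V mod F = (F * smult c q + smult c r) mod F" by simp
  also have "\<dots> = smult c r mod F" by (simp only: mod_mult_self4)
  also have "\<dots> = smult c r" using qr(4) Fe by (intro mod_poly_less) auto
  finally show ?thesis using qr(2) cBs by (auto intro: poly_over_smult subring_Bs)
qed

text \<open>Euler's construction: \<open>fb\<close> is \<open>F / (T - y)\<close>, and its
  coefficients divided by \<open>F'(y)\<close> form the basis dual to the powers of \<open>y\<close>
  under the trace form. Traces are not formed; the duality enters through \<open>sum_ed\<close> and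
  \<open>lb_fb\<close>.\<close>

definition fb where "fb = synthetic_div F y"
definition ed where "ed j = coeff fb j * inverse (poly (pderiv F) y)"

lemma fb_eq: "F = [:- y, 1:] * fb"
  using synthetic_div_correct'[of y F] F(2) by (simp add: fb_def)

lemma fb_y: "poly fb y = poly (pderiv F) y"
proof -
  have "pderiv F = pderiv ([:- y, 1:] * fb)" by (simp only: fb_eq[symmetric])
  also have "\<dots> = [:- y, 1:] * pderiv fb + fb * pderiv [:- y, 1:]" by (rule pderiv_mult)
  finally have "pderiv F = [:- y, 1:] * pderiv fb + fb * pderiv [:- y, 1:]" .
  then show ?thesis by (simp add: pderiv_pCons)
qed

lemma degree_fb: "degree fb < degree F"
  using Fe by (simp add: fb_def degree_synthetic_div)

lemma ed_L: "ed j \<in> L"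
proof -
  have "f \<in> poly_over L \<Longrightarrow> synthetic_div f y \<in> poly_over L" for f
  proof (induction f)
    case 0
    then show ?case by simp
  next
    case (pCons a f)
    then have "f \<in> poly_over L" by (auto simp: poly_over_def coeff_pCons dest: spec[of _ "Suc _"])
    then show ?case using pCons L by (auto intro!: poly_over_pCons poly_over_poly)
  qed
  moreover have "F \<in> poly_over L" using F L poly_over_mono by blast
  ultimately have "fb \<in> poly_over L" by (simp add: fb_def)
  then show ?thesis unfolding ed_def using Fd(2) by (intro subring_mult L(1)) (auto simp: poly_over_def)
qed

lemma sum_below: "degree f < n \<Longrightarrow> (\<Sum>j<n. coeff f j * x ^ j) = poly f x" for f :: "'e poly"
  unfolding poly_altdef by (intro sum.mono_neutral_right) (auto simp: coeff_eq_0)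

lemma sum_ed: "(\<Sum>j<degree F. ed j * y ^ j) = 1"
proof -
  have "(\<Sum>j<degree F. ed j * y ^ j) = inverse (poly (pderiv F) y) * (\<Sum>j<degree F. coeff fb j * y ^ j)"
    unfolding sum_distrib_left by (intro sum.cong) (auto simp: ed_def)
  also have "\<dots> = 1" unfolding sum_below[OF degree_fb] using Fd(1) by (simp add: fb_y)
  finally show ?thesis .
qed

text \<open>The linear functional on polynomials modulo \<open>F\<close> whose value at
  \<open>T ^ j\<close> is \<open>q j\<close>.\<close>

definition lb :: "(nat \<Rightarrow> 'e) \<Rightarrow> 'e poly \<Rightarrow> 'e" where
  "lb q V = (\<Sum>j<degree F. coeff (V mod F) j * q j)"

lemma lb_add: "lb q (V + W) = lb q V + lb q W"
  by (simp add: lb_def poly_mod_add_left sum.distrib algebra_simps)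

lemma lb_smult: "lb q (smult c V) = c * lb q V"
  by (simp add: lb_def mod_smult_left sum_distrib_left mult.assoc)

lemma lb_sum: "lb q (sum V A) = (\<Sum>i\<in>A. lb q (V i))"
proof (induction A rule: infinite_finite_induct)
  case (insert a A)
  then show ?case by (simp add: lb_add)
qed (simp_all add: lb_def)

text \<open>Multiplication by \<open>y\<close> on the dual basis \<open>ed\<close> is the transpose of multiplication by \<open>y\<close> on the
  powers of \<open>y\<close>, because \<open>(T - y) fb = F\<close>.\<close>

lemma lb_fb: "lb q (fb * V) = poly V y * lb q fb"
proof -
  have "V = [:- y, 1:] * synthetic_div V y + [:poly V y:]" by (rule synthetic_div_correct'[symmetric])
  moreover have "fb * (C * D + E) = (C * fb) * D + E * fb" for C D E :: "'e poly"
    by (simp add: algebra_simps)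
  ultimately have "fb * V = ([:- y, 1:] * fb) * synthetic_div V y + [:poly V y:] * fb" by metis
  then have "fb * V = F * synthetic_div V y + smult (poly V y) fb"
    by (simp only: fb_eq[symmetric]) simp
  moreover have "lb q (F * U) = 0" for U by (simp add: lb_def)
  ultimately show ?thesis by (simp add: lb_add lb_smult)
qed

text \<open>Because \<open>q j\<close> is congruent to \<open>y ^ j * t\<close>, the functional
  \<open>lb q\<close> maps polynomials that represent elements of \<open>P\<close> into
  \<open>P\<close>. Its values are in \<open>B\<close> up to powers of \<open>s\<close>, so they are
  multiples of \<open>p\<close>, and \<open>lb_fb\<close> expands \<open>w * H\<close> into such
  values. Geometrically, \<open>H / p\<close> agrees with \<open>t / p\<close> along
  \<open>P\<close> up to a regular function there, and has no pole along the other components of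
  \<open>p = 0\<close>.\<close>

lemma dual_combination:
  assumes P: "prime_of L P" and pB: "\<And>b. b \<in> P \<Longrightarrow> b \<in> B \<Longrightarrow> b \<in> (*) p ` B" and t: "t \<in> L"
    and q: "\<And>j. q j \<in> B" "\<And>j. q j - y ^ j * t \<in> P"
  defines "H \<equiv> \<Sum>j<degree F. ed j * q j"
  shows "H \<in> L" and "H - t \<in> P" and "\<And>w. w \<in> P \<Longrightarrow> \<exists>c\<in>L. w * H = p * c"
proof -
  have Id: "ideal_of L P" using P by (rule prime_of_ideal)
  show "H \<in> L"
    unfolding H_def using q(1) L by (intro subring_sum subring_mult ed_L) auto
  have "H - t = H - (\<Sum>j<degree F. ed j * y ^ j) * t" by (simp add: sum_ed)
  also have "\<dots> = (\<Sum>j<degree F. ed j * (q j - y ^ j * t))"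
    by (simp add: H_def sum_distrib_right sum_subtractf right_diff_distrib mult.assoc)
  also have "\<dots> \<in> P" by (intro ideal_of_sum[OF Id] ideal_of_mult[OF Id] ed_L q(2))
  finally show "H - t \<in> P" .
  fix w assume w: "w \<in> P"
  then have wL: "w \<in> L" by (rule ideal_of_subset[OF Id])
  then obtain V where V: "V \<in> poly_over Bs" "degree V < degree F" "w = poly V y" by (rule L_rep_Bs)
  have "\<exists>c\<in>L. lb q (monom 1 j * V) = p * c" for j
  proof -
    define U where "U = (monom 1 j * V) mod F"
    have U: "U \<in> poly_over Bs"
      unfolding U_def using V(1) subring_1[OF subring_Bs]
      by (intro mod_F_over poly_over_mult subring_Bs poly_over_monom)
    have dU: "degree U < degree F" unfolding U_def using Fe by (metis degree_mod_less' F0 degree_0)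
    have "monom 1 j * V = F * (monom 1 j * V div F) + U" by (simp add: U_def)
    then have "poly (monom 1 j * V) y = poly (F * (monom 1 j * V div F) + U) y" by simp
    then have Uy: "poly U y = y ^ j * w" by (simp add: poly_monom V(3) F(2))
    define z where "z = lb q (monom 1 j * V)"
    have z: "z = (\<Sum>i<degree F. coeff U i * q i)" by (simp add: z_def lb_def U_def)
    also have "\<dots> = (\<Sum>i<degree F. coeff U i * (q i - y ^ i * t)) + t * (\<Sum>i<degree F. coeff U i * y ^ i)"
      by (simp add: sum_distrib_left right_diff_distrib sum_subtractf mult_ac)
    also have "\<dots> = (\<Sum>i<degree F. coeff U i * (q i - y ^ i * t)) + t * (y ^ j * w)"
      by (simp add: sum_below[OF dU] Uy)
    also have "\<dots> \<in> P"
    proof (intro ideal_of_add[OF Id] ideal_of_sum[OF Id])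
      show "coeff U i * (q i - y ^ i * t) \<in> P" for i
        using U Bs_L by (intro ideal_of_mult[OF Id] q(2)) (auto simp: poly_over_def)
      have "(t * y ^ j) * w \<in> P"
        using t L by (intro ideal_of_mult[OF Id] w subring_mult subring_power)
      then show "t * (y ^ j * w) \<in> P" by (simp add: mult.assoc)
    qed
    finally have zP: "z \<in> P" .
    have "z \<in> Bs"
      unfolding z using U q(1) B_Bs by (intro subring_sum subring_mult subring_Bs) (auto simp: poly_over_def)
    then obtain i where i: "s ^ i * z \<in> B" by (auto simp: Bs_def)
    moreover have "s ^ i * z \<in> P" using zP s_pow_L by (intro ideal_of_mult[OF Id]) auto
    ultimately obtain c where c: "c \<in> B" "s ^ i * z = p * c" using pB by blast
    have "z = inverse (s ^ i) * (s ^ i * z)" using s by (simp add: mult.assoc[symmetric])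
    also have "\<dots> = p * (inverse (s ^ i) * c)" by (simp add: c(2))
    finally have "z = p * (inverse (s ^ i) * c)" .
    moreover have "inverse (s ^ i) * c \<in> L" using c(1) L s_pow_L subring_mult[OF L(1)] by blast
    ultimately show ?thesis unfolding z_def by blast
  qed
  then obtain c where c: "\<And>j. c j \<in> L" "\<And>j. lb q (monom 1 j * V) = p * c j" by metis
  have "fb = (\<Sum>j<degree F. monom (coeff fb j) j)"
    using poly_as_sum_of_monoms'[of fb "degree F - 1"] degree_fb Fe
    by (simp add: lessThan_Suc_atMost[symmetric])
  then have "fb * V = (\<Sum>j<degree F. monom (coeff fb j) j * V)" by (metis sum_distrib_right)
  also have "\<dots> = (\<Sum>j<degree F. smult (coeff fb j) (monom 1 j * V))"
    by (intro sum.cong refl) (simp add: smult_monom flip: mult_smult_left)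
  finally have "lb q (fb * V) = (\<Sum>j<degree F. coeff fb j * (p * c j))"
    by (simp add: lb_sum lb_smult c(2))
  moreover have "lb q fb = (\<Sum>j<degree F. coeff fb j * q j)"
    using degree_fb by (simp add: lb_def mod_poly_less)
  then have "H = inverse (poly (pderiv F) y) * lb q fb"
    by (simp add: H_def ed_def sum_distrib_left mult_ac)
  ultimately have "w * H = inverse (poly (pderiv F) y) * (\<Sum>j<degree F. coeff fb j * (p * c j))"
    by (metis V(3) lb_fb mult.left_commute)
  also have "\<dots> = p * (\<Sum>j<degree F. ed j * c j)"
    by (simp add: ed_def sum_distrib_left mult_ac)
  finally show "\<exists>c\<in>L. w * H = p * c"
    using c(1) ed_L L(1) by (intro bexI[of _ "\<Sum>j<degree F. ed j * c j"]) (auto intro!: subring_sum subring_mult)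
qed

text \<open>Uniqueness of representations turns the hypotheses into an identity between
  coefficients, \<open>c * V = s ^ i * p ^ 2 * U\<close> with \<open>c\<close> outside
  \<open>P\<close>. Hence \<open>p\<close> can be cancelled from \<open>V\<close> twice, and each
  cancellation lowers the degree bound by \<open>n\<close>. A function with a double pole at most
  along \<open>p = 0\<close>, and regular at \<open>P\<close>, thus gets a bound free of
  \<open>n\<close>.\<close>

lemma clear_denominators:
  assumes P: "prime_of L P" and pB: "\<And>b. b \<in> P \<Longrightarrow> b \<in> B \<Longrightarrow> b \<in> (*) p ` B"
    and p: "p \<in> B" "p \<noteq> 0" "p \<notin> dl n" and pP: "p \<in> P"
    and u: "u \<in> B" "u \<notin> P" "u * z \<in> L"
    and V: "\<And>j. coeff V j \<in> dl (2 * n + N)" "degree V < degree F" "s ^ i * (p ^ 2 * z) = poly V y"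
  shows "\<exists>W. (\<forall>j. coeff W j \<in> dl N) \<and> degree W < degree F \<and> s ^ i * z = poly W y"
proof -
  have Id: "ideal_of L P" using P by (rule prime_of_ideal)
  obtain l U where U: "U \<in> poly_over B" "degree U < degree F" "s ^ l * (u * z) = poly U y"
    using L_rep[OF u(3)] by blast
  have VB: "V \<in> poly_over B" using V(1) by (auto simp: poly_over_def intro: deg_lt_pring)
  define c where "c = s ^ l * u"
  have cB: "c \<in> B" unfolding c_def by (intro subring_mult Br s_pow_B u)
  have sP: "s ^ l \<notin> P"
  proof
    assume "s ^ l \<in> P"
    then have "inverse (s ^ l) * s ^ l \<in> P" using s_pow_L by (intro ideal_of_mult[OF Id])
    then show False using s prime_of_1[OF P] by simp
  qed
  have cP: "c \<notin> P"
    unfolding c_def using prime_of_mult[OF P s_pow_L(1), of u l] u L sP by blast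
  have "poly (smult c V) y = s ^ i * p ^ 2 * poly U y"
    unfolding U(3)[symmetric] poly_smult V(3)[symmetric] by (simp add: c_def algebra_simps)
  then have "poly (smult c V - smult (s ^ i * p ^ 2) U) y = 0" by simp
  moreover have "smult c V - smult (s ^ i * p ^ 2) U \<in> poly_over B"
    by (intro poly_over_diff poly_over_smult Br cB VB U subring_mult subring_power s_pow_B p)
  moreover have "degree (smult c V - smult (s ^ i * p ^ 2) U) < degree F"
    using V(2) U(2) degree_smult_le[of c V] degree_smult_le[of "s ^ i * p ^ 2" U] by (intro degree_diff_less) linarith+
  ultimately have eq: "smult c V = smult (s ^ i * p ^ 2) U" using V_uniq by fastforce
  have div: "\<exists>b'\<in>B. b = p * b'" if "b \<in> B" "c * b = p * b''" "b'' \<in> B" for b b''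
  proof -
    have "p * b'' \<in> P" using that L pP by (intro ideal_of_mult2[OF Id]) auto
    then have "b \<in> P" using prime_of_mult[OF P, of c b] cB cP that L by auto
    then show ?thesis using pB that by blast
  qed
  have quot: "\<exists>w\<in>B. coeff V j = p ^ 2 * w" for j
  proof -
    have e: "c * coeff V j = p * (p * (s ^ i * coeff U j))"
      using arg_cong[OF eq, of "\<lambda>f. coeff f j"] by (simp add: power2_eq_square mult_ac)
    have UB: "s ^ i * coeff U j \<in> B" using U by (intro subring_mult Br s_pow_B) (auto simp: poly_over_def)
    obtain b where b: "b \<in> B" "coeff V j = p * b"
      using div[OF _ e] VB UB subring_mult[OF Br p(1)] by (auto simp: poly_over_def)
    have "p * (c * b) = p * (p * (s ^ i * coeff U j))" using e b by (simp add: mult_ac)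
    then have "c * b = p * (s ^ i * coeff U j)" using p(2) by simp
    then obtain b' where "b' \<in> B" "b = p * b'" using div[OF b(1) _ UB] by blast
    then show ?thesis using b by (auto simp: power2_eq_square mult.assoc)
  qed
  define W where "W = smult (inverse (p ^ 2)) V"
  have "coeff W j \<in> dl N" for j
  proof -
    obtain w where w: "w \<in> B" "coeff V j = p ^ 2 * w" using quot by blast
    have "p * (p * w) \<in> dl (n + (n + N))"
      using V(1)[of j] w(2) by (simp add: power2_eq_square mult.assoc mult_2 add.assoc)
    then have "p * w \<in> dl (n + N)"
      by (rule deg_lt_cancel[OF kr I p(1,3) subring_mult[OF Br p(1) w(1)]])
    then have "w \<in> dl N" by (rule deg_lt_cancel[OF kr I p(1,3) w(1)])
    moreover have "coeff W j = w" using w(2) p(2) by (simp add: W_def)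
    ultimately show ?thesis by simp
  qed
  moreover have "degree W < degree F" using V(2) by (simp add: W_def)
  moreover have "s ^ i * z = poly W y"
    using p(2) by (simp add: W_def V(3)[symmetric])
  ultimately show ?thesis by blast
qed

end

lemma subring_prod: "subring S \<Longrightarrow> (\<And>i. i \<in> A \<Longrightarrow> f i \<in> S) \<Longrightarrow> prod f A \<in> S"
  by (induction A rule: infinite_finite_induct) (auto simp: subring_1 subring_mult)

section \<open>Bounded pieces of the coordinate ring and Lie derivatives of logarithmic
  forms\<close>

context core
begin

text \<open>These sets exhaust \<open>L\<close> by \<open>L_bd\<close> and lie in finite-dimensional
  spaces over \<open>k\<close> by \<open>bd_finite_span\<close>; they measure the size of a Lie
  derivative.\<close>

definition bd :: "nat \<Rightarrow> nat \<Rightarrow> 'e set" where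
  "bd i d = {x. \<exists>V. (\<forall>j. coeff V j \<in> dl d) \<and> degree V < degree F \<and> s ^ i * x = poly V y}"

lemma bd_mono: "x \<in> bd i d \<Longrightarrow> d \<le> d' \<Longrightarrow> x \<in> bd i d'"
  unfolding bd_def by (blast intro: deg_lt_mono)

lemma bd_0: "0 \<in> bd i d"
  unfolding bd_def using Fe by (auto intro!: exI[of _ 0] deg_lt_zero)

lemma bd_add:
  assumes "x \<in> bd i d" "z \<in> bd i d"
  shows "x + z \<in> bd i d"
proof -
  from assms obtain V W where
    "\<And>j. coeff V j \<in> dl d" "degree V < degree F" "s ^ i * x = poly V y"
    "\<And>j. coeff W j \<in> dl d" "degree W < degree F" "s ^ i * z = poly W y"
    by (auto simp: bd_def)
  then show ?thesis
    unfolding bd_def by (auto intro!: exI[of _ "V + W"] deg_lt_add degree_add_less simp: distrib_left)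
qed

lemma bd_sum: "(\<And>t. t \<in> A \<Longrightarrow> f t \<in> bd i d) \<Longrightarrow> sum f A \<in> bd i d"
  by (induction A rule: infinite_finite_induct) (auto intro: bd_0 bd_add)

lemma bd_scale:
  assumes b: "b \<in> dl m" and "x \<in> bd i d"
  shows "b * x \<in> bd i (m + d)"
proof -
  from assms(2) obtain V where
    V: "\<And>j. coeff V j \<in> dl d" "degree V < degree F" "s ^ i * x = poly V y"
    by (auto simp: bd_def)
  have "coeff (smult b V) j \<in> dl (m + d)" for j
    using deg_lt_mono[OF deg_lt_mult[OF kr b V(1)]] by simp
  moreover have "degree (smult b V) < degree F" using V(2) degree_smult_le[of b V] by linarith
  moreover have "s ^ i * (b * x) = poly (smult b V) y" by (simp add: V(3)[symmetric] mult.left_commute)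
  ultimately show ?thesis unfolding bd_def by blast
qed

lemma bd_uminus:
  assumes "x \<in> bd i d"
  shows "- x \<in> bd i d"
proof -
  from assms obtain V where
    V: "\<And>j. coeff V j \<in> dl d" "degree V < degree F" "s ^ i * x = poly V y"
    by (auto simp: bd_def)
  then show ?thesis
    unfolding bd_def by (auto intro!: exI[of _ "- V"] deg_lt_uminus[OF kr])
qed

lemma bd_diff: "x \<in> bd i d \<Longrightarrow> z \<in> bd i d \<Longrightarrow> x - z \<in> bd i d"
  using bd_add[of x i d "- z"] bd_uminus[of z i d] by simp

lemma bd_shift:
  assumes "x \<in> bd i d"
  shows "\<exists>d'. x \<in> bd (i + l) d'"
proof -
  from assms obtain V where
    V: "\<And>j. coeff V j \<in> dl d" "degree V < degree F" "s ^ i * x = poly V y"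
    by (auto simp: bd_def)
  obtain m where m: "s ^ l \<in> dl m" using s_pow_B by (auto simp: pring_def)
  have "coeff (smult (s ^ l) V) j \<in> dl (m + d - 1)" for j
    using deg_lt_mult[OF kr m V(1)] by simp
  moreover have "degree (smult (s ^ l) V) < degree F" using V(2) degree_smult_le[of "s ^ l" V] by linarith
  moreover have "s ^ (i + l) * x = poly (smult (s ^ l) V) y"
    by (simp add: V(3)[symmetric] power_add mult_ac)
  ultimately show ?thesis unfolding bd_def by blast
qed

lemma L_bd:
  assumes "x \<in> L"
  shows "\<exists>i d. x \<in> bd i d"
proof -
  obtain i V where V: "V \<in> poly_over B" "degree V < degree F" "s ^ i * x = poly V y"
    using L_rep[OF assms] by blast
  have "\<forall>j. \<exists>d. coeff V j \<in> dl d" using V(1) by (auto simp: poly_over_def pring_def)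
  then obtain d where d: "\<And>j. coeff V j \<in> dl (d j)" by metis
  have "coeff V j \<in> dl (\<Sum>j\<le>degree V. d j)" for j
  proof (cases "j \<le> degree V")
    case True
    then have "d j \<le> (\<Sum>j\<le>degree V. d j)" by (intro member_le_sum) auto
    then show ?thesis using deg_lt_mono[OF d] by blast
  next
    case False
    then show ?thesis by (simp add: coeff_eq_0 deg_lt_zero)
  qed
  then show ?thesis using V unfolding bd_def by blast
qed

lemma finite_bd:
  assumes "finite A" "A \<subseteq> L"
  shows "\<exists>i d. A \<subseteq> bd i d"
  using assms
proof (induction A rule: finite_induct)
  case (insert x A)
  then obtain i d where id: "A \<subseteq> bd i d" by auto
  obtain i' d' where x: "x \<in> bd i' d'" using insert.prems L_bd by blast
  have "\<exists>D. \<forall>z\<in>A. z \<in> bd (i + i') D"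
    using insert.hyps(1) id
  proof (induction A rule: finite_induct)
    case (insert z A)
    then obtain D where "\<forall>z\<in>A. z \<in> bd (i + i') D" by auto
    moreover obtain D' where "z \<in> bd (i + i') D'" using insert.prems bd_shift by blast
    ultimately have "\<forall>w\<in>insert z A. w \<in> bd (i + i') (max D D')"
      by (auto intro: bd_mono)
    then show ?case by blast
  qed auto
  then obtain D where "\<forall>z\<in>A. z \<in> bd (i + i') D" by blast
  moreover obtain D' where "x \<in> bd (i + i') D'" using bd_shift[OF x, of i] by (auto simp: add.commute)
  ultimately have "insert x A \<subseteq> bd (i + i') (max D D')" by (auto intro: bd_mono)
  then show ?case by blast
qed auto

lemma pd_dl: "a \<in> I \<Longrightarrow> b \<in> dl n \<Longrightarrow> pd a b \<in> dl (n - 1)"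
  by (intro derivation_deg_lt_lower[OF kr pd(1)]) (auto simp: pd subring_0[OF kr] subring_1[OF kr])

lemma pd_B: "a \<in> I \<Longrightarrow> b \<in> B \<Longrightarrow> pd a b \<in> B"
  using pd_dl by (auto simp: pring_def)

lemma chain_rule:
  assumes \<delta>: "derivation \<delta>" "\<And>c. c \<in> k \<Longrightarrow> \<delta> c = 0" and b: "b \<in> B"
  shows "\<delta> b = (\<Sum>a\<in>I. pd a b * \<delta> (X a))"
proof -
  obtain n where "b \<in> dl n" using b by (auto simp: pring_def)
  then show ?thesis
  proof (induction rule: deg_lt_induct)
    case (zero n)
    then show ?case using \<delta> pd by (simp add: derivation_0)
  next
    case (const c n)
    then show ?case using \<delta> pd by simp
  next
    case (var i b n)
    have "(\<Sum>a\<in>I. pd a (X i * b) * \<delta> (X a)) =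
      (\<Sum>a\<in>I. (if a = i then b * \<delta> (X i) else 0) + X i * (pd a b * \<delta> (X a)))"
      using var(1) pd by (intro sum.cong) (auto simp: derivation_mult algebra_simps)
    also have "\<dots> = b * \<delta> (X i) + X i * \<delta> b"
      using var I by (simp add: sum.distrib sum_distrib_left)
    finally show ?case using \<delta> by (simp add: derivation_mult algebra_simps)
  next
    case (add a n b)
    have "(\<Sum>c\<in>I. pd c (a + b) * \<delta> (X c)) = (\<Sum>c\<in>I. pd c a * \<delta> (X c) + pd c b * \<delta> (X c))"
      using pd by (intro sum.cong) (auto simp: derivation_add algebra_simps)
    then show ?case using add \<delta> by (simp add: derivation_add sum.distrib)
  qed
qed

lemma pd_commute:
  assumes ab: "a \<in> I" "b \<in> I" and x: "x \<in> B"
  shows "pd a (pd b x) = pd b (pd a x)"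
proof -
  have d: "derivation (pd a)" "derivation (pd b)" using pd ab by auto
  have k01: "pd a (if P then 1 else 0) = 0" "pd b (if P then 1 else 0) = 0" for P
    using d by (auto simp: derivation_0 derivation_1)
  obtain n where "x \<in> dl n" using x by (auto simp: pring_def)
  then show ?thesis
  proof (induction rule: deg_lt_induct)
    case (var i x n)
    then show ?case
      using d k01 ab pd(3) by (simp add: derivation_mult derivation_add algebra_simps)
  qed (use d pd ab in \<open>auto simp: derivation_0 derivation_add\<close>)
qed

text \<open>The choices behind a logarithmic form are recorded explicitly, because the bounds have
  to hold uniformly for all primes and all such choices. The number \<open>n\<close> is the exact
  degree of \<open>p\<close>.\<close>

definition form_data :: "'e set \<Rightarrow> 'e \<Rightarrow> nat \<Rightarrow> (nat \<Rightarrow> nat \<Rightarrow> 'e) \<Rightarrow> bool" where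
  "form_data P p n q \<longleftrightarrow> p \<in> P \<and> p \<in> B \<and> p \<noteq> 0 \<and> (\<forall>b\<in>P. b \<in> B \<longrightarrow> b \<in> (*) p ` B) \<and>
     p \<in> dl (Suc n) \<and> p \<notin> dl n \<and>
     (\<forall>a\<in>I. \<forall>j. q a j \<in> dl (n + j) \<and> q a j - y ^ j * pd a p \<in> P)"

text \<open>The coefficients of \<open>dX a\<close> in a differential form with logarithmic pole along \<open>P\<close>, residue \<open>1\<close>
  and no other poles on \<open>Spec L\<close>: it is \<open>dp / p\<close> up to regular forms near \<open>P\<close>, and regular along
  the remaining components of \<open>p = 0\<close>.\<close>

definition log_form :: "'e \<Rightarrow> (nat \<Rightarrow> nat \<Rightarrow> 'e) \<Rightarrow> nat \<Rightarrow> 'e" where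
  "log_form p q a = (\<Sum>j<degree F. ed j * q a j) / p"

text \<open>The Lie derivative along \<open>\<delta>\<close> of the form \<open>\<Sum>a. w a * dX a\<close>.\<close>

definition lie :: "('e \<Rightarrow> 'e) \<Rightarrow> (nat \<Rightarrow> 'e) \<Rightarrow> nat \<Rightarrow> 'e" where
  "lie \<delta> w b = \<delta> (w b) + (\<Sum>a\<in>I. w a * pd b (\<delta> (X a)))"

lemma good_form_data:
  assumes "good P"
  shows "\<exists>p n q. form_data P p n q"
proof -
  from good_generator[OF assms] obtain p n where pn: "p \<in> P" "p \<in> B" "p \<noteq> 0"
    "\<And>b. b \<in> P \<Longrightarrow> b \<in> B \<Longrightarrow> b \<in> (*) p ` B" "p \<in> dl (Suc n)" "p \<notin> dl n" by metis
  have "\<forall>a\<in>I. \<forall>j. \<exists>q. q \<in> dl (n + j) \<and> q - y ^ j * pd a p \<in> P"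
    using good_lift[OF assms pn] by blast
  then obtain q where "\<forall>a\<in>I. \<forall>j. q a j \<in> dl (n + j) \<and> q a j - y ^ j * pd a p \<in> P" by metis
  then show ?thesis using pn unfolding form_data_def by blast
qed

context
  fixes P p n q
  assumes P: "good P" and fd: "form_data P p n q"
begin

lemma fdp: "p \<in> P" "p \<in> B" "p \<noteq> 0" "\<And>b. b \<in> P \<Longrightarrow> b \<in> B \<Longrightarrow> b \<in> (*) p ` B" "p \<in> dl (Suc n)" "p \<notin> dl n"
  and fdq: "\<And>a j. a \<in> I \<Longrightarrow> q a j \<in> dl (n + j)" "\<And>a j. a \<in> I \<Longrightarrow> q a j - y ^ j * pd a p \<in> P"
  using fd unfolding form_data_def by blast+

lemma Pp: "prime_of L P"
  using P by (simp add: good_def)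

lemma Id: "ideal_of L P"
  using Pp by (rule prime_of_ideal)

definition H where "H a = (\<Sum>j<degree F. ed j * q a j)"

lemma log_form_H: "log_form p q a = H a / p"
  by (simp add: log_form_def H_def)

lemma pd_p_L: "a \<in> I \<Longrightarrow> pd a p \<in> L"
  using pd_B fdp L by blast

lemma
  assumes "a \<in> I"
  shows H_L: "H a \<in> L" and H_P: "H a - pd a p \<in> P" and H_mult: "\<And>w. w \<in> P \<Longrightarrow> \<exists>c\<in>L. w * H a = p * c"
proof -
  have qB: "\<And>j. q a j \<in> B" using fdq(1)[OF assms] by (auto simp: pring_def)
  note D = dual_combination[OF Pp fdp(4) pd_p_L[OF assms] qB fdq(2)[OF assms]]
  show "H a \<in> L" "H a - pd a p \<in> P" unfolding H_def by (rule D(1), assumption+, rule D(2), assumption+)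
  show "\<exists>c\<in>L. w * H a = p * c" if "w \<in> P" for w unfolding H_def by (rule D(3)[OF _ _ that])
qed

text \<open>Some partial derivative has degree exactly \<open>n - 1\<close> by
  \<open>top_derivative\<close>; if it were in \<open>P\<close>, it would be a multiple of
  \<open>p\<close> of smaller degree than \<open>p\<close>, hence zero. So the form has a genuine
  pole along \<open>P\<close>.\<close>

lemma exists_pd_notin: "\<exists>c\<in>I. pd c p \<notin> P"
proof -
  have "0 < n"
  proof (rule ccontr)
    assume "\<not> 0 < n"
    then have "p \<in> k" using fdp(5) deg_lt_Suc_0[OF kr] by simp
    then obtain v where "v \<in> k" "p * v = 1" using k fdp(3) by (auto simp: subfield_def)
    moreover from this have "v \<in> L" using const_pring[OF kr] L by blast
    ultimately have "1 \<in> P" using ideal_of_mult2[OF Id _ fdp(1)] by metis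
    then show False using prime_of_1[OF Pp] by simp
  qed
  then obtain c where c: "c \<in> I" "pd c p \<notin> dl (n - 1)"
    using top_derivative[OF k char I pd(1-3) fdp(5,6)] by blast
  have "pd c p \<notin> P"
  proof
    assume "pd c p \<in> P"
    then obtain b where b: "b \<in> B" "pd c p = p * b" using fdp(4) pd_B[OF c(1) fdp(2)] by blast
    have "p * b \<in> dl (n + 0)" using pd_dl[OF c(1) fdp(5)] b by simp
    then have "b \<in> dl 0" by (rule deg_lt_cancel[OF kr I fdp(2,6) b(1)])
    then show False using b c(2) by (simp add: deg_lt_0 deg_lt_zero)
  qed
  then show ?thesis using c by blast
qed

context
  fixes \<delta> :: "'e \<Rightarrow> 'e"
  assumes \<delta>: "derivation \<delta>" "\<And>c. c \<in> k \<Longrightarrow> \<delta> c = 0" "\<delta> ` L \<subseteq> L" and \<delta>P: "\<delta> ` P \<subseteq> P"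
begin

lemma \<xi>_L: "a \<in> I \<Longrightarrow> \<delta> (X a) \<in> L"
  using \<delta>(3) L var_pring[OF kr, of a I X] by blast

lemma \<delta>_L: "x \<in> L \<Longrightarrow> \<delta> x \<in> L"
  using \<delta>(3) by blast

text \<open>In coordinates: the Lie derivative of \<open>dp / p\<close> along
  \<open>\<delta>\<close> is the differential of \<open>\<delta> p / p\<close>. It rests on
  \<open>chain_rule\<close> and on the commutation of partial derivatives.\<close>

lemma lie_dlog:
  assumes b: "b \<in> I"
  shows "\<delta> (pd b p / p) + (\<Sum>a\<in>I. pd a p / p * pd b (\<delta> (X a))) = pd b (\<delta> p / p)"
proof -
  have db: "derivation (pd b)" using pd b by blast
  have "pd b (\<delta> p) = (\<Sum>a\<in>I. pd b (pd a p) * \<delta> (X a) + pd a p * pd b (\<delta> (X a)))"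
    using db by (simp add: chain_rule[OF \<delta>(1,2) fdp(2)] derivation_sum derivation_mult)
  also have "\<dots> = (\<Sum>a\<in>I. pd a (pd b p) * \<delta> (X a)) + (\<Sum>a\<in>I. pd a p * pd b (\<delta> (X a)))"
    using pd_commute[OF b _ fdp(2)] by (simp add: sum.distrib)
  also have "(\<Sum>a\<in>I. pd a (pd b p) * \<delta> (X a)) = \<delta> (pd b p)"
    using chain_rule[OF \<delta>(1,2) pd_B[OF b fdp(2)]] by simp
  finally have e: "pd b (\<delta> p) = \<delta> (pd b p) + (\<Sum>a\<in>I. pd a p * pd b (\<delta> (X a)))" .
  have "(\<Sum>a\<in>I. pd a p / p * pd b (\<delta> (X a))) = (\<Sum>a\<in>I. pd a p * pd b (\<delta> (X a))) / p"
    by (simp add: sum_divide_distrib)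
  then show ?thesis
    using fdp(3) e by (simp add: derivation_divide[OF \<delta>(1)] derivation_divide[OF db] field_simps)
qed

text \<open>Write \<open>pd c p = u + v\<close> with \<open>u = H c\<close> and
  \<open>v \<in> P\<close>. Where \<open>u\<close> is inverted, \<open>p\<close> generates
  \<open>P\<close>, so \<open>\<delta> p / p\<close> is regular and the form is
  \<open>dp / p\<close> plus a regular form; its Lie derivative is then regular by
  \<open>lie_dlog\<close>. Where \<open>v\<close> is inverted, the form itself is regular.
  Differentiating a quotient once costs the square of its denominator.\<close>

lemma cube_lie_L:
  assumes b: "b \<in> I" and c: "c \<in> I"
  shows "pd c p ^ 3 * lie \<delta> (log_form p q) b \<in> L"
proof -
  define u where "u = H c"
  define v where "v = pd c p - H c"
  define l where "l = lie \<delta> (log_form p q) b"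
  have l: "l = \<delta> (H b / p) + (\<Sum>a\<in>I. H a / p * pd b (\<delta> (X a)))"
    by (simp add: l_def lie_def log_form_H)
  have db: "derivation (pd b)" using pd b by blast
  have uL: "u \<in> L" using H_L c by (simp add: u_def)
  have vP: "v \<in> P" using ideal_of_uminus[OF Id L(1) H_P[OF c]] by (simp add: v_def)
  have vL: "v \<in> L" using ideal_of_subset[OF Id vP] .
  note ops = subring_add[OF L(1)] subring_mult[OF L(1)] subring_diff[OF L(1)] subring_sum[OF L(1)]
  have um: "\<exists>x\<in>L. u * w = p * x" if "w \<in> P" for w
    using H_mult[OF c that] by (simp add: u_def mult.commute)
  have U: "u ^ 2 * l \<in> L"
  proof (cases "u = 0")
    case True
    then show ?thesis using subring_0[OF L(1)] by simp
  next
    case u0: False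
    have "\<forall>a\<in>I. \<exists>t\<in>L. u * (H a - pd a p) = p * t" using um H_P by blast
    then obtain t where t: "\<And>a. a \<in> I \<Longrightarrow> t a \<in> L" "\<And>a. a \<in> I \<Longrightarrow> u * (H a - pd a p) = p * t a" by metis
    obtain \<sigma> where \<sigma>: "\<sigma> \<in> L" "u * \<delta> p = p * \<sigma>" using um[of "\<delta> p"] \<delta>P fdp(1) by blast
    have Hp: "H a / p = pd a p / p + t a / u" if "a \<in> I" for a
      using t(2)[OF that] fdp(3) u0 by (simp add: field_simps)
    have sp: "\<delta> p / p = \<sigma> / u" using \<sigma>(2) fdp(3) u0 by (simp add: field_simps)
    have "l = (\<delta> (pd b p / p) + (\<Sum>a\<in>I. pd a p / p * pd b (\<delta> (X a)))) +
        (\<delta> (t b / u) + (\<Sum>a\<in>I. t a / u * pd b (\<delta> (X a))))"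
      using Hp b \<delta>(1) by (simp add: l derivation_add sum.distrib algebra_simps)
    also have "\<dots> = pd b (\<sigma> / u) + \<delta> (t b / u) + (\<Sum>a\<in>I. t a * pd b (\<delta> (X a))) / u"
      unfolding lie_dlog[OF b] sp by (simp add: sum_divide_distrib)
    also have "u ^ 2 * \<dots> = (pd b \<sigma> * u - \<sigma> * pd b u) + (\<delta> (t b) * u - t b * \<delta> u) +
        u * (\<Sum>a\<in>I. t a * pd b (\<delta> (X a)))"
      using u0 by (simp add: derivation_divide[OF \<delta>(1) u0] derivation_divide[OF db u0] power2_eq_square field_simps)
    also have "\<dots> \<in> L"
      by (intro ops pd(4) b \<sigma> uL \<delta>_L t \<xi>_L) auto
    finally show ?thesis .
  qed
  have V: "v ^ 2 * l \<in> L"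
  proof (cases "v = 0")
    case True
    then show ?thesis using subring_0[OF L(1)] by simp
  next
    case v0: False
    have "\<forall>a\<in>I. \<exists>t\<in>L. v * H a = p * t" using H_mult vP by blast
    then obtain t where t: "\<And>a. a \<in> I \<Longrightarrow> t a \<in> L" "\<And>a. a \<in> I \<Longrightarrow> v * H a = p * t a" by metis
    have Hp: "H a / p = t a / v" if "a \<in> I" for a
      using t(2)[OF that] fdp(3) v0 by (simp add: field_simps)
    have "l = \<delta> (t b / v) + (\<Sum>a\<in>I. t a * pd b (\<delta> (X a))) / v"
      using Hp b by (simp add: l sum_divide_distrib)
    also have "v ^ 2 * \<dots> = (\<delta> (t b) * v - t b * \<delta> v) + v * (\<Sum>a\<in>I. t a * pd b (\<delta> (X a)))"
      using v0 by (simp add: derivation_divide[OF \<delta>(1) v0] power2_eq_square field_simps)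
    also have "\<dots> \<in> L"
      by (intro ops pd(4) b vL \<delta>_L t \<xi>_L) auto
    finally show ?thesis .
  qed
  \<comment> \<open>Every monomial of \<open>(u + v) ^ 3\<close> contains \<open>u ^ 2\<close> or
    \<open>v ^ 2\<close>.\<close>
  have "pd c p ^ 3 * l = (u + 3 * v) * (u ^ 2 * l) + (3 * u + v) * (v ^ 2 * l)"
    by (simp add: u_def v_def power2_eq_square power3_eq_cube algebra_simps)
  also have "\<dots> \<in> L"
    using subring_of_nat[OF L(1), of 3] by (intro ops uL vL U V) auto
  finally show ?thesis by (simp add: l_def)
qed

text \<open>Each summand is arranged as a product of two polynomials, which depend on
  \<open>P\<close> and have known degree, with an element of \<open>L\<close> that does not depend
  on \<open>P\<close>.\<close>

lemma square_lie:
  assumes b: "b \<in> I"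
  shows "p ^ 2 * lie \<delta> (log_form p q) b =
    (\<Sum>j<degree F. (q b j * p) * \<delta> (ed j)) +
    (\<Sum>j<degree F. \<Sum>a\<in>I. (pd a (q b j) * p) * (ed j * \<delta> (X a))) -
    (\<Sum>j<degree F. \<Sum>a\<in>I. (q b j * pd a p) * (ed j * \<delta> (X a))) +
    (\<Sum>a\<in>I. \<Sum>j<degree F. (q a j * p) * (ed j * pd b (\<delta> (X a))))"
proof -
  have qB: "q b j \<in> B" for j using fdq(1)[OF b] by (auto simp: pring_def)
  have "p ^ 2 * lie \<delta> (log_form p q) b =
      \<delta> (H b) * p - H b * \<delta> p + p * (\<Sum>a\<in>I. H a * pd b (\<delta> (X a)))"
  proof -
    have "(\<Sum>a\<in>I. H a / p * pd b (\<delta> (X a))) = (\<Sum>a\<in>I. H a * pd b (\<delta> (X a))) / p"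
      by (simp add: sum_divide_distrib)
    then show ?thesis
      using fdp(3) by (simp add: lie_def log_form_H derivation_divide[OF \<delta>(1)] power2_eq_square field_simps)
  qed
  moreover have "\<delta> (H b) * p = (\<Sum>j<degree F. (q b j * p) * \<delta> (ed j)) +
      (\<Sum>j<degree F. \<Sum>a\<in>I. (pd a (q b j) * p) * (ed j * \<delta> (X a)))"
  proof -
    have "\<delta> (H b) * p = (\<Sum>j<degree F. (q b j * p) * \<delta> (ed j) + \<delta> (q b j) * (p * ed j))"
      unfolding H_def derivation_sum[OF \<delta>(1)] derivation_mult[OF \<delta>(1)] sum_distrib_right
      by (intro sum.cong) (auto simp: algebra_simps)
    also have "(\<lambda>j. \<delta> (q b j) * (p * ed j)) = (\<lambda>j. \<Sum>a\<in>I. (pd a (q b j) * p) * (ed j * \<delta> (X a)))"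
    proof
      fix j
      show "\<delta> (q b j) * (p * ed j) = (\<Sum>a\<in>I. (pd a (q b j) * p) * (ed j * \<delta> (X a)))"
        by (subst chain_rule[OF \<delta>(1,2) qB]) (simp_all add: sum_distrib_left sum_distrib_right mult_ac)
    qed
    finally show ?thesis by (simp add: sum.distrib)
  qed
  moreover have "H b * \<delta> p = (\<Sum>j<degree F. \<Sum>a\<in>I. (q b j * pd a p) * (ed j * \<delta> (X a)))"
  proof -
    have "\<delta> p = (\<Sum>a\<in>I. pd a p * \<delta> (X a))" by (rule chain_rule[OF \<delta>(1) _ fdp(2)]) (rule \<delta>(2))
    then show ?thesis
      unfolding H_def by (simp only: sum_product) (intro sum.cong refl; simp add: mult_ac)
  qed
  moreover have "p * (\<Sum>a\<in>I. H a * pd b (\<delta> (X a))) =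
      (\<Sum>a\<in>I. \<Sum>j<degree F. (q a j * p) * (ed j * pd b (\<delta> (X a))))"
    unfolding H_def by (simp add: sum_distrib_left sum_distrib_right mult_ac)
  ultimately show ?thesis by simp
qed

end

end

text \<open>The finite set \<open>A\<close> of all elements of \<open>L\<close> entering
  \<open>square_lie\<close> fixes \<open>i\<close> and \<open>d\<close> once for all primes. The
  numerator over \<open>p ^ 2\<close> then has degree below \<open>2 * n + (degree F + d)\<close>,
  and \<open>clear_denominators\<close> strips the part \<open>2 * n\<close>, the only one that
  varies with \<open>P\<close>.\<close>

lemma lie_bounded:
  assumes \<delta>: "derivation \<delta>" "\<And>c. c \<in> k \<Longrightarrow> \<delta> c = 0" "\<delta> ` L \<subseteq> L"
  shows "\<exists>i N. \<forall>P p n q b. good P \<longrightarrow> form_data P p n q \<longrightarrow> \<delta> ` P \<subseteq> P \<longrightarrow> b \<in> I \<longrightarrow>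
    lie \<delta> (log_form p q) b \<in> bd i N"
proof -
  define A where "A = (\<lambda>j. \<delta> (ed j)) ` {..<degree F} \<union> (\<lambda>(j, a). ed j * \<delta> (X a)) ` ({..<degree F} \<times> I) \<union>
    (\<lambda>(j, a, b). ed j * pd b (\<delta> (X a))) ` ({..<degree F} \<times> I \<times> I)"
  have XL: "a \<in> I \<Longrightarrow> \<delta> (X a) \<in> L" for a using \<delta>(3) L var_pring[OF kr, of a I X] by blast
  have "finite A" using I by (simp add: A_def)
  moreover have "A \<subseteq> L"
    using \<delta>(3) ed_L XL pd(4) subring_mult[OF L(1)] by (auto simp: A_def)
  ultimately obtain i d where id: "A \<subseteq> bd i d" using finite_bd by blast
  have Amem: "\<delta> (ed j) \<in> A" "ed j * \<delta> (X a) \<in> A" "ed j * pd b (\<delta> (X a)) \<in> A"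
    if "j < degree F" "a \<in> I" "b \<in> I" for j a b
  proof -
    show "\<delta> (ed j) \<in> A" using that unfolding A_def by blast
    have "ed j * \<delta> (X a) \<in> (\<lambda>(j, a). ed j * \<delta> (X a)) ` ({..<degree F} \<times> I)"
      using that by (intro image_eqI[of _ _ "(j, a)"]) auto
    then show "ed j * \<delta> (X a) \<in> A" unfolding A_def by blast
    have "ed j * pd b (\<delta> (X a)) \<in> (\<lambda>(j, a, b). ed j * pd b (\<delta> (X a))) ` ({..<degree F} \<times> I \<times> I)"
      using that by (intro image_eqI[of _ _ "(j, a, b)"]) auto
    then show "ed j * pd b (\<delta> (X a)) \<in> A" unfolding A_def by blast
  qed
  have "lie \<delta> (log_form p q) b \<in> bd i (degree F + d)"
    if P: "good P" and fd: "form_data P p n q" and \<delta>P: "\<delta> ` P \<subseteq> P" and b: "b \<in> I" for P p n q b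
  proof -
    note fdp = fdp[OF P fd] and fdq = fdq[OF P fd]
    have q: "q a j \<in> dl (n + degree F)" if "a \<in> I" "j < degree F" for a j
      using deg_lt_mono[OF fdq(1)[OF that(1)], of j "n + degree F" I] that by simp
    have summand: "x * z * w \<in> bd i (2 * n + (degree F + d))"
      if "x \<in> dl (n + degree F)" "z \<in> dl (Suc n)" "w \<in> A" for x z w
    proof -
      have "x * z \<in> dl (n + degree F + Suc n - 1)" by (rule deg_lt_mult[OF kr that(1,2)])
      then have "x * z * w \<in> bd i (n + degree F + Suc n - 1 + d)" using id that by (intro bd_scale) auto
      then show ?thesis by (rule bd_mono) simp
    qed
    have pdp: "pd a p \<in> dl (Suc n)" if "a \<in> I" for a
      using deg_lt_mono[OF pd_dl[OF that fdp(5)]] by simp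
    have pdq: "pd a (q b j) \<in> dl (n + degree F)" if "a \<in> I" "j < degree F" for a j
      using deg_lt_mono[OF pd_dl[OF that(1) q[OF b that(2)]]] by simp
    have "p ^ 2 * lie \<delta> (log_form p q) b \<in> bd i (2 * n + (degree F + d))"
      apply (subst square_lie[OF P fd \<delta>(1) _ \<delta>(3) \<delta>P b], erule \<delta>(2))
      using b by (intro bd_add bd_diff bd_sum summand q pdp pdq fdp(5) Amem) auto
    then obtain V where V: "\<And>j. coeff V j \<in> dl (2 * n + (degree F + d))" "degree V < degree F"
      "s ^ i * (p ^ 2 * lie \<delta> (log_form p q) b) = poly V y"
      by (auto simp: bd_def)
    obtain c where c: "c \<in> I" "pd c p \<notin> P" using exists_pd_notin[OF P fd] by blast
    have "pd c p ^ 3 \<in> B" using pd_B[OF c(1) fdp(2)] by (intro subring_power Br)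
    moreover have "pd c p ^ 3 \<notin> P"
      using prime_of_power[OF Pp[OF P fd] L(1)] pd_B[OF c(1) fdp(2)] L c(2) by blast
    moreover have "pd c p ^ 3 * lie \<delta> (log_form p q) b \<in> L"
      by (rule cube_lie_L[OF P fd \<delta>(1) _ \<delta>(3) \<delta>P b c(1)]) (rule \<delta>(2))
    ultimately show ?thesis
      unfolding bd_def mem_Collect_eq
      by (intro clear_denominators[OF Pp[OF P fd] _ fdp(2,3,6,1) _ _ _ V]) (use fdp(4) in auto)
  qed
  then show ?thesis by blast
qed

text \<open>A residue argument. The product \<open>W\<close> of elements taken from the other
  primes, but outside \<open>P\<close>, clears the poles of all other forms. A nonzero coefficient
  at \<open>P\<close> would make \<open>W * log_form\<close> regular there too and force the
  numerator into \<open>P\<close>, although it is congruent to some \<open>pd a p\<close> outside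
  \<open>P\<close>.\<close>

lemma log_form_independent:
  assumes S: "finite S" "\<And>P. P \<in> S \<Longrightarrow> good P" and dist: "\<And>P Q. P \<in> S \<Longrightarrow> Q \<in> S \<Longrightarrow> P \<subseteq> Q \<Longrightarrow> P = Q"
    and fd: "\<And>P. P \<in> S \<Longrightarrow> form_data P (p P) (n P) (q P)"
    and c: "\<And>P. P \<in> S \<Longrightarrow> c P \<in> k"
    and zero: "\<And>a. a \<in> I \<Longrightarrow> (\<Sum>P\<in>S. c P * log_form (p P) (q P) a) = 0" and P: "P \<in> S"
  shows "c P = 0"
proof (rule ccontr)
  assume cP: "c P \<noteq> 0"
  note gP = S(2)[OF P] and fP = fd[OF P]
  have Pp: "prime_of L Q" if "Q \<in> S" for Q using S(2)[OF that] by (simp add: good_def)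
  have "\<forall>Q\<in>S - {P}. \<exists>w. w \<in> Q \<and> w \<notin> P" using dist P by blast
  then obtain w where w: "\<And>Q. Q \<in> S - {P} \<Longrightarrow> w Q \<in> Q" "\<And>Q. Q \<in> S - {P} \<Longrightarrow> w Q \<notin> P" by metis
  have wL: "w Q \<in> L" if "Q \<in> S - {P}" for Q
    using w(1)[OF that] Pp[of Q] that ideal_of_subset prime_of_ideal by blast
  define W where "W = prod w (S - {P})"
  have W: "W \<in> L" "W \<notin> P"
    using prime_of_prod[OF Pp[OF P] L(1), of "S - {P}" w] S(1) w wL by (auto simp: W_def)
  have WQ: "W \<in> Q" if Q: "Q \<in> S - {P}" for Q
  proof -
    have "W = w Q * prod w (S - {P} - {Q})" unfolding W_def using S(1) Q by (subst prod.remove[of _ Q]) auto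
    moreover have prodL: "prod w (S - {P} - {Q}) \<in> L" using wL by (intro subring_prod L(1)) auto
    moreover have "prime_of L Q" using Pp Q by blast
    ultimately show ?thesis
      using ideal_of_mult2[OF prime_of_ideal prodL w(1)[OF Q]] by metis
  qed
  obtain a where a: "a \<in> I" "pd a (p P) \<notin> P" using exists_pd_notin[OF gP fP] by blast
  have "W * log_form (p Q) (q Q) a \<in> L" if Q: "Q \<in> S - {P}" for Q
  proof -
    have Q': "good Q" "form_data Q (p Q) (n Q) (q Q)" using S fd Q by auto
    obtain x where "x \<in> L" "W * H (q Q) a = p Q * x"
      using H_mult[OF Q' a(1) WQ[OF Q]] by blast
    then show ?thesis using fdp(3)[OF Q'] by (simp add: log_form_H[OF Q'])
  qed
  moreover have "c Q \<in> L" if "Q \<in> S - {P}" for Q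
    using c[of Q] that const_pring[OF kr, of "c Q" X I] L by auto
  ultimately have "c Q * (W * log_form (p Q) (q Q) a) \<in> L" if "Q \<in> S - {P}" for Q
    using subring_mult[OF L(1)] that by blast
  then have "(\<Sum>Q\<in>S - {P}. c Q * (W * log_form (p Q) (q Q) a)) \<in> L"
    by (rule subring_sum[OF L(1)])
  moreover have "c P * (W * log_form (p P) (q P) a) = - (\<Sum>Q\<in>S - {P}. c Q * (W * log_form (p Q) (q Q) a))"
  proof -
    have "0 = W * (\<Sum>P\<in>S. c P * log_form (p P) (q P) a)" using zero[OF a(1)] by simp
    also have "\<dots> = (\<Sum>P\<in>S. c P * (W * log_form (p P) (q P) a))" by (simp add: sum_distrib_left mult_ac)
    also have "\<dots> = c P * (W * log_form (p P) (q P) a) + (\<Sum>Q\<in>S - {P}. c Q * (W * log_form (p Q) (q Q) a))"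
      using S(1) P by (rule sum.remove)
    finally show ?thesis by (simp add: eq_neg_iff_add_eq_0)
  qed
  ultimately have "c P * (W * log_form (p P) (q P) a) \<in> L" using subring_uminus[OF L(1)] by simp
  moreover obtain v where v: "v \<in> k" "c P * v = 1" using c[OF P] cP k by (auto simp: subfield_def)
  moreover have "v \<in> L" using v(1) const_pring[OF kr] L by blast
  ultimately have "v * (c P * (W * log_form (p P) (q P) a)) \<in> L" using subring_mult[OF L(1)] by blast
  moreover have "v * (c P * (W * log_form (p P) (q P) a)) = W * log_form (p P) (q P) a"
    using v(2) by (metis mult.assoc mult.commute mult_1_left)
  ultimately have x: "W * log_form (p P) (q P) a \<in> L" by simp
  have "W * H (q P) a = (W * log_form (p P) (q P) a) * p P"
    using fdp(3)[OF gP fP] by (simp add: log_form_H[OF gP fP])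
  also have "\<dots> \<in> P" using x fdp(1)[OF gP fP] by (intro ideal_of_mult[OF Id[OF gP fP]])
  finally have "H (q P) a \<in> P"
    using prime_of_mult[OF Pp[OF P] W(1) H_L[OF gP fP a(1)]] W(2) by blast
  from ideal_of_diff[OF Id[OF gP fP] L(1) this H_P[OF gP fP a(1)]] show False
    using a(2) by simp
qed

end

section \<open>Constants from infinitely many logarithmic forms\<close>

text \<open>Gaussian elimination by cross-multiplication, so that the solution stays in
  \<open>R\<close>. It serves over \<open>k\<close>, over the whole field, and over rings without
  division.\<close>

lemma linear_system:
  fixes A :: "'q \<Rightarrow> 'u \<Rightarrow> 'r::idom"
  assumes R: "subring R" and "finite Q" "finite U" "card Q < card U"
    and A: "\<And>q u. q \<in> Q \<Longrightarrow> u \<in> U \<Longrightarrow> A q u \<in> R"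
  shows "\<exists>l. (\<forall>u. l u \<in> R) \<and> (\<exists>u\<in>U. l u \<noteq> 0) \<and> (\<forall>q\<in>Q. (\<Sum>u\<in>U. l u * A q u) = 0)"
  using assms(2-)
proof (induction Q arbitrary: U A rule: finite_induct)
  case empty
  then obtain u where "u \<in> U" by fastforce
  then show ?case using R by (intro exI[of _ "\<lambda>_. 1"]) (auto simp: subring_1)
next
  case (insert q Q)
  show ?case
  proof (cases "\<forall>u\<in>U. A q u = 0")
    case True
    have "card Q < card U" using insert by simp
    then obtain l where "\<forall>u. l u \<in> R" "\<exists>u\<in>U. l u \<noteq> 0" "\<forall>q\<in>Q. (\<Sum>u\<in>U. l u * A q u) = 0"
      using insert.IH[of U A] insert.prems by auto
    then show ?thesis using True by (intro exI[of _ l]) auto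
  next
    case False
    then obtain v where v: "v \<in> U" "A q v \<noteq> 0" by blast
    define A' where "A' q' u = A q v * A q' u - A q' v * A q u" for q' u
    have "card Q < card (U - {v})" using insert v by (simp add: card_Diff_singleton)
    moreover have "A' q' u \<in> R" if "q' \<in> Q" "u \<in> U - {v}" for q' u
      unfolding A'_def using insert.prems(3) that v by (intro subring_diff subring_mult R) auto
    ultimately have "\<exists>l. (\<forall>u. l u \<in> R) \<and> (\<exists>u\<in>U - {v}. l u \<noteq> 0) \<and>
        (\<forall>q\<in>Q. (\<Sum>u\<in>U - {v}. l u * A' q u) = 0)"
      using insert.prems(1) by (intro insert.IH) auto
    then obtain l where l: "\<And>u. l u \<in> R" "\<exists>u\<in>U - {v}. l u \<noteq> 0"
      "\<And>q'. q' \<in> Q \<Longrightarrow> (\<Sum>u\<in>U - {v}. l u * A' q' u) = 0" by blast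
    \<comment> \<open>The other unknowns are scaled by the pivot \<open>A q v\<close>, which lets
      equation \<open>q\<close> be solved for the unknown \<open>v\<close> without division.\<close>
    define l' where "l' u = (if u = v then - (\<Sum>u\<in>U - {v}. l u * A q u) else A q v * l u)" for u
    define l'' where "l'' u = (if u \<in> U then l' u else 0)" for u
    have split: "(\<Sum>u\<in>U. l'' u * A q' u) =
      (\<Sum>u\<in>U - {v}. A q v * l u * A q' u) - (\<Sum>u\<in>U - {v}. l u * A q u) * A q' v" for q'
      using insert.prems(1) v by (subst sum.remove[of U v]) (auto simp: l'_def l''_def)
    have "(\<Sum>u\<in>U. l'' u * A q' u) = 0" if "q' \<in> insert q Q" for q'
    proof (cases "q' = q")
      case True
      then show ?thesis unfolding split True sum_distrib_right by (simp add: mult_ac)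
    next
      case False
      have "0 = (\<Sum>u\<in>U - {v}. l u * A' q' u)" using l(3) that False by simp
      also have "\<dots> = (\<Sum>u\<in>U - {v}. A q v * l u * A q' u) - (\<Sum>u\<in>U - {v}. l u * A q u) * A q' v"
        unfolding sum_distrib_right A'_def sum_subtractf[symmetric] by (intro sum.cong) (auto simp: algebra_simps)
      finally show ?thesis unfolding split by simp
    qed
    moreover have "l'' u \<in> R" for u
      unfolding l''_def l'_def using l(1) insert.prems(3) v R
      by (auto intro!: subring_uminus subring_sum subring_mult subring_0)
    moreover have "\<exists>u\<in>U. l'' u \<noteq> 0" using l(2) v by (auto simp: l'_def l''_def)
    ultimately show ?thesis by blast
  qed
qed

section \<open>Finite spans over the scalars and the shortest relation\<close>

context core
begin

definition spank :: "'e set \<Rightarrow> 'e set" where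
  "spank M = {x. \<exists>c. (\<forall>m. c m \<in> k) \<and> x = (\<Sum>m\<in>M. c m * m)}"

lemma spank_0: "0 \<in> spank M"
  unfolding spank_def by (auto intro!: exI[of _ "\<lambda>_. 0"] subring_0 kr)

lemma spank_add:
  assumes "x \<in> spank M" "z \<in> spank M"
  shows "x + z \<in> spank M"
proof -
  from assms obtain c d where "\<And>m. c m \<in> k" "x = (\<Sum>m\<in>M. c m * m)" "\<And>m. d m \<in> k" "z = (\<Sum>m\<in>M. d m * m)"
    by (auto simp: spank_def)
  then show ?thesis unfolding spank_def
    by (auto intro!: exI[of _ "\<lambda>m. c m + d m"] subring_add kr simp: sum.distrib distrib_right)
qed

lemma spank_sum: "(\<And>t. t \<in> A \<Longrightarrow> f t \<in> spank M) \<Longrightarrow> sum f A \<in> spank M"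
  by (induction A rule: infinite_finite_induct) (auto intro: spank_0 spank_add)

lemma spank_single:
  assumes "finite M" "m \<in> M" "c \<in> k"
  shows "c * m \<in> spank M"
proof -
  have "c * m = (\<Sum>x\<in>M. (if x = m then c else 0) * x)"
    using assms by (simp add: if_distrib[of "\<lambda>z. z * _"] cong: if_cong)
  moreover have "(if x = m then c else 0) \<in> k" for x using assms subring_0[OF kr] by simp
  ultimately show ?thesis unfolding spank_def by (intro CollectI exI[of _ "\<lambda>x. if x = m then c else 0"]) blast
qed

lemma spank_mult_image:
  assumes M: "finite M" "finite M'" and sub: "(*) g ` M \<subseteq> M'" and x: "x \<in> spank M"
  shows "g * x \<in> spank M'"
proof -
  obtain c where c: "\<And>m. c m \<in> k" "x = (\<Sum>m\<in>M. c m * m)" using x by (auto simp: spank_def)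
  have "g * x = (\<Sum>m\<in>M. c m * (g * m))" by (simp add: c(2) sum_distrib_left mult_ac)
  also have "\<dots> \<in> spank M'" using sub c(1) by (intro spank_sum spank_single M) auto
  finally show ?thesis .
qed

lemma dl_finite_span: "\<exists>M. finite M \<and> dl n \<subseteq> spank M"
proof -
  define M where "M = rec_nat {} (\<lambda>n M. insert 1 (M \<union> (\<Union>i\<in>I. (*) (X i) ` M)))"
  have M: "M 0 = {}" "M (Suc n) = insert 1 (M n \<union> (\<Union>i\<in>I. (*) (X i) ` M n))" for n
    by (simp_all add: M_def)
  have fin: "finite (M n)" for n using I by (induction n) (auto simp: M)
  have "b \<in> spank (M n)" if "b \<in> dl n" for b n
    using that
  proof (induction rule: deg_lt_induct)
    case (const c n)
    then show ?case using spank_single[of "M (Suc n)" 1 c] fin[of "Suc n"] by (simp add: M)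
  next
    case (var i b n)
    then show ?case by (intro spank_mult_image[OF fin fin]) (auto simp: M)
  qed (auto intro: spank_0 spank_add)
  then show ?thesis using fin by blast
qed

lemma bd_finite_span: "\<exists>M. finite M \<and> bd i d \<subseteq> spank M"
proof -
  obtain M where M: "finite M" "dl d \<subseteq> spank M" using dl_finite_span by blast
  define M' where "M' = (\<Union>j<degree F. (*) (inverse (s ^ i) * y ^ j) ` M)"
  have M': "finite M'" using M by (simp add: M'_def)
  have "x \<in> spank M'" if x: "x \<in> bd i d" for x
  proof -
    obtain V where V: "\<And>j. coeff V j \<in> dl d" "degree V < degree F" "s ^ i * x = poly V y"
      using x by (auto simp: bd_def)
    have "x = inverse (s ^ i) * (s ^ i * x)" using s by (simp add: mult.assoc[symmetric])
    also have "\<dots> = (\<Sum>j<degree F. (inverse (s ^ i) * y ^ j) * coeff V j)"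
      unfolding V(3) sum_below[OF V(2), symmetric] by (simp add: sum_distrib_left mult_ac)
    also have "\<dots> \<in> spank M'"
    proof (rule spank_sum)
      fix j assume "j \<in> {..<degree F}"
      then show "inverse (s ^ i) * y ^ j * coeff V j \<in> spank M'"
        using M V(1) by (intro spank_mult_image[OF M(1) M']) (auto simp: M'_def)
    qed
    finally show ?thesis .
  qed
  then show ?thesis using M' by blast
qed

lemma lie_sum:
  assumes \<delta>: "derivation \<delta>"
  shows "lie \<delta> (\<lambda>a. \<Sum>t\<in>T. f t * w t a) b = (\<Sum>t\<in>T. \<delta> (f t) * w t b + f t * lie \<delta> (w t) b)"
  unfolding lie_def derivation_sum[OF \<delta>] derivation_mult[OF \<delta>]
  by (simp add: sum.distrib sum_distrib_left sum_distrib_right algebra_simps)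
     (subst sum.swap, simp add: mult_ac)

theorem exists_constant:
  fixes \<delta> :: "nat \<Rightarrow> 'e \<Rightarrow> 'e" and m :: nat
  assumes \<delta>: "\<And>i. i < m \<Longrightarrow> derivation (\<delta> i)" "\<And>i c. i < m \<Longrightarrow> c \<in> k \<Longrightarrow> \<delta> i c = 0"
      "\<And>i. i < m \<Longrightarrow> \<delta> i ` L \<subseteq> L"
    and PP: "infinite PP" "\<And>P. P \<in> PP \<Longrightarrow> good P" "\<And>P i. P \<in> PP \<Longrightarrow> i < m \<Longrightarrow> \<delta> i ` P \<subseteq> P"
      "\<And>P Q. P \<in> PP \<Longrightarrow> Q \<in> PP \<Longrightarrow> P \<subseteq> Q \<Longrightarrow> P = Q"
  shows "\<exists>f. f \<notin> k \<and> (\<forall>i<m. \<delta> i f = 0)"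
proof (rule ccontr)
  \<comment> \<open>If all constants are in \<open>k\<close>, a shortest relation over the field
    turns out to be a relation over \<open>k\<close>, which the independence of logarithmic forms
    excludes.\<close>
  assume "\<not> ?thesis"
  then have const_k: "f \<in> k" if "\<And>i. i < m \<Longrightarrow> \<delta> i f = 0" for f using that by blast
  have "\<forall>P. \<exists>p n q. P \<in> PP \<longrightarrow> form_data P p n q" using PP(2) good_form_data by blast
  then obtain p n q where fd: "\<And>P. P \<in> PP \<Longrightarrow> form_data P (p P) (n P) (q P)" by metis
  define w where "w P = log_form (p P) (q P)" for P
  have "\<forall>i. \<exists>M. i < m \<longrightarrow> finite M \<and> (\<forall>P\<in>PP. \<forall>b\<in>I. lie (\<delta> i) (w P) b \<in> spank M)"
  proof
    fix i
    show "\<exists>M. i < m \<longrightarrow> finite M \<and> (\<forall>P\<in>PP. \<forall>b\<in>I. lie (\<delta> i) (w P) b \<in> spank M)"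
    proof (cases "i < m")
      case True
      have "\<exists>j N. \<forall>P p n q b. good P \<longrightarrow> form_data P p n q \<longrightarrow> \<delta> i ` P \<subseteq> P \<longrightarrow> b \<in> I \<longrightarrow>
        lie (\<delta> i) (log_form p q) b \<in> bd j N"
        by (rule lie_bounded[OF \<delta>(1)[OF True] _ \<delta>(3)[OF True]]) (rule \<delta>(2)[OF True])
      then obtain j N where jN: "\<And>P p n q b. good P \<Longrightarrow> form_data P p n q \<Longrightarrow> \<delta> i ` P \<subseteq> P \<Longrightarrow>
        b \<in> I \<Longrightarrow> lie (\<delta> i) (log_form p q) b \<in> bd j N" by metis
      obtain M where M: "finite M" "bd j N \<subseteq> spank M" using bd_finite_span by blast
      have "lie (\<delta> i) (w P) b \<in> spank M" if "P \<in> PP" "b \<in> I" for P b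
        using jN[OF PP(2) fd PP(3)[OF _ True]] that M(2) unfolding w_def by blast
      then show ?thesis using M(1) by blast
    qed auto
  qed
  then obtain M where M: "\<And>i. i < m \<Longrightarrow> finite (M i)"
    "\<And>i P b. i < m \<Longrightarrow> P \<in> PP \<Longrightarrow> b \<in> I \<Longrightarrow> lie (\<delta> i) (w P) b \<in> spank (M i)"
    by metis
  have "\<forall>i P b. \<exists>c. i < m \<longrightarrow> P \<in> PP \<longrightarrow> b \<in> I \<longrightarrow> (\<forall>x. c x \<in> k) \<and> lie (\<delta> i) (w P) b = (\<Sum>x\<in>M i. c x * x)"
    using M(2) unfolding spank_def by blast
  then obtain c where c: "\<And>i P b x. i < m \<Longrightarrow> P \<in> PP \<Longrightarrow> b \<in> I \<Longrightarrow> c i P b x \<in> k"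
    "\<And>i P b. i < m \<Longrightarrow> P \<in> PP \<Longrightarrow> b \<in> I \<Longrightarrow> lie (\<delta> i) (w P) b = (\<Sum>x\<in>M i. c i P b x * x)"
    by metis
  \<comment> \<open>An index consists of a derivation, a coordinate of the form and a spanning
    element. Vanishing of all Lie derivatives of a combination amounts to \<open>card Q\<close>
    linear equations over \<open>k\<close>.\<close>
  define Q where "Q = (SIGMA i:{..<m}. I \<times> M i)"
  have finQ: "finite Q" unfolding Q_def using I(1) M(1) by (intro finite_SigmaI finite_cartesian_product) auto
  have flat: "\<exists>l. (\<forall>P. l P \<in> k) \<and> (\<exists>P\<in>S. l P \<noteq> 0) \<and> (\<forall>i<m. \<forall>b\<in>I. lie (\<delta> i) (\<lambda>a. \<Sum>P\<in>S. l P * w P a) b = 0)"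
    if S: "S \<subseteq> PP" "finite S" "card Q < card S" for S
  proof -
    obtain l where l: "\<And>P. l P \<in> k" "\<exists>P\<in>S. l P \<noteq> 0"
      "\<And>z. z \<in> Q \<Longrightarrow> (\<Sum>P\<in>S. l P * (case z of (i, b, x) \<Rightarrow> c i P b x)) = 0"
    proof -
      define C where "C z P = (case z of (i, b, x) \<Rightarrow> c i P b x)" for z P
      have "C z P \<in> k" if "z \<in> Q" "P \<in> S" for z P
        using that S(1) c(1) by (auto simp: Q_def C_def)
      from linear_system[OF kr finQ S(2,3), of C, OF this] obtain l where
        "\<forall>P. l P \<in> k" "\<exists>P\<in>S. l P \<noteq> 0" "\<forall>z\<in>Q. (\<Sum>P\<in>S. l P * C z P) = 0" by blast
      then show ?thesis using that[of l] unfolding C_def by blast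
    qed
    have "lie (\<delta> i) (\<lambda>a. \<Sum>P\<in>S. l P * w P a) b = 0" if i: "i < m" and b: "b \<in> I" for i b
    proof -
      have "lie (\<delta> i) (\<lambda>a. \<Sum>P\<in>S. l P * w P a) b = (\<Sum>P\<in>S. l P * (\<Sum>x\<in>M i. c i P b x * x))"
        unfolding lie_sum[OF \<delta>(1)[OF i]] using \<delta>(2)[OF i l(1)] c(2)[OF i _ b] S(1)
        by (intro sum.cong) auto
      also have "\<dots> = (\<Sum>P\<in>S. \<Sum>x\<in>M i. (l P * c i P b x) * x)"
        by (simp add: sum_distrib_left mult.assoc)
      also have "\<dots> = (\<Sum>x\<in>M i. (\<Sum>P\<in>S. l P * c i P b x) * x)"
        by (subst sum.swap) (simp add: sum_distrib_right)
      also have "\<dots> = 0"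
        using l(3)[of "(i, b, _)"] i b by (intro sum.neutral) (auto simp: Q_def)
      finally show ?thesis .
    qed
    then show ?thesis using l by blast
  qed
  \<comment> \<open>A block of \<open>r\<close> primes has more unknowns than equations and so
    carries a combination with vanishing Lie derivatives. Taking \<open>card I + 1\<close> disjoint
    blocks yields more combinations than a form has coordinates, hence a relation over the
    field.\<close>
  define r where "r = Suc (card Q)"
  obtain T where T: "T \<subseteq> PP" "finite T" "card T = Suc (card I) * r"
    using infinite_arbitrarily_large[OF PP(1)] by blast
  obtain e where e: "bij_betw e {..<Suc (card I) * r} T"
    using ex_bij_betw_nat_finite[OF T(2)] T(3) by (auto simp: atLeast0LessThan)
  define S where "S t = e ` {t * r..<Suc t * r}" for t
  have sub: "{t * r..<Suc t * r} \<subseteq> {..<Suc (card I) * r}" if "t \<le> card I" for t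
  proof
    fix x assume "x \<in> {t * r..<Suc t * r}"
    then have "x < Suc t * r" by simp
    also have "\<dots> \<le> Suc (card I) * r" using that by (intro mult_le_mono1) simp
    finally show "x \<in> {..<Suc (card I) * r}" by simp
  qed
  have S: "S t \<subseteq> T" "card (S t) = r" "finite (S t)" if "t \<le> card I" for t
  proof -
    show "S t \<subseteq> T" using sub[OF that] e unfolding S_def bij_betw_def by blast
    have "inj_on e {t * r..<Suc t * r}" using sub[OF that] e inj_on_subset unfolding bij_betw_def by blast
    then show "card (S t) = r" unfolding S_def by (simp add: card_image)
  qed (simp add: S_def)
  have disj: "t = u" if "P \<in> S t" "P \<in> S u" "t \<le> card I" "u \<le> card I" for P t u
  proof -
    from that(1,2) obtain x x' where
      x: "x \<in> {t * r..<Suc t * r}" "P = e x" "x' \<in> {u * r..<Suc u * r}" "P = e x'"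
      unfolding S_def by blast
    then have "x = x'" using sub[OF that(3)] sub[OF that(4)] e unfolding bij_betw_def inj_on_def by blast
    then have "x div r = t" "x div r = u" using x by (auto intro!: div_nat_eqI simp: mult.commute)
    then show ?thesis by simp
  qed
  have "\<forall>t. \<exists>l. t \<le> card I \<longrightarrow> (\<forall>P. l P \<in> k) \<and> (\<exists>P\<in>S t. l P \<noteq> 0) \<and>
    (\<forall>i<m. \<forall>b\<in>I. lie (\<delta> i) (\<lambda>a. \<Sum>P\<in>S t. l P * w P a) b = 0)"
  proof
    fix t
    show "\<exists>l. t \<le> card I \<longrightarrow> (\<forall>P. l P \<in> k) \<and> (\<exists>P\<in>S t. l P \<noteq> 0) \<and>
      (\<forall>i<m. \<forall>b\<in>I. lie (\<delta> i) (\<lambda>a. \<Sum>P\<in>S t. l P * w P a) b = 0)"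
    proof (cases "t \<le> card I")
      case True
      have "S t \<subseteq> PP" "card Q < card (S t)" using S[OF True] T(1) by (auto simp: r_def)
      from flat[OF this(1) S(3)[OF True] this(2)] show ?thesis by blast
    qed auto
  qed
  then obtain l where l: "\<And>t P. t \<le> card I \<Longrightarrow> l t P \<in> k" "\<And>t. t \<le> card I \<Longrightarrow> \<exists>P\<in>S t. l t P \<noteq> 0"
    "\<And>t i b. t \<le> card I \<Longrightarrow> i < m \<Longrightarrow> b \<in> I \<Longrightarrow> lie (\<delta> i) (\<lambda>a. \<Sum>P\<in>S t. l t P * w P a) b = 0"
    unfolding choice_iff by blast
  define W where "W t a = (\<Sum>P\<in>S t. l t P * w P a)" for t a
  define rel where "rel f \<longleftrightarrow> (\<forall>a\<in>I. (\<Sum>t\<le>card I. f t * W t a) = 0)" for f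
  have indep: "\<forall>t\<le>card I. f t = 0" if f: "rel f" "\<And>t. t \<le> card I \<Longrightarrow> f t \<in> k" for f
  proof (intro allI impI)
    fix t assume t: "t \<le> card I"
    define U where "U = (\<Union>t\<le>card I. S t)"
    \<comment> \<open>A relation between the block forms over \<open>k\<close> is rewritten as one
      between the logarithmic forms; disjointness of the blocks leaves a single term in each
      coefficient.\<close>
    define h where "h P = (\<Sum>t\<le>card I. if P \<in> S t then f t * l t P else 0)" for P
    have h: "h P = f t * l t P" if "P \<in> S t" "t \<le> card I" for P t
    proof -
      have "h P = (\<Sum>u\<le>card I. if u = t then f t * l t P else 0)"
        unfolding h_def
      proof (intro sum.cong refl)
        fix u assume "u \<in> {..card I}"
        then have "P \<in> S u \<longleftrightarrow> u = t" using disj[OF that(1) _ that(2), of u] that by auto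
        then show "(if P \<in> S u then f u * l u P else 0) = (if u = t then f t * l t P else 0)" by auto
      qed
      then show ?thesis using that by simp
    qed
    have UP: "U \<subseteq> PP" using S(1) T(1) by (auto simp: U_def)
    have finU: "finite U" using S(3) by (auto simp: U_def)
    have zero: "(\<Sum>P\<in>U. h P * log_form (p P) (q P) a) = 0" if "a \<in> I" for a
    proof -
      have "(\<Sum>P\<in>U. h P * w P a) = (\<Sum>t\<le>card I. \<Sum>P\<in>S t. h P * w P a)"
        unfolding U_def using S(3) disj by (intro sum.UNION_disjoint) auto
      also have "\<dots> = (\<Sum>t\<le>card I. f t * W t a)"
        using h by (intro sum.cong refl) (auto simp: W_def sum_distrib_left mult.assoc intro!: sum.cong)
      also have "\<dots> = 0" using f(1) that by (simp add: rel_def)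
      finally show ?thesis by (simp add: w_def)
    qed
    obtain P where P: "P \<in> S t" "l t P \<noteq> 0" using l(2)[OF t] by blast
    have "h R \<in> k" for R
      unfolding h_def using f(2) l(1) by (intro subring_sum kr) (auto intro!: subring_mult subring_0 kr)
    then have hk: "\<And>R. h R \<in> k" .
    have PU: "P \<in> U" using P(1) t by (auto simp: U_def)
    have "h P = 0"
    proof (rule log_form_independent[OF finU _ _ _ _ zero PU])
      show "good R" if "R \<in> U" for R using PP(2) UP that by blast
      show "R = R'" if "R \<in> U" "R' \<in> U" "R \<subseteq> R'" for R R'
        using PP(4)[of R R'] UP that by blast
      show "form_data R (p R) (n R) (q R)" if "R \<in> U" for R using fd UP that by blast
    qed (use hk in auto)
    then show "f t = 0" using h[OF P(1) t] P(2) by simp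
  qed
  have "card I < card {..card I}" by simp
  then obtain f0 where "\<exists>t\<in>{..card I}. f0 t \<noteq> 0" "\<forall>a\<in>I. (\<Sum>t\<in>{..card I}. f0 t * W t a) = 0"
    using linear_system[OF subring_UNIV I(1), of "{..card I}" "\<lambda>a t. W t a"] by auto
  then have f0: "rel f0" "\<exists>t\<le>card I. f0 t \<noteq> 0" by (auto simp: rel_def)
  define supp where "supp f = card {t\<in>{..card I}. f t \<noteq> (0::'e)}" for f
  define G where "G = {f. rel f \<and> (\<exists>t\<le>card I. f t \<noteq> 0)}"
  have "f0 \<in> G" using f0 by (simp add: G_def)
  then obtain f where f: "f \<in> G" "\<And>g. g \<in> G \<Longrightarrow> supp f \<le> supp g"
    using exists_least_iff[of "\<lambda>n. \<exists>g\<in>G. supp g = n"] by (metis not_le)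
  obtain t0 where t0: "t0 \<le> card I" "f t0 \<noteq> 0" using f(1) by (auto simp: G_def)
  \<comment> \<open>With one coefficient normalised to \<open>1\<close>, applying a Lie derivative
    removes that coefficient and would give a shorter relation unless all derivatives
    vanish.\<close>
  define g where "g t = f t / f t0" for t
  have relg: "rel g"
  proof -
    have "(\<Sum>t\<le>card I. g t * W t a) = (\<Sum>t\<le>card I. f t * W t a) / f t0" for a
      by (simp add: g_def sum_divide_distrib)
    then show ?thesis using f(1) by (simp add: rel_def G_def)
  qed
  have "\<delta> i (g t) = 0" if i: "i < m" and t: "t \<le> card I" for i t
  proof (rule ccontr)
    assume nz: "\<delta> i (g t) \<noteq> 0"
    have di: "derivation (\<delta> i)" using \<delta>(1)[OF i] .
    have "rel (\<lambda>t. \<delta> i (g t))"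
      unfolding rel_def
    proof
      fix b assume b: "b \<in> I"
      have "lie (\<delta> i) (\<lambda>a. \<Sum>t\<le>card I. g t * W t a) b = (\<Sum>t\<le>card I. \<delta> i (g t) * W t b + g t * lie (\<delta> i) (W t) b)"
        by (rule lie_sum[OF di])
      also have "\<dots> = (\<Sum>t\<le>card I. \<delta> i (g t) * W t b)"
        using l(3)[OF _ i b] by (intro sum.cong) (auto simp: W_def[abs_def])
      also have "lie (\<delta> i) (\<lambda>a. \<Sum>t\<le>card I. g t * W t a) b = 0"
        using relg b di unfolding lie_def rel_def by (simp add: derivation_0)
      finally show "(\<Sum>t\<le>card I. \<delta> i (g t) * W t b) = 0" by simp
    qed
    then have "(\<lambda>t. \<delta> i (g t)) \<in> G" using t nz by (auto simp: G_def)
    then have "supp f \<le> supp (\<lambda>t. \<delta> i (g t))" by (rule f(2))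
    moreover have "supp (\<lambda>t. \<delta> i (g t)) < supp f"
      unfolding supp_def
    proof (rule psubset_card_mono)
      have "g t = 0" if "f t = 0" for t using that by (simp add: g_def)
      moreover have "g t0 = 1" using t0 by (simp add: g_def)
      ultimately have "t0 \<notin> {t \<in> {..card I}. \<delta> i (g t) \<noteq> 0}"
        "{t \<in> {..card I}. \<delta> i (g t) \<noteq> 0} \<subseteq> {t \<in> {..card I}. f t \<noteq> 0}"
        using di by (auto simp: derivation_0 derivation_1)
      then show "{t \<in> {..card I}. \<delta> i (g t) \<noteq> 0} \<subset> {t \<in> {..card I}. f t \<noteq> 0}"
        using t0 by blast
    qed simp
    ultimately show False by simp
  qed
  then have "g t \<in> k" if "t \<le> card I" for t using const_k that by blast
  then have "g t0 = 0" using indep[OF relg] t0 by blast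
  then show False using t0 by (simp add: g_def)
qed

end

section \<open>Polynomials in infinitely many indeterminates\<close>

text \<open>Monomials are finitely supported exponent vectors. An unbounded supply of indeterminates
  avoids a type that depends on the number of generators.\<close>

type_synonym 'a mp = "(nat \<Rightarrow>\<^sub>0 nat) \<Rightarrow>\<^sub>0 'a"

abbreviation sng :: "'b \<Rightarrow> 'c::zero \<Rightarrow> 'b \<Rightarrow>\<^sub>0 'c" where "sng \<equiv> Poly_Mapping.single"
abbreviation lkp :: "('b \<Rightarrow>\<^sub>0 'c::zero) \<Rightarrow> 'b \<Rightarrow> 'c" where "lkp \<equiv> Poly_Mapping.lookup"

lemma mp_sum_single: "f = (\<Sum>m\<in>Poly_Mapping.keys f. sng m (lkp f m))"
  by (rule poly_mapping_eqI)
    (auto simp: lookup_sum lookup_single when_def in_keys_iff intro: sum.neutral)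

lemma mp_mult_sum:
  fixes f g :: "'a::comm_ring_1 mp"
  shows "f * g = (\<Sum>i\<in>Poly_Mapping.keys f. \<Sum>j\<in>Poly_Mapping.keys g. sng (i + j) (lkp f i * lkp g j))"
proof -
  have "f * g = (\<Sum>i\<in>Poly_Mapping.keys f. sng i (lkp f i)) * (\<Sum>j\<in>Poly_Mapping.keys g. sng j (lkp g j))"
    by (simp only: mp_sum_single[symmetric])
  also have "\<dots> = (\<Sum>i\<in>Poly_Mapping.keys f. \<Sum>j\<in>Poly_Mapping.keys g. sng (i + j) (lkp f i * lkp g j))"
    by (simp add: sum_product mult_single)
  finally show ?thesis .
qed

lemma lookup_mp_mult:
  fixes f g :: "'a::comm_ring_1 mp"
  shows "lkp (f * g) m = (\<Sum>i\<in>Poly_Mapping.keys f. \<Sum>j\<in>Poly_Mapping.keys g. (lkp f i * lkp g j when i + j = m))"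
  by (subst mp_mult_sum) (simp add: lookup_sum lookup_single)

lemma derivation_mpI:
  fixes D :: "'a::comm_ring_1 mp \<Rightarrow> 'a mp"
  assumes add: "\<And>f g. D (f + g) = D f + D g"
    and single: "\<And>m n a b. D (sng m a * sng n b) = D (sng m a) * sng n b + sng m a * D (sng n b)"
  shows "derivation D"
proof -
  have "D (0 + 0) = D 0 + D 0" by (rule add)
  then have D0: "D 0 = 0" by simp
  have sum: "D (sum h A) = (\<Sum>i\<in>A. D (h i))" for h :: "(nat \<Rightarrow>\<^sub>0 nat) \<Rightarrow> 'a mp" and A
    by (induction A rule: infinite_finite_induct) (auto simp: D0 add)
  have "D (f * g) = D f * g + f * D g" for f g
  proof -
    let ?K = "Poly_Mapping.keys f" and ?L = "Poly_Mapping.keys g"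
    let ?u = "\<lambda>i. sng i (lkp f i)" and ?v = "\<lambda>j. sng j (lkp g j)"
    have "D (f * g) = D ((\<Sum>i\<in>?K. ?u i) * (\<Sum>j\<in>?L. ?v j))"
      by (simp only: mp_sum_single[symmetric])
    also have "\<dots> = (\<Sum>i\<in>?K. \<Sum>j\<in>?L. D (?u i) * ?v j + ?u i * D (?v j))"
      by (simp add: sum_product sum single)
    also have "\<dots> = (\<Sum>i\<in>?K. D (?u i)) * (\<Sum>j\<in>?L. ?v j) + (\<Sum>i\<in>?K. ?u i) * (\<Sum>j\<in>?L. D (?v j))"
      by (simp add: sum.distrib sum_product)
    also have "\<dots> = D f * g + f * D g"
      by (simp only: sum[symmetric] mp_sum_single[symmetric])
    finally show ?thesis .
  qed
  then show ?thesis using add by (simp add: derivation_def)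
qed

section \<open>Derivations on coefficients and differentiation by indeterminates\<close>

definition dcoef :: "('a::comm_ring_1 \<Rightarrow> 'a) \<Rightarrow> 'a mp \<Rightarrow> 'a mp" where
  "dcoef d f = Poly_Mapping.map d f"

lemma lookup_dcoef: "derivation d \<Longrightarrow> lkp (dcoef d f) m = d (lkp f m)"
  unfolding dcoef_def by (simp add: Poly_Mapping.map.rep_eq when_def derivation_0)

lemma dcoef_single: "derivation d \<Longrightarrow> dcoef d (sng m a) = sng m (d a)"
  by (rule poly_mapping_eqI) (simp add: lookup_dcoef lookup_single when_def derivation_0)

lemma derivation_dcoef: "derivation d \<Longrightarrow> derivation (dcoef d)"
proof (rule derivation_mpI)
  assume d: "derivation d"
  show "dcoef d (f + g) = dcoef d f + dcoef d g" for f g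
    by (rule poly_mapping_eqI) (simp add: lookup_dcoef d lookup_add derivation_add)
  show "dcoef d (sng m a * sng n b) = dcoef d (sng m a) * sng n b + sng m a * dcoef d (sng n b)" for m n a b
    by (simp add: dcoef_single d mult_single derivation_mult single_add)
qed

text \<open>Partial differentiation by the indeterminate \<open>v\<close>, read off on coefficients:
  the monomial \<open>m\<close> receives its coefficient from the monomial with one more factor
  \<open>v\<close>.\<close>

lift_definition dvar :: "nat \<Rightarrow> 'a::comm_ring_1 mp \<Rightarrow> 'a mp" is
  "\<lambda>v f m. of_nat (Suc (lkp m v)) * f (m + sng v 1)"
proof -
  fix v :: nat and f :: "(nat \<Rightarrow>\<^sub>0 nat) \<Rightarrow> 'a"
  assume fin: "finite {m. f m \<noteq> 0}"
  have "inj (\<lambda>m. m + sng v (1::nat))" by (rule injI) simp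
  then have "finite ((\<lambda>m. m + sng v (1::nat)) -` {m. f m \<noteq> 0})" using fin by (rule finite_vimageI[rotated])
  then show "finite {m. of_nat (Suc (lkp m v)) * f (m + sng v 1) \<noteq> 0}"
    by (rule rev_finite_subset) auto
qed

lemma lookup_dvar: "lkp (dvar v f) m = of_nat (Suc (lkp m v)) * lkp f (m + sng v 1)"
  by (simp add: dvar.rep_eq)

lemma dvar_single_0:
  assumes "lkp m v = 0"
  shows "dvar v (sng m a) = 0"
proof (rule poly_mapping_eqI)
  fix l
  have "m \<noteq> l + sng v 1"
  proof
    assume "m = l + sng v 1"
    then have "lkp m v = lkp l v + 1" by (simp add: lookup_add)
    then show False using assms by simp
  qed
  then show "lkp (dvar v (sng m a)) l = lkp 0 l" by (simp add: lookup_dvar lookup_single)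
qed

lemma dvar_single_Suc: "dvar v (sng (m + sng v 1) a) = sng m (of_nat (Suc (lkp m v)) * a)"
  by (rule poly_mapping_eqI) (auto simp: lookup_dvar lookup_single when_def)

lemma monomial_cases:
  fixes m :: "nat \<Rightarrow>\<^sub>0 nat"
  obtains "lkp m v = 0" | l where "m = l + sng v 1"
proof (cases "lkp m v = 0")
  case False
  have "m = (m - sng v 1) + sng v 1"
    by (rule poly_mapping_eqI) (use False in \<open>auto simp: lookup_add lookup_minus lookup_single when_def\<close>)
  then show ?thesis using that by blast
qed (use that in blast)

lemma derivation_dvar: "derivation (dvar v :: 'a::comm_ring_1 mp \<Rightarrow> 'a mp)"
proof (rule derivation_mpI)
  show "dvar v (f + g) = dvar v f + dvar v g" for f g :: "'a mp"
    by (rule poly_mapping_eqI) (simp add: lookup_dvar lookup_add algebra_simps)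
  fix m n and a b :: 'a
  show "dvar v (sng m a * sng n b) = dvar v (sng m a) * sng n b + sng m a * dvar v (sng n b)"
  proof (cases m v rule: monomial_cases)
    case m: 1
    show ?thesis
    proof (cases n v rule: monomial_cases)
      case 1
      then show ?thesis using m by (simp add: mult_single dvar_single_0 lookup_add)
    next
      case (2 l)
      have "m + (l + sng v 1) = (m + l) + sng v 1" by (simp add: add.assoc)
      then have "sng m a * sng (l + sng v 1) b = sng ((m + l) + sng v 1) (a * b)" by (simp only: mult_single)
      then show ?thesis
        unfolding 2 using m by (simp only: dvar_single_Suc dvar_single_0 mult_single) (simp add: lookup_add mult_ac)
    qed
  next
    case m: (2 l)
    show ?thesis
    proof (cases n v rule: monomial_cases)
      case 1
      have "(l + sng v 1) + n = (l + n) + sng v 1" by (simp add: ac_simps)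
      then have "sng (l + sng v 1) a * sng n b = sng ((l + n) + sng v 1) (a * b)" by (simp only: mult_single)
      then show ?thesis
        unfolding m using 1 by (simp only: dvar_single_Suc dvar_single_0 mult_single) (simp add: lookup_add mult_ac)
    next
      case (2 l')
      have "(l + sng v 1) + (l' + sng v 1) = (l + l' + sng v 1) + sng v 1" by (simp add: ac_simps)
      then have "sng (l + sng v 1) a * sng (l' + sng v 1) b = sng ((l + l' + sng v 1) + sng v 1) (a * b)"
        by (simp only: mult_single)
      moreover have "l + (l' + sng v 1) = l + l' + sng v 1" "l + sng v 1 + l' = l + l' + sng v 1"
        by (simp_all add: ac_simps)
      ultimately show ?thesis
        unfolding m 2 by (simp only: dvar_single_Suc mult_single single_add[symmetric])
          (simp add: lookup_add algebra_simps)
    qed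
  qed
qed

definition cst :: "'a::comm_ring_1 \<Rightarrow> 'a mp" where "cst a = sng 0 a"
definition tv :: "nat \<Rightarrow> 'a::comm_ring_1 mp" where "tv v = sng (sng v 1) 1"

lemma cst_hom: "cst (a + b) = cst a + cst b" "cst (a * b) = cst a * cst b" "cst 0 = 0" "cst 1 = 1"
  "cst (- a) = - cst a"
  by (simp_all add: cst_def single_add mult_single single_uminus)

lemma cst_inj: "cst a = cst b \<longleftrightarrow> a = b"
  unfolding cst_def by (metis lookup_single_eq)

lemma dvar_cst: "dvar v (cst a) = 0"
  by (simp add: cst_def dvar_single_0)

lemma dvar_tv: "dvar v (tv u) = (if u = v then 1 else 0)"
proof (cases "u = v")
  case True
  have "dvar v (tv v) = sng 0 (of_nat (Suc (lkp (0 :: nat \<Rightarrow>\<^sub>0 nat) v)) * 1)"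
    using dvar_single_Suc[of v 0 1] unfolding tv_def by (simp only: add_0)
  then show ?thesis using True by simp
next
  case False
  then show ?thesis by (simp add: tv_def dvar_single_0 lookup_single)
qed

lemma mp_generated:
  fixes f :: "'a::comm_ring_1 mp"
  assumes S: "subring S" and c: "\<And>m. cst (lkp f m) \<in> S" and t: "\<And>v. tv v \<in> S"
  shows "f \<in> S"
proof -
  have mono: "sng m (1::'a) \<in> S" for m :: "nat \<Rightarrow>\<^sub>0 nat"
  proof (induction "\<Sum>v\<in>Poly_Mapping.keys m. lkp m v" arbitrary: m rule: less_induct)
    case less
    show ?case
    proof (cases "m = 0")
      case True
      then show ?thesis using subring_1[OF S] by simp
    next
      case False
      then obtain v where v: "lkp m v \<noteq> 0" by (metis poly_mapping_eqI lookup_zero)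
      then obtain l where l: "m = l + sng v 1" using monomial_cases[of m v] by metis
      have "(\<Sum>u\<in>Poly_Mapping.keys l. lkp l u) < (\<Sum>u\<in>Poly_Mapping.keys m. lkp m u)"
      proof -
        have sub: "Poly_Mapping.keys l \<subseteq> Poly_Mapping.keys m"
          by (auto simp: l in_keys_iff lookup_add)
        have "(\<Sum>u\<in>Poly_Mapping.keys l. lkp l u) = (\<Sum>u\<in>Poly_Mapping.keys m. lkp l u)"
          using sub by (intro sum.mono_neutral_left) (auto simp: in_keys_iff)
        also have "\<dots> < (\<Sum>u\<in>Poly_Mapping.keys m. lkp m u)"
          using v by (intro sum_strict_mono_ex1) (auto simp: l in_keys_iff lookup_add lookup_single intro!: bexI[of _ v])
        finally show ?thesis .
      qed
      then have "sng l 1 \<in> S" by (rule less)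
      moreover have "sng m (1::'a) = sng l 1 * tv v" by (simp add: l tv_def mult_single)
      ultimately show ?thesis using t subring_mult[OF S] by auto
    qed
  qed
  have "sng m (lkp f m) \<in> S" for m
  proof -
    have "sng m (lkp f m) = cst (lkp f m) * sng m 1" by (simp add: cst_def mult_single)
    then show ?thesis using subring_mult[OF S c mono] by simp
  qed
  then show ?thesis by (subst mp_sum_single) (intro subring_sum S)
qed

text \<open>For an ideal this is its extension to the polynomial ring, for a subring the polynomials
  over it; both readings occur.\<close>

definition pt :: "'a::comm_ring_1 set \<Rightarrow> 'a mp set" where
  "pt P = {f. \<forall>m. lkp f m \<in> P}"

lemma subring_pt:
  assumes S: "subring S"
  shows "subring (pt S)"
  unfolding subring_def pt_def
  using S by (auto simp: lookup_add lookup_mp_mult lookup_one when_def subring_0 subring_1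
      intro!: subring_add subring_sum subring_mult subring_uminus)

lemma ideal_pt:
  fixes P :: "'a::comm_ring_1 set"
  assumes P: "ideal_of UNIV P"
  shows "ideal_of UNIV (pt P)"
  unfolding ideal_of_def
proof (intro conjI ballI)
  show "0 \<in> pt P" using P by (simp add: pt_def ideal_of_0)
  show "f + g \<in> pt P" if "f \<in> pt P" "g \<in> pt P" for f g
    using that P by (simp add: pt_def lookup_add ideal_of_add)
  show "r * f \<in> pt P" if "f \<in> pt P" for r f
    using that ideal_of_0[OF P] ideal_of_mult[OF P UNIV_I]
    by (auto simp: pt_def lookup_mp_mult when_def intro!: ideal_of_sum[OF P])
qed simp

text \<open>Monomials carry a total order compatible with addition, so the largest monomials with
  coefficients outside \<open>P\<close> lead to a coefficient of the product outside
  \<open>P\<close>.\<close>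

lemma prime_pt:
  fixes P :: "'a::comm_ring_1 set"
  assumes P: "prime_of UNIV P"
  shows "prime_of UNIV (pt P)"
  unfolding prime_of_def
proof (intro conjI ballI impI)
  have Id: "ideal_of UNIV P" using P by (rule prime_of_ideal)
  show "ideal_of UNIV (pt P)" by (rule ideal_pt[OF Id])
  show "1 \<notin> pt P" using prime_of_1[OF P] by (auto simp: pt_def lookup_one intro!: exI[of _ 0])
  fix f g :: "'a mp" assume fg: "f * g \<in> pt P"
  show "f \<in> pt P \<or> g \<in> pt P"
  proof (rule ccontr)
    assume neg: "\<not> ?thesis"
    define A where "A h = {i\<in>Poly_Mapping.keys h. lkp h i \<notin> P}" for h :: "'a mp"
    have finA: "finite (A h)" for h by (simp add: A_def)
    have neA: "A h \<noteq> {}" if "h \<notin> pt P" for h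
    proof -
      from that obtain i where "lkp h i \<notin> P" by (auto simp: pt_def)
      moreover from this have "lkp h i \<noteq> 0" using ideal_of_0[OF Id] by metis
      ultimately show ?thesis by (auto simp: A_def in_keys_iff)
    qed
    have maxA: "Max (A h) \<in> A h" "\<And>i. Max (A h) < i \<Longrightarrow> lkp h i \<in> P" if "h \<notin> pt P" for h
    proof -
      show "Max (A h) \<in> A h" using finA neA[OF that] by (rule Max_in)
      fix i assume lt: "Max (A h) < i"
      show "lkp h i \<in> P"
      proof (rule ccontr)
        assume "lkp h i \<notin> P"
        moreover from this have "lkp h i \<noteq> 0" using ideal_of_0[OF Id] by metis
        ultimately have "i \<in> A h" by (simp add: A_def in_keys_iff)
        then show False using Max_ge[OF finA] lt by (meson not_le)
      qed
    qed
    define i0 where "i0 = Max (A f)"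
    define j0 where "j0 = Max (A g)"
    have i0: "i0 \<in> A f" "\<And>i. i0 < i \<Longrightarrow> lkp f i \<in> P"
      using maxA neg by (auto simp: i0_def)
    have j0: "j0 \<in> A g" "\<And>j. j0 < j \<Longrightarrow> lkp g j \<in> P"
      using maxA neg by (auto simp: j0_def)
    let ?K = "Poly_Mapping.keys f \<times> Poly_Mapping.keys g"
    define h where "h z = (lkp f (fst z) * lkp g (snd z) when fst z + snd z = i0 + j0)" for z
    have "lkp (f * g) (i0 + j0) = sum h ?K"
      by (simp add: lookup_mp_mult h_def sum.cartesian_product split_def)
    also have "\<dots> = h (i0, j0) + sum h (?K - {(i0, j0)})"
      using i0(1) j0(1) by (intro sum.remove) (auto simp: A_def)
    finally have e: "h (i0, j0) = lkp (f * g) (i0 + j0) - sum h (?K - {(i0, j0)})" by simp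
    have "h z \<in> P" if z: "z \<in> ?K - {(i0, j0)}" for z
    proof (cases "fst z + snd z = i0 + j0")
      case True
      have "i0 < fst z \<or> j0 < snd z"
      proof (rule ccontr)
        assume "\<not> ?thesis"
        then have le: "fst z \<le> i0" "snd z \<le> j0" by auto
        have "fst z = i0"
        proof (rule ccontr)
          assume "fst z \<noteq> i0"
          then have "fst z + snd z < i0 + j0" using le by (intro add_less_le_mono) auto
          then show False using True by simp
        qed
        then have "snd z = j0" using True by simp
        then show False using z \<open>fst z = i0\<close> by (metis Diff_iff insertI1 prod.collapse)
      qed
      then show ?thesis
        using i0(2) j0(2) True ideal_of_mult[OF Id UNIV_I] ideal_of_mult2[OF Id UNIV_I] by (auto simp: h_def)
    next
      case False
      then show ?thesis using ideal_of_0[OF Id] by (simp add: h_def)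
    qed
    then have "h (i0, j0) \<in> P"
      unfolding e using fg by (intro ideal_of_diff[OF Id subring_UNIV] ideal_of_sum[OF Id]) (auto simp: pt_def)
    then have "lkp f i0 * lkp g j0 \<in> P" by (simp add: h_def)
    then show False using prime_of_mult[OF P] i0(1) j0(1) by (auto simp: A_def)
  qed
qed

lemma dcoef_pt: "derivation d \<Longrightarrow> d ` P \<subseteq> P \<Longrightarrow> dcoef d ` pt P \<subseteq> pt P"
  by (auto simp: pt_def lookup_dcoef)

lemma dvar_pt:
  assumes "\<And>n x. x \<in> P \<Longrightarrow> of_nat n * x \<in> P"
  shows "dvar v ` pt P \<subseteq> pt P"
  using assms by (auto simp: pt_def lookup_dvar simp del: of_nat_Suc)

text \<open>The chosen representative does not matter: differentiating
  \<open>a * b' = a' * b\<close> and eliminating shows that both quotient rules agree.\<close>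

lemma frac_deriv_Fract:
  fixes d :: "'r::idom \<Rightarrow> 'r"
  assumes d: "derivation d" and b: "b \<noteq> 0"
  shows "frac_deriv d (Fract a b) = Fract (d a * b - a * d b) (b * b)"
proof -
  define z where "z = (SOME (a', b'). b' \<noteq> 0 \<and> Fract a b = Fract a' b')"
  have "\<exists>z. case z of (a', b') \<Rightarrow> b' \<noteq> 0 \<and> Fract a b = Fract a' b'" using b by (intro exI[of _ "(a, b)"]) auto
  from someI_ex[OF this] obtain a' b' where z: "z = (a', b')" "b' \<noteq> 0" "Fract a b = Fract a' b'"
    unfolding z_def[symmetric] by (cases z) auto
  have e: "a * b' = a' * b" using z b by (simp add: eq_fract)
  have "d (a * b') = d (a' * b)" by (simp only: e)
  then have e': "d a * b' + a * d b' = d a' * b + a' * d b" using d by (simp add: derivation_mult)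
  have "(d a' * b' - a' * d b') * (b * b) = (d a * b - a * d b) * (b' * b')"
    using e e' by algebra
  then have "Fract (d a' * b' - a' * d b') (b' * b') = Fract (d a * b - a * d b) (b * b)"
    using b z(2) by (simp add: eq_fract)
  moreover have "frac_deriv d (Fract a b) = Fract (d a' * b' - a' * d b') (b' * b')"
    unfolding frac_deriv_def z_def[symmetric] z(1) by simp
  ultimately show ?thesis by simp
qed

lemma derivation_frac_deriv:
  fixes d :: "'r::idom \<Rightarrow> 'r"
  assumes d: "derivation d"
  shows "derivation (frac_deriv d)"
  unfolding derivation_def
proof (intro conjI allI)
  fix x y :: "'r fract"
  obtain a b where x: "x = Fract a b" "b \<noteq> 0" by (cases x)
  obtain a' b' where y: "y = Fract a' b'" "b' \<noteq> 0" by (cases y)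
  show "frac_deriv d (x + y) = frac_deriv d x + frac_deriv d y"
    using x y d by (simp add: frac_deriv_Fract eq_fract derivation_add derivation_mult algebra_simps)
  show "frac_deriv d (x * y) = frac_deriv d x * y + x * frac_deriv d y"
    using x y d by (simp add: frac_deriv_Fract eq_fract derivation_mult algebra_simps)
qed

section \<open>Noetherian rings\<close>

definition lin :: "'r::comm_ring_1 set \<Rightarrow> 'r set \<Rightarrow> 'r set" where
  "lin R G = {x. \<exists>c. (\<forall>g. c g \<in> R) \<and> x = (\<Sum>g\<in>G. c g * g)}"

definition noeth :: "'r::comm_ring_1 set \<Rightarrow> bool" where
  "noeth R \<longleftrightarrow> (\<forall>I. ideal_of R I \<longrightarrow> (\<exists>G. finite G \<and> G \<subseteq> I \<and> I \<subseteq> lin R G))"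

lemma lin_0: "subring R \<Longrightarrow> 0 \<in> lin R G"
  unfolding lin_def by (auto intro!: exI[of _ "\<lambda>_. 0"] simp: subring_0)

lemma lin_add:
  assumes "subring R" "x \<in> lin R G" "y \<in> lin R G"
  shows "x + y \<in> lin R G"
proof -
  obtain c d where "\<And>g. c g \<in> R" "x = (\<Sum>g\<in>G. c g * g)" "\<And>g. d g \<in> R" "y = (\<Sum>g\<in>G. d g * g)"
    using assms by (auto simp: lin_def)
  then show ?thesis unfolding lin_def
    using assms(1) by (auto intro!: exI[of _ "\<lambda>g. c g + d g"] simp: subring_add sum.distrib distrib_right)
qed

lemma lin_scale:
  assumes "subring R" "x \<in> lin R G" "r \<in> R"
  shows "r * x \<in> lin R G"
proof -
  obtain c where "\<And>g. c g \<in> R" "x = (\<Sum>g\<in>G. c g * g)" using assms by (auto simp: lin_def)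
  then show ?thesis unfolding lin_def
    using assms(1,3) by (auto intro!: exI[of _ "\<lambda>g. r * c g"] simp: subring_mult sum_distrib_left mult.assoc)
qed

lemma lin_sum: "subring R \<Longrightarrow> (\<And>i. i \<in> A \<Longrightarrow> f i \<in> lin R G) \<Longrightarrow> sum f A \<in> lin R G"
  by (induction A rule: infinite_finite_induct) (auto intro: lin_0 lin_add)

lemma lin_base:
  assumes "subring R" "finite G" "g \<in> G"
  shows "g \<in> lin R G"
proof -
  have "g = (\<Sum>x\<in>G. (if x = g then 1 else 0) * x)"
    using assms by (simp add: if_distrib[of "\<lambda>z. z * _"] cong: if_cong)
  moreover have "\<forall>x. (if x = g then 1 else 0) \<in> R" using assms by (auto simp: subring_0 subring_1)
  ultimately show ?thesis unfolding lin_def by (intro CollectI exI[of _ "\<lambda>x. if x = g then 1 else 0"]) simp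
qed

text \<open>Hilbert's argument, with the ideal pulled back from \<open>R[x]\<close> to polynomials.
  The ideals \<open>LC n\<close> of coefficients at \<open>n\<close> increase; generators are lifted
  separately for each \<open>n \<le> nm\<close>, and beyond \<open>nm\<close> the lifts of the
  generators \<open>A\<close> of the union suffice after multiplication by monomials.\<close>

lemma hilbert_basis:
  fixes R :: "'r::idom set"
  assumes R: "subring R" and N: "noeth R"
  shows "noeth ((\<lambda>\<beta>. poly \<beta> x) ` poly_over R)"
  unfolding noeth_def
proof (intro allI impI)
  let ?S = "(\<lambda>\<beta>. poly \<beta> x) ` poly_over R"
  fix I assume I: "ideal_of ?S I"
  define M where "M = {\<beta>\<in>poly_over R. poly \<beta> x \<in> I}"
  have Madd: "\<beta> + \<gamma> \<in> M" if "\<beta> \<in> M" "\<gamma> \<in> M" for \<beta> \<gamma>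
    using that ideal_of_add[OF I] by (auto simp: M_def intro: poly_over_add R)
  have Mmult: "\<gamma> * \<beta> \<in> M" if "\<beta> \<in> M" "\<gamma> \<in> poly_over R" for \<beta> \<gamma>
    using that ideal_of_mult[OF I, of "poly \<gamma> x" "poly \<beta> x"] by (auto simp: M_def intro: poly_over_mult R)
  have M0: "0 \<in> M" using ideal_of_0[OF I] by (simp add: M_def poly_over_0 R)
  have Msum: "sum h A \<in> M" if "\<And>i. i \<in> A \<Longrightarrow> h i \<in> M" for h and A :: "'r set"
    using that by (induction A rule: infinite_finite_induct) (auto simp: M0 Madd)
  have smM: "smult c \<beta> \<in> M" if "\<beta> \<in> M" "c \<in> R" for c \<beta>
    using Mmult[OF that(1) poly_over_const[OF R that(2)]] by simp
  have monM: "monom 1 n * \<beta> \<in> M" if "\<beta> \<in> M" for n \<beta>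
    using that by (intro Mmult poly_over_monom R subring_1)
  define LC where "LC n = {coeff \<beta> n |\<beta>. \<beta> \<in> M \<and> degree \<beta> \<le> n}" for n
  have LC_ideal: "ideal_of R (LC n)" for n
    unfolding ideal_of_def
  proof (intro conjI ballI)
    show "LC n \<subseteq> R" by (auto simp: LC_def M_def poly_over_def)
    show "0 \<in> LC n" unfolding LC_def using M0 by (intro CollectI exI[of _ 0]) auto
    show "a + b \<in> LC n" if ab: "a \<in> LC n" "b \<in> LC n" for a b
    proof -
      from ab obtain \<beta> \<gamma> where "\<beta> \<in> M" "degree \<beta> \<le> n" "a = coeff \<beta> n" "\<gamma> \<in> M" "degree \<gamma> \<le> n" "b = coeff \<gamma> n"
        by (auto simp: LC_def)
      then show ?thesis unfolding LC_def
        using Madd degree_add_le[of \<beta> n \<gamma>] by (intro CollectI exI[of _ "\<beta> + \<gamma>"]) auto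
    qed
    show "r * a \<in> LC n" if ra: "r \<in> R" "a \<in> LC n" for r a
    proof -
      from ra obtain \<beta> where "\<beta> \<in> M" "degree \<beta> \<le> n" "a = coeff \<beta> n" by (auto simp: LC_def)
      then show ?thesis unfolding LC_def
        using smM ra(1) degree_smult_le[of r \<beta>] by (intro CollectI exI[of _ "smult r \<beta>"]) auto
    qed
  qed
  have LC_mono: "LC n \<subseteq> LC (n + i)" for n i
  proof
    fix a assume "a \<in> LC n"
    then obtain \<beta> where b: "\<beta> \<in> M" "degree \<beta> \<le> n" "a = coeff \<beta> n" by (auto simp: LC_def)
    have "degree (monom 1 i * \<beta>) \<le> n + i"
      using degree_mult_le[of "monom (1::'r) i" \<beta>] b(2) by (simp add: degree_monom_eq)
    moreover have "coeff (monom 1 i * \<beta>) (n + i) = a" using b by (simp add: coeff_monom_mult)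
    ultimately show "a \<in> LC (n + i)" unfolding LC_def using monM[OF b(1)] by blast
  qed
  have "ideal_of R (\<Union>n. LC n)"
    unfolding ideal_of_def
  proof (intro conjI ballI)
    show "(\<Union>n. LC n) \<subseteq> R" using LC_ideal ideal_of_subset by blast
    show "0 \<in> (\<Union>n. LC n)" using ideal_of_0[OF LC_ideal] by blast
    show "a + b \<in> (\<Union>n. LC n)" if ab: "a \<in> (\<Union>n. LC n)" "b \<in> (\<Union>n. LC n)" for a b
    proof -
      from ab obtain i j where "a \<in> LC i" "b \<in> LC j" by blast
      then have "a \<in> LC (i + j)" "b \<in> LC (i + j)" using LC_mono[of i j] LC_mono[of j i] by (auto simp: add.commute)
      then show ?thesis using ideal_of_add[OF LC_ideal] by blast
    qed
    show "r * a \<in> (\<Union>n. LC n)" if "r \<in> R" "a \<in> (\<Union>n. LC n)" for r a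
      using that ideal_of_mult[OF LC_ideal] by blast
  qed
  then obtain A where A: "finite A" "A \<subseteq> (\<Union>n. LC n)" "(\<Union>n. LC n) \<subseteq> lin R A"
    using N unfolding noeth_def by meson
  have "\<forall>a\<in>A. \<exists>n. a \<in> LC n" using A(2) by blast
  then obtain d where d: "\<And>a. a \<in> A \<Longrightarrow> a \<in> LC (d a)" by metis
  define nm where "nm = (\<Sum>a\<in>A. d a)"
  have dnm: "d a \<le> nm" if "a \<in> A" for a unfolding nm_def using A(1) that by (intro member_le_sum) auto
  have "LC n \<subseteq> lin R A" for n using A(3) by blast
  moreover have "A \<subseteq> LC n" if "nm \<le> n" for n
  proof
    fix a assume a: "a \<in> A"
    then have "d a \<le> n" using dnm that order_trans by blast
    then show "a \<in> LC n" using d[OF a] LC_mono[of "d a" "n - d a"] by auto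
  qed
  ultimately have big: "A \<subseteq> LC n \<and> LC n \<subseteq> lin R A" if "nm \<le> n" for n using that by blast
  have "\<forall>n. \<exists>G. finite G \<and> G \<subseteq> LC n \<and> LC n \<subseteq> lin R G"
    using N LC_ideal unfolding noeth_def by blast
  then obtain B where B: "\<And>n. finite (B n)" "\<And>n. B n \<subseteq> LC n" "\<And>n. LC n \<subseteq> lin R (B n)" by metis
  have "\<forall>n a. \<exists>\<beta>. a \<in> LC n \<longrightarrow> \<beta> \<in> M \<and> degree \<beta> \<le> n \<and> coeff \<beta> n = a" by (auto simp: LC_def)
  then obtain f where f: "\<And>n a. a \<in> LC n \<Longrightarrow> f n a \<in> M \<and> degree (f n a) \<le> n \<and> coeff (f n a) n = a" by metis
  define G where "G = (\<Union>n\<le>nm. f n ` B n) \<union> f nm ` A"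
  have finG: "finite G" using B A by (simp add: G_def)
  have GM: "G \<subseteq> M" using f B(2) big[of nm] by (fastforce simp: G_def)
  note PR = subring_poly_over[OF R]
  have main: "\<beta> \<in> M \<Longrightarrow> (\<forall>i\<ge>n. coeff \<beta> i = 0) \<Longrightarrow> \<beta> \<in> lin (poly_over R) G" for n \<beta>
  proof (induction n arbitrary: \<beta>)
    case 0
    then have "\<beta> = 0" by (intro poly_eqI) auto
    then show ?case using lin_0[OF PR] by simp
  next
    case (Suc n)
    have "degree \<beta> \<le> n" using Suc.prems(2) by (intro degree_le) auto
    then have aLC: "coeff \<beta> n \<in> LC n" using Suc.prems(1) by (auto simp: LC_def)
    have "\<exists>\<gamma>\<in>M. \<gamma> \<in> lin (poly_over R) G \<and> degree \<gamma> \<le> n \<and> coeff \<gamma> n = coeff \<beta> n"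
    proof (cases "n \<le> nm")
      case True
      obtain c where c: "\<And>g. c g \<in> R" "coeff \<beta> n = (\<Sum>g\<in>B n. c g * g)"
        using aLC B(3)[of n] by (auto simp: lin_def)
      have fB: "f n g \<in> M \<and> degree (f n g) \<le> n \<and> coeff (f n g) n = g \<and> f n g \<in> G" if "g \<in> B n" for g
        using f[of g n] B(2)[of n] that True by (auto simp: G_def)
      define \<gamma> where "\<gamma> = (\<Sum>g\<in>B n. [:c g:] * f n g)"
      have "\<gamma> \<in> lin (poly_over R) G"
        unfolding \<gamma>_def using fB c(1) finG by (intro lin_sum[OF PR] lin_scale[OF PR] lin_base[OF PR] poly_over_const R) auto
      moreover have "\<gamma> \<in> M"
        unfolding \<gamma>_def using fB smM c(1) by (intro Msum) auto
      moreover have "degree \<gamma> \<le> n"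
        unfolding \<gamma>_def using fB degree_smult_le order_trans by (intro degree_sum_le B(1)) fastforce
      moreover have "coeff \<gamma> n = coeff \<beta> n" using fB by (simp add: \<gamma>_def coeff_sum c(2))
      ultimately show ?thesis by blast
    next
      case False
      then have nn: "nm \<le> n" by simp
      obtain c where c: "\<And>g. c g \<in> R" "coeff \<beta> n = (\<Sum>g\<in>A. c g * g)"
        using aLC big[OF nn] unfolding lin_def by blast
      have fA: "f nm g \<in> M \<and> degree (f nm g) \<le> nm \<and> coeff (f nm g) nm = g \<and> f nm g \<in> G" if "g \<in> A" for g
        using f[of g nm] big[of nm] that by (auto simp: G_def)
      define t where "t g = monom (c g) (n - nm) * f nm g" for g
      have t: "t g \<in> M" "t g \<in> lin (poly_over R) G" "degree (t g) \<le> n" "coeff (t g) n = c g * g" if "g \<in> A" for g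
      proof -
        show "t g \<in> M" unfolding t_def using fA[OF that] c(1) by (intro Mmult poly_over_monom R) auto
        show "t g \<in> lin (poly_over R) G"
          unfolding t_def using fA[OF that] c(1) finG by (intro lin_scale[OF PR] lin_base[OF PR] poly_over_monom R) auto
        show "degree (t g) \<le> n"
          unfolding t_def using degree_mult_le[of "monom (c g) (n - nm)" "f nm g"] fA[OF that] nn
            degree_monom_le[of "c g" "n - nm"] by linarith
        show "coeff (t g) n = c g * g" unfolding t_def using fA[OF that] nn by (simp add: coeff_monom_mult)
      qed
      define \<gamma> where "\<gamma> = (\<Sum>g\<in>A. t g)"
      have "\<gamma> \<in> lin (poly_over R) G" unfolding \<gamma>_def using t by (intro lin_sum[OF PR])
      moreover have "\<gamma> \<in> M"
        unfolding \<gamma>_def using t(1) by (intro Msum)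
      moreover have "degree \<gamma> \<le> n" unfolding \<gamma>_def using t(3) A(1) by (intro degree_sum_le) auto
      moreover have "coeff \<gamma> n = coeff \<beta> n" using t(4) by (simp add: \<gamma>_def coeff_sum c(2))
      ultimately show ?thesis by blast
    qed
    then obtain \<gamma> where \<gamma>: "\<gamma> \<in> M" "\<gamma> \<in> lin (poly_over R) G" "degree \<gamma> \<le> n" "coeff \<gamma> n = coeff \<beta> n" by blast
    have "\<beta> - \<gamma> \<in> M" using Madd[OF Suc.prems(1) smM[OF \<gamma>(1), of "- 1"]] R by (simp add: subring_1 subring_uminus)
    moreover have "\<forall>i\<ge>n. coeff (\<beta> - \<gamma>) i = 0"
    proof (intro allI impI)
      fix i assume "n \<le> i"
      then show "coeff (\<beta> - \<gamma>) i = 0"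
        using \<gamma>(3,4) Suc.prems(2) by (cases "i = n") (auto simp: coeff_eq_0)
    qed
    ultimately have "\<beta> - \<gamma> \<in> lin (poly_over R) G" by (rule Suc.IH)
    then show ?case using lin_add[OF PR _ \<gamma>(2), of "\<beta> - \<gamma>"] by simp
  qed
  define H where "H = (\<lambda>\<beta>. poly \<beta> x) ` G"
  have S: "subring ?S" by (rule subring_image[OF R])
  have "I \<subseteq> lin ?S H"
  proof
    fix u assume "u \<in> I"
    then obtain \<beta> where b: "\<beta> \<in> poly_over R" "u = poly \<beta> x" using ideal_of_subset[OF I] by blast
    then have "\<beta> \<in> M" using \<open>u \<in> I\<close> by (simp add: M_def)
    then have "\<beta> \<in> lin (poly_over R) G" by (rule main[of _ "Suc (degree \<beta>)"]) (auto simp: coeff_eq_0)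
    then obtain c where c: "\<And>g. c g \<in> poly_over R" "\<beta> = (\<Sum>g\<in>G. c g * g)" by (auto simp: lin_def)
    have "u = (\<Sum>g\<in>G. poly (c g) x * poly g x)" by (simp add: b(2) c(2) poly_sum)
    also have "\<dots> \<in> lin ?S H"
      using c(1) finG by (intro lin_sum[OF S] lin_scale[OF S] lin_base[OF S]) (auto simp: H_def)
    finally show "u \<in> lin ?S H" .
  qed
  moreover have "finite H" "H \<subseteq> I" using finG GM by (auto simp: H_def M_def)
  ultimately show "\<exists>G. finite G \<and> G \<subseteq> I \<and> I \<subseteq> lin ?S G" by blast
qed

lemma noeth_pring:
  fixes k :: "'r::idom set"
  assumes k: "subfield k"
  shows "noeth (pring k X {..<r::nat})"
proof (induction r)
  case 0
  have kr: "subring k" using k by (simp add: subfield_def)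
  have "\<exists>G. finite G \<and> G \<subseteq> I \<and> I \<subseteq> lin k G" if I: "ideal_of k I" for I
  proof (cases "I = {0}")
    case True
    then show ?thesis using lin_0[OF kr] by (intro exI[of _ "{}"]) auto
  next
    case False
    then obtain c where c: "c \<in> I" "c \<noteq> 0" using ideal_of_0[OF I] by blast
    then obtain v where v: "v \<in> k" "c * v = 1" using k ideal_of_subset[OF I] by (auto simp: subfield_def)
    have "x \<in> lin k {c}" if "x \<in> I" for x
    proof -
      have "x = (x * v) * c" using v by (simp add: mult.assoc mult.commute[of v])
      moreover have "x * v \<in> k" using v that ideal_of_subset[OF I] subring_mult[OF kr] by blast
      ultimately show ?thesis using lin_scale[OF kr lin_base[OF kr, of "{c}" c]] by (metis finite.emptyI finite_insert insertI1)
    qed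
    then show ?thesis using c by (intro exI[of _ "{c}"]) auto
  qed
  then show ?case by (simp add: noeth_def pring_empty[OF kr])
next
  case (Suc r)
  have kr: "subring k" using k by (simp add: subfield_def)
  have "{..<Suc r} - {r} = {..<r}" by auto
  then show ?case
    using hilbert_basis[OF subring_pring[OF kr] Suc] pring_insert_eq[OF kr, of r "{..<Suc r}" X] by simp
qed

text \<open>Noetherian induction. An ideal maximal among the counterexamples is not prime; if
  \<open>x * y\<close> lies in it without \<open>x\<close> and \<open>y\<close>, every prime above
  it contains \<open>x\<close> or \<open>y\<close>, so the finite sets for the two enlarged ideals
  together serve.\<close>

lemma finitely_many_minimal_primes:
  fixes I0 :: "'r::comm_ring_1 set"
  assumes N: "noeth (UNIV :: 'r set)" and I0: "ideal_of UNIV I0"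
  shows "\<exists>Ps. finite Ps \<and> (\<forall>P\<in>Ps. prime_of UNIV P \<and> I0 \<subseteq> P) \<and>
    (\<forall>P. prime_of UNIV P \<longrightarrow> I0 \<subseteq> P \<longrightarrow> (\<exists>P'\<in>Ps. P' \<subseteq> P))"
proof (rule ccontr)
  define T where "T I \<longleftrightarrow> (\<exists>Ps. finite Ps \<and> (\<forall>P\<in>Ps. prime_of UNIV P \<and> I \<subseteq> P) \<and>
    (\<forall>P. prime_of UNIV P \<longrightarrow> I \<subseteq> P \<longrightarrow> (\<exists>P'\<in>Ps. P' \<subseteq> P)))" for I :: "'r set"
  define F where "F = {I. ideal_of UNIV I \<and> \<not> T I}"
  assume "\<not> ?thesis"
  then have "I0 \<in> F" using I0 by (simp add: F_def T_def)
  have "\<exists>M\<in>F. \<forall>X\<in>F. M \<subseteq> X \<longrightarrow> X = M"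
  proof (rule subset_Zorn)
    fix C assume C: "subset.chain F C"
    show "\<exists>U\<in>F. \<forall>X\<in>C. X \<subseteq> U"
    proof (cases "C = {}")
      case True
      then show ?thesis using \<open>I0 \<in> F\<close> by blast
    next
      case False
      have CF: "\<And>X. X \<in> C \<Longrightarrow> X \<in> F" using C by (auto simp: subset.chain_def)
      have lin: "\<And>X Y. X \<in> C \<Longrightarrow> Y \<in> C \<Longrightarrow> X \<subseteq> Y \<or> Y \<subseteq> X" using C by (auto simp: subset.chain_def)
      have idC: "\<And>X. X \<in> C \<Longrightarrow> ideal_of UNIV X" using CF by (auto simp: F_def)
      have "ideal_of UNIV (\<Union>C)"
        unfolding ideal_of_def
      proof (intro conjI ballI)
        show "0 \<in> \<Union>C" using False idC ideal_of_0 by blast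
        fix x y assume "x \<in> \<Union>C" "y \<in> \<Union>C"
        then obtain X Y where "X \<in> C" "Y \<in> C" "x \<in> X" "y \<in> Y" by blast
        then show "x + y \<in> \<Union>C" using lin[of X Y] idC ideal_of_add by (metis UnionI subsetD)
      next
        fix r x assume "x \<in> \<Union>C"
        then show "r * x \<in> \<Union>C" using idC ideal_of_mult by (metis UNIV_I Union_iff)
      qed simp
      then obtain G where G: "finite G" "G \<subseteq> \<Union>C" "\<Union>C \<subseteq> lin UNIV G" using N unfolding noeth_def by meson
      \<comment> \<open>The finitely many generators of the union of the chain already lie in one
        member, so the union is that member.\<close>
      have "\<exists>X\<in>C. G \<subseteq> X"
        using G(1,2)
      proof (induction G rule: finite_induct)
        case empty
        then show ?case using False by blast
      next
        case (insert g G)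
        then obtain X Y where "X \<in> C" "G \<subseteq> X" "Y \<in> C" "g \<in> Y" by auto
        then show ?case using lin[of X Y] by blast
      qed
      then obtain X where X: "X \<in> C" "G \<subseteq> X" by blast
      have "lin UNIV G \<subseteq> X"
        using X(2) idC[OF X(1)] by (auto simp: lin_def intro!: ideal_of_sum[OF idC[OF X(1)]] ideal_of_mult[OF idC[OF X(1)]])
      then have "\<Union>C \<subseteq> X" using G(3) by blast
      then show ?thesis using CF[OF X(1)] by blast
    qed
  qed
  then obtain I where I: "I \<in> F" and max: "\<And>X. X \<in> F \<Longrightarrow> I \<subseteq> X \<Longrightarrow> X = I" by blast
  have Id: "ideal_of UNIV I" and nT: "\<not> T I" using I by (auto simp: F_def)
  have "1 \<notin> I"
  proof
    assume "1 \<in> I"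
    then have "\<And>P. prime_of UNIV P \<Longrightarrow> \<not> I \<subseteq> P" using prime_of_1 by blast
    then have "T I" unfolding T_def by (intro exI[of _ "{}"]) auto
    then show False using nT by blast
  qed
  have "\<not> prime_of UNIV I"
  proof
    assume "prime_of UNIV I"
    then have "T I" unfolding T_def by (intro exI[of _ "{I}"]) auto
    then show False using nT by blast
  qed
  then obtain x y where xy: "x * y \<in> I" "x \<notin> I" "y \<notin> I"
    using Id \<open>1 \<notin> I\<close> by (auto simp: prime_of_def)
  define E where "E u = {i + r * u |i r. i \<in> I}" for u
  have E_ideal: "ideal_of UNIV (E u)" for u
    unfolding ideal_of_def
  proof (intro conjI ballI)
    show "0 \<in> E u" unfolding E_def using ideal_of_0[OF Id] by (intro CollectI exI[of _ 0]) auto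
    fix a b assume "a \<in> E u" "b \<in> E u"
    then obtain i r i' r' where "a = i + r * u" "b = i' + r' * u" "i \<in> I" "i' \<in> I" by (auto simp: E_def)
    then have "a + b = (i + i') + (r + r') * u \<and> i + i' \<in> I" using ideal_of_add[OF Id] by (auto simp: algebra_simps)
    then show "a + b \<in> E u" unfolding E_def by blast
  next
    fix s a assume "a \<in> E u"
    then obtain i r where "a = i + r * u" "i \<in> I" by (auto simp: E_def)
    then have "s * a = s * i + (s * r) * u \<and> s * i \<in> I" using ideal_of_mult[OF Id, of s i] by (simp add: algebra_simps)
    then show "s * a \<in> E u" unfolding E_def by blast
  qed simp
  have IE: "I \<subseteq> E u" for u
  proof
    fix i assume "i \<in> I"
    then have "i = i + 0 * u \<and> i \<in> I" by simp
    then show "i \<in> E u" unfolding E_def by blast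
  qed
  have uE: "u \<in> E u" for u
  proof -
    have "u = 0 + 1 * u \<and> 0 \<in> I" using ideal_of_0[OF Id] by simp
    then show ?thesis unfolding E_def by blast
  qed
  have TE: "T (E u)" if "u \<notin> I" for u
    using max[of "E u"] IE[of u] uE[of u] E_ideal[of u] that by (auto simp: F_def)
  obtain Ps where Ps: "finite Ps" "\<And>P. P \<in> Ps \<Longrightarrow> prime_of UNIV P \<and> E x \<subseteq> P"
    "\<And>P. prime_of UNIV P \<Longrightarrow> E x \<subseteq> P \<Longrightarrow> \<exists>P'\<in>Ps. P' \<subseteq> P" using TE[OF xy(2)] unfolding T_def by blast
  obtain Qs where Qs: "finite Qs" "\<And>P. P \<in> Qs \<Longrightarrow> prime_of UNIV P \<and> E y \<subseteq> P"
    "\<And>P. prime_of UNIV P \<Longrightarrow> E y \<subseteq> P \<Longrightarrow> \<exists>P'\<in>Qs. P' \<subseteq> P" using TE[OF xy(3)] unfolding T_def by blast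
  have E_sub: "E u \<subseteq> P" if "prime_of UNIV P" "I \<subseteq> P" "u \<in> P" for u P
    using that ideal_of_add[OF prime_of_ideal[OF that(1)]] ideal_of_mult[OF prime_of_ideal[OF that(1)] UNIV_I]
    by (auto simp: E_def)
  have "T I"
    unfolding T_def
  proof (intro exI[of _ "Ps \<union> Qs"] conjI ballI allI impI)
    show "finite (Ps \<union> Qs)" using Ps(1) Qs(1) by simp
    show "prime_of UNIV P" "I \<subseteq> P" if "P \<in> Ps \<union> Qs" for P using that Ps(2) Qs(2) IE by blast+
    fix P assume P: "prime_of UNIV P" "I \<subseteq> P"
    then have "x \<in> P \<or> y \<in> P" using prime_of_mult[OF P(1), of x y] xy(1) by blast
    then have "E x \<subseteq> P \<or> E y \<subseteq> P" using E_sub[OF P] by blast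
    then show "\<exists>P'\<in>Ps \<union> Qs. P' \<subseteq> P" using Ps(3)[OF P(1)] Qs(3)[OF P(1)] by blast
  qed
  then show False using nT by blast
qed

lemma is_prime_ideal_iff: "is_prime_ideal P \<longleftrightarrow> prime_of UNIV P"
proof -
  have "P \<noteq> UNIV \<longleftrightarrow> 1 \<notin> P" if "\<And>r x. x \<in> P \<Longrightarrow> r * x \<in> P"
    using that[of 1] by auto
  then show ?thesis
    unfolding is_prime_ideal_def is_ideal_def prime_of_def ideal_of_def by auto
qed

text \<open>A height one prime that contains \<open>a\<close> equals a minimal prime over
  \<open>(a)\<close>. This permits discarding the primes that contain a given denominator.\<close>

lemma finite_height_one_containing:
  fixes a :: "'r::idom"
  assumes N: "noeth (UNIV :: 'r set)" and a: "a \<noteq> 0"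
  shows "finite {P. height_one_prime P \<and> a \<in> P}"
proof -
  have Id: "ideal_of UNIV (range ((*) a))" by (rule ideal_of_principal[OF subring_UNIV UNIV_I])
  obtain Ps where Ps: "finite Ps" "\<forall>P\<in>Ps. prime_of UNIV P \<and> range ((*) a) \<subseteq> P"
    "\<forall>P. prime_of UNIV P \<longrightarrow> range ((*) a) \<subseteq> P \<longrightarrow> (\<exists>P'\<in>Ps. P' \<subseteq> P)"
    using finitely_many_minimal_primes[OF N Id] by blast
  have "P \<in> Ps" if P: "height_one_prime P" "a \<in> P" for P
  proof -
    have pP: "prime_of UNIV P" using P by (simp add: height_one_prime_def is_prime_ideal_iff)
    have "range ((*) a) \<subseteq> P" using ideal_of_mult2[OF prime_of_ideal[OF pP]] P(2) by auto
    then obtain P' where P': "P' \<in> Ps" "P' \<subseteq> P" using Ps(3) pP by blast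
    have "a * 1 \<in> P'" using P'(1) Ps(2) by blast
    then have "P' \<noteq> {0}" using a by auto
    then have "P' = P" using P P' Ps(2) by (auto simp: height_one_prime_def is_prime_ideal_iff)
    then show ?thesis using P' by simp
  qed
  then show ?thesis using Ps(1) by (auto intro: finite_subset[of _ Ps])
qed

section \<open>Transcendence bases\<close>

lemma transc_mono: "transc S x \<Longrightarrow> R \<subseteq> S \<Longrightarrow> transc R x"
  using poly_over_mono[of R S] by (auto simp: transc_def)

lemma not_transc_self:
  assumes "subring R" "x \<in> R"
  shows "\<not> transc R x"
proof
  assume "transc R x"
  moreover have "[:- x, 1:] \<in> poly_over R"
    using assms by (intro poly_over_pCons poly_over_0 subring_1 subring_uminus)
  ultimately show False by (auto dest: transcD)
qed

text \<open>A polynomial in \<open>X a\<close> with coefficients involving \<open>X b\<close> is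
  rewritten as a polynomial \<open>?g\<close> in \<open>X b\<close>. Transcendence of
  \<open>X b\<close> kills the coefficients of \<open>?g\<close>, and independence of
  \<open>J\<close> then kills the double coefficients.\<close>

lemma alg_indep_insert:
  assumes k: "subring k" and J: "alg_indep k X J" and b: "b \<notin> J" "transc (pring k X J) (X b)"
  shows "alg_indep k X (insert b J)"
  unfolding alg_indep_def
proof
  fix a assume a: "a \<in> insert b J"
  show "transc (pring k X (insert b J - {a})) (X a)"
  proof (cases "a = b")
    case True
    then show ?thesis using b by simp
  next
    case False
    then have aJ: "a \<in> J" using a by simp
    let ?R = "pring k X (J - {a})"
    have e: "insert b J - {a} = insert b (J - {a})" "insert b (J - {a}) - {b} = J - {a}" using False b by auto
    show ?thesis
      unfolding transc_def e(1)
    proof (intro ballI impI)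
      fix \<beta> assume \<beta>: "\<beta> \<in> poly_over (pring k X (insert b (J - {a})))" "poly \<beta> (X a) = 0"
      have "\<forall>j. \<exists>\<gamma>. \<gamma> \<in> poly_over ?R \<and> poly \<gamma> (X b) = coeff \<beta> j"
        using pring_expand[OF k, of b "insert b (J - {a})"] poly_overD[OF \<beta>(1)] unfolding e(2) by blast
      then obtain \<gamma> where \<gamma>: "\<And>j. \<gamma> j \<in> poly_over ?R" "\<And>j. poly (\<gamma> j) (X b) = coeff \<beta> j"
        unfolding choice_iff by blast
      let ?g = "\<Sum>j\<le>degree \<beta>. smult (X a ^ j) (\<gamma> j)"
      have PR: "subring (poly_over (pring k X J))" by (rule subring_poly_over[OF subring_pring[OF k]])
      have "?g \<in> poly_over (pring k X J)"
        using \<gamma>(1) aJ poly_over_mono[OF pring_mono[of "J - {a}" J k X]]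
        by (intro subring_sum[OF PR] poly_over_smult subring_pring k subring_power var_pring) auto
      moreover have "poly ?g (X b) = 0"
        using \<beta>(2) by (simp add: poly_sum \<gamma>(2) poly_altdef[of \<beta>] mult.commute)
      ultimately have g0: "?g = 0" using b(2) transcD by blast
      have "\<gamma> j = 0" if j: "j \<le> degree \<beta>" for j
      proof (rule poly_eqI)
        fix i
        let ?h = "\<Sum>j\<le>degree \<beta>. monom (coeff (\<gamma> j) i) j"
        have "?h \<in> poly_over ?R"
          using \<gamma>(1) by (intro subring_sum[OF subring_poly_over] poly_over_monom subring_pring k) (rule poly_overD)
        moreover have "poly ?h (X a) = coeff ?g i" by (simp add: poly_sum poly_monom coeff_sum mult.commute)
        ultimately have h0: "?h = 0" using g0 J aJ by (auto simp: alg_indep_def dest: transcD)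
        have "coeff ?h j = coeff (\<gamma> j) i" using j by (simp add: coeff_sum)
        then show "coeff (\<gamma> j) i = coeff 0 i" using h0 by simp
      qed
      then have "coeff \<beta> j = 0" for j using \<gamma>(2)[of j] by (cases "j \<le> degree \<beta>") (auto simp: coeff_eq_0)
      then show "\<beta> = 0" by (intro poly_eqI) simp
    qed
  qed
qed

lemma exists_basis:
  assumes k: "subring k" and T: "finite T" and S: "S \<subseteq> T" "alg_indep k X S"
  shows "\<exists>I. S \<subseteq> I \<and> I \<subseteq> T \<and> alg_indep k X I \<and> (\<forall>b\<in>T. \<not> transc (pring k X I) (X b))"
proof -
  let ?F = "{I. I \<subseteq> T \<and> alg_indep k X I}"
  have "finite ?F" using T by (intro finite_subset[of ?F "Pow T"]) auto
  then obtain I where I: "I \<in> ?F" "S \<subseteq> I" "\<And>I'. I' \<in> ?F \<Longrightarrow> I \<subseteq> I' \<Longrightarrow> I = I'"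
    using finite_has_maximal2[of ?F S] S by auto
  have "\<not> transc (pring k X I) (X b)" if b: "b \<in> T" for b
  proof (cases "b \<in> I")
    case True
    then show ?thesis by (intro not_transc_self subring_pring k var_pring)
  next
    case False
    show ?thesis
    proof
      assume "transc (pring k X I) (X b)"
      then have "alg_indep k X (insert b I)" using alg_indep_insert[OF k] I(1) False by blast
      then show False using I(3)[of "insert b I"] I(1) b False by auto
    qed
  qed
  then show ?thesis using I by blast
qed

text \<open>After inverting one nonzero \<open>s\<close>, the ring \<open>S\<close> lies in a
  finitely generated module over \<open>R\<close>. This takes the place of finite dimension over the
  fraction field and keeps transitivity of algebraicity inside the given rings.\<close>

definition almost_fg :: "'r::comm_ring_1 set \<Rightarrow> 'r set \<Rightarrow> bool" where
  "almost_fg R S \<longleftrightarrow> (\<exists>s\<in>R. \<exists>G. s \<noteq> 0 \<and> finite G \<and> (\<forall>x\<in>S. \<exists>i. s ^ i * x \<in> lin R G))"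

lemma lin_pow_mono:
  assumes R: "subring R" and s: "s \<in> R" and x: "s ^ i * x \<in> lin R G" and "i \<le> j"
  shows "s ^ j * x \<in> lin R G"
proof -
  have "s ^ j * x = s ^ (j - i) * (s ^ i * x)" using \<open>i \<le> j\<close> by (simp add: mult.assoc[symmetric] power_add[symmetric])
  then show ?thesis using lin_scale[OF R x subring_power[OF R s]] by simp
qed

lemma lin_pow_common:
  assumes R: "subring R" and s: "s \<in> R" and U: "finite U" and "\<And>u. u \<in> U \<Longrightarrow> \<exists>i. s ^ i * f u \<in> lin R G"
  shows "\<exists>i. \<forall>u\<in>U. s ^ i * f u \<in> lin R G"
proof -
  have "\<forall>u\<in>U. \<exists>i. s ^ i * f u \<in> lin R G" using assms by blast
  then obtain i where i: "\<forall>u\<in>U. s ^ i u * f u \<in> lin R G" unfolding bchoice_iff by blast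
  have "s ^ sum i U * f u \<in> lin R G" if "u \<in> U" for u
    using that i U by (auto intro!: lin_pow_mono[OF R s _ member_le_sum, of i])
  then show ?thesis by blast
qed

text \<open>With \<open>card G\<close> generators, the \<open>card G + 1\<close> powers of
  \<open>f\<close> up to exponent \<open>card G\<close> satisfy a linear relation over
  \<open>R\<close>.\<close>

lemma almost_fg_algebraic:
  fixes R :: "'r::idom set"
  assumes R: "subring R" and S: "subring S" and RS: "almost_fg R S" and f: "f \<in> S"
  shows "\<not> transc R f"
proof
  assume tr: "transc R f"
  obtain s G where s: "s \<in> R" "s \<noteq> 0" and G: "finite G" "\<And>x. x \<in> S \<Longrightarrow> \<exists>i. s ^ i * x \<in> lin R G"
    using RS by (auto simp: almost_fg_def)
  let ?U = "{..card G}"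
  obtain i where "\<forall>u\<in>?U. s ^ i * f ^ u \<in> lin R G"
    using lin_pow_common[OF R s(1), of ?U "\<lambda>u. f ^ u" G] G(2) f S by (auto simp: subring_power)
  then have "\<forall>u\<in>?U. \<exists>c. (\<forall>g. c g \<in> R) \<and> s ^ i * f ^ u = (\<Sum>g\<in>G. c g * g)" by (auto simp: lin_def)
  then obtain c where c: "\<And>u g. u \<in> ?U \<Longrightarrow> c u g \<in> R" "\<And>u. u \<in> ?U \<Longrightarrow> s ^ i * f ^ u = (\<Sum>g\<in>G. c u g * g)"
    unfolding bchoice_iff by blast
  obtain l where l: "\<And>u. l u \<in> R" "\<exists>u\<in>?U. l u \<noteq> 0" "\<And>g. g \<in> G \<Longrightarrow> (\<Sum>u\<in>?U. l u * c u g) = 0"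
  proof -
    have "\<exists>l. (\<forall>u. l u \<in> R) \<and> (\<exists>u\<in>?U. l u \<noteq> 0) \<and> (\<forall>g\<in>G. (\<Sum>u\<in>?U. l u * c u g) = 0)"
      using c(1) by (intro linear_system[OF R G(1)]) auto
    then show ?thesis using that by blast
  qed
  let ?\<beta> = "\<Sum>u\<in>?U. monom (l u) u"
  have "s ^ i * poly ?\<beta> f = (\<Sum>u\<in>?U. l u * (s ^ i * f ^ u))"
    by (simp add: poly_sum poly_monom sum_distrib_left mult_ac)
  also have "\<dots> = (\<Sum>u\<in>?U. \<Sum>g\<in>G. l u * c u g * g)"
    using c(2) by (intro sum.cong refl) (simp add: sum_distrib_left mult.assoc)
  also have "\<dots> = (\<Sum>g\<in>G. (\<Sum>u\<in>?U. l u * c u g) * g)"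
    unfolding sum_distrib_right by (rule sum.swap)
  also have "\<dots> = 0" using l(3) by simp
  finally have "poly ?\<beta> f = 0" using s by simp
  moreover have "?\<beta> \<in> poly_over R"
    by (intro subring_sum[OF subring_poly_over] poly_over_monom R l(1))
  ultimately have z: "?\<beta> = 0" using tr transcD by blast
  have "l u = 0" if "u \<in> ?U" for u
  proof -
    have "coeff ?\<beta> u = l u" using that by (simp add: coeff_sum)
    then show ?thesis using z by simp
  qed
  then show False using l(2) by blast
qed

text \<open>The constant term of a relation of least degree is nonzero, since \<open>f\<close> could
  otherwise be cancelled, and it is a multiple of \<open>f\<close>.\<close>

lemma algebraic_multiple:
  fixes R :: "'r::idom set"
  assumes S: "subring S" "R \<subseteq> S" and f: "f \<in> S" "f \<noteq> 0" "\<not> transc R f"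
  shows "\<exists>w\<in>S. f * w \<in> R \<and> f * w \<noteq> 0"
proof -
  define N where "N = {\<beta>\<in>poly_over R. \<beta> \<noteq> 0 \<and> poly \<beta> f = 0}"
  have "N \<noteq> {}" using f(3) by (auto simp: N_def transc_def)
  then obtain \<beta> where \<beta>: "\<beta> \<in> N" "\<And>\<gamma>. \<gamma> \<in> N \<Longrightarrow> degree \<beta> \<le> degree \<gamma>"
    using ex_has_least_nat[of "\<lambda>\<gamma>. \<gamma> \<in> N" _ degree] by blast
  obtain c \<gamma> where e: "\<beta> = pCons c \<gamma>" by (cases \<beta>)
  have \<gamma>: "\<gamma> \<in> poly_over R" "c \<in> R"
  proof -
    show "\<gamma> \<in> poly_over R"
      unfolding poly_over_def using \<beta>(1) e by (auto simp: N_def dest!: poly_overD[of _ _ "Suc _"])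
    show "c \<in> R" using \<beta>(1) e by (auto simp: N_def dest!: poly_overD[of _ _ 0])
  qed
  have z: "c + f * poly \<gamma> f = 0" using \<beta>(1) by (simp add: N_def e)
  have "c \<noteq> 0"
  proof
    assume c: "c = 0"
    then have "\<gamma> \<in> N" using z f(2) \<gamma> \<beta>(1) by (auto simp: N_def e)
    then show False using \<beta>(2)[of \<gamma>] c e by (auto simp: N_def)
  qed
  moreover have "f * - poly \<gamma> f = c" using z by (simp add: add_eq_0_iff)
  moreover have "- poly \<gamma> f \<in> S"
    using \<gamma> S f(1) poly_over_mono[OF S(2)] by (intro subring_uminus[OF S(1)] poly_over_poly) auto
  ultimately show ?thesis using \<gamma>(2) by metis
qed

text \<open>The leading coefficient of the relation for \<open>x\<close> lies in \<open>S\<close>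
  and is scaled into \<open>R\<close> by \<open>algebraic_multiple\<close>. Powers of it reduce
  every polynomial in \<open>x\<close> to degree below \<open>e\<close>, so the product
  \<open>s * r\<close> serves as common denominator.\<close>

lemma almost_fg_adjoin:
  fixes R :: "'r::idom set"
  assumes R: "subring R" and S: "subring S" "R \<subseteq> S" and RS: "almost_fg R S" and x: "\<not> transc S x"
  shows "almost_fg R ((\<lambda>\<beta>. poly \<beta> x) ` poly_over S)"
proof -
  obtain s G where s: "s \<in> R" "s \<noteq> 0" and G: "finite G" "\<And>x. x \<in> S \<Longrightarrow> \<exists>i. s ^ i * x \<in> lin R G"
    using RS by (auto simp: almost_fg_def)
  obtain F0 where F0: "F0 \<in> poly_over S" "F0 \<noteq> 0" "poly F0 x = 0" using x by (auto simp: transc_def)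
  obtain w where w: "w \<in> S" "lead_coeff F0 * w \<in> R" "lead_coeff F0 * w \<noteq> 0"
    using algebraic_multiple[OF S poly_overD[OF F0(1)] _ almost_fg_algebraic[OF R S(1) RS poly_overD[OF F0(1)]]] F0(2)
    by (metis leading_coeff_0_iff)
  define F where "F = smult w F0"
  define r where "r = lead_coeff F"
  define e where "e = degree F"
  have r: "r \<in> R" "r \<noteq> 0" using w(2,3) by (auto simp: r_def F_def mult.commute)
  have F: "F \<in> poly_over S" "F \<noteq> 0" "poly F x = 0"
    using F0 w by (auto simp: F_def intro: poly_over_smult S)
  let ?G = "(\<lambda>(g, j). g * x ^ j) ` (G \<times> {..<e})"
  have finG: "finite ?G" using G(1) by simp
  have shift: "a * x ^ j \<in> lin R ?G" if "a \<in> lin R G" "j < e" for a j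
  proof -
    obtain c where c: "\<And>g. c g \<in> R" "a = (\<Sum>g\<in>G. c g * g)" using \<open>a \<in> lin R G\<close> by (auto simp: lin_def)
    have "a * x ^ j = (\<Sum>g\<in>G. c g * (g * x ^ j))" by (simp add: c(2) sum_distrib_right mult.assoc)
    also have "\<dots> \<in> lin R ?G"
      using c(1) that(2) by (intro lin_sum[OF R] lin_scale[OF R] lin_base[OF R finG]) auto
    finally show ?thesis .
  qed
  have "\<exists>i. (s * r) ^ i * poly \<beta> x \<in> lin R ?G" if \<beta>: "\<beta> \<in> poly_over S" for \<beta>
  proof -
    obtain N q h where h: "h \<in> poly_over S" "smult (r ^ N) \<beta> = F * q + h" "h = 0 \<or> degree h < e"
      using pseudo_division[OF S(1) F(1,2) \<beta>] unfolding r_def e_def by blast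
    have "r ^ N * poly \<beta> x = poly (F * q + h) x" by (simp flip: h(2))
    then have rx: "r ^ N * poly \<beta> x = poly h x" using F(3) by simp
    have "\<exists>i. \<forall>l\<in>{..<e}. s ^ i * coeff h l \<in> lin R G"
      using G(2) poly_overD[OF h(1)] by (intro lin_pow_common[OF R s(1)]) auto
    then obtain i where i: "\<And>l. l < e \<Longrightarrow> s ^ i * coeff h l \<in> lin R G" by blast
    have hx: "poly h x = (\<Sum>l<e. coeff h l * x ^ l)"
    proof (cases "h = 0")
      case False
      then show ?thesis
        unfolding poly_altdef using h(3) by (intro sum.mono_neutral_cong_left) (auto simp: coeff_eq_0)
    qed simp
    have "s ^ i * (r ^ N * poly \<beta> x) = (\<Sum>l<e. s ^ i * coeff h l * x ^ l)"
      unfolding rx hx by (simp add: sum_distrib_left mult.assoc)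
    also have "\<dots> \<in> lin R ?G" using i shift by (intro lin_sum[OF R]) auto
    finally have "s ^ i * (r ^ N * poly \<beta> x) \<in> lin R ?G" .
    from lin_scale[OF R this, of "s ^ N * r ^ i"]
    have "(s ^ N * r ^ i) * (s ^ i * (r ^ N * poly \<beta> x)) \<in> lin R ?G"
      using s r by (simp add: subring_mult[OF R] subring_power[OF R])
    then have "(s * r) ^ (i + N) * poly \<beta> x \<in> lin R ?G"
      by (simp add: power_mult_distrib power_add mult_ac)
    then show ?thesis ..
  qed
  then show ?thesis
    unfolding almost_fg_def using s r finG subring_mult[OF R]
    by (intro bexI[of _ "s * r"] exI[of _ ?G]) auto
qed

lemma almost_fg_refl:
  assumes R: "subring (R :: 'r::idom set)"
  shows "almost_fg R R"
proof -
  have "1 ^ 0 * x \<in> lin R {1}" if "x \<in> R" for x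
    using lin_scale[OF R lin_base[OF R, of "{1}" 1] that] by simp
  then show ?thesis unfolding almost_fg_def
    using subring_1[OF R] by (intro bexI[of _ 1] exI[of _ "{1}"] conjI ballI exI[of _ 0]) auto
qed

lemma almost_fg_pring:
  fixes k :: "'r::idom set"
  assumes k: "subring k" and T: "finite T" "\<And>b. b \<in> T \<Longrightarrow> \<not> transc (pring k X J) (X b)"
  shows "almost_fg (pring k X J) (pring k X (J \<union> T))"
  using T
proof (induction T rule: finite_induct)
  case empty
  then show ?case using almost_fg_refl[OF subring_pring[OF k]] by simp
next
  case (insert b T)
  show ?case
  proof (cases "b \<in> J \<union> T")
    case True
    then have "J \<union> insert b T = J \<union> T" by auto
    then show ?thesis using insert by simp
  next
    case False
    then have e: "J \<union> insert b T - {b} = J \<union> T" by auto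
    have "\<not> transc (pring k X (J \<union> T)) (X b)"
      using insert.prems(1)[of b] transc_mono pring_mono[of J "J \<union> T" k X] by blast
    then show ?thesis
      using almost_fg_adjoin[OF subring_pring[OF k] subring_pring[OF k] pring_mono insert.IH] insert.prems
        pring_insert_eq[OF k, of b "J \<union> insert b T" X] unfolding e by auto
  qed
qed

lemma algebraic_trans:
  fixes k :: "'r::idom set"
  assumes k: "subring k" and T: "finite T" "\<And>b. b \<in> T \<Longrightarrow> \<not> transc (pring k X J) (X b)"
    and x: "\<not> transc (pring k X T) x"
  shows "\<not> transc (pring k X J) x"
proof -
  let ?S = "pring k X (J \<union> T)"
  have S: "subring ?S" "pring k X J \<subseteq> ?S" using k by (auto simp: subring_pring intro!: pring_mono)
  have "\<not> transc ?S x" using x transc_mono pring_mono[of T "J \<union> T" k X] by blast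
  then have "almost_fg (pring k X J) ((\<lambda>\<beta>. poly \<beta> x) ` poly_over ?S)"
    by (intro almost_fg_adjoin subring_pring k S(2) almost_fg_pring T)
  moreover have "x \<in> (\<lambda>\<beta>. poly \<beta> x) ` poly_over ?S"
    using S(1) by (intro image_eqI[of _ _ "[:0, 1:]"] poly_over_pCons poly_over_0) (auto simp: subring_0 subring_1)
  ultimately show ?thesis by (rule almost_fg_algebraic[OF subring_pring[OF k] subring_image[OF S(1)]])
qed

text \<open>Exchange of one element: extend \<open>S \<inter> T\<close> and some
  \<open>b \<in> S - T\<close> to a basis within \<open>insert b T\<close>. It misses some element,
  because \<open>b\<close> is algebraic over \<open>T\<close>; so it has at most
  \<open>card T\<close> elements and shares more with \<open>S\<close>.\<close>

lemma steinitz: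
  fixes k :: "'r::idom set"
  assumes k: "subring k" and S: "finite S" "alg_indep k X S"
    and T: "finite T" "\<And>s. s \<in> S \<Longrightarrow> \<not> transc (pring k X T) (X s)"
  shows "card S \<le> card T"
  using T
proof (induction "card (S - T)" arbitrary: T rule: less_induct)
  case less
  show ?case
  proof (cases "S \<subseteq> T")
    case True
    then show ?thesis using less.prems by (intro card_mono)
  next
    case False
    then obtain b where b: "b \<in> S" "b \<notin> T" by blast
    have "insert b (S \<inter> T) \<subseteq> insert b T" "alg_indep k X (insert b (S \<inter> T))" "finite (insert b T)"
      using b less.prems(1) alg_indep_subset[OF S(2), of "insert b (S \<inter> T)"] by auto
    from exists_basis[OF k this(3,1,2)]
    obtain I where I: "insert b (S \<inter> T) \<subseteq> I" "I \<subseteq> insert b T" "alg_indep k X I"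
      "\<And>c. c \<in> insert b T \<Longrightarrow> \<not> transc (pring k X I) (X c)" by blast
    have finI: "finite I" using I(2) less.prems(1) by (auto intro: finite_subset)
    have "I \<noteq> insert b T"
    proof
      assume e: "I = insert b T"
      then have "transc (pring k X (insert b T - {b})) (X b)" using I(3) by (auto simp: alg_indep_def)
      then show False using less.prems(2)[OF b(1)] b by simp
    qed
    then have "card I < card (insert b T)" using I(2) less.prems(1) by (intro psubset_card_mono) auto
    then have "card I \<le> card T" using b less.prems(1) by simp
    moreover have "card S \<le> card I"
    proof (rule less.hyps)
      show "card (S - I) < card (S - T)" using S(1) I(1) b by (intro psubset_card_mono) auto
      show "\<not> transc (pring k X I) (X s)" if "s \<in> S" for s
        using I(4) by (intro algebraic_trans[OF k less.prems(1) _ less.prems(2)[OF that]]) auto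
    qed (rule finI)
    ultimately show ?thesis by simp
  qed
qed

definition lin_indep :: "'r::comm_ring_1 set \<Rightarrow> 'r set \<Rightarrow> bool" where
  "lin_indep R G \<longleftrightarrow> (\<forall>c. (\<forall>g. c g \<in> R) \<longrightarrow> (\<Sum>g\<in>G. c g * g) = 0 \<longrightarrow> (\<forall>g\<in>G. c g = 0))"

text \<open>Take a maximal independent subset of the generators. Every generator has a nonzero
  multiple in its span, and the product of the multipliers joins the denominator.\<close>

lemma almost_fg_basis:
  fixes R :: "'r::idom set"
  assumes R: "subring R" and RS: "almost_fg R S"
  obtains s G where "s \<in> R" "s \<noteq> 0" "finite G" "lin_indep R G" "\<And>x. x \<in> S \<Longrightarrow> \<exists>i. s ^ i * x \<in> lin R G"
proof -
  obtain s H where s: "s \<in> R" "s \<noteq> 0" and H: "finite H" "\<And>x. x \<in> S \<Longrightarrow> \<exists>i. s ^ i * x \<in> lin R H"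
    using RS by (auto simp: almost_fg_def)
  let ?F = "{G. G \<subseteq> H \<and> lin_indep R G}"
  have "finite ?F" using H(1) by (intro finite_subset[of ?F "Pow H"]) auto
  moreover have "{} \<in> ?F" by (simp add: lin_indep_def)
  ultimately obtain G where G: "G \<in> ?F" "\<And>G'. G' \<in> ?F \<Longrightarrow> G \<subseteq> G' \<Longrightarrow> G = G'"
    using finite_has_maximal2[of ?F "{}"] by auto
  have finG: "finite G" using G(1) H(1) by (auto intro: finite_subset)
  have "\<exists>c. c \<in> R \<and> c \<noteq> 0 \<and> c * h \<in> lin R G" if h: "h \<in> H" for h
  proof (cases "h \<in> G")
    case True
    then show ?thesis using lin_base[OF R finG True] subring_1[OF R] by (intro exI[of _ 1]) simp
  next
    case False
    have "\<not> lin_indep R (insert h G)" using G(2)[of "insert h G"] G(1) h False by auto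
    then obtain c where c: "\<And>g. c g \<in> R" "(\<Sum>g\<in>insert h G. c g * g) = 0" "\<exists>g\<in>insert h G. c g \<noteq> 0"
      by (auto simp: lin_indep_def)
    have e: "c h * h + (\<Sum>g\<in>G. c g * g) = 0" using c(2) finG False by simp
    have "c h \<noteq> 0"
    proof
      assume z: "c h = 0"
      then have "(\<Sum>g\<in>G. c g * g) = 0" using e by simp
      then have "\<forall>g\<in>G. c g = 0" using G(1) c(1) by (auto simp: lin_indep_def)
      then show False using c(3) z by auto
    qed
    moreover have "c h * h = (\<Sum>g\<in>G. (- c g) * g)" using e by (simp add: sum_negf add_eq_0_iff2)
    then have "c h * h \<in> lin R G"
      unfolding lin_def using c(1) subring_uminus[OF R] by (intro CollectI exI[of _ "\<lambda>g. - c g"]) auto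
    ultimately show ?thesis using c(1) by blast
  qed
  then have "\<forall>h\<in>H. \<exists>c. c \<in> R \<and> c \<noteq> 0 \<and> c * h \<in> lin R G" by blast
  then obtain c where c: "\<And>h. h \<in> H \<Longrightarrow> c h \<in> R \<and> c h \<noteq> 0 \<and> c h * h \<in> lin R G"
    unfolding bchoice_iff by blast
  define p where "p = prod c H"
  have p: "p \<in> R" "p \<noteq> 0" using c H(1) R by (auto simp: p_def intro: subring_prod)
  have ph: "p * h \<in> lin R G" if "h \<in> H" for h
  proof -
    have "p * h = prod c (H - {h}) * (c h * h)"
      unfolding p_def by (subst prod.remove[OF H(1) that]) (simp add: mult_ac)
    moreover have "prod c (H - {h}) \<in> R" using c by (intro subring_prod R) auto
    ultimately show ?thesis using lin_scale[OF R, of "c h * h"] c that by metis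
  qed
  have "\<exists>i. (s * p) ^ i * x \<in> lin R G" if "x \<in> S" for x
  proof -
    obtain i where "s ^ i * x \<in> lin R H" using H(2)[OF \<open>x \<in> S\<close>] by blast
    then obtain d where d: "\<And>g. d g \<in> R" "s ^ i * x = (\<Sum>g\<in>H. d g * g)" by (auto simp: lin_def)
    have "p * (s ^ i * x) = (\<Sum>g\<in>H. d g * (p * g))" unfolding d(2) by (simp add: sum_distrib_left mult_ac)
    also have "\<dots> \<in> lin R G" using ph d(1) by (auto intro!: lin_sum[OF R] intro: lin_scale[OF R])
    finally have "p * (s ^ i * x) \<in> lin R G" .
    from lin_scale[OF R this, of "s * p ^ i"]
    have "(s * p ^ i) * (p * (s ^ i * x)) \<in> lin R G"
      using s p by (simp add: subring_mult[OF R] subring_power[OF R])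
    then have "(s * p) ^ Suc i * x \<in> lin R G" by (simp add: power_mult_distrib mult_ac)
    then show ?thesis ..
  qed
  then show ?thesis using that[of "s * p" G] s p finG G(1) subring_mult[OF R] by auto
qed

text \<open>After inverting \<open>s\<close> the algebra is free over the factorial ring
  \<open>pring C z J\<close> of the application. Freeness yields enough of going down to show that
  the trace of \<open>P\<close> is generated by a single prime \<open>p\<close>, and any variable
  that occurs in \<open>p\<close> can be omitted.\<close>

lemma height_one_omits_variable:
  fixes k :: "'r::idom set"
  assumes k: "subfield k" and J: "finite J" "alg_indep k X J"
    and G: "finite G" "lin_indep (pring k X J) G" and s: "s \<in> pring k X J" "s \<noteq> 0"
    and rep: "\<And>x. \<exists>i. s ^ i * x \<in> lin (pring k X J) G"
    and P: "height_one_prime P" "s \<notin> P"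
  shows "\<exists>a\<in>J. P \<inter> pring k X (J - {a}) = {0}"
proof -
  let ?B = "pring k X J"
  have kr: "subring k" using k by (simp add: subfield_def)
  have B: "subring ?B" by (rule subring_pring[OF kr])
  have pP: "prime_of UNIV P" using P(1) by (simp add: height_one_prime_def is_prime_ideal_iff)
  have Id: "ideal_of UNIV P" using pP by (rule prime_of_ideal)
  have "almost_fg ?B UNIV" unfolding almost_fg_def using s G(1) rep by blast
  obtain f where f: "f \<in> P" "f \<noteq> 0" using P(1) ideal_of_0[OF Id] by (auto simp: height_one_prime_def)
  obtain w where w: "f * w \<in> ?B" "f * w \<noteq> 0"
    using algebraic_multiple[OF subring_UNIV subset_UNIV UNIV_I f(2)
        almost_fg_algebraic[OF B subring_UNIV \<open>almost_fg ?B UNIV\<close> UNIV_I]] by blast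
  have "f * w \<in> P" using f ideal_of_mult2[OF Id] by blast
  moreover obtain n where "prime_prod ?B (f * w) n"
    using prime_factorial_pring[OF k J] w by (auto simp: prime_factorial_def)
  ultimately obtain p where p: "prime_elt ?B p" "p \<in> P"
    using prime_contains_prime_elt[OF B _ pP] by blast
  have pB: "p \<in> ?B" "p \<noteq> 0" using p(1) by (auto simp: prime_elt_def)
  have pB_P: "(*) p ` ?B \<subseteq> P" using p(2) ideal_of_mult2[OF Id] by blast
  have gen: "b \<in> (*) p ` ?B" if b: "b \<in> P" "b \<in> ?B" for b
  proof (rule ccontr)
    assume nb: "b \<notin> (*) p ` ?B"
    \<comment> \<open>A prime that contains \<open>p\<close> and avoids these products is contained
      in \<open>P\<close> and misses \<open>b\<close>, contrary to height one. That \<open>p\<close>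
      divides none of them is seen on the coordinates in the basis \<open>G\<close>: as
      \<open>p\<close> divides neither \<open>s\<close> nor \<open>b\<close>, it would divide all
      coordinates of \<open>T\<close>.\<close>
    define M where "M = {T * b ^ N |T N. T \<notin> P}"
    have disj: "range ((*) p) \<inter> M = {}"
    proof (rule ccontr)
      assume ne: "\<not> ?thesis"
      obtain T N a where T: "T \<notin> P" "T * b ^ N = p * a"
      proof -
        from ne obtain x where "x \<in> range ((*) p)" "x \<in> M" by blast
        then obtain a T N where "x = p * a" "x = T * b ^ N" "T \<notin> P" unfolding M_def by blast
        then show ?thesis using that[of T N a] by simp
      qed
      obtain i where i: "s ^ i * T \<in> lin ?B G" using rep by blast
      obtain j where j: "s ^ j * a \<in> lin ?B G" using rep by blast
      obtain c where c: "\<And>g. c g \<in> ?B" "s ^ i * T = (\<Sum>g\<in>G. c g * g)" using i by (auto simp: lin_def)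
      obtain d where d: "\<And>g. d g \<in> ?B" "s ^ j * a = (\<Sum>g\<in>G. d g * g)" using j by (auto simp: lin_def)
      have "(\<Sum>g\<in>G. (s ^ j * b ^ N * c g - s ^ i * p * d g) * g) =
          s ^ j * b ^ N * (\<Sum>g\<in>G. c g * g) - s ^ i * p * (\<Sum>g\<in>G. d g * g)"
        unfolding left_diff_distrib sum_subtractf by (simp add: sum_distrib_left mult_ac)
      also have "\<dots> = s ^ i * s ^ j * (T * b ^ N) - s ^ i * s ^ j * (p * a)"
        unfolding c(2)[symmetric] d(2)[symmetric] by (simp add: mult_ac)
      also have "\<dots> = 0" using T(2) by simp
      finally have *: "(\<Sum>g\<in>G. (s ^ j * b ^ N * c g - s ^ i * p * d g) * g) = 0" .
      have inB: "s ^ j * b ^ N * c g - s ^ i * p * d g \<in> ?B" for g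
        using s(1) b(2) c(1) d(1) pB(1)
        by (intro subring_diff[OF B] subring_mult[OF B] subring_power[OF B])
      have "s ^ j * b ^ N * c g - s ^ i * p * d g = 0" if "g \<in> G" for g
        using G(2)[unfolded lin_indep_def, rule_format, of "\<lambda>g. s ^ j * b ^ N * c g - s ^ i * p * d g", OF inB * that] .
      then have e: "s ^ j * b ^ N * c g = p * (s ^ i * d g)" if "g \<in> G" for g using that by (simp add: mult_ac)
      have pr: "prime_of ?B ((*) p ` ?B)" using p(1) by (simp add: prime_elt_def)
      have sp: "s \<notin> (*) p ` ?B" using pB_P P(2) by blast
      have "c g \<in> P" if "g \<in> G" for g
      proof -
        have "s ^ j * b ^ N * c g \<in> (*) p ` ?B"
          unfolding e[OF that] using s(1) d(1) by (intro imageI subring_mult[OF B] subring_power[OF B])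
        moreover have "s ^ j * b ^ N \<in> ?B" using s(1) b(2) by (intro subring_mult[OF B] subring_power[OF B])
        ultimately have "s ^ j * b ^ N \<in> (*) p ` ?B \<or> c g \<in> (*) p ` ?B"
          using prime_of_mult[OF pr] c(1) by blast
        moreover have "s ^ j * b ^ N \<notin> (*) p ` ?B"
          using prime_of_mult[OF pr subring_power[OF B s(1)] subring_power[OF B b(2)]]
            prime_of_power[OF pr B] s(1) b(2) sp nb by blast
        ultimately show ?thesis using pB_P by blast
      qed
      then have "s ^ i * T \<in> P"
        unfolding c(2) using ideal_of_mult2[OF Id] by (intro ideal_of_sum[OF Id]) auto
      then show False
        using prime_of_mult[OF pP] prime_of_power[OF pP subring_UNIV] T(1) P(2) by blast
    qed
    have "\<exists>Q. prime_of UNIV Q \<and> range ((*) p) \<subseteq> Q \<and> Q \<inter> M = {}"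
    proof (rule prime_avoiding[OF subring_UNIV ideal_of_principal[OF subring_UNIV UNIV_I] _ _ disj])
      show "1 \<in> M" unfolding M_def using prime_of_1[OF pP] by (intro CollectI exI[of _ 1] exI[of _ 0]) auto
      fix u v assume "u \<in> M" "v \<in> M"
      then obtain T N T' N' where "u = T * b ^ N" "v = T' * b ^ N'" "T \<notin> P" "T' \<notin> P" by (auto simp: M_def)
      then have "u * v = (T * T') * b ^ (N + N') \<and> T * T' \<notin> P"
        using prime_of_mult[OF pP] by (auto simp: power_add mult_ac)
      then show "u * v \<in> M" unfolding M_def by blast
    qed
    then obtain Q where Q: "prime_of UNIV Q" "range ((*) p) \<subseteq> Q" "Q \<inter> M = {}" by blast
    have "Q \<subseteq> P"
    proof
      fix x assume "x \<in> Q"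
      then have "x * b ^ 0 \<notin> M" using Q(3) by auto
      then show "x \<in> P" unfolding M_def by blast
    qed
    moreover have "b \<notin> Q"
    proof
      assume "b \<in> Q"
      moreover have "b = 1 * b ^ 1 \<and> 1 \<notin> P" using prime_of_1[OF pP] by simp
      then have "b \<in> M" unfolding M_def by blast
      ultimately show False using Q(3) by blast
    qed
    moreover have "p * 1 \<in> Q" using Q(2) by blast
    ultimately show False using P(1) Q(1) b(1) pB(2) by (auto simp: height_one_prime_def is_prime_ideal_iff)
  qed
  \<comment> \<open>A minimal set of variables expressing \<open>p\<close>: each of its members
    occurs in \<open>p\<close>, hence by degrees in every nonzero multiple of
    \<open>p\<close>.\<close>
  let ?F = "{I. I \<subseteq> J \<and> p \<in> pring k X I}"
  have "finite ?F" using J(1) by (intro finite_subset[of ?F "Pow J"]) auto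
  then obtain I where I: "I \<in> ?F" "\<And>I'. I' \<in> ?F \<Longrightarrow> I' \<subseteq> I \<Longrightarrow> I = I'"
    using finite_has_minimal2[of ?F J] pB by auto
  have "I \<noteq> {}"
  proof
    assume "I = {}"
    then have "p \<in> k" using I(1) by (simp add: pring_empty[OF kr])
    then obtain v where "p * v = 1" using k pB(2) by (auto simp: subfield_def)
    then have "1 \<in> P" using ideal_of_mult2[OF Id UNIV_I p(2), of v] by simp
    then show False using prime_of_1[OF pP] by simp
  qed
  then obtain a where a: "a \<in> I" by blast
  then have aJ: "a \<in> J" using I(1) by blast
  have "x = 0" if x: "x \<in> P" "x \<in> pring k X (J - {a})" for x
  proof (rule ccontr)
    assume x0: "x \<noteq> 0"
    have "x \<in> ?B" using x(2) pring_mono[of "J - {a}" J k X] by blast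
    then obtain h where h: "h \<in> ?B" "x = p * h" using gen[OF x(1)] by blast
    obtain \<beta> where \<beta>: "\<beta> \<in> poly_over (pring k X (I - {a}))" "poly \<beta> (X a) = p"
      using pring_expand[OF kr a, of p] I(1) by blast
    obtain \<gamma> where \<gamma>: "\<gamma> \<in> poly_over (pring k X (J - {a}))" "poly \<gamma> (X a) = h"
      using pring_expand[OF kr aJ h(1)] by blast
    let ?R = "pring k X (J - {a})"
    have R: "subring ?R" by (rule subring_pring[OF kr])
    have \<beta>R: "\<beta> \<in> poly_over ?R"
      using \<beta>(1) I(1) poly_over_mono[OF pring_mono[of "I - {a}" "J - {a}" k X]] by blast
    have eq: "\<beta> * \<gamma> = [:x:]"
    proof (rule transc_eq[of ?R "X a"])
      show "transc ?R (X a)" using J(2) aJ by (simp add: alg_indep_def)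
      show "poly (\<beta> * \<gamma>) (X a) = poly [:x:] (X a)" using \<beta> \<gamma> h by simp
    qed (use \<beta>R \<gamma>(1) x(2) R in \<open>auto intro: poly_over_mult poly_over_const\<close>)
    then have nz: "\<beta> \<noteq> 0" "\<gamma> \<noteq> 0" using x0 by auto
    have "degree \<beta> + degree \<gamma> = 0" using degree_mult_eq[OF nz] unfolding eq by simp
    then have "\<beta> = [:coeff \<beta> 0:]" by (auto elim: degree_eq_zeroE)
    then have "p = coeff \<beta> 0" using \<beta>(2) by (metis mult_zero_right poly_0 poly_pCons add.right_neutral)
    then have "p \<in> pring k X (I - {a})" using poly_overD[OF \<beta>(1)] by simp
    then have "I = I - {a}" using I by (intro I(2)) auto
    then show False using a by blast
  qed
  moreover have "0 \<in> P \<inter> pring k X (J - {a})" using ideal_of_0[OF Id] subring_0[OF subring_pring[OF kr]] by blast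
  ultimately show ?thesis using aJ by blast
qed

section \<open>Lowest coefficients and fractions\<close>

lemma mp_zero_le: "(0 :: nat \<Rightarrow>\<^sub>0 nat) \<le> m"
proof (rule ccontr)
  assume "\<not> 0 \<le> m"
  then have "m < 0" by simp
  then show False by (simp add: less_poly_mapping.rep_eq less_fun_def)
qed

lemma lookup_mult_lowest:
  fixes f g :: "'a::comm_ring_1 mp"
  assumes "\<And>i. i < m \<Longrightarrow> lkp f i = 0"
  shows "i < m \<Longrightarrow> lkp (f * g) i = 0" "lkp (f * g) m = lkp f m * lkp g 0"
proof -
  have ge: "m \<le> i" if "i \<in> Poly_Mapping.keys f" for i
    using that assms[of i] by (metis in_keys_iff not_le)
  have le: "m \<le> i + j" if "i \<in> Poly_Mapping.keys f" for i j
    using add_mono[OF ge[OF that] mp_zero_le[of j]] by simp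
  show "lkp (f * g) i = 0" if "i < m"
    unfolding lookup_mp_mult using le that
    by (intro sum.neutral ballI) (auto simp: when_def dest: leD)
  have eq: "i = m \<and> j = 0" if "i \<in> Poly_Mapping.keys f" "i + j = m" for i j
  proof -
    have "\<not> m < i"
    proof
      assume "m < i"
      then have "m + 0 < i + j" using mp_zero_le[of j] by (rule add_less_le_mono)
      then show False using that by simp
    qed
    then have "i = m" using ge[OF that(1)] by simp
    then show ?thesis using that by simp
  qed
  have "lkp (f * g) m = (\<Sum>i\<in>Poly_Mapping.keys f. \<Sum>j\<in>Poly_Mapping.keys g. if j = 0 then (if i = m then lkp f m * lkp g 0 else 0) else 0)"
    unfolding lookup_mp_mult using eq by (intro sum.cong refl) (auto simp: when_def)
  also have "\<dots> = (\<Sum>i\<in>Poly_Mapping.keys f. if i = m then lkp f m * lkp g 0 else 0)"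
    by (intro sum.cong refl) (simp add: in_keys_iff)
  also have "\<dots> = lkp f m * lkp g 0" by (simp add: in_keys_iff)
  finally show "lkp (f * g) m = lkp f m * lkp g 0" .
qed

lemma lookup_0_mult: "lkp (f * g) 0 = lkp f 0 * lkp (g :: 'a::comm_ring_1 mp) 0"
  using lookup_mult_lowest(2)[of 0 f g] mp_zero_le by (metis leD)

lemma lookup_0_power: "lkp (f ^ n) 0 = lkp (f :: 'a::comm_ring_1 mp) 0 ^ n"
  by (induction n) (auto simp: lookup_0_mult lookup_one)

text \<open>Replaces the substitution \<open>t = 0\<close>, which may annihilate a nonzero element;
  the coefficient at the lowest monomial present does not vanish.\<close>

definition low_coeff_in :: "'a::zero set \<Rightarrow> 'a mp \<Rightarrow> bool" where
  "low_coeff_in R b \<longleftrightarrow> (\<exists>m. (\<forall>i<m. lkp b i = 0) \<and> lkp b m \<noteq> 0 \<and> lkp b m \<in> R)"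

lemma low_coeff_inI:
  assumes "b \<noteq> 0" "\<And>m. lkp b m \<in> R"
  shows "low_coeff_in R b"
proof -
  let ?m = "Min (Poly_Mapping.keys b)"
  have "Poly_Mapping.keys b \<noteq> {}" using assms(1) by simp
  then have "?m \<in> Poly_Mapping.keys b" by (intro Min_in) auto
  moreover have "lkp b i = 0" if "i < ?m" for i
    using that Min_le[of "Poly_Mapping.keys b" i] by (metis finite_keys in_keys_iff leD)
  ultimately show ?thesis unfolding low_coeff_in_def using assms(2) by (metis in_keys_iff)
qed

text \<open>At the least monomial \<open>m\<close> present in the coefficients of
  \<open>\<beta>\<close>, only the constant term of \<open>x\<close> contributes. So the coefficient
  there is the value of a nonzero polynomial over \<open>R\<close> at
  \<open>lkp x 0\<close>.\<close>

lemma low_coeff_poly: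
  fixes R :: "'a::idom set"
  assumes R: "subring R" and tr: "transc R (lkp x 0)"
    and \<beta>: "\<And>j. coeff \<beta> j \<noteq> 0 \<Longrightarrow> low_coeff_in R (coeff \<beta> j)" and nz: "\<beta> \<noteq> 0"
  shows "low_coeff_in ((\<lambda>\<gamma>. poly \<gamma> (lkp x 0)) ` poly_over R) (poly \<beta> x)"
proof -
  let ?N = "{j. j \<le> degree \<beta> \<and> coeff \<beta> j \<noteq> 0}"
  have "\<forall>j\<in>?N. \<exists>m. (\<forall>i<m. lkp (coeff \<beta> j) i = 0) \<and> lkp (coeff \<beta> j) m \<noteq> 0 \<and> lkp (coeff \<beta> j) m \<in> R"
    using \<beta> by (auto simp: low_coeff_in_def)
  then obtain l where l: "\<And>j i. j \<in> ?N \<Longrightarrow> i < l j \<Longrightarrow> lkp (coeff \<beta> j) i = 0"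
    "\<And>j. j \<in> ?N \<Longrightarrow> lkp (coeff \<beta> j) (l j) \<noteq> 0" "\<And>j. j \<in> ?N \<Longrightarrow> lkp (coeff \<beta> j) (l j) \<in> R"
    unfolding bchoice_iff by blast
  define m where "m = Min (l ` ?N)"
  have "degree \<beta> \<in> ?N" using nz by simp
  then have ne: "l ` ?N \<noteq> {}" by blast
  have fin: "finite (l ` ?N)" by simp
  have "m \<in> l ` ?N" unfolding m_def by (rule Min_in[OF fin ne])
  then obtain j0 where j0: "j0 \<in> ?N" "m = l j0" by blast
  have mle: "m \<le> l j" if "j \<in> ?N" for j unfolding m_def using that by (intro Min_le[OF fin]) blast
  have below: "lkp (coeff \<beta> j) i = 0" if "i < m" for i j
  proof (cases "j \<in> ?N")
    case True
    then show ?thesis using l(1)[OF True, of i] mle[OF True] that by simp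
  next
    case False
    then have "coeff \<beta> j = 0" using le_degree by blast
    then show ?thesis by simp
  qed
  have atm: "lkp (coeff \<beta> j) m \<in> R" for j
  proof (cases "j \<in> ?N \<and> l j = m")
    case True
    then show ?thesis using l(3) by metis
  next
    case False
    have "lkp (coeff \<beta> j) m = 0"
    proof (cases "j \<in> ?N")
      case True
      then show ?thesis using False l(1)[OF True, of m] mle[OF True] by (metis order.not_eq_order_implies_strict)
    next
      case False
      then have "coeff \<beta> j = 0" using le_degree by blast
      then show ?thesis by simp
    qed
    then show ?thesis using subring_0[OF R] by simp
  qed
  let ?\<gamma> = "\<Sum>j\<le>degree \<beta>. monom (lkp (coeff \<beta> j) m) j"
  have \<gamma>: "?\<gamma> \<in> poly_over R" by (intro subring_sum[OF subring_poly_over] poly_over_monom R atm)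
  have "coeff ?\<gamma> j0 = lkp (coeff \<beta> j0) m" using j0(1) by (simp add: coeff_sum)
  then have "?\<gamma> \<noteq> 0" using l(2)[OF j0(1)] j0(2) by force
  have "lkp (poly \<beta> x) m = (\<Sum>j\<le>degree \<beta>. lkp (coeff \<beta> j) m * lkp x 0 ^ j)"
    unfolding poly_altdef lookup_sum using lookup_mult_lowest(2)[OF below] by (simp add: lookup_0_power)
  also have "\<dots> = poly ?\<gamma> (lkp x 0)" by (simp add: poly_sum poly_monom)
  finally have e: "lkp (poly \<beta> x) m = poly ?\<gamma> (lkp x 0)" .
  have "poly ?\<gamma> (lkp x 0) \<noteq> 0" using tr \<gamma> \<open>?\<gamma> \<noteq> 0\<close> transcD by blast
  moreover have "lkp (poly \<beta> x) i = 0" if "i < m" for i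
    unfolding poly_altdef lookup_sum using lookup_mult_lowest(1)[OF below that] by simp
  ultimately show ?thesis unfolding low_coeff_in_def using \<gamma> by (intro exI[of _ m] conjI allI impI) (auto simp: e)
qed

text \<open>The generic elements reduce to the \<open>z a\<close> at \<open>t = 0\<close>. Lowest
  coefficients transfer independence from the \<open>z a\<close> to them, and in
  \<open>pring_pt_avoids\<close> also the property that a prime meets a polynomial ring only in
  zero.\<close>

lemma low_coeff_pring:
  fixes C :: "'a::idom set"
  assumes C: "subring C" and J: "finite J" "alg_indep C z J" and X: "\<And>a. a \<in> J \<Longrightarrow> lkp (X a) 0 = z a"
  shows "alg_indep (pt C) X J \<and> (\<forall>b\<in>pring (pt C) X J. b \<noteq> 0 \<longrightarrow> low_coeff_in (pring C z J) b)"
  using J X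
proof (induction J rule: finite_induct)
  case empty
  then show ?case
    unfolding pring_empty[OF C] pring_empty[OF subring_pt[OF C]]
    using low_coeff_inI[of _ C] by (auto simp: alg_indep_def pt_def)
next
  case (insert a J)
  have CJ: "alg_indep C z J" using alg_indep_subset[OF insert.prems(1)] by blast
  have IH: "alg_indep (pt C) X J" "\<And>b. b \<in> pring (pt C) X J \<Longrightarrow> b \<noteq> 0 \<Longrightarrow> low_coeff_in (pring C z J) b"
    using insert.IH[OF CJ] insert.prems(2) by auto
  have e: "insert a J - {a} = J" using insert.hyps by auto
  have xa: "lkp (X a) 0 = z a" using insert.prems(2) by simp
  have tr: "transc (pring C z J) (z a)" using insert.prems(1) e by (auto simp: alg_indep_def)
  have im: "(\<lambda>\<gamma>. poly \<gamma> (z a)) ` poly_over (pring C z J) = pring C z (insert a J)"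
    using pring_insert_eq[OF C, of a "insert a J" z] e by simp
  have low: "low_coeff_in (pring C z (insert a J)) (poly \<beta> (X a))"
    if "\<beta> \<in> poly_over (pring (pt C) X J)" "\<beta> \<noteq> 0" for \<beta>
    using low_coeff_poly[OF subring_pring[OF C], of z J "X a" \<beta>] tr that IH(2) poly_overD[OF that(1)]
    unfolding xa im by blast
  have "transc (pring (pt C) X J) (X a)"
    unfolding transc_def
  proof (intro ballI impI)
    fix \<beta> assume "\<beta> \<in> poly_over (pring (pt C) X J)" "poly \<beta> (X a) = 0"
    then show "\<beta> = 0" using low[of \<beta>] unfolding low_coeff_in_def by force
  qed
  then have "alg_indep (pt C) X (insert a J)"
    by (rule alg_indep_insert[OF subring_pt[OF C] IH(1) insert.hyps(2)])
  moreover have "low_coeff_in (pring C z (insert a J)) b" if b: "b \<in> pring (pt C) X (insert a J)" "b \<noteq> 0" for b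
  proof -
    obtain \<beta> where \<beta>: "\<beta> \<in> poly_over (pring (pt C) X J)" "poly \<beta> (X a) = b"
      using pring_expand[OF subring_pt[OF C], of a "insert a J" b X] b(1) e by auto
    then show ?thesis using low[OF \<beta>(1)] b(2) by (cases "\<beta> = 0") auto
  qed
  ultimately show ?case by blast
qed

lemma pring_pt_avoids:
  fixes C :: "'a::idom set"
  assumes "subring C" "finite J" "alg_indep C z J" "\<And>a. a \<in> J \<Longrightarrow> lkp (X a) 0 = z a"
    and "P \<inter> pring C z J = {0}" and b: "b \<in> pring (pt C) X J" "b \<in> pt P"
  shows "b = 0"
proof (rule ccontr)
  assume "b \<noteq> 0"
  then obtain m where "lkp b m \<noteq> 0" "lkp b m \<in> pring C z J"
    using low_coeff_pring[OF assms(1-4)] b(1) by (auto simp: low_coeff_in_def)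
  moreover have "lkp b m \<in> P" using b(2) by (simp add: pt_def)
  ultimately show False using assms(5) by blast
qed

section \<open>Fractions with numerator and denominator in a subring\<close>

definition emb :: "'r::idom \<Rightarrow> 'r fract" where "emb f = Fract f 1"
definition frac_set :: "'r::idom set \<Rightarrow> 'r fract set" where
  "frac_set D = {emb f / emb g |f g. f \<in> D \<and> g \<in> D \<and> g \<noteq> 0}"

lemma emb_hom: "emb (a + b) = emb a + emb b" "emb (a * b) = emb a * emb b" "emb 0 = 0" "emb 1 = 1"
  "emb (- a) = - emb a"
  by (simp_all add: emb_def fract_collapse)

lemma emb_eq_iff: "emb a = emb b \<longleftrightarrow> a = b"
  by (simp add: emb_def eq_fract)

lemma emb_eq_0_iff: "emb a = 0 \<longleftrightarrow> a = 0"
  using emb_eq_iff[of a 0] by (simp add: emb_hom)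

lemma emb_power: "emb (a ^ n) = emb a ^ n"
  by (induction n) (auto simp: emb_hom)

lemma emb_poly: "emb (poly \<beta> x) = poly (map_poly emb \<beta>) (emb x)"
  by (induction \<beta>) (auto simp: emb_hom map_poly_pCons)

lemma Fract_emb: "Fract f g = emb f / emb g"
  by (simp add: emb_def divide_fract)

lemma frac_deriv_emb:
  assumes "derivation d"
  shows "frac_deriv d (emb f) = emb (d f)"
  using assms by (simp add: emb_def frac_deriv_Fract derivation_1)

lemma frac_set_emb: "subring D \<Longrightarrow> f \<in> D \<Longrightarrow> emb f \<in> frac_set D"
  unfolding frac_set_def using subring_1[of D] by (intro CollectI exI[of _ f] exI[of _ 1]) (auto simp: emb_hom)

lemma subfield_frac_set:
  assumes D: "subring D"
  shows "subfield (frac_set D)"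
  unfolding subfield_def subring_def
proof (intro conjI ballI impI)
  show "0 \<in> frac_set D" "1 \<in> frac_set D"
    using frac_set_emb[OF D subring_0[OF D]] frac_set_emb[OF D subring_1[OF D]] by (auto simp: emb_hom)
next
  fix x y assume "x \<in> frac_set D" "y \<in> frac_set D"
  then obtain f g f' g' where *: "x = emb f / emb g" "y = emb f' / emb g'" "f \<in> D" "g \<in> D" "g \<noteq> 0"
    "f' \<in> D" "g' \<in> D" "g' \<noteq> 0" by (auto simp: frac_set_def)
  then have "x + y = emb (f * g' + f' * g) / emb (g * g')" "x * y = emb (f * f') / emb (g * g')"
    by (simp_all add: emb_hom emb_eq_0_iff add_frac_eq)
  moreover have "f * g' + f' * g \<in> D" "f * f' \<in> D" "g * g' \<in> D" "g * g' \<noteq> 0"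
    using * D by (auto intro!: subring_add subring_mult)
  ultimately show "x + y \<in> frac_set D" "x * y \<in> frac_set D" unfolding frac_set_def by blast+
next
  fix x assume "x \<in> frac_set D"
  then obtain f g where *: "x = emb f / emb g" "f \<in> D" "g \<in> D" "g \<noteq> 0" by (auto simp: frac_set_def)
  then have "- x = emb (- f) / emb g \<and> - f \<in> D" using D by (auto simp: emb_hom subring_uminus)
  then show "- x \<in> frac_set D" unfolding frac_set_def using * by blast
  assume "x \<noteq> 0"
  then have "f \<noteq> 0" "x * (emb g / emb f) = 1" using * by (auto simp: emb_hom emb_eq_0_iff)
  then show "\<exists>v\<in>frac_set D. x * v = 1" unfolding frac_set_def using * by blast
qed

lemma frac_deriv_frac_set:
  assumes D: "subring D" and d: "derivation d" "d ` D \<subseteq> D"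
  shows "frac_deriv d ` frac_set D \<subseteq> frac_set D"
proof
  fix z assume "z \<in> frac_deriv d ` frac_set D"
  then obtain f g where *: "z = frac_deriv d (Fract f g)" "f \<in> D" "g \<in> D" "g \<noteq> 0"
    by (auto simp: frac_set_def Fract_emb)
  then have "z = emb (d f * g - f * d g) / emb (g * g)"
    using frac_deriv_Fract[OF d(1) *(4)] by (simp add: Fract_emb[symmetric])
  moreover have "d f * g - f * d g \<in> D" "g * g \<in> D"
    using * D d(2) by (auto intro!: subring_diff subring_mult)
  ultimately show "z \<in> frac_set D" unfolding frac_set_def using * by (metis (mono_tags, lifting) mem_Collect_eq no_zero_divisors)
qed

lemma frac_deriv_kills:
  assumes d: "derivation d" "\<And>f. f \<in> D \<Longrightarrow> d f = 0" and x: "x \<in> frac_set D"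
  shows "frac_deriv d x = 0"
proof -
  obtain f g where "x = Fract f g" "f \<in> D" "g \<in> D" "g \<noteq> 0"
    using x by (auto simp: frac_set_def Fract_emb)
  then show ?thesis using d by (simp add: frac_deriv_Fract fract_collapse)
qed

lemma emb_pring:
  assumes D: "subring D" and f: "f \<in> pring D X J"
  shows "emb f \<in> pring (frac_set D) (\<lambda>i. emb (X i)) J"
proof -
  let ?B = "pring (frac_set D) (\<lambda>i. emb (X i)) J"
  have k: "subring (frac_set D)" using subfield_frac_set[OF D] by (simp add: subfield_def)
  have B: "subring ?B" by (rule subring_pring[OF k])
  have "subring {f. emb f \<in> ?B}"
    unfolding subring_def using subringD[OF B] by (auto simp: emb_hom)
  then have "pring D X J \<subseteq> {f. emb f \<in> ?B}"
    using frac_set_emb[OF D] const_pring[OF k] var_pring[OF k, of _ J "\<lambda>i. emb (X i)"]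
    by (intro pring_minimal D) auto
  then show ?thesis using f by blast
qed

lemma pring_clear:
  assumes D: "subring D" and b: "b \<in> pring (frac_set D) (\<lambda>i. emb (X i)) J"
  shows "\<exists>d\<in>D. \<exists>f\<in>pring D X J. d \<noteq> 0 \<and> emb d * b = emb f"
proof -
  let ?S = "{b. \<exists>d\<in>D. \<exists>f\<in>pring D X J. d \<noteq> 0 \<and> emb d * b = emb f}"
  let ?R = "pring D X J"
  have R: "subring ?R" by (rule subring_pring[OF D])
  have DR: "d \<in> ?R" if "d \<in> D" for d using const_pring[OF D that] .
  have SI: "b \<in> ?S" if "d \<in> D" "f \<in> ?R" "d \<noteq> 0" "emb d * b = emb f" for b d f using that by blast
  have "subring ?S"
    unfolding subring_def
  proof (intro conjI ballI)
    show "0 \<in> ?S" by (rule SI[of 1 0]) (auto simp: emb_hom subring_1[OF D] subring_0[OF R])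
    show "1 \<in> ?S" by (rule SI[of 1 1]) (auto simp: emb_hom subring_1[OF D] subring_1[OF R])
  next
    fix x y assume "x \<in> ?S" "y \<in> ?S"
    then obtain d f d' f' where *: "d \<in> D" "f \<in> ?R" "d \<noteq> 0" "emb d * x = emb f"
      "d' \<in> D" "f' \<in> ?R" "d' \<noteq> 0" "emb d' * y = emb f'" by blast
    have m: "d * d' \<in> D" "d * d' \<noteq> 0" using * by (auto intro: subring_mult[OF D])
    have e: "emb (d * d') * (x + y) = emb (d' * f + d * f')" "emb (d * d') * (x * y) = emb (f * f')"
      unfolding emb_hom *(4)[symmetric] *(8)[symmetric] by (simp_all add: algebra_simps)
    have "d' * f + d * f' \<in> ?R" "f * f' \<in> ?R"
      using * DR by (auto intro!: subring_add[OF R] subring_mult[OF R])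
    then show "x + y \<in> ?S" "x * y \<in> ?S" using SI[OF m(1) _ m(2)] e by blast+
  next
    fix x assume "x \<in> ?S"
    then obtain d f where *: "d \<in> D" "f \<in> ?R" "d \<noteq> 0" "emb d * x = emb f" by blast
    then show "- x \<in> ?S" by (intro SI[of d "- f"]) (auto simp: emb_hom subring_uminus[OF R])
  qed
  moreover have "frac_set D \<subseteq> ?S"
  proof
    fix x assume "x \<in> frac_set D"
    then obtain f g where "x = emb f / emb g" "f \<in> D" "g \<in> D" "g \<noteq> 0" by (auto simp: frac_set_def)
    then show "x \<in> ?S" using SI[of g f x] DR by (auto simp: emb_eq_0_iff)
  qed
  moreover have "emb (X i) \<in> ?S" if "i \<in> J" for i
    using that by (intro SI[of 1 "X i"]) (auto simp: emb_hom subring_1[OF D] var_pring[OF D])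
  ultimately have "pring (frac_set D) (\<lambda>i. emb (X i)) J \<subseteq> ?S" using subfield_frac_set[OF D] unfolding subfield_def
    by (intro pring_minimal) auto
  then show ?thesis using b by blast
qed

lemma poly_over_clear:
  assumes D: "subring D" and \<beta>: "\<beta> \<in> poly_over (pring (frac_set D) (\<lambda>i. emb (X i)) J)"
  shows "\<exists>d\<in>D. \<exists>\<gamma>\<in>poly_over (pring D X J). d \<noteq> 0 \<and> smult (emb d) \<beta> = map_poly emb \<gamma>"
  using \<beta>
proof (induction \<beta>)
  case 0
  then show ?case using subring_1[OF D] by (intro bexI[of _ 1] bexI[of _ 0] poly_over_0 subring_pring D) auto
next
  case (pCons a \<beta>)
  let ?R = "pring D X J"
  have R: "subring ?R" by (rule subring_pring[OF D])
  have "a \<in> pring (frac_set D) (\<lambda>i. emb (X i)) J" using poly_overD[OF pCons.prems, of 0] by simp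
  then obtain d f where a: "d \<in> D" "f \<in> ?R" "d \<noteq> 0" "emb d * a = emb f" using pring_clear[OF D] by blast
  have "\<beta> \<in> poly_over (pring (frac_set D) (\<lambda>i. emb (X i)) J)"
    unfolding poly_over_def using poly_overD[OF pCons.prems, of "Suc _"] by simp
  then obtain d' \<gamma> where g: "d' \<in> D" "\<gamma> \<in> poly_over ?R" "d' \<noteq> 0" "smult (emb d') \<beta> = map_poly emb \<gamma>"
    using pCons.IH by blast
  have "smult (emb (d * d')) (pCons a \<beta>) = map_poly emb (pCons (d' * f) (smult d \<gamma>))"
  proof -
    have "emb (d * d') * a = emb (d' * f)" by (simp add: emb_hom a(4)[symmetric])
    moreover have "smult (emb (d * d')) \<beta> = map_poly emb (smult d \<gamma>)"
    proof (rule poly_eqI)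
      fix n
      have "coeff (smult (emb d') \<beta>) n = coeff (map_poly emb \<gamma>) n" using g(4) by simp
      then have "emb d' * coeff \<beta> n = emb (coeff \<gamma> n)" by (simp add: coeff_map_poly emb_hom)
      then show "coeff (smult (emb (d * d')) \<beta>) n = coeff (map_poly emb (smult d \<gamma>)) n"
        by (simp add: coeff_map_poly emb_hom mult.assoc)
    qed
    ultimately show ?thesis by (simp add: map_poly_pCons emb_hom)
  qed
  moreover have "d * d' \<in> D" "d * d' \<noteq> 0" using a g by (auto intro: subring_mult[OF D])
  moreover have "pCons (d' * f) (smult d \<gamma>) \<in> poly_over ?R"
    using a g const_pring[OF D] by (intro poly_over_pCons[OF R] poly_over_smult[OF R] subring_mult[OF R]) auto
  ultimately show ?case by blast
qed

lemma alg_indep_emb: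
  assumes D: "subring D" and J: "alg_indep D X J"
  shows "alg_indep (frac_set D) (\<lambda>i. emb (X i)) J"
  unfolding alg_indep_def transc_def
proof (intro ballI impI)
  fix a \<beta> assume a: "a \<in> J" and \<beta>: "\<beta> \<in> poly_over (pring (frac_set D) (\<lambda>i. emb (X i)) (J - {a}))" "poly \<beta> (emb (X a)) = 0"
  obtain d \<gamma> where g: "d \<in> D" "\<gamma> \<in> poly_over (pring D X (J - {a}))" "d \<noteq> 0" "smult (emb d) \<beta> = map_poly emb \<gamma>"
    using poly_over_clear[OF D \<beta>(1)] by blast
  have "emb (poly \<gamma> (X a)) = emb d * poly \<beta> (emb (X a))" unfolding emb_poly g(4)[symmetric] by simp
  then have "poly \<gamma> (X a) = 0" using \<beta>(2) by (simp add: emb_eq_0_iff)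
  then have "\<gamma> = 0" using J a g(2) by (auto simp: alg_indep_def dest: transcD)
  then have "smult (emb d) \<beta> = 0" using g(4) by simp
  then show "\<beta> = 0" using g(3) by (simp add: emb_eq_0_iff)
qed

section \<open>Extension of derivations\<close>

text \<open>A derivation along the homomorphism \<open>h\<close>. With \<open>h\<close> an
  evaluation map, derivations are first defined on polynomials and then pushed down to
  values.\<close>

definition derivation_on :: "'r::comm_ring_1 set \<Rightarrow> ('r \<Rightarrow> 's::comm_ring_1) \<Rightarrow> ('r \<Rightarrow> 's) \<Rightarrow> bool" where
  "derivation_on M h T \<longleftrightarrow> (\<forall>u\<in>M. \<forall>v\<in>M. T (u + v) = T u + T v \<and> T (u * v) = T u * h v + h u * T v)"

lemma derivation_onD:
  assumes "derivation_on M h T" "u \<in> M" "v \<in> M"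
  shows "T (u + v) = T u + T v" "T (u * v) = T u * h v + h u * T v"
  using assms by (auto simp: derivation_on_def)

lemma derivation_on_0:
  assumes "subring M" "derivation_on M h T"
  shows "T 0 = 0"
  using derivation_onD(1)[OF assms(2) subring_0[OF assms(1)] subring_0[OF assms(1)]] by simp

lemma derivation_on_diff:
  assumes M: "subring M" and T: "derivation_on M h T" and uv: "u \<in> M" "v \<in> M"
  shows "T (u - v) = T u - T v"
  using derivation_onD(1)[OF T subring_diff[OF M uv] uv(2)] by simp

lemma derivation_on_sum:
  assumes M: "subring M" and T: "derivation_on M h T" and "\<And>i. i \<in> A \<Longrightarrow> f i \<in> M"
  shows "T (sum f A) = (\<Sum>i\<in>A. T (f i))"
  using assms(3)
proof (induction A rule: infinite_finite_induct)
  case (insert a A)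
  then show ?case using derivation_onD(1)[OF T, of "f a" "sum f A"] subring_sum[OF M, of A f] by simp
qed (simp_all add: derivation_on_0[OF M T])

lemma derivation_on_descend:
  assumes M: "subring M" and T: "derivation_on M h T"
    and h: "\<And>u v. h (u - v) = h u - h v" "\<And>u v. h (u + v) = h u + h v" "\<And>u v. h (u * v) = h u * h v"
    and ker: "\<And>u. u \<in> M \<Longrightarrow> h u = 0 \<Longrightarrow> T u = 0"
  shows "\<exists>T'. derivation_on (h ` M) (\<lambda>x. x) T' \<and> (\<forall>u\<in>M. T' (h u) = T u)"
proof -
  define T' where "T' x = T (SOME u. u \<in> M \<and> h u = x)" for x
  have T': "T' (h u) = T u" if u: "u \<in> M" for u
  proof -
    define v where "v = (SOME v. v \<in> M \<and> h v = h u)"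
    have v: "v \<in> M \<and> h v = h u" unfolding v_def by (rule someI[of _ u]) (use u in simp)
    have "h (v - u) = 0" using v h(1) by simp
    then have "T (v - u) = 0" using ker subring_diff[OF M] v u by blast
    then have "T v = T u" using derivation_on_diff[OF M T] v u by simp
    then show ?thesis by (simp add: T'_def v_def)
  qed
  have "derivation_on (h ` M) (\<lambda>x. x) T'"
    unfolding derivation_on_def
    using T' derivation_onD[OF T] subring_add[OF M] subring_mult[OF M] by (auto simp flip: h(2,3))
  then show ?thesis using T' by blast
qed

lemma derivation_on_fractions:
  fixes M :: "'e::field set"
  assumes M: "subring M" and T: "derivation_on M (\<lambda>x. x) T"
    and frac: "\<And>x. \<exists>u\<in>M. \<exists>v\<in>M. v \<noteq> 0 \<and> x = u / v"
  shows "\<exists>d. derivation d \<and> (\<forall>u\<in>M. d u = T u)"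
proof -
  define d where "d x = (let (u, v) = (SOME (u, v). u \<in> M \<and> v \<in> M \<and> v \<noteq> 0 \<and> x = u / v)
    in (T u * v - u * T v) / (v * v))" for x
  have d: "d (u / v) = (T u * v - u * T v) / (v * v)" if uv: "u \<in> M" "v \<in> M" "v \<noteq> 0" for u v
  proof -
    define w where "w = (SOME (u', v'). u' \<in> M \<and> v' \<in> M \<and> v' \<noteq> 0 \<and> u / v = u' / v')"
    have "\<exists>w. case w of (u', v') \<Rightarrow> u' \<in> M \<and> v' \<in> M \<and> v' \<noteq> 0 \<and> u / v = u' / v'"
      using uv by (intro exI[of _ "(u, v)"]) auto
    from someI_ex[OF this] obtain u' v' where w: "w = (u', v')" "u' \<in> M" "v' \<in> M" "v' \<noteq> 0" "u / v = u' / v'"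
      unfolding w_def[symmetric] by (cases w) auto
    have e: "u * v' = u' * v" using w uv by (simp add: field_simps)
    have "T (u * v') = T (u' * v)" by (simp only: e)
    then have e': "T u * v' + u * T v' = T u' * v + u' * T v"
      using derivation_onD(2)[OF T] uv w by simp
    have "(T u' * v' - u' * T v') * (v * v) = (T u * v - u * T v) * (v' * v')"
      using e e' by algebra
    then have "(T u' * v' - u' * T v') / (v' * v') = (T u * v - u * T v) / (v * v)"
      using uv w by (simp add: frac_eq_eq)
    moreover have "d (u / v) = (T u' * v' - u' * T v') / (v' * v')"
      unfolding d_def w_def[symmetric] w(1) by simp
    ultimately show ?thesis by simp
  qed
  have "derivation d"
    unfolding derivation_def
  proof (intro conjI allI)
    fix x y
    obtain u v where x: "u \<in> M" "v \<in> M" "v \<noteq> 0" "x = u / v" using frac by blast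
    obtain u' v' where y: "u' \<in> M" "v' \<in> M" "v' \<noteq> 0" "y = u' / v'" using frac by blast
    have m: "u * v' \<in> M" "u' * v \<in> M" "v * v' \<in> M" "u * u' \<in> M" "v * v' \<noteq> 0"
      using x y by (auto intro: subring_mult[OF M])
    have T1: "T (u * v' + u' * v) = (T u * v' + u * T v') + (T u' * v + u' * T v)"
      "T (v * v') = T v * v' + v * T v'" "T (u * u') = T u * u' + u * T u'"
      using derivation_onD[OF T] x y m by simp_all
    have "x + y = (u * v' + u' * v) / (v * v')" using x y by (simp add: add_frac_eq)
    then have dadd: "d (x + y) = (T (u * v' + u' * v) * (v * v') - (u * v' + u' * v) * T (v * v')) / ((v * v') * (v * v'))"
      using d[OF subring_add[OF M m(1,2)] m(3,5)] by simp
    have dx: "d x = (T u * v - u * T v) / (v * v)" and dy: "d y = (T u' * v' - u' * T v') / (v' * v')"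
      using d x y by simp_all
    show "d (x + y) = d x + d y"
      unfolding dadd dx dy T1 using x(3) y(3) by (subst add_frac_eq; (subst frac_eq_eq)?) (auto simp: algebra_simps)
    have "x * y = (u * u') / (v * v')" using x y by simp
    then have dmul: "d (x * y) = (T (u * u') * (v * v') - (u * u') * T (v * v')) / ((v * v') * (v * v'))"
      using d[OF m(4,3,5)] by simp
    show "d (x * y) = d x * y + x * d y"
      unfolding dmul dx dy T1 unfolding x(4) y(4) using x(3) y(3) by (simp add: field_simps)
  qed
  moreover have "d u = T u" if u: "u \<in> M" for u
  proof -
    have "T 1 + T 1 = T 1" using derivation_onD(2)[OF T subring_1[OF M] subring_1[OF M]] by simp
    then have "T 1 = 0" by (simp only: add_cancel_left_right)
    then show ?thesis using d[OF u subring_1[OF M]] by simp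
  qed
  ultimately show ?thesis by blast
qed

lemma derivation_on_map_poly:
  assumes B: "subring B" and T: "derivation_on B (\<lambda>x. x) T"
  shows "derivation_on (poly_over B) (\<lambda>x. x) (map_poly T)"
  unfolding derivation_on_def
proof (intro ballI conjI)
  fix V W assume V: "V \<in> poly_over B" and W: "W \<in> poly_over B"
  note T0 = derivation_on_0[OF B T]
  show "map_poly T (V + W) = map_poly T V + map_poly T W"
    using derivation_onD(1)[OF T] poly_overD[OF V] poly_overD[OF W]
    by (intro poly_eqI) (simp add: coeff_map_poly T0)
  show "map_poly T (V * W) = map_poly T V * W + V * map_poly T W"
  proof (rule poly_eqI)
    fix n
    have "coeff (map_poly T (V * W)) n = T (\<Sum>i\<le>n. coeff V i * coeff W (n - i))"
      by (simp add: coeff_map_poly T0 coeff_mult)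
    also have "\<dots> = (\<Sum>i\<le>n. T (coeff V i * coeff W (n - i)))"
      using poly_overD[OF V] poly_overD[OF W] by (intro derivation_on_sum[OF B T] subring_mult[OF B])
    also have "\<dots> = (\<Sum>i\<le>n. T (coeff V i) * coeff W (n - i) + coeff V i * T (coeff W (n - i)))"
      using derivation_onD(2)[OF T] poly_overD[OF V] poly_overD[OF W] by simp
    also have "\<dots> = coeff (map_poly T V * W + V * map_poly T W) n"
      by (simp add: coeff_mult coeff_map_poly T0 sum.distrib)
    finally show "coeff (map_poly T (V * W)) n = coeff (map_poly T V * W + V * map_poly T W) n" .
  qed
qed

text \<open>The relation \<open>F(y) = 0\<close> forces the value \<open>\<eta>\<close> at
  \<open>y\<close>. The extension is well defined because pseudo-division by \<open>F\<close> of a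
  polynomial vanishing at \<open>y\<close> leaves no remainder, by minimality.\<close>

lemma derivation_extend_algebraic:
  fixes y :: "'e::field"
  assumes B: "subring B" and T: "derivation_on B (\<lambda>x. x) T"
    and F: "F \<in> poly_over B" "F \<noteq> 0" "poly F y = 0" "poly (pderiv F) y \<noteq> 0"
    and uniq: "\<And>V. V \<in> poly_over B \<Longrightarrow> degree V < degree F \<Longrightarrow> poly V y = 0 \<Longrightarrow> V = 0"
    and frac: "\<And>x. \<exists>V\<in>poly_over B. \<exists>W\<in>poly_over B. poly W y \<noteq> 0 \<and> x = poly V y / poly W y"
  shows "\<exists>d. derivation d \<and> (\<forall>b\<in>B. d b = T b)"
proof -
  define \<eta> where "\<eta> = - poly (map_poly T F) y / poly (pderiv F) y"
  define U where "U W = poly (map_poly T W) y + poly (pderiv W) y * \<eta>" for W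
  note PB = subring_poly_over[OF B]
  note DT = derivation_on_map_poly[OF B T]
  have U: "derivation_on (poly_over B) (\<lambda>W. poly W y) U"
    unfolding derivation_on_def U_def
    using derivation_onD[OF DT] by (simp add: pderiv_add pderiv_mult algebra_simps)
  have UF: "U F = 0" using F(4) by (simp add: U_def \<eta>_def)
  have U1: "U W = 0" if W: "W \<in> poly_over B" "poly W y = 0" for W
  proof -
    obtain N q r where r: "q \<in> poly_over B" "r \<in> poly_over B" "smult (lead_coeff F ^ N) W = F * q + r"
      "r = 0 \<or> degree r < degree F" using pseudo_division[OF B F(1,2) W(1)] by blast
    let ?c = "lead_coeff F ^ N"
    have "poly (smult ?c W) y = poly (F * q + r) y" by (simp only: r(3))
    then have "poly r y = 0" using W(2) F(3) by simp
    then have "r = 0" using uniq r(2,4) by blast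
    then have e: "[:?c:] * W = F * q" using r(3) by simp
    have c: "[:?c:] \<in> poly_over B" using F(1) by (intro poly_over_const B subring_power[OF B] poly_overD)
    have "U ([:?c:] * W) = U (F * q)" by (simp only: e)
    then have "?c * U W = 0"
      using derivation_onD(2)[OF U c W(1)] derivation_onD(2)[OF U F(1) r(1)] W(2) F(3) UF by simp
    then show ?thesis using F(2) by simp
  qed
  obtain T' where T': "derivation_on ((\<lambda>W. poly W y) ` poly_over B) (\<lambda>x. x) T'"
    "\<And>W. W \<in> poly_over B \<Longrightarrow> T' (poly W y) = U W"
    using derivation_on_descend[OF PB U] U1 by auto
  obtain d where d: "derivation d" "\<And>u. u \<in> (\<lambda>W. poly W y) ` poly_over B \<Longrightarrow> d u = T' u"
    using derivation_on_fractions[OF subring_image[OF B] T'(1)] frac by (auto simp: bex_simps)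
  have "d b = T b" if b: "b \<in> B" for b
  proof -
    have bp: "[:b:] \<in> poly_over B" using b by (intro poly_over_const B)
    then have "d b = T' (poly [:b:] y)" using d(2)[OF imageI[OF bp]] by simp
    also have "\<dots> = T b" using T'(2)[OF bp] derivation_on_0[OF B T] by (simp add: U_def map_poly_pCons)
    finally show ?thesis .
  qed
  then show ?thesis using d(1) by blast
qed

lemma partial_derivative_pring:
  fixes k :: "'r::idom set"
  assumes k: "subring k" and I: "alg_indep k X I" and a: "a \<in> I"
  shows "\<exists>T. derivation_on (pring k X I) (\<lambda>x. x) T \<and> (\<forall>b\<in>pring k X (I - {a}). T b = 0) \<and> T (X a) = 1"
proof -
  let ?R = "pring k X (I - {a})"
  have R: "subring ?R" by (rule subring_pring[OF k])
  let ?T = "\<lambda>\<beta>. poly (pderiv \<beta>) (X a)"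
  have "derivation_on (poly_over ?R) (\<lambda>\<beta>. poly \<beta> (X a)) ?T"
    unfolding derivation_on_def by (simp add: pderiv_add pderiv_mult algebra_simps)
  moreover have "?T \<beta> = 0" if "\<beta> \<in> poly_over ?R" "poly \<beta> (X a) = 0" for \<beta>
    using transcD[of ?R "X a" \<beta>] that I a by (simp add: alg_indep_def)
  ultimately obtain T where T: "derivation_on ((\<lambda>\<beta>. poly \<beta> (X a)) ` poly_over ?R) (\<lambda>x. x) T"
    "\<And>\<beta>. \<beta> \<in> poly_over ?R \<Longrightarrow> T (poly \<beta> (X a)) = ?T \<beta>"
    using derivation_on_descend[OF subring_poly_over[OF R], of "\<lambda>\<beta>. poly \<beta> (X a)" ?T] by auto
  have "T b = 0" if "b \<in> ?R" for b
    using T(2)[of "[:b:]"] that by (simp add: poly_over_const[OF R] pderiv_pCons)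
  moreover have "T (X a) = 1"
    using T(2)[of "[:0, 1:]"] by (simp add: poly_over_pCons[OF R] poly_over_const[OF R] subring_0[OF R] subring_1[OF R] pderiv_pCons)
  ultimately show ?thesis using T(1) pring_insert_eq[OF k a, of X] by auto
qed

lemma derivation_into:
  assumes k: "subring k" and L: "subring L" and d: "derivation d" and "d ` k \<subseteq> L" "k \<subseteq> L" "\<And>i. i \<in> I \<Longrightarrow> X i \<in> L \<and> d (X i) \<in> L"
    and b: "b \<in> pring k X I"
  shows "d b \<in> L"
proof -
  have "subring {b\<in>L. d b \<in> L}"
    unfolding subring_def
    using subringD[OF L] d by (auto simp: derivation_0 derivation_1 derivation_add derivation_mult derivation_uminus)
  then have "pring k X I \<subseteq> {b\<in>L. d b \<in> L}"
    using assms by (intro pring_minimal) auto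
  then show ?thesis using b by blast
qed

section \<open>Localised primes and generic coordinates\<close>

text \<open>The extension of \<open>P\<close> to a localisation with denominators \<open>M\<close>.
  By \<open>loc_prime_iff\<close> membership can be tested with any denominator that clears
  \<open>x\<close>.\<close>

definition loc_prime :: "'r::idom fract set \<Rightarrow> 'r set \<Rightarrow> 'r set \<Rightarrow> 'r fract set" where
  "loc_prime L M P = {x\<in>L. \<exists>\<mu>\<in>M. \<exists>f\<in>P. emb \<mu> * x = emb f}"

context
  fixes L :: "'r::idom fract set" and M P :: "'r set"
  assumes L: "subring L" and M: "1 \<in> M" "\<And>u v. u \<in> M \<Longrightarrow> v \<in> M \<Longrightarrow> u * v \<in> M"
    and rep: "\<And>x. x \<in> L \<Longrightarrow> \<exists>\<mu>\<in>M. \<exists>f. emb \<mu> * x = emb f"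
    and P: "prime_of UNIV P" and MP: "M \<inter> P = {}"
begin

lemma loc_prime_iff:
  assumes "x \<in> L" "\<mu> \<in> M" "emb \<mu> * x = emb f"
  shows "x \<in> loc_prime L M P \<longleftrightarrow> f \<in> P"
proof
  assume "x \<in> loc_prime L M P"
  then obtain \<nu> g where *: "\<nu> \<in> M" "g \<in> P" "emb \<nu> * x = emb g" by (auto simp: loc_prime_def)
  have "emb (\<nu> * f) = emb (\<mu> * g)" unfolding emb_hom assms(3)[symmetric] *(3)[symmetric] by (simp add: mult_ac)
  then have "\<nu> * f \<in> P" using *(2) ideal_of_mult[OF prime_of_ideal[OF P]] by (simp add: emb_eq_iff)
  then show "f \<in> P" using prime_of_mult[OF P] *(1) MP by blast
qed (use assms in \<open>auto simp: loc_prime_def\<close>)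

lemma prime_of_loc_prime: "prime_of L (loc_prime L M P)"
  unfolding prime_of_def ideal_of_def
proof (intro conjI ballI impI)
  note Id = prime_of_ideal[OF P]
  show "loc_prime L M P \<subseteq> L" by (auto simp: loc_prime_def)
  show "0 \<in> loc_prime L M P"
    using loc_prime_iff[of 0 1 0] M(1) subring_0[OF L] ideal_of_0[OF Id] by (simp add: emb_hom)
  show "1 \<notin> loc_prime L M P"
    using loc_prime_iff[of 1 1 1] M(1) subring_1[OF L] prime_of_1[OF P] by (simp add: emb_hom)
next
  note Id = prime_of_ideal[OF P]
  fix x y assume "x \<in> loc_prime L M P" "y \<in> loc_prime L M P"
  then obtain \<mu> f \<nu> g where *: "x \<in> L" "\<mu> \<in> M" "f \<in> P" "emb \<mu> * x = emb f"
    "y \<in> L" "\<nu> \<in> M" "g \<in> P" "emb \<nu> * y = emb g" by (auto simp: loc_prime_def)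
  have "emb (\<mu> * \<nu>) * (x + y) = emb (\<nu> * f + \<mu> * g)"
    unfolding emb_hom *(4)[symmetric] *(8)[symmetric] by (simp add: algebra_simps)
  moreover have "\<nu> * f + \<mu> * g \<in> P" using * ideal_of_add[OF Id] ideal_of_mult[OF Id] by blast
  ultimately show "x + y \<in> loc_prime L M P"
    using loc_prime_iff[of "x + y" "\<mu> * \<nu>"] * M(2) subring_add[OF L] by blast
next
  note Id = prime_of_ideal[OF P]
  fix x y assume "x \<in> L" "y \<in> loc_prime L M P"
  then obtain \<nu> g where *: "y \<in> L" "\<nu> \<in> M" "g \<in> P" "emb \<nu> * y = emb g" by (auto simp: loc_prime_def)
  obtain \<mu> f where f: "\<mu> \<in> M" "emb \<mu> * x = emb f" using rep \<open>x \<in> L\<close> by blast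
  have "emb (\<mu> * \<nu>) * (x * y) = emb (f * g)"
    unfolding emb_hom *(4)[symmetric] f(2)[symmetric] by (simp add: algebra_simps)
  moreover have "f * g \<in> P" using * ideal_of_mult[OF Id] by blast
  ultimately show "x * y \<in> loc_prime L M P"
    using loc_prime_iff[of "x * y" "\<mu> * \<nu>"] * f M(2) subring_mult[OF L] \<open>x \<in> L\<close> by blast
next
  fix x y assume xy: "x \<in> L" "y \<in> L" "x * y \<in> loc_prime L M P"
  obtain \<mu> f where f: "\<mu> \<in> M" "emb \<mu> * x = emb f" using rep xy by blast
  obtain \<nu> g where g: "\<nu> \<in> M" "emb \<nu> * y = emb g" using rep xy by blast
  have "emb (\<mu> * \<nu>) * (x * y) = emb (f * g)"
    unfolding emb_hom g(2)[symmetric] f(2)[symmetric] by (simp add: algebra_simps)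
  then have "f * g \<in> P"
    using loc_prime_iff[of "x * y" "\<mu> * \<nu>"] xy f g M(2) subring_mult[OF L] by blast
  then have "f \<in> P \<or> g \<in> P" using prime_of_mult[OF P] by blast
  then show "x \<in> loc_prime L M P \<or> y \<in> loc_prime L M P"
    using loc_prime_iff[OF xy(1) f] loc_prime_iff[OF xy(2) g] by blast
qed

lemma loc_prime_derivation:
  assumes d: "derivation d" "d ` P \<subseteq> P" and dL: "frac_deriv d ` L \<subseteq> L"
  shows "frac_deriv d ` loc_prime L M P \<subseteq> loc_prime L M P"
proof
  note Id = prime_of_ideal[OF P]
  fix u assume "u \<in> frac_deriv d ` loc_prime L M P"
  then obtain x \<mu> f where *: "u = frac_deriv d x" "x \<in> L" "\<mu> \<in> M" "f \<in> P" "emb \<mu> * x = emb f"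
    by (auto simp: loc_prime_def)
  have "frac_deriv d (emb \<mu> * x) = emb (d f)" unfolding *(5) by (rule frac_deriv_emb[OF d(1)])
  then have e: "emb (d \<mu>) * x + emb \<mu> * u = emb (d f)"
    unfolding *(1) by (simp add: derivation_mult[OF derivation_frac_deriv[OF d(1)]] frac_deriv_emb[OF d(1)])
  have "emb (\<mu> * \<mu>) * u = emb \<mu> * (emb (d \<mu>) * x + emb \<mu> * u) - emb (d \<mu>) * (emb \<mu> * x)"
    by (simp add: emb_hom algebra_simps)
  also have "\<dots> = emb (\<mu> * d f - d \<mu> * f)" unfolding e *(5) by (simp add: emb_def)
  finally have "emb (\<mu> * \<mu>) * u = emb (\<mu> * d f - d \<mu> * f)" .
  moreover have "\<mu> * d f - d \<mu> * f \<in> P"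
    using *(4) d(2) by (intro ideal_of_diff[OF Id subring_UNIV] ideal_of_mult[OF Id]) auto
  moreover have "u \<in> L" using *(1,2) dL by blast
  ultimately show "u \<in> loc_prime L M P"
    using loc_prime_iff[of u "\<mu> * \<mu>"] *(3) M(2) by blast
qed

end

lemma not_transc_hom:
  fixes h :: "'r::idom \<Rightarrow> 's::idom"
  assumes x: "\<not> transc R x" and RS: "h ` R \<subseteq> S"
    and h: "\<And>a b. h (a + b) = h a + h b" "\<And>a b. h (a * b) = h a * h b" "\<And>a. h a = 0 \<Longrightarrow> a = 0"
  shows "\<not> transc S (h x)"
proof
  assume tr: "transc S (h x)"
  have "h 0 + h 0 = h 0" using h(1)[of 0 0] by simp
  then have h0: "h 0 = 0" by (simp only: add_cancel_left_right)
  obtain \<beta> where \<beta>: "\<beta> \<in> poly_over R" "poly \<beta> x = 0" "\<beta> \<noteq> 0" using x by (auto simp: transc_def)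
  have "poly (map_poly h \<beta>) (h x) = h (poly \<beta> x)"
    by (induction \<beta>) (simp_all add: h0 h map_poly_pCons)
  moreover have "map_poly h \<beta> \<in> poly_over S"
    using poly_overD[OF \<beta>(1)] RS by (auto simp: poly_over_def coeff_map_poly h0)
  ultimately have "map_poly h \<beta> = 0" using \<beta>(2) h0 transcD[OF tr] by simp
  then have "h (coeff \<beta> n) = 0" for n using coeff_map_poly[of h \<beta> n] h0 by simp
  then have "\<beta> = 0" using h(3) by (intro poly_eqI) simp
  then show False using \<beta>(3) by blast
qed

lemma tv_pt: "subring C \<Longrightarrow> tv v \<in> pt C"
  by (auto simp: pt_def tv_def lookup_single when_def subring_0 subring_1)

lemma cst_pt: "subring C \<Longrightarrow> c \<in> C \<Longrightarrow> cst c \<in> pt C"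
  by (auto simp: pt_def cst_def lookup_single when_def subring_0)

lemma lookup_tv_0: "lkp (tv v) 0 = (0 :: 'a::comm_ring_1)"
proof -
  have "sng v (1::nat) \<noteq> 0" by (metis lookup_single_eq lookup_zero zero_neq_one)
  then show ?thesis by (simp add: tv_def lookup_single)
qed

lemma lookup_cst_0: "lkp (cst a) 0 = (a :: 'a::comm_ring_1)"
  by (simp add: cst_def)

lemma cst_of_nat: "cst (of_nat n :: 'a::comm_ring_1) = of_nat n"
  by (induction n) (auto simp: cst_hom)

lemma emb_sum: "emb (sum f A) = (\<Sum>i\<in>A. emb (f i))"
  by (induction A rule: infinite_finite_induct) (auto simp: emb_hom)

lemma emb_of_nat: "emb (of_nat n :: 'a::idom) = of_nat n"
  by (induction n) (auto simp: emb_hom)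

text \<open>The indices below r carry the generic linear forms, the index r + b carries the
  generator z b itself and the index 2 * r carries the generic primitive element.\<close>

locale generic =
  fixes C :: "'a::idom set" and z :: "nat \<Rightarrow> 'a" and r :: nat and J :: "nat set"
  assumes C: "subfield C" and char: "\<And>n. n > 0 \<Longrightarrow> of_nat n \<noteq> (0::'a)"
    and gen: "pring C z {..<r} = UNIV"
    and J: "J \<subseteq> {..<r}" "alg_indep C z J" "\<And>b. b < r \<Longrightarrow> \<not> transc (pring C z J) (z b)"
begin

text \<open>Entry \<open>b\<close> of row \<open>a\<close> is the indeterminate numbered
  \<open>a * r + b\<close>. The rows below \<open>r\<close> perturb the generators, and row
  \<open>r\<close> is the primitive element.\<close>

definition row :: "nat \<Rightarrow> 'a mp" where "row a = (\<Sum>b<r. tv (a * r + b) * cst (z b))"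
definition Xt :: "nat \<Rightarrow> 'a mp" where
  "Xt i = (if i < r then cst (z i) + row i else if i < 2 * r then cst (z (i - r)) else row r)"
definition X :: "nat \<Rightarrow> 'a mp fract" where "X i = emb (Xt i)"
definition y :: "'a mp fract" where "y = emb (row r)"
definition D :: "'a mp set" where "D = pt C"
definition k :: "'a mp fract set" where "k = frac_set D"
text \<open>The vector field that puts row \<open>c\<close> in place of row \<open>a\<close>: it
  kills the other rows and the original algebra, by \<open>comb_row\<close> and
  \<open>comb_cst\<close>. With \<open>c = r\<close> it sends \<open>X a\<close> to \<open>y\<close>
  and kills \<open>y\<close>.\<close>

definition comb :: "nat \<Rightarrow> nat \<Rightarrow> 'a mp \<Rightarrow> 'a mp" where
  "comb c a f = (\<Sum>b<r. tv (c * r + b) * dvar (a * r + b) f)"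

abbreviation B where "B \<equiv> pring k X J"

lemma Cr: "subring C" using C by (simp add: subfield_def)
lemma Dr: "subring D" unfolding D_def by (rule subring_pt[OF Cr])
lemma kf: "subfield k" unfolding k_def by (rule subfield_frac_set[OF Dr])
lemma kr: "subring k" using kf by (simp add: subfield_def)
lemma Br: "subring B" by (rule subring_pring[OF kr])
lemma finJ: "finite J" using J(1) by (auto intro: finite_subset)
lemma X_eq: "X = (\<lambda>i. emb (Xt i))" by (simp add: X_def fun_eq_iff)
lemma y_eq: "y = X (2 * r)" by (simp add: y_def X_def Xt_def)

lemma emb_D_k: "f \<in> D \<Longrightarrow> emb f \<in> k"
  unfolding k_def by (rule frac_set_emb[OF Dr])

lemma tv_D: "tv v \<in> D" unfolding D_def by (rule tv_pt[OF Cr])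

lemma char_E: "n > 0 \<Longrightarrow> of_nat n \<noteq> (0 :: 'a mp fract)"
proof -
  assume n: "n > 0"
  have "(of_nat n :: 'a mp fract) = emb (cst (of_nat n))" by (simp add: cst_of_nat emb_of_nat)
  moreover have "cst (of_nat n :: 'a) \<noteq> cst 0" unfolding cst_inj using char[OF n] .
  ultimately show ?thesis by (simp add: emb_eq_0_iff cst_hom)
qed

lemma lookup_Xt: "a \<in> J \<Longrightarrow> lkp (Xt a) 0 = z a"
  using J(1) by (auto simp: Xt_def row_def lookup_add lookup_sum lookup_0_mult lookup_tv_0 lookup_cst_0)

lemma indep_Xt: "I \<subseteq> J \<Longrightarrow> alg_indep D Xt I"
  unfolding D_def using low_coeff_pring[OF Cr _ alg_indep_subset[OF J(2)], of I Xt] lookup_Xt finJ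
  by (auto intro: finite_subset)

lemma indep_X: "alg_indep k X J"
  unfolding k_def X_eq using alg_indep_emb[OF Dr indep_Xt[OF order.refl]] .

lemma algebraic_over_z:
  assumes x: "x \<in> pring k X {r..<2 * r}"
  shows "\<not> transc (pring k X ((+) r ` J)) x"
proof (rule algebraic_trans[OF kr, of "{r..<2 * r}"])
  fix i assume i: "i \<in> {r..<2 * r}"
  then have "\<not> transc (pring C z J) (z (i - r))" by (intro J(3)) auto
  moreover have "(\<lambda>a. emb (cst a)) ` pring C z J \<subseteq> pring k X ((+) r ` J)"
  proof -
    let ?S = "pring k X ((+) r ` J)"
    have S: "subring ?S" by (rule subring_pring[OF kr])
    have "subring {a. emb (cst a) \<in> ?S}"
      unfolding subring_def using subringD[OF S] by (auto simp: emb_hom cst_hom)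
    moreover have "emb (cst c) \<in> ?S" if "c \<in> C" for c
      using that by (intro const_pring[OF kr] emb_D_k) (simp add: D_def cst_pt[OF Cr])
    moreover have "emb (cst (z a)) \<in> ?S" if "a \<in> J" for a
    proof -
      have "X (r + a) = emb (cst (z a))" using that J(1) by (auto simp: X_def Xt_def)
      then show ?thesis using var_pring[OF kr, of "r + a" "(+) r ` J" X] that by auto
    qed
    ultimately have "pring C z J \<subseteq> {a. emb (cst a) \<in> ?S}" by (intro pring_minimal Cr) auto
    then show ?thesis by blast
  qed
  ultimately have "\<not> transc (pring k X ((+) r ` J)) (emb (cst (z (i - r))))"
    by (rule not_transc_hom) (auto simp: emb_hom cst_hom emb_eq_0_iff cst_inj[of _ 0, unfolded cst_hom])
  then show "\<not> transc (pring k X ((+) r ` J)) (X i)" using i by (simp add: X_def Xt_def)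
qed (use x in \<open>simp_all add: not_transc_self subring_pring[OF kr]\<close>)

text \<open>Otherwise \<open>y\<close> and the \<open>X a\<close> with \<open>a \<in> J\<close>
  would be \<open>card J + 1\<close> independent elements, all algebraic over the
  \<open>card J\<close> elements \<open>z b\<close> with \<open>b \<in> J\<close>, against
  \<open>steinitz\<close>.\<close>

lemma y_algebraic: "\<not> transc B y"
proof
  assume tr: "transc B y"
  let ?T = "(+) r ` J"
  let ?S = "pring k X {r..<2 * r}"
  have S: "subring ?S" by (rule subring_pring[OF kr])
  have z: "emb (cst (z b)) \<in> ?S" if "b < r" for b
    using var_pring[OF kr, of "r + b" "{r..<2 * r}" X] that by (simp add: X_def Xt_def)
  have row: "emb (row a) \<in> ?S" for a
  proof -
    have "emb (row a) = (\<Sum>b<r. emb (tv (a * r + b)) * emb (cst (z b)))"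
      unfolding row_def by (simp add: emb_sum emb_hom)
    also have "\<dots> \<in> ?S"
      using z const_pring[OF kr emb_D_k[OF tv_D]] by (intro subring_sum[OF S] subring_mult[OF S]) auto
    finally show ?thesis .
  qed
  have n: "2 * r \<notin> J" using J(1) by auto
  have "X i \<in> ?S" if "i \<in> insert (2 * r) J" for i
    using that J(1) row z S by (auto simp: X_def Xt_def emb_hom intro!: subring_add[OF S])
  moreover have "alg_indep k X (insert (2 * r) J)"
    by (rule alg_indep_insert[OF kr indep_X n]) (use tr y_eq in simp)
  ultimately have "card (insert (2 * r) J) \<le> card ?T"
    using algebraic_over_z finJ by (intro steinitz[OF kr]) auto
  moreover have "card ?T \<le> card J" using finJ by (rule card_image_le)
  ultimately show False using n finJ by simp
qed

lemma dvar_row: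
  assumes "b < r"
  shows "dvar (a * r + b) (row a') = (if a = a' then cst (z b) else 0)"
proof -
  have idx: "a' * r + b' = a * r + b \<longleftrightarrow> a' = a \<and> b' = b" if "b' < r" for b'
  proof
    assume e: "a' * r + b' = a * r + b"
    have "a' = (a' * r + b') div r" "a = (a * r + b) div r" using that assms by auto
    then have "a' = a" using e by simp
    then show "a' = a \<and> b' = b" using e by simp
  qed simp
  have "dvar (a * r + b) (row a') = (\<Sum>b'<r. if a' = a \<and> b' = b then cst (z b') else 0)"
    unfolding row_def derivation_sum[OF derivation_dvar] using idx
    by (intro sum.cong) (auto simp: derivation_mult[OF derivation_dvar] dvar_tv dvar_cst)
  also have "\<dots> = (if a = a' then cst (z b) else 0)"
    using assms by (cases "a' = a") (auto simp: sum.delta)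
  finally show ?thesis .
qed

lemma derivation_comb: "derivation (comb c a)"
  unfolding derivation_def comb_def
  by (simp add: derivation_add[OF derivation_dvar] derivation_mult[OF derivation_dvar] sum.distrib[symmetric]
      sum_distrib_left sum_distrib_right algebra_simps)

lemma comb_row: "comb c a (row a') = (if a = a' then row c else 0)"
  unfolding comb_def by (simp add: dvar_row row_def[of c])

lemma comb_cst: "comb c a (cst w) = 0"
  unfolding comb_def by (simp add: dvar_cst)

lemma dvar_pt_ideal: "ideal_of UNIV P \<Longrightarrow> dvar v ` pt P \<subseteq> pt P"
  using ideal_of_mult[of UNIV P] by (intro dvar_pt) auto

lemma dvar_D: "dvar v ` D \<subseteq> D"
  unfolding D_def by (intro dvar_pt subring_mult[OF Cr] subring_of_nat[OF Cr])

lemma comb_pt_ideal: "ideal_of UNIV P \<Longrightarrow> comb c a ` pt P \<subseteq> pt P"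
  using dvar_pt_ideal[of P] ideal_of_mult[OF ideal_pt[of P] UNIV_I]
  by (auto simp: comb_def intro!: ideal_of_sum[OF ideal_pt])

lemma comb_D: "comb c a ` D \<subseteq> D"
  using dvar_D tv_D by (auto simp: comb_def intro!: subring_sum[OF Dr] subring_mult[OF Dr])

end

section \<open>A minimal relation for the primitive element and its denominator\<close>

context generic
begin

abbreviation BY where "BY \<equiv> (\<lambda>V. poly V y) ` poly_over B"

lemma BYr: "subring BY" by (rule subring_image[OF Br])

lemma B_BY: "B \<subseteq> BY"
  by (auto simp: image_iff intro!: bexI[of _ "[:_:]"] poly_over_const[OF Br])

lemma y_BY: "y \<in> BY"
  by (intro image_eqI[of _ _ "[:0, 1:]"] poly_over_pCons poly_over_0 Br subring_0[OF Br] subring_1[OF Br]) simp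

lemma exists_minimal_relation:
  "\<exists>F. F \<in> poly_over B \<and> F \<noteq> 0 \<and> poly F y = 0 \<and> poly (pderiv F) y \<noteq> 0 \<and>
    (\<forall>V\<in>poly_over B. degree V < degree F \<longrightarrow> poly V y = 0 \<longrightarrow> V = 0)"
proof -
  define Q where "Q F \<longleftrightarrow> F \<in> poly_over B \<and> F \<noteq> 0 \<and> poly F y = 0" for F
  obtain F0 where "Q F0" using y_algebraic by (auto simp: transc_def Q_def)
  from ex_has_least_nat[of Q, OF this, of degree]
  obtain F where F: "Q F" "\<And>V. Q V \<Longrightarrow> degree F \<le> degree V" by blast
  have uniq: "V = 0" if "V \<in> poly_over B" "degree V < degree F" "poly V y = 0" for V
    using F(2)[of V] that by (auto simp: Q_def)
  have d0: "degree F \<noteq> 0"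
  proof
    assume "degree F = 0"
    then obtain c where "F = [:c:]" by (rule degree_eq_zeroE)
    then show False using F(1) by (simp add: Q_def)
  qed
  have "coeff (pderiv F) (degree F - 1) = of_nat (degree F) * lead_coeff F"
    using d0 by (simp add: coeff_pderiv del: of_nat_Suc)
  also have "\<dots> \<noteq> 0" using char_E[of "degree F"] d0 F(1) by (auto simp: Q_def)
  finally have "pderiv F \<noteq> 0" by auto
  moreover have "degree (pderiv F) < degree F"
  proof -
    have "degree (pderiv F) \<le> degree F - 1"
      using d0 by (intro degree_le) (auto simp: coeff_pderiv coeff_eq_0)
    then show ?thesis using d0 by simp
  qed
  ultimately have "poly (pderiv F) y \<noteq> 0"
    using uniq[of "pderiv F"] poly_over_pderiv[OF Br] F(1) by (auto simp: Q_def)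
  then show ?thesis using F(1) uniq unfolding Q_def by blast
qed

text \<open>\<open>F'(y)\<close> is algebraic over \<open>B\<close> and so divides a nonzero element
  of \<open>B\<close>; multiplying by the leading coefficient of \<open>F\<close> serves both
  divisibilities. Denominators from \<open>k\<close> are cleared so that \<open>s0\<close> is a
  polynomial and its membership in \<open>pt P\<close> can be tested on coefficients.\<close>

lemma exists_denominator:
  assumes F: "F \<in> poly_over B" "F \<noteq> 0" "poly (pderiv F) y \<noteq> 0"
  shows "\<exists>s0. s0 \<in> pring D Xt J \<and> s0 \<noteq> 0 \<and> (\<exists>c\<in>B. lead_coeff F * c = emb s0) \<and>
    (\<exists>w\<in>BY. poly (pderiv F) y * w = emb s0)"
proof -
  have F': "poly (pderiv F) y \<in> BY" using poly_over_pderiv[OF Br F(1)] by blast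
  have "almost_fg B BY"
    by (rule almost_fg_adjoin[OF Br Br order.refl almost_fg_refl[OF Br] y_algebraic])
  then have "\<not> transc B (poly (pderiv F) y)" by (rule almost_fg_algebraic[OF Br BYr _ F'])
  then obtain w where w: "w \<in> BY" "poly (pderiv F) y * w \<in> B" "poly (pderiv F) y * w \<noteq> 0"
    using algebraic_multiple[OF BYr B_BY F' F(3)] by blast
  let ?r = "poly (pderiv F) y * w"
  have lc: "lead_coeff F \<in> B" "lead_coeff F \<noteq> 0" using F poly_overD by auto
  have "lead_coeff F * ?r \<in> pring (frac_set D) (\<lambda>i. emb (Xt i)) J"
    using subring_mult[OF Br lc(1) w(2)] unfolding k_def X_eq .
  then obtain d f where d: "d \<in> D" "f \<in> pring D Xt J" "d \<noteq> 0" "emb d * (lead_coeff F * ?r) = emb f"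
    using pring_clear[OF Dr] by blast
  have dB: "emb d \<in> B" using const_pring[OF kr emb_D_k[OF d(1)]] .
  have "f \<noteq> 0"
  proof
    assume "f = 0"
    then have "emb d * (lead_coeff F * ?r) = 0" using d(4) by (simp add: emb_hom)
    then show False using d(3) lc(2) w(3) by (simp add: emb_eq_0_iff)
  qed
  moreover have "lead_coeff F * (emb d * ?r) = emb f" "poly (pderiv F) y * (emb d * lead_coeff F * w) = emb f"
    using d(4) by (simp_all add: mult_ac)
  moreover have "emb d * ?r \<in> B" using dB w(2) by (rule subring_mult[OF Br])
  moreover have "emb d * lead_coeff F * w \<in> BY"
    using subring_mult[OF BYr _ w(1)] subring_mult[OF Br dB lc(1)] B_BY by blast
  ultimately show ?thesis using d(2) by blast
qed

end

locale generic_extension = generic +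
  fixes F :: "'a mp fract poly" and s0 :: "'a mp"
  assumes F: "F \<in> poly_over B" "F \<noteq> 0" "poly F y = 0" "poly (pderiv F) y \<noteq> 0"
    and uniq: "\<And>V. V \<in> poly_over B \<Longrightarrow> degree V < degree F \<Longrightarrow> poly V y = 0 \<Longrightarrow> V = 0"
    and s0: "s0 \<in> pring D Xt J" "s0 \<noteq> 0" "\<exists>c\<in>B. lead_coeff F * c = emb s0"
      "\<exists>w\<in>BY. poly (pderiv F) y * w = emb s0"
begin

definition s where "s = emb s0"
definition L where "L = {x. \<exists>i. s ^ i * x \<in> BY}"
text \<open>With these denominators \<open>L\<close> is a localisation of the whole polynomial ring
  over the algebra, by \<open>emb_L\<close> and \<open>M_rep\<close>; this is what lets primes of
  the algebra be extended to \<open>L\<close>.\<close>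

definition M where "M = {d * s0 ^ i |d i. d \<in> D \<and> d \<noteq> 0}"

lemma sB: "s \<in> B" unfolding s_def k_def X_eq by (rule emb_pring[OF Dr s0(1)])
lemma s_nz: "s \<noteq> 0" using s0(2) by (simp add: s_def emb_eq_0_iff)
lemma s_pow_BY: "s ^ i \<in> BY" using subring_power[OF Br sB] B_BY by blast

lemma BY_L: "x \<in> BY \<Longrightarrow> x \<in> L"
  unfolding L_def by (intro CollectI exI[of _ 0]) simp

lemma B_L: "x \<in> B \<Longrightarrow> x \<in> L" using BY_L B_BY by blast
lemma k_L: "x \<in> k \<Longrightarrow> x \<in> L" using B_L const_pring[OF kr] by blast

lemma Lr: "subring L"
  unfolding subring_def
proof (intro conjI ballI)
  show "0 \<in> L" "1 \<in> L" using BY_L subring_0[OF BYr] subring_1[OF BYr] by auto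
  fix u v assume "u \<in> L" "v \<in> L"
  then obtain i j where ij: "s ^ i * u \<in> BY" "s ^ j * v \<in> BY" by (auto simp: L_def)
  have "s ^ (i + j) * (u + v) = s ^ j * (s ^ i * u) + s ^ i * (s ^ j * v)"
    "s ^ (i + j) * (u * v) = (s ^ i * u) * (s ^ j * v)"
    by (simp_all add: power_add algebra_simps)
  moreover have "s ^ j * (s ^ i * u) + s ^ i * (s ^ j * v) \<in> BY" "(s ^ i * u) * (s ^ j * v) \<in> BY"
    using subring_add[OF BYr subring_mult[OF BYr s_pow_BY ij(1)] subring_mult[OF BYr s_pow_BY ij(2)]]
      subring_mult[OF BYr ij] by auto
  ultimately show "u + v \<in> L" "u * v \<in> L" unfolding L_def by (metis (mono_tags, lifting) mem_Collect_eq)+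
next
  fix u assume "u \<in> L"
  then obtain i where "s ^ i * u \<in> BY" by (auto simp: L_def)
  then have "s ^ i * - u \<in> BY" using subring_uminus[OF BYr] by fastforce
  then show "- u \<in> L" by (auto simp: L_def)
qed

lemma inverse_s_L: "inverse s \<in> L"
  unfolding L_def using s_nz subring_1[OF BYr] by (intro CollectI exI[of _ 1]) simp

lemma inverse_F'_L: "inverse (poly (pderiv F) y) \<in> L"
proof -
  obtain w where w: "w \<in> BY" "poly (pderiv F) y * w = s" using s0(4) s_def by auto
  have "s ^ 1 * inverse (poly (pderiv F) y) = w" using F(4) by (simp flip: w(2))
  then show ?thesis unfolding L_def using w(1) by (intro CollectI exI[of _ 1]) simp
qed

lemma L_rep:
  assumes "x \<in> L"
  shows "\<exists>i V. V \<in> poly_over B \<and> degree V < degree F \<and> s ^ i * x = poly V y"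
proof -
  obtain i V where V: "V \<in> poly_over B" "s ^ i * x = poly V y" using assms by (auto simp: L_def)
  obtain c where c: "c \<in> B" "lead_coeff F * c = s" using s0(3) s_def by auto
  obtain N q h where h: "h \<in> poly_over B" "smult (lead_coeff F ^ N) V = F * q + h" "h = 0 \<or> degree h < degree F"
    using pseudo_division[OF Br F(1,2) V(1)] by blast
  have "poly (smult (lead_coeff F ^ N) V) y = poly (F * q + h) y" by (simp only: h(2))
  then have e: "lead_coeff F ^ N * poly V y = poly h y" using F(3) by simp
  have "s ^ (N + i) * x = c ^ N * (lead_coeff F ^ N * poly V y)"
    unfolding V(2)[symmetric] c(2)[symmetric] by (simp add: power_add power_mult_distrib mult_ac)
  also have "\<dots> = poly (smult (c ^ N) h) y" unfolding e by simp
  finally have "s ^ (N + i) * x = poly (smult (c ^ N) h) y" .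
  moreover have "smult (c ^ N) h \<in> poly_over B" using c(1) h(1) by (intro poly_over_smult Br subring_power[OF Br])
  moreover have "degree F \<noteq> 0"
  proof
    assume "degree F = 0"
    then obtain b where "F = [:b:]" by (rule degree_eq_zeroE)
    then show False using F by simp
  qed
  then have "degree (smult (c ^ N) h) < degree F"
    using h(3) degree_smult_le[of "c ^ N" h] by auto
  ultimately show ?thesis by blast
qed

text \<open>Differentiating \<open>F(y) = 0\<close> determines \<open>d y\<close> with denominator
  \<open>F'(y)\<close>, a unit of \<open>L\<close>; inverting \<open>s\<close> causes no further
  denominators.\<close>

lemma derivation_L:
  assumes d: "derivation d" "d ` k \<subseteq> L" "\<And>a. a \<in> J \<Longrightarrow> d (X a) \<in> L"
  shows "d y \<in> L" "d ` L \<subseteq> L"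
proof -
  have dB: "d b \<in> L" if "b \<in> B" for b
    using that d k_L B_L[OF var_pring[OF kr, of _ J X]] by (intro derivation_into[OF kr Lr d(1,2), of J X]) auto
  have mp: "poly (map_poly d V) y \<in> L" if "V \<in> poly_over B" for V
    by (rule poly_over_poly[OF Lr _ BY_L[OF y_BY]])
      (use poly_overD[OF that] dB in \<open>auto simp: poly_over_def coeff_map_poly_derivation[OF d(1)]\<close>)
  have "d (poly F y) = 0" using F(3) derivation_0[OF d(1)] by simp
  then have "poly (map_poly d F) y + poly (pderiv F) y * d y = 0" unfolding derivation_poly[OF d(1)] .
  then have "d y = - poly (map_poly d F) y * inverse (poly (pderiv F) y)"
    using F(4) by (simp add: field_simps add_eq_0_iff)
  then show dy: "d y \<in> L" using mp[OF F(1)] inverse_F'_L by (auto intro: subring_mult[OF Lr] subring_uminus[OF Lr])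
  show "d ` L \<subseteq> L"
  proof
    fix u assume "u \<in> d ` L"
    then obtain x where x1: "u = d x" "x \<in> L" by blast
    then obtain i V where x2: "V \<in> poly_over B" "s ^ i * x = poly V y" by (auto simp: L_def)
    note x = x1 x2
    have "d (poly V y) \<in> L"
      unfolding derivation_poly[OF d(1)]
      using mp[OF x(3)] dy BY_L[OF imageI[OF poly_over_pderiv[OF Br x(3)]]]
      by (intro subring_add[OF Lr] subring_mult[OF Lr]) auto
    moreover have "d (poly V y) = d (s ^ i) * x + s ^ i * u"
      unfolding x(4)[symmetric] x(1) by (rule derivation_mult[OF d(1)])
    moreover have "d (s ^ i) * x \<in> L"
      using dB[OF subring_power[OF Br sB]] x(2) by (rule subring_mult[OF Lr])
    ultimately have "d (s ^ i) * x + s ^ i * u - d (s ^ i) * x \<in> L" by (metis subring_diff[OF Lr])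
    then have "inverse s ^ i * (s ^ i * u) \<in> L"
      using subring_mult[OF Lr subring_power[OF Lr inverse_s_L]] by simp
    moreover have "inverse s ^ i * (s ^ i * u) = u"
      using s_nz by (simp add: mult.assoc[symmetric] power_mult_distrib[symmetric])
    ultimately show "u \<in> L" by simp
  qed
qed

lemma frac_deriv_k:
  assumes "derivation d" "d ` D \<subseteq> D"
  shows "frac_deriv d ` k \<subseteq> k"
  unfolding k_def by (rule frac_deriv_frac_set[OF Dr assms])

lemma Xt_J: "a \<in> J \<Longrightarrow> Xt a = cst (z a) + row a"
  using J(1) by (auto simp: Xt_def)

text \<open>Differentiation by the indeterminate at \<open>z b\<close> in row \<open>r\<close>
  preserves \<open>k\<close>, kills every \<open>X a\<close> with \<open>a \<in> J\<close> and sends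
  \<open>y\<close> to \<open>z b\<close>. By \<open>derivation_L\<close> the value at
  \<open>y\<close> lies in \<open>L\<close>. This shows that \<open>y\<close> is a primitive element
  without any discussion of conjugates.\<close>

lemma z_L: assumes b: "b < r" shows "emb (cst (z b)) \<in> L"
proof -
  let ?d = "frac_deriv (dvar (r * r + b)) :: 'a mp fract \<Rightarrow> 'a mp fract"
  have d: "derivation ?d" by (rule derivation_frac_deriv[OF derivation_dvar])
  have "?d y \<in> L"
  proof (rule derivation_L(1)[OF d])
    show "?d ` k \<subseteq> L" using frac_deriv_k[OF derivation_dvar dvar_D] k_L by blast
    show "?d (X a) \<in> L" if "a \<in> J" for a
    proof -
      have "r \<noteq> a" using that J(1) by auto
      then have "?d (X a) = emb 0"
        using that dvar_row[OF b, of r a] unfolding X_def frac_deriv_emb[OF derivation_dvar]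
        by (simp add: Xt_J derivation_add[OF derivation_dvar] dvar_cst)
      then have "?d (X a) = 0" by (simp add: emb_hom)
      then show ?thesis using subring_0[OF Lr] by simp
    qed
  qed
  then show ?thesis using dvar_row[OF b, of r r] by (simp add: y_def frac_deriv_emb[OF derivation_dvar])
qed

lemma emb_L: "emb f \<in> L"
proof -
  have S: "subring {f. emb f \<in> L}"
    unfolding subring_def using subringD[OF Lr] by (auto simp: emb_hom)
  have Sc: "subring {a. emb (cst a) \<in> L}"
    unfolding subring_def using subringD[OF Lr] by (auto simp: emb_hom cst_hom)
  have "pring C z {..<r} \<subseteq> {a. emb (cst a) \<in> L}"
    by (rule pring_minimal[OF Cr Sc]) (use z_L k_L[OF emb_D_k] cst_pt[OF Cr] in \<open>auto simp: D_def\<close>)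
  then have "emb (cst a) \<in> L" for a using gen by blast
  then have "f \<in> {f. emb f \<in> L}"
    using mp_generated[OF S, of f] k_L[OF emb_D_k[OF tv_D]] by blast
  then show ?thesis by simp
qed

lemma exists_pd:
  assumes a: "a \<in> J"
  shows "\<exists>d. derivation d \<and> (\<forall>c\<in>k. d c = 0) \<and> (\<forall>b\<in>J. d (X b) = (if a = b then 1 else 0)) \<and> d ` L \<subseteq> L"
proof -
  obtain T where T: "derivation_on B (\<lambda>x. x) T" "\<And>b. b \<in> pring k X (J - {a}) \<Longrightarrow> T b = 0" "T (X a) = 1"
    using partial_derivative_pring[OF kr indep_X a] by blast
  have frac: "\<exists>V\<in>poly_over B. \<exists>W\<in>poly_over B. poly W y \<noteq> 0 \<and> x = poly V y / poly W y" for x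
  proof -
    obtain f g where fg: "x = emb f / emb g" "g \<noteq> 0" by (cases x) (auto simp: Fract_emb)
    obtain i V where V: "V \<in> poly_over B" "s ^ i * emb f = poly V y" using emb_L[of f] by (auto simp: L_def)
    obtain j W where W: "W \<in> poly_over B" "s ^ j * emb g = poly W y" using emb_L[of g] by (auto simp: L_def)
    have "x = poly (smult (s ^ j) V) y / poly (smult (s ^ i) W) y"
      using fg s_nz by (simp flip: V(2) W(2) add: emb_eq_0_iff field_simps)
    moreover have "poly (smult (s ^ i) W) y \<noteq> 0"
      using fg s_nz by (simp flip: W(2) add: emb_eq_0_iff)
    moreover have "smult (s ^ j) V \<in> poly_over B" "smult (s ^ i) W \<in> poly_over B"
      using V(1) W(1) by (auto intro!: poly_over_smult[OF Br] subring_power[OF Br sB])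
    ultimately show ?thesis by blast
  qed
  obtain d where d: "derivation d" "\<And>b. b \<in> B \<Longrightarrow> d b = T b"
    using derivation_extend_algebraic[OF Br T(1) F uniq frac] by blast
  have dk: "d c = 0" if "c \<in> k" for c
    using d(2)[OF const_pring[OF kr that]] T(2)[OF const_pring[OF kr that]] by simp
  have dX: "d (X b) = (if a = b then 1 else 0)" if "b \<in> J" for b
    using d(2)[OF var_pring[OF kr that]] T(3) T(2)[OF var_pring[OF kr, of b "J - {a}" X]] that by auto
  have "d ` L \<subseteq> L"
    using dk dX subring_0[OF Lr] subring_1[OF Lr] by (intro derivation_L(2)[OF d(1)]) auto
  then show ?thesis using d(1) dk dX by blast
qed

lemma M_1: "1 \<in> M" unfolding M_def using subring_1[OF Dr] by (intro CollectI exI[of _ 1] exI[of _ 0]) simp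

lemma M_mult: "u \<in> M \<Longrightarrow> v \<in> M \<Longrightarrow> u * v \<in> M"
proof -
  assume "u \<in> M" "v \<in> M"
  then obtain d i d' i' where "u = d * s0 ^ i" "v = d' * s0 ^ i'" "d \<in> D" "d' \<in> D" "d \<noteq> 0" "d' \<noteq> 0"
    by (auto simp: M_def)
  then have "u * v = (d * d') * s0 ^ (i + i') \<and> d * d' \<in> D \<and> d * d' \<noteq> 0"
    by (auto simp: power_add mult_ac intro: subring_mult[OF Dr])
  then show ?thesis unfolding M_def by blast
qed

lemma M_rep:
  assumes "x \<in> L"
  shows "\<exists>\<mu>\<in>M. \<exists>f. emb \<mu> * x = emb f"
proof -
  obtain i V where V: "V \<in> poly_over B" "s ^ i * x = poly V y" using assms by (auto simp: L_def)
  obtain d \<gamma> where d: "d \<in> D" "d \<noteq> 0" "smult (emb d) V = map_poly emb \<gamma>"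
    using poly_over_clear[OF Dr V(1)[unfolded k_def X_eq]] by blast
  have "emb (d * s0 ^ i) * x = emb d * poly V y" by (simp add: emb_hom emb_power s_def flip: V(2))
  also have "\<dots> = poly (smult (emb d) V) y" by simp
  also have "\<dots> = emb (poly \<gamma> (row r))" unfolding d(3) y_def emb_poly ..
  finally show ?thesis unfolding M_def using d(1,2) by blast
qed

text \<open>A nonzero element of \<open>D\<close> has a nonzero coefficient in the field
  \<open>C\<close>, so it cannot lie in the extension of a proper ideal.\<close>

lemma M_avoids:
  assumes P: "prime_of UNIV P" and s: "s0 \<notin> pt P"
  shows "M \<inter> pt P = {}"
proof (rule ccontr)
  assume "M \<inter> pt P \<noteq> {}"
  then obtain d i where d: "d \<in> D" "d \<noteq> 0" "d * s0 ^ i \<in> pt P" by (auto simp: M_def)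
  have pP: "prime_of UNIV (pt P)" by (rule prime_pt[OF P])
  have "d \<in> pt P" using prime_of_mult[OF pP _ _ d(3)] prime_of_power[OF pP subring_UNIV] s by blast
  obtain m where m: "lkp d m \<noteq> 0" using d(2) by (metis poly_mapping_eqI lookup_zero)
  have "lkp d m \<in> C" "lkp d m \<in> P" using d(1) \<open>d \<in> pt P\<close> by (auto simp: D_def pt_def)
  then obtain v where "lkp d m * v = 1" using C m by (auto simp: subfield_def)
  then have "1 \<in> P" using ideal_of_mult2[OF prime_of_ideal[OF P] UNIV_I \<open>lkp d m \<in> P\<close>] by metis
  then show False using prime_of_1[OF P] by blast
qed

end

section \<open>The derivations between coordinates and the constant over the polynomial ring\<close>

context generic_extension
begin

text \<open>\<open>comb c a\<close> alone sends \<open>X a\<close> to \<open>row c\<close>; the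
  additional partial derivative supplies the missing summand \<open>z c\<close> of
  \<open>X c\<close>.\<close>

definition Dx0 :: "nat \<Rightarrow> nat \<Rightarrow> 'a mp \<Rightarrow> 'a mp" where
  "Dx0 a c f = dvar (a * r + c) f + comb c a f"

lemma derivation_Dx0: "derivation (Dx0 a c)"
  using derivation_dvar[of "a * r + c"] derivation_comb[of c a]
  unfolding derivation_def Dx0_def by (simp add: algebra_simps)

lemma Dx0_D: "Dx0 a c ` D \<subseteq> D"
  using dvar_D comb_D unfolding image_subset_iff Dx0_def by (blast intro: subring_add[OF Dr])

lemma Dx0_pt:
  assumes "ideal_of UNIV P"
  shows "Dx0 a c ` pt P \<subseteq> pt P"
  using dvar_pt_ideal[OF assms] comb_pt_ideal[OF assms] unfolding image_subset_iff Dx0_def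
  by (blast intro: ideal_of_add[OF ideal_pt[OF assms]])

lemma comb_X: "b \<in> J \<Longrightarrow> frac_deriv (comb c a) (X b) = (if a = b then emb (row c) else 0)"
  by (simp add: X_def frac_deriv_emb[OF derivation_comb] Xt_J derivation_add[OF derivation_comb] comb_cst comb_row emb_hom(3))

lemma comb_y: "a \<in> J \<Longrightarrow> frac_deriv (comb r a) y = 0"
  using J(1) by (auto simp: y_def frac_deriv_emb[OF derivation_comb] comb_row emb_hom(3))

lemma Dx0_X:
  assumes "b \<in> J" "c \<in> J"
  shows "frac_deriv (Dx0 a c) (X b) = (if a = b then X c else 0)"
proof -
  have c: "c < r" using assms(2) J(1) by auto
  have "Dx0 a c (Xt b) = (if a = b then Xt c else 0)"
    using assms dvar_row[OF c, of a b]
    by (simp add: Xt_J Dx0_def derivation_add[OF derivation_comb] derivation_add[OF derivation_dvar] dvar_cst comb_cst comb_row)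
  then show ?thesis by (simp add: X_def frac_deriv_emb[OF derivation_Dx0] emb_hom(3))
qed

lemma exists_generic_constant:
  fixes \<delta> :: "nat \<Rightarrow> 'a \<Rightarrow> 'a"
  assumes \<delta>: "\<And>i. i < m \<Longrightarrow> derivation (\<delta> i)" "\<And>i c. i < m \<Longrightarrow> c \<in> C \<Longrightarrow> \<delta> i c = 0"
    and PP: "infinite PP" "\<And>P. P \<in> PP \<Longrightarrow> height_one_prime P" "\<And>P i. P \<in> PP \<Longrightarrow> i < m \<Longrightarrow> \<delta> i ` P \<subseteq> P"
      "\<And>P. P \<in> PP \<Longrightarrow> \<exists>a\<in>J. P \<inter> pring C z (J - {a}) = {0}" "\<And>P. P \<in> PP \<Longrightarrow> s0 \<notin> pt P"
  shows "\<exists>f. f \<notin> k \<and> (\<forall>i<m. frac_deriv (dcoef (\<delta> i)) f = 0)"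
proof -
  have "\<forall>a\<in>J. \<exists>d. derivation d \<and> (\<forall>c\<in>k. d c = 0) \<and> (\<forall>b\<in>J. d (X b) = (if a = b then 1 else 0)) \<and> d ` L \<subseteq> L"
    using exists_pd by blast
  then obtain pd where pd: "\<forall>a\<in>J. derivation (pd a) \<and> (\<forall>c\<in>k. pd a c = 0) \<and>
      (\<forall>b\<in>J. pd a (X b) = (if a = b then 1 else 0)) \<and> pd a ` L \<subseteq> L" unfolding bchoice_iff by blast
  interpret core: core k X J y s F L pd "\<lambda>a. frac_deriv (comb r a)" "\<lambda>a c. frac_deriv (Dx0 a c)"
  proof
    show "\<exists>c\<in>B. \<exists>i. lead_coeff F * c = s ^ i" using s0(3) by (metis s_def power_one_right)
    show "frac_deriv (comb r a) ` k \<subseteq> k" for a by (rule frac_deriv_k[OF derivation_comb comb_D])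
    show "frac_deriv (Dx0 a c) ` k \<subseteq> k" for a c by (rule frac_deriv_k[OF derivation_Dx0 Dx0_D])
    show "frac_deriv (comb r a) (X b) = (if a = b then y else 0)" if "b \<in> J" for a b
      using comb_X[OF that] by (simp add: y_def)
  qed (use pd kf char_E finJ indep_X Lr B_L BY_L[OF y_BY] F inverse_F'_L sB s_nz inverse_s_L L_rep uniq
      derivation_frac_deriv[OF derivation_comb] derivation_frac_deriv[OF derivation_Dx0] comb_y Dx0_X in \<open>auto simp only: if_True\<close>)
  have prime: "prime_of UNIV P" if "P \<in> PP" for P
    using PP(2)[OF that] by (simp add: height_one_prime_def is_prime_ideal_iff)
  have ppt: "prime_of UNIV (pt P)" and av: "M \<inter> pt P = {}" if "P \<in> PP" for P
    using prime_pt[OF prime[OF that]] M_avoids[OF prime[OF that] PP(5)[OF that]] by auto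
  define lp where "lp P = loc_prime L M (pt P)" for P
  have lpD: "x \<in> lp P \<longleftrightarrow> f \<in> pt P" if "P \<in> PP" "x \<in> L" "\<mu> \<in> M" "emb \<mu> * x = emb f" for P x \<mu> f
    unfolding lp_def using loc_prime_iff[OF Lr M_1 M_mult M_rep ppt[OF that(1)] av[OF that(1)] that(2-4)] .
  have lp_prime: "prime_of L (lp P)" if "P \<in> PP" for P
    unfolding lp_def by (rule prime_of_loc_prime[OF Lr M_1 M_mult M_rep ppt[OF that] av[OF that]])
  have lp_der: "frac_deriv d ` lp P \<subseteq> lp P"
    if "P \<in> PP" "derivation d" "d ` pt P \<subseteq> pt P" "frac_deriv d ` L \<subseteq> L" for P d
    unfolding lp_def by (rule loc_prime_derivation[OF Lr M_1 M_mult M_rep ppt[OF that(1)] av[OF that(1)] that(2-4)])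
  have D1: "d \<in> M" if "d \<in> D" "d \<noteq> 0" for d
    unfolding M_def using that by (intro CollectI exI[of _ d] exI[of _ 0]) simp
  \<comment> \<open>Stability under \<open>comb\<close> and \<open>Dx0\<close> holds since
    coefficientwise extension commutes with differentiation by indeterminates; the omitted variable
    is transferred by lowest coefficients.\<close>
  have good: "core.good (lp P)" if P: "P \<in> PP" for P
    unfolding core.good_def
  proof (intro conjI ballI)
    note Id = prime_of_ideal[OF prime[OF P]]
    show "prime_of L (lp P)" by (rule lp_prime[OF P])
    show "frac_deriv (comb r a) ` lp P \<subseteq> lp P" if "a \<in> J" for a
    proof (rule lp_der[OF P derivation_comb comb_pt_ideal[OF Id]])
      show "frac_deriv (comb r a) ` L \<subseteq> L"
        using frac_deriv_k[OF derivation_comb comb_D] k_L comb_X BY_L[OF y_BY] subring_0[OF Lr]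
        by (intro derivation_L(2) derivation_frac_deriv derivation_comb) (auto simp: y_def[symmetric])
    qed
    show "frac_deriv (Dx0 a c) ` lp P \<subseteq> lp P" if "a \<in> J" "c \<in> J" for a c
    proof (rule lp_der[OF P derivation_Dx0 Dx0_pt[OF Id]])
      show "frac_deriv (Dx0 a c) ` L \<subseteq> L"
        using frac_deriv_k[OF derivation_Dx0 Dx0_D] k_L Dx0_X that B_L[OF var_pring[OF kr]] subring_0[OF Lr]
        by (intro derivation_L(2) derivation_frac_deriv derivation_Dx0) auto
    qed
    obtain a where a: "a \<in> J" "P \<inter> pring C z (J - {a}) = {0}" using PP(4)[OF P] by blast
    have "b = 0" if b: "b \<in> lp P" "b \<in> pring k X (J - {a})" for b
    proof -
      obtain d f where d: "d \<in> D" "f \<in> pring D Xt (J - {a})" "d \<noteq> 0" "emb d * b = emb f"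
        using pring_clear[OF Dr b(2)[unfolded k_def X_eq]] by blast
      have "b \<in> L" using b(1) by (simp add: lp_def loc_prime_def)
      then have "f \<in> pt P" using lpD[OF P _ D1[OF d(1,3)] d(4)] b(1) by blast
      then have "f = 0"
        using pring_pt_avoids[OF Cr _ alg_indep_subset[OF J(2)] _ a(2), of Xt f] lookup_Xt finJ d(2)
        by (auto simp: D_def)
      then show "b = 0" using d(3,4) by (simp add: emb_hom(3) emb_eq_0_iff)
    qed
    moreover have "0 \<in> lp P" "0 \<in> pring k X (J - {a})"
      using ideal_of_0[OF prime_of_ideal[OF lp_prime[OF P]]] subring_0[OF subring_pring[OF kr]] by auto
    ultimately show "\<exists>a\<in>J. lp P \<inter> pring k X (J - {a}) = {0}" using a(1) by blast
    note Idl = prime_of_ideal[OF lp_prime[OF P]]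
    \<comment> \<open>A nonzero element of \<open>P\<close>, multiplied by a power of
      \<open>s\<close>, is algebraic over \<open>B\<close> and therefore has a nonzero multiple in
      \<open>B\<close>.\<close>
    obtain a0 where a0: "a0 \<in> P" "a0 \<noteq> 0"
      using PP(2)[OF P] ideal_of_0[OF Id] by (auto simp: height_one_prime_def)
    have "cst a0 \<in> pt P" using a0(1) ideal_of_0[OF Id] by (auto simp: pt_def cst_def lookup_single when_def)
    then have x: "emb (cst a0) \<in> lp P" using lpD[OF P emb_L M_1, of "cst a0" "cst a0"] by (simp add: emb_hom(4))
    obtain i where i: "s ^ i * emb (cst a0) \<in> BY" using emb_L[of "cst a0"] by (auto simp: L_def)
    have nz: "s ^ i * emb (cst a0) \<noteq> 0"
      using s_nz a0(2) cst_inj[of a0 0] by (simp add: emb_eq_0_iff cst_hom)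
    have "almost_fg B BY"
      by (rule almost_fg_adjoin[OF Br Br order.refl almost_fg_refl[OF Br] y_algebraic])
    from algebraic_multiple[OF BYr B_BY i nz almost_fg_algebraic[OF Br BYr this i]]
    obtain w where w: "w \<in> BY" "s ^ i * emb (cst a0) * w \<in> B" "s ^ i * emb (cst a0) * w \<noteq> 0" by blast
    have "(s ^ i * w) * emb (cst a0) \<in> lp P"
      by (rule ideal_of_mult[OF Idl subring_mult[OF Lr BY_L[OF s_pow_BY] BY_L[OF w(1)]] x])
    moreover have "(s ^ i * w) * emb (cst a0) = s ^ i * emb (cst a0) * w" by (simp only: mult_ac)
    ultimately have "s ^ i * emb (cst a0) * w \<in> lp P \<inter> B" using w(2) by (simp only: IntI)
    then show "lp P \<inter> B \<noteq> {0}" using w(3) by blast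
  qed
  have mono: "P = Q" if PQ: "P \<in> PP" "Q \<in> PP" "lp P \<subseteq> lp Q" for P Q
  proof -
    have "P \<subseteq> Q"
    proof
      fix a assume a: "a \<in> P"
      have e: "emb 1 * emb (cst a) = emb (cst a)" by (simp add: emb_hom(4))
      have "cst a \<in> pt P"
        using a ideal_of_0[OF prime_of_ideal[OF prime[OF PQ(1)]]] by (auto simp: pt_def cst_def lookup_single when_def)
      then have "emb (cst a) \<in> lp Q" using lpD[OF PQ(1) emb_L M_1 e] PQ(3) by blast
      then have "cst a \<in> pt Q" using lpD[OF PQ(2) emb_L M_1 e] by blast
      then have "lkp (cst a) 0 \<in> Q" unfolding pt_def by blast
      then show "a \<in> Q" by (simp add: lookup_cst_0)
    qed
    then show ?thesis using PP(2)[OF PQ(1)] PP(2)[OF PQ(2)] by (auto simp: height_one_prime_def)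
  qed
  have "inj_on lp PP" using mono by (auto intro!: inj_onI)
  then have inf: "infinite (lp ` PP)" using PP(1) finite_imageD by blast
  show ?thesis
  proof (rule core.exists_constant[of m "\<lambda>i. frac_deriv (dcoef (\<delta> i))" "lp ` PP"])
    fix i assume i: "i < m"
    note dd = derivation_dcoef[OF \<delta>(1)[OF i]]
    show "derivation (frac_deriv (dcoef (\<delta> i)))" by (rule derivation_frac_deriv[OF dd])
    have "dcoef (\<delta> i) f = 0" if "f \<in> D" for f
      using that \<delta>(2)[OF i] by (intro poly_mapping_eqI) (simp add: lookup_dcoef[OF \<delta>(1)[OF i]] D_def pt_def)
    then show z: "frac_deriv (dcoef (\<delta> i)) c = 0" if "c \<in> k" for c
      using frac_deriv_kills[OF dd] that unfolding k_def by blast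
    show dL: "frac_deriv (dcoef (\<delta> i)) ` L \<subseteq> L"
      using z subring_0[OF Lr] emb_L
      by (intro derivation_L(2) derivation_frac_deriv dd) (auto simp: X_def frac_deriv_emb[OF dd])
    show "frac_deriv (dcoef (\<delta> i)) ` P' \<subseteq> P'" if P': "P' \<in> lp ` PP" for P'
    proof -
      obtain P where P: "P \<in> PP" "P' = lp P" using P' by blast
      show ?thesis unfolding P(2)
        by (rule lp_der[OF P(1) dd dcoef_pt[OF \<delta>(1)[OF i] PP(3)[OF P(1) i]] dL])
    qed
  qed (use inf good mono in auto)
qed

end

section \<open>Descent of constants\<close>

text \<open>Among all representations g / h of a constant choose one whose denominator has the fewest
  monomials. With a coefficient a of h, the pair (a * d g - d a * g, a * d h - d a * h) is another
  representation with fewer monomials unless its denominator vanishes, so all ratios of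
  coefficients are constant.\<close>

lemma constant_descent:
  fixes f :: "'a::idom mp fract"
  assumes C: "subring C" and \<delta>: "\<And>i. i < m \<Longrightarrow> derivation (\<delta> i)"
    and f: "f \<notin> frac_set (pt C)" "\<And>i. i < m \<Longrightarrow> frac_deriv (dcoef (\<delta> i)) f = 0"
  shows "\<exists>x a. a \<noteq> 0 \<and> (\<forall>i<m. \<delta> i x * a = x * \<delta> i a) \<and> (\<forall>c\<in>C. x \<noteq> c * a)"
proof -
  define Q where "Q gh \<longleftrightarrow> snd gh \<noteq> 0 \<and> f = Fract (fst gh) (snd gh)" for gh :: "'a mp \<times> 'a mp"
  obtain g0 h0 where "f = Fract g0 h0" "h0 \<noteq> 0" by (cases f)
  then have "Q (g0, h0)" by (simp add: Q_def)
  from ex_has_least_nat[of Q, OF this, of "\<lambda>gh. card (Poly_Mapping.keys (snd gh))"]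
  obtain g h where gh: "h \<noteq> 0" "f = Fract g h"
    and min: "\<And>g' h'. h' \<noteq> 0 \<Longrightarrow> f = Fract g' h' \<Longrightarrow> card (Poly_Mapping.keys h) \<le> card (Poly_Mapping.keys h')"
    by (fastforce simp: Q_def)
  obtain n where n: "n \<in> Poly_Mapping.keys h" using gh(1) by (metis all_not_in_conv keys_eq_empty)
  define a where "a = lkp h n"
  have a: "a \<noteq> 0" using n by (simp add: a_def in_keys_iff)
  have const: "\<delta> i x * a = x * \<delta> i a" if i: "i < m" and x: "x \<in> range (lkp g) \<union> range (lkp h)" for i x
  proof -
    let ?d = "dcoef (\<delta> i)"
    define W where "W u = cst a * ?d u - cst (\<delta> i a) * u" for u
    have lW: "lkp (W u) l = a * \<delta> i (lkp u l) - \<delta> i a * lkp u l" for u l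
    proof -
      have c: "lkp (cst b * v) l = b * lkp v l" for b :: 'a and v
        unfolding cst_def by (simp add: lookup_mp_mult when_def in_keys_iff)
      show ?thesis by (simp add: W_def lookup_minus c lookup_dcoef[OF \<delta>[OF i]])
    qed
    have "Fract (?d g * h - g * ?d h) (h * h) = 0"
      using f(2)[OF i] frac_deriv_Fract[OF derivation_dcoef[OF \<delta>[OF i]] gh(1)] gh(2) by simp
    then have "?d g * h = g * ?d h" using gh(1) by (simp add: Zero_fract_def eq_fract)
    then have e: "W g * h = g * W h" by (simp add: W_def algebra_simps)
    have "W h = 0"
    proof (rule ccontr)
      assume nz: "W h \<noteq> 0"
      then have "f = Fract (W g) (W h)" using e gh by (simp add: eq_fract)
      then have "card (Poly_Mapping.keys h) \<le> card (Poly_Mapping.keys (W h))" using min nz by blast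
      moreover have "Poly_Mapping.keys (W h) \<subset> Poly_Mapping.keys h"
      proof
        show "Poly_Mapping.keys (W h) \<subseteq> Poly_Mapping.keys h"
          using derivation_0[OF \<delta>[OF i]] by (auto simp: in_keys_iff lW)
        show "Poly_Mapping.keys (W h) \<noteq> Poly_Mapping.keys h"
          using n lW[of h n] by (auto simp: in_keys_iff a_def)
      qed
      ultimately show False using psubset_card_mono[of "Poly_Mapping.keys h"] by (metis finite_keys not_le)
    qed
    moreover from this have "W g = 0" using e gh(1) by simp
    ultimately have "lkp (W g) l = 0" "lkp (W h) l = 0" for l by simp_all
    then show ?thesis using x by (auto simp: lW algebra_simps)
  qed
  have "\<exists>x\<in>range (lkp g) \<union> range (lkp h). \<forall>c\<in>C. x \<noteq> c * a"
  proof (rule ccontr)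
    \<comment> \<open>If all coefficients were \<open>C\<close>-multiples of \<open>a\<close>,
      cancelling \<open>a\<close> would write \<open>f\<close> as a fraction of polynomials over
      \<open>C\<close>.\<close>
    assume neg: "\<not> ?thesis"
    then have "\<exists>u0\<in>pt C. u = cst a * u0" if "u = g \<or> u = h" for u
    proof -
      have "\<forall>l. \<exists>c. c \<in> C \<and> lkp u l = c * a" using neg that by blast
      then obtain c where c: "\<And>l. c l \<in> C" "\<And>l. lkp u l = c l * a" unfolding choice_iff by blast
      define u0 where "u0 = (\<Sum>l\<in>Poly_Mapping.keys u. sng l (c l))"
      have "u = cst a * u0"
      proof -
        have "u = (\<Sum>l\<in>Poly_Mapping.keys u. sng l (lkp u l))" by (rule mp_sum_single)
        also have "\<dots> = cst a * u0"
          unfolding u0_def sum_distrib_left c(2) by (simp add: cst_def mult_single mult.commute)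
        finally show ?thesis .
      qed
      moreover have "u0 \<in> pt C"
        unfolding u0_def pt_def using c(1) C
        by (auto simp: lookup_sum lookup_single when_def subring_0 intro!: subring_sum)
      ultimately show ?thesis by blast
    qed
    then obtain g1 h1 where g1: "g1 \<in> pt C" "h1 \<in> pt C" "g = cst a * g1" "h = cst a * h1" by blast
    then have "h1 \<noteq> 0" using gh(1) by auto
    have "cst a \<noteq> 0" using a cst_inj[of a 0] by (simp add: cst_hom)
    then have "f = Fract g1 h1" using gh g1 \<open>h1 \<noteq> 0\<close> by (simp add: eq_fract)
    then have "f \<in> frac_set (pt C)" unfolding frac_set_def Fract_emb using g1 \<open>h1 \<noteq> 0\<close> by blast
    then show False using f(1) by blast
  qed
  then show ?thesis using a const by blast
qed

theorem theorem6p1: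
  fixes \<iota> :: "complex \<Rightarrow> 'a::idom" and \<delta> :: "nat \<Rightarrow> 'a \<Rightarrow> 'a" and m :: nat
  assumes "affine_C_algebra \<iota>"
    and "\<forall>i<m. C_derivation \<iota> (\<delta> i)"
    and "infinite {P :: 'a set. height_one_prime P \<and> differential_ideal \<delta> m P}"
  shows "\<exists>f :: 'a fract. f \<notin> frac_consts \<iota> \<and> (\<forall>i<m. frac_deriv (\<delta> i) f = 0)"
proof -
  have hom: "\<iota> 1 = 1" "\<And>c d. \<iota> (c + d) = \<iota> c + \<iota> d" "\<And>c d. \<iota> (c * d) = \<iota> c * \<iota> d"
    using assms(1) by (auto simp: affine_C_algebra_def ring_hom_C_def)
  obtain S where S: "finite S" "alg_gen \<iota> S = UNIV" using assms(1) by (auto simp: affine_C_algebra_def)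
  have "\<iota> 0 + \<iota> 0 = \<iota> 0" using hom(2)[of 0 0] by simp
  then have \<iota>0: "\<iota> 0 = 0" by (simp only: add_cancel_left_right)
  have \<iota>m: "\<iota> (- c) = - \<iota> c" for c using hom(2)[of c "- c"] \<iota>0 by (simp add: eq_neg_iff_add_eq_0 add.commute)
  have \<iota>nz: "\<iota> c \<noteq> 0" if "c \<noteq> 0" for c using hom(3)[of c "inverse c"] hom(1) that by auto
  let ?C = "range \<iota>"
  have Cr: "subring ?C"
    unfolding subring_def
    by (auto simp flip: hom \<iota>m intro!: range_eqI[of 0 \<iota> 0] range_eqI[of 1 \<iota> 1] simp: \<iota>0)
  have C: "subfield ?C"
    unfolding subfield_def
  proof (intro conjI ballI impI Cr)
    fix c assume "c \<in> ?C" "c \<noteq> 0"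
    then obtain d where d: "c = \<iota> d" "d \<noteq> 0" using \<iota>0 by auto
    then have "c * \<iota> (inverse d) = 1" by (simp flip: hom(3) add: hom(1))
    then show "\<exists>v\<in>?C. c * v = 1" by blast
  qed
  have "(of_nat n :: 'a) = \<iota> (of_nat n)" for n by (induction n) (auto simp: \<iota>0 hom)
  then have char: "(of_nat n :: 'a) \<noteq> 0" if "n > 0" for n using \<iota>nz[of "of_nat n"] that by simp
  obtain zs where zs: "set zs = S" using finite_list[OF S(1)] by blast
  define z where "z i = zs ! i" for i
  define r where "r = length zs"
  have gen: "pring ?C z {..<r} = UNIV"
  proof -
    have R: "subring (pring ?C z {..<r})" by (rule subring_pring[OF Cr])
    have "x \<in> pring ?C z {..<r}" if "x \<in> alg_gen \<iota> S" for x
      using that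
    proof (induction rule: alg_gen.induct)
      case (scalar c)
      then show ?case by (intro const_pring[OF Cr]) simp
    next
      case (gen x)
      then obtain i where "i < r" "x = z i" by (auto simp: zs[symmetric] in_set_conv_nth z_def r_def)
      then show ?case using var_pring[OF Cr, of i "{..<r}" z] by simp
    qed (auto intro: subring_add[OF R] subring_mult[OF R])
    then show ?thesis using S(2) by blast
  qed
  have "alg_indep ?C z {}" by (simp add: alg_indep_def)
  then obtain J where J: "J \<subseteq> {..<r}" "alg_indep ?C z J" "\<forall>b\<in>{..<r}. \<not> transc (pring ?C z J) (z b)"
    using exists_basis[OF Cr, of "{..<r}" "{}" z] by blast
  interpret generic ?C z r J using C char gen J by unfold_locales auto
  obtain F where F: "F \<in> poly_over B" "F \<noteq> 0" "poly F y = 0" "poly (pderiv F) y \<noteq> 0"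
    "\<forall>V\<in>poly_over B. degree V < degree F \<longrightarrow> poly V y = 0 \<longrightarrow> V = 0"
    using exists_minimal_relation by blast
  obtain s0 where s0: "s0 \<in> pring D Xt J" "s0 \<noteq> 0" "\<exists>c\<in>B. lead_coeff F * c = emb s0"
    "\<exists>w\<in>BY. poly (pderiv F) y * w = emb s0" using exists_denominator[OF F(1,2,4)] by blast
  interpret generic_extension ?C z r J F s0 using F s0 by unfold_locales auto
  have "J \<union> {..<r} = {..<r}" using J(1) by auto
  then have "almost_fg (pring ?C z J) UNIV"
    using almost_fg_pring[OF Cr, where T = "{..<r}" and J = J and X = z] J(3) gen by simp
  then obtain s1 G where s1: "s1 \<in> pring ?C z J" "s1 \<noteq> 0" "finite G" "lin_indep (pring ?C z J) G"
    "\<And>x. \<exists>i. s1 ^ i * x \<in> lin (pring ?C z J) G"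
    using almost_fg_basis[OF subring_pring[OF Cr]] by (metis UNIV_I)
  \<comment> \<open>One fixed nonzero coefficient of \<open>s0\<close> outside \<open>P\<close>
    keeps \<open>s0\<close> outside \<open>pt P\<close>. Together with \<open>s1 \<notin> P\<close>
    this discards only finitely many of the given primes.\<close>
  obtain n where n: "lkp s0 n \<noteq> 0" using s0(2) by (metis poly_mapping_eqI lookup_zero)
  have noeth: "noeth (UNIV :: 'a set)" using noeth_pring[OF C, of z r] gen by simp
  let ?PP = "{P :: 'a set. height_one_prime P \<and> differential_ideal \<delta> m P}"
  define PP where "PP = ?PP - ({P. height_one_prime P \<and> s1 \<in> P} \<union> {P. height_one_prime P \<and> lkp s0 n \<in> P})"
  have inf: "infinite PP"
    unfolding PP_def using assms(3) finite_height_one_containing[OF noeth s1(2)]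
      finite_height_one_containing[OF noeth n] by (intro Diff_infinite_finite) auto
  have \<delta>: "derivation (\<delta> i)" "\<And>c. \<delta> i (\<iota> c) = 0" if "i < m" for i
  proof -
    have d: "C_derivation \<iota> (\<delta> i)" using assms(2) that by blast
    then show "derivation (\<delta> i)" by (auto simp: C_derivation_def derivation_def)
    then have "\<delta> i 1 = 0" by (rule derivation_1)
    then show "\<delta> i (\<iota> c) = 0" for c using d unfolding C_derivation_def by (metis mult.right_neutral mult_zero_right)
  qed
  have "\<exists>f. f \<notin> k \<and> (\<forall>i<m. frac_deriv (dcoef (\<delta> i)) f = 0)"
  proof (rule exists_generic_constant[of m \<delta> PP])
    show "\<exists>a\<in>J. P \<inter> pring ?C z (J - {a}) = {0}" if "P \<in> PP" for P
      by (rule height_one_omits_variable[OF C finJ J(2) s1(3,4,1,2,5)]) (use that in \<open>auto simp: PP_def\<close>)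
    show "s0 \<notin> pt P" if "P \<in> PP" for P using that by (auto simp: PP_def pt_def)
  qed (use \<delta> inf in \<open>auto simp: PP_def differential_ideal_def\<close>)
  then obtain f where f: "f \<notin> frac_set (pt ?C)" "\<And>i. i < m \<Longrightarrow> frac_deriv (dcoef (\<delta> i)) f = 0"
    unfolding k_def D_def by blast
  have "\<exists>x a. a \<noteq> 0 \<and> (\<forall>i<m. \<delta> i x * a = x * \<delta> i a) \<and> (\<forall>c\<in>?C. x \<noteq> c * a)"
    by (rule constant_descent[OF Cr _ f(1)]) (fact \<delta>(1) f(2))+
  then obtain x a where xa: "a \<noteq> 0" "\<And>i. i < m \<Longrightarrow> \<delta> i x * a = x * \<delta> i a" "\<And>c. c \<in> ?C \<Longrightarrow> x \<noteq> c * a"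
    by blast
  have "Fract x a \<notin> frac_consts \<iota>" using xa(1,3) by (auto simp: frac_consts_def eq_fract)
  moreover have "frac_deriv (\<delta> i) (Fract x a) = 0" if "i < m" for i
    using frac_deriv_Fract[OF \<delta>(1)[OF that] xa(1), of x] xa(2)[OF that] by (simp add: fract_collapse)
  ultimately show ?thesis by blast
qed

end
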